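(* Let $H$ be a Hilbert space and let $A:D(A)\to H$ be a positive self-adjoint operator with compact inverse, with eigenvalues $0<\lambda_1\le\lambda_2\le\cdots$ and orthonormal basis of eigenvectors $\{e_n\}$. Assume $L_0:=\sup_{n\in\mathbb N}(\lambda_{n+1}-\lambda_n)<\infty$. Then for any $L>\max\{\frac12L_0,\lambda_2\}$ there exists a $C^\infty$-smooth nonlinearity $F:H\to H$ with global Lipschitz constant $L$ such that the equation $\partial_t u+Au=F(u)$ possesses a compact global attractor $\mathcal A$ with infinite log-doubling dimension: $$\dim_{Log-D}(\mathcal A)=\infty .$$ In particular, $\mathcal A$ does not possess any finite-dimensional log-Lipschitz Mañé projections and cannot be embedded into any finite-dimensional log-Lipschitz manifold.
   Context: A global attractor of the semigroup generated by $\partial_t u+Au=F(u)$ in $H$ is a compact, strictly invariant set attracting the images of all bounded sets. For a compact metric space $X$, $N_\varepsilon(B,X)$ is the minimal number of $\varepsilon$-balls of $X$ covering $B\subset X$; $D_\varepsilon(X):=\sup_{x\in X}N_{\varepsilon/2}(B(\varepsilon,x),X)$ with $B(r,x)$ the ball of radius $r$ centered at $x$; and $\dim_{Log-D}(X):=\limsup_{\varepsilon\to0}\frac{\log D_\varepsilon(X)}{\log\log(1/\varepsilon)}$. A map $T$ between metric spaces is log-Lipschitz if $d(Tx_1,Tx_2)\le C d(x_1,x_2)(\log\frac{C}{d(x_1,x_2)})^\gamma$ for some $C,\gamma>0$; a log-Lipschitz manifold over $\mathbb R^N$ is a set locally homeomorphic to $\mathbb R^N$ whose coordinate maps and their inverses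 are all log-Lipschitz with the same constants. A log-Lipschitz Mañé projection of $\mathcal A$ is an orthogonal projection $P$ of $H$ onto a finite-dimensional subspace which is injective on $\mathcal A$ and whose inverse $P^{-1}:P\mathcal A\to\mathcal A$ is log-Lipschitz. *)

theory Defs
  imports "HOL-Analysis.Analysis"
begin

text \<open>A positive self-adjoint operator with compact inverse is given by its eigenvalues lam
  (0 < lam 0 <= lam 1 <= ..., lam n tends to infinity) and an orthonormal basis e of eigenvectors;
  A u = sum of lam n (u . e n) e n on its natural domain.  exp(-tA) is then:\<close>

definition spec_exp :: "(nat \<Rightarrow> 'a::real_inner) \<Rightarrow> (nat \<Rightarrow> real) \<Rightarrow> real \<Rightarrow> 'a \<Rightarrow> 'a" where
  "spec_exp e lam t u = (\<Sum>n. (exp (- t * lam n) * inner u (e n)) *\<^sub>R e n)"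

definition mild_solution ::
  "(nat \<Rightarrow> 'a::{real_inner,complete_space}) \<Rightarrow> (nat \<Rightarrow> real) \<Rightarrow> ('a \<Rightarrow> 'a) \<Rightarrow> 'a \<Rightarrow> (real \<Rightarrow> 'a) \<Rightarrow> bool" where
  "mild_solution e lam F u0 u \<longleftrightarrow>
     continuous_on {0..} u \<and> u 0 = u0 \<and>
     (\<forall>t\<ge>0. ((\<lambda>s. spec_exp e lam (t - s) (F (u s))) has_integral (u t - spec_exp e lam t u0)) {0..t})"

definition sg ::
  "(nat \<Rightarrow> 'a::{real_inner,complete_space}) \<Rightarrow> (nat \<Rightarrow> real) \<Rightarrow> ('a \<Rightarrow> 'a) \<Rightarrow> real \<Rightarrow> 'a \<Rightarrow> 'a" where
  "sg e lam F t u0 = (THE x. \<exists>u. mild_solution e lam F u0 u \<and> u t = x)"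

definition global_attractor ::
  "(nat \<Rightarrow> 'a::{real_inner,complete_space}) \<Rightarrow> (nat \<Rightarrow> real) \<Rightarrow> ('a \<Rightarrow> 'a) \<Rightarrow> 'a set \<Rightarrow> bool" where
  "global_attractor e lam F \<A> \<longleftrightarrow>
     compact \<A> \<and> (\<forall>t\<ge>0. sg e lam F t ` \<A> = \<A>) \<and>
     (\<forall>B. bounded B \<longrightarrow> (\<forall>\<epsilon>>0. \<exists>T\<ge>0. \<forall>t\<ge>T. \<forall>b\<in>B. infdist (sg e lam F t b) \<A> < \<epsilon>))"

definition multilinear_bounded :: "nat \<Rightarrow> ('a::real_normed_vector list \<Rightarrow> 'b::real_normed_vector) \<Rightarrow> bool" where
  "multilinear_bounded k M \<longleftrightarrow>
     (\<forall>hs1 hs2. length hs1 + length hs2 + 1 = k \<longrightarrow> linear (\<lambda>h. M (hs1 @ h # hs2))) \<and>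
     (\<exists>B. \<forall>hs. length hs = k \<longrightarrow> norm (M hs) \<le> B * prod_list (map norm hs))"

text \<open>D k x is the k-th Frechet derivative of f at x (a bounded k-linear map), and D (k+1) x is the
  Frechet derivative of x -> D k x with respect to the operator norm.\<close>
definition C_infinity :: "('a::real_normed_vector \<Rightarrow> 'b::real_normed_vector) \<Rightarrow> bool" where
  "C_infinity f \<longleftrightarrow> (\<exists>D :: nat \<Rightarrow> 'a \<Rightarrow> 'a list \<Rightarrow> 'b.
     (\<forall>x. D 0 x [] = f x) \<and>
     (\<forall>k x. multilinear_bounded k (D k x)) \<and>
     (\<forall>k x. \<forall>\<epsilon>>0. \<exists>\<delta>>0. \<forall>h. norm h < \<delta> \<longrightarrow>
        (\<forall>hs. length hs = k \<and> (\<forall>v\<in>set hs. norm v \<le> 1) \<longrightarrow>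
          norm (D k (x + h) hs - D k x hs - D (Suc k) x (h # hs)) \<le> \<epsilon> * norm h)))"

definition cover_num :: "real \<Rightarrow> 'a::metric_space set \<Rightarrow> 'a set \<Rightarrow> nat" where
  "cover_num \<epsilon> B X = (LEAST n. \<exists>C. C \<subseteq> X \<and> finite C \<and> card C = n \<and> B \<subseteq> (\<Union>c\<in>C. ball c \<epsilon>))"

definition doubling_fn :: "real \<Rightarrow> 'a::metric_space set \<Rightarrow> real" where
  "doubling_fn \<epsilon> X = (SUP x\<in>X. real (cover_num (\<epsilon> / 2) (X \<inter> ball x \<epsilon>) X))"

definition dim_logD :: "'a::metric_space set \<Rightarrow> ereal" where
  "dim_logD X = Limsup (at_right 0) (\<lambda>\<epsilon>. ereal (ln (doubling_fn \<epsilon> X) / ln (ln (1 / \<epsilon>))))"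

text \<open>Log-Lipschitz w.r.t. general distance functions. The formula only makes sense when
  C / d > 1, so distinct points are required to be at distance < C.\<close>
definition loglip ::
  "('a \<Rightarrow> 'a \<Rightarrow> real) \<Rightarrow> ('b \<Rightarrow> 'b \<Rightarrow> real) \<Rightarrow> real \<Rightarrow> real \<Rightarrow> 'a set \<Rightarrow> ('a \<Rightarrow> 'b) \<Rightarrow> bool" where
  "loglip d1 d2 C \<gamma> S T \<longleftrightarrow> C > 0 \<and> \<gamma> > 0 \<and>
     (\<forall>x1\<in>S. \<forall>x2\<in>S. x1 \<noteq> x2 \<longrightarrow>
        d1 x1 x2 < C \<and> d2 (T x1) (T x2) \<le> C * d1 x1 x2 * (ln (C / d1 x1 x2)) powr \<gamma>)"

definition fin_orth_proj :: "('a::real_inner \<Rightarrow> 'a) \<Rightarrow> bool" where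
  "fin_orth_proj P \<longleftrightarrow> (\<exists>V. subspace V \<and> (\<exists>B. finite B \<and> span B = V) \<and>
      (\<forall>x. P x \<in> V \<and> (\<forall>v\<in>V. inner (x - P x) v = 0)))"

definition loglip_Mane_proj :: "('a::real_inner \<Rightarrow> 'a) \<Rightarrow> 'a set \<Rightarrow> bool" where
  "loglip_Mane_proj P \<A> \<longleftrightarrow> fin_orth_proj P \<and> inj_on P \<A> \<and>
      (\<exists>C \<gamma>. loglip dist dist C \<gamma> (P ` \<A>) (the_inv_into \<A> P))"

definition eucl_N :: "nat \<Rightarrow> (nat \<Rightarrow> real) set" where
  "eucl_N N = {v. \<forall>i\<ge>N. v i = 0}"

definition dist_N :: "nat \<Rightarrow> (nat \<Rightarrow> real) \<Rightarrow> (nat \<Rightarrow> real) \<Rightarrow> real" where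
  "dist_N N v w = sqrt (\<Sum>i<N. (v i - w i)^2)"

definition loglip_manifold :: "nat \<Rightarrow> 'a::metric_space set \<Rightarrow> bool" where
  "loglip_manifold N M \<longleftrightarrow> (\<exists>C \<gamma>. \<forall>x\<in>M. \<exists>r>0. \<exists>\<phi>.
      \<phi> ` (M \<inter> ball x r) \<subseteq> eucl_N N \<and> inj_on \<phi> (M \<inter> ball x r) \<and>
      (\<forall>y\<in>\<phi> ` (M \<inter> ball x r). \<exists>\<rho>>0. \<forall>z\<in>eucl_N N. dist_N N z y < \<rho> \<longrightarrow> z \<in> \<phi> ` (M \<inter> ball x r)) \<and>
      loglip dist (dist_N N) C \<gamma> (M \<inter> ball x r) \<phi> \<and>
      loglip (dist_N N) dist C \<gamma> (\<phi> ` (M \<inter> ball x r)) (the_inv_into (M \<inter> ball x r) \<phi>))"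

end

theory Submission
  imports Defs "HOL-Real_Asymp.Real_Asymp"
begin

text \<open>Put \<open>f j = e (c j)\<close> along a chain of eigenvalues with consecutive gaps at most \<open>G < 2 L\<close> and bounded
  below. In the plane of \<open>e 0\<close> and \<open>e 1\<close> the nonlinearity drives every orbit of interest from the origin along a
  corridor to the unit circle, where it rotates with slow speed \<open>\<epsilon>\<close>. On each half turn the decay
  rates within pairs of neighbouring chain modes are made equal, which moves each rate by at most \<open>G / 2 < L\<close>,
  and the two modes of a pair are exchanged; the pairs alternate between \<open>{2k, 2k+1}\<close> and \<open>{2k+1, 2k+2}\<close>.
  Hence an odd mode descends the chain to the bottom before it climbs, while mode \<open>0\<close> climbs from the start
  and after \<open>O(M)\<close> half turns is smaller by a factor \<open>exp (- M^2)\<close> than any odd mode with index in \<open>[2M, 4M)\<close>.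
  Leaving the corridor, an orbit carries a parameter \<open>s\<close> in mode \<open>0\<close>; a kick depending on \<open>s\<close> writes the
  \<open>M\<close> low bits of \<open>N \<in> [2^M, 2^(M+1))\<close> into odd modes when \<open>s\<close> is of order \<open>1 / N\<close>. The kicks may decay faster
  than any power of \<open>N\<close>, so they are smooth in \<open>s\<close>, and still dominate \<open>s\<close> in the end:
  the attractor contains the vertices of cubes of dimension \<open>M = m^2\<close> and side \<open>exp (- O(M^2))\<close>. Passing from the diameter
  to the side takes \<open>m\<close> halvings, so one of the doubling numbers is at least \<open>2^m\<close>, whereas \<open>log log (1 / \<epsilon>)\<close>
  is \<open>O(log m)\<close> at these scales.\<close>

section \<open>Smooth functions of a real variable\<close>

text \<open>The threshold max(L0/2, \<lambda>_2) is the cost of the fast part alone. Cancelling the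
  eigenvalues of the plane costs \<lambda>_2, equalising two neighbouring rates costs half their
  gap, and since these act on mutually orthogonal blocks the costs combine as a maximum, not as a
  sum. All other terms carry the slow speed \<epsilon> or, for the kick, are made small by dropping
  finitely many N; this works only if every truncation of the fast part has Lipschitz constant
  exactly 1. Rates are equalised because a rotation commutes with the decay only where both modes
  decay equally; then the exchange is explicit and all estimates concern exponents.

  The obstacle is smoothness. The parameter s is the position on a line of equilibria s e 1, and a
  smooth kick that tells apart values of s near 0 is smaller than any power of s, so at birth the
  orbits differ almost only in one direction. The alternating exchanges reverse this order of sizes,
  because the gain in the exponent is quadratic in the number of half turns. The sizes themselves
  shrink only to exp(-O(M^2)), so that log log of the scale remains logarithmic in M.\<close>

primrec ndiff :: "nat \<Rightarrow> (real \<Rightarrow> 'b::real_normed_vector) \<Rightarrow> bool" where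
  "ndiff 0 G \<longleftrightarrow> True"
| "ndiff (Suc n) G \<longleftrightarrow> (\<exists>G'. (\<forall>x. (G has_vector_derivative G' x) (at x)) \<and> ndiff n G')"

definition smoothR :: "(real \<Rightarrow> 'b::real_normed_vector) \<Rightarrow> bool" where
  "smoothR G \<longleftrightarrow> (\<forall>n. ndiff n G)"

lemma ndiff_SucI: "(\<And>x. (G has_vector_derivative G' x) (at x)) \<Longrightarrow> ndiff n G' \<Longrightarrow> ndiff (Suc n) G"
  by auto

lemma ndiff_Suc_imp: "ndiff (Suc n) G \<Longrightarrow> ndiff n G"
proof (induction n arbitrary: G)
  case (Suc n)
  then show ?case by (metis ndiff.simps(2))
qed simp

lemma ndiff_const: "ndiff n (\<lambda>x. c)"
proof (induction n arbitrary: c)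
  case (Suc n)
  show ?case by (rule ndiff_SucI[of _ "\<lambda>x. 0"]) (auto intro: Suc)
qed simp

lemma ndiff_add: "ndiff n f \<Longrightarrow> ndiff n g \<Longrightarrow> ndiff n (\<lambda>x. f x + g x)"
proof (induction n arbitrary: f g)
  case (Suc n)
  then obtain f' g' where "\<And>x. (f has_vector_derivative f' x) (at x)" "ndiff n f'"
    "\<And>x. (g has_vector_derivative g' x) (at x)" "ndiff n g'" by auto
  then show ?case
    by (intro ndiff_SucI[of _ "\<lambda>x. f' x + g' x"] Suc.IH) (auto intro!: derivative_intros)
qed simp

lemma ndiff_scaleR:
  fixes f :: "real \<Rightarrow> real"
  shows "ndiff n f \<Longrightarrow> ndiff n g \<Longrightarrow> ndiff n (\<lambda>x. f x *\<^sub>R g x)"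
proof (induction n arbitrary: f g)
  case (Suc n)
  then obtain f' g' where d: "\<And>x. (f has_vector_derivative f' x) (at x)" "ndiff n f'"
    "\<And>x. (g has_vector_derivative g' x) (at x)" "ndiff n g'" by auto
  have n: "ndiff n f" "ndiff n g" using Suc.prems ndiff_Suc_imp by blast+
  have "((\<lambda>x. f x *\<^sub>R g x) has_vector_derivative (f x *\<^sub>R g' x + f' x *\<^sub>R g x)) (at x)" for x
    using has_vector_derivative_scaleR[of f "f' x" x UNIV g "g' x"] d
    by (simp add: has_real_derivative_iff_has_vector_derivative)
  then show ?case
    by (intro ndiff_SucI[of _ "\<lambda>x. f x *\<^sub>R g' x + f' x *\<^sub>R g x"] ndiff_add Suc.IH d n) 
qed simp

lemma ndiff_compose:
  fixes h :: "real \<Rightarrow> real"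
  shows "ndiff n g \<Longrightarrow> ndiff n h \<Longrightarrow> ndiff n (\<lambda>x. g (h x))"
proof (induction n arbitrary: g)
  case (Suc n)
  then obtain g' h' where d: "\<And>x. (g has_vector_derivative g' x) (at x)" "ndiff n g'"
    "\<And>x. (h has_vector_derivative h' x) (at x)" "ndiff n h'" by auto
  have n: "ndiff n h" using Suc.prems ndiff_Suc_imp by blast
  have "((\<lambda>x. g (h x)) has_vector_derivative (h' x *\<^sub>R g' (h x))) (at x)" for x
    using vector_diff_chain_at[of h "h' x" x g "g' (h x)"] d by (simp add: o_def)
  then show ?case
    by (intro ndiff_SucI[of _ "\<lambda>x. h' x *\<^sub>R g' (h x)"] ndiff_scaleR Suc.IH d n) 
qed simp

lemma smoothR_const [simp, intro]: "smoothR (\<lambda>x. c)"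
  by (simp add: smoothR_def ndiff_const)

lemma smoothR_ident [simp, intro]: "smoothR (\<lambda>x. x)"
proof -
  have "ndiff n (\<lambda>x::real. x)" for n
    by (cases n) (auto intro!: exI[of _ "\<lambda>x. 1"] ndiff_const derivative_eq_intros)
  then show ?thesis by (simp add: smoothR_def)
qed

lemma smoothR_add [intro]: "smoothR f \<Longrightarrow> smoothR g \<Longrightarrow> smoothR (\<lambda>x. f x + g x)"
  by (simp add: smoothR_def ndiff_add)

lemma smoothR_scaleR [intro]:
  fixes f :: "real \<Rightarrow> real"
  shows "smoothR f \<Longrightarrow> smoothR g \<Longrightarrow> smoothR (\<lambda>x. f x *\<^sub>R g x)"
  by (simp add: smoothR_def ndiff_scaleR)

lemma smoothR_mult [intro]:
  fixes f g :: "real \<Rightarrow> real"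
  shows "smoothR f \<Longrightarrow> smoothR g \<Longrightarrow> smoothR (\<lambda>x. f x * g x)"
  using smoothR_scaleR[of f g] by simp

lemma smoothR_minus [intro]: "smoothR g \<Longrightarrow> smoothR (\<lambda>x. - g x)"
  using smoothR_scaleR[of "\<lambda>x. -1" g] by simp

lemma smoothR_diff [intro]: "smoothR f \<Longrightarrow> smoothR g \<Longrightarrow> smoothR (\<lambda>x. f x - g x)"
  using smoothR_add[of f "\<lambda>x. - g x"] smoothR_minus[of g] by simp

lemma smoothR_divide [intro]: 
  fixes f :: "real \<Rightarrow> real"
  shows "smoothR f \<Longrightarrow> smoothR (\<lambda>x. f x / c)"
  using smoothR_mult[of "\<lambda>x. inverse c" f] by (simp add: field_simps)

lemma smoothR_compose:
  fixes h :: "real \<Rightarrow> real"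
  shows "smoothR g \<Longrightarrow> smoothR h \<Longrightarrow> smoothR (\<lambda>x. g (h x))"
  by (simp add: smoothR_def ndiff_compose)

text \<open>\<open>ndiff\<close> allows a different derivative at each order; uniqueness of
  derivatives makes all these choices one function, which is therefore smooth itself.\<close>

lemma smoothR_derivE:
  assumes "smoothR G"
  obtains G' where "\<And>x. (G has_vector_derivative G' x) (at x)" "smoothR G'"
proof -
  from assms have "ndiff (Suc 0) G" by (simp add: smoothR_def)
  then obtain G' where G': "\<And>x. (G has_vector_derivative G' x) (at x)" by auto
  have "ndiff n G'" for n
  proof -
    from assms have "ndiff (Suc n) G" unfolding smoothR_def by blast
    then obtain G'' where G'': "\<And>x. (G has_vector_derivative G'' x) (at x)" "ndiff n G''" by auto
    have "G'' = G'" using G' G'' vector_derivative_unique_at by blast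
    then show ?thesis using G'' by simp
  qed
  then show ?thesis using that G' by (auto simp: smoothR_def)
qed

lemma smoothR_antideriv:
  assumes "\<And>x. (G has_vector_derivative G' x) (at x)" "smoothR G'"
  shows "smoothR G"
  unfolding smoothR_def
proof
  fix n show "ndiff n G" using assms by (cases n) (auto simp: smoothR_def)
qed

lemma smoothR_continuous: "smoothR G \<Longrightarrow> continuous_on A G"
  by (meson smoothR_derivE has_vector_derivative_continuous continuous_at_imp_continuous_on)

lemma smoothR_real_derivE:
  fixes G :: "real \<Rightarrow> real"
  assumes "smoothR G"
  obtains G' where "\<And>x. (G has_real_derivative G' x) (at x)" "smoothR G'"
  using smoothR_derivE[OF assms] that unfolding has_real_derivative_iff_has_vector_derivative by blast

lemma smoothR_seqE:
  assumes "smoothR G"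
  obtains g where "g 0 = G" "\<And>k x. (g k has_vector_derivative g (Suc k) x) (at x)" "\<And>k. smoothR (g k)"
proof -
  have "\<forall>G::real \<Rightarrow> 'a. \<exists>G'. smoothR G \<longrightarrow> (\<forall>x. (G has_vector_derivative G' x) (at x)) \<and> smoothR G'"
    using smoothR_derivE by blast
  then obtain D where D0: "\<forall>G::real \<Rightarrow> 'a. smoothR G \<longrightarrow> (\<forall>x. (G has_vector_derivative D G x) (at x)) \<and> smoothR (D G)"
    by (rule choice[THEN exE])
  then have D: "(\<forall>x. (G has_vector_derivative D G x) (at x)) \<and> smoothR (D G)" if "smoothR G" for G :: "real \<Rightarrow> 'a"
    using that by blast
  define g where "g k = (D ^^ k) G" for k
  have S: "smoothR (g k)" for k
  proof (induction k)
    case (Suc k) then show ?case using D[OF Suc] by (simp add: g_def)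
  qed (simp add: g_def assms)
  show ?thesis
  proof (rule that[of g])
    fix k x show "(g k has_vector_derivative g (Suc k) x) (at x)"
      using D[OF S[of k]] by (simp add: g_def)
  qed (simp_all add: S, simp add: g_def)
qed

lemma smoothR_seqI:
  assumes "\<And>k x. (g k has_vector_derivative g (Suc k) x) (at x)"
  shows "smoothR (g 0)"
proof -
  have "ndiff n (g k)" for n k
    by (induction n arbitrary: k) (use assms in auto)
  then show ?thesis by (simp add: smoothR_def)
qed

lemma smoothR_bounded_on_Icc:
  assumes "smoothR G"
  shows "\<exists>C>0. (\<forall>x. \<bar>x\<bar> \<le> b \<longrightarrow> norm (G x) \<le> C) \<and>
    (\<forall>x y. \<bar>x\<bar> \<le> b \<longrightarrow> \<bar>y\<bar> \<le> b \<longrightarrow> norm (G x - G y) \<le> C * \<bar>x - y\<bar>)"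
proof -
  obtain G' where G': "\<And>x. (G has_vector_derivative G' x) (at x)" "smoothR G'"
    using smoothR_derivE[OF assms] by blast
  have "compact (G ` {-b..b})" "compact (G' ` {-b..b})"
    by (intro compact_continuous_image smoothR_continuous assms G' compact_Icc)+
  then obtain B1 B2 where B: "\<And>x. x \<in> {-b..b} \<Longrightarrow> norm (G x) \<le> B1" "\<And>x. x \<in> {-b..b} \<Longrightarrow> norm (G' x) \<le> B2"
    using compact_imp_bounded[of "G ` {-b..b}"] compact_imp_bounded[of "G' ` {-b..b}"]
    unfolding bounded_iff by blast
  define C where "C = max 1 (max B1 B2)"
  have C2: "B2 \<le> C" "B1 \<le> C" by (auto simp: C_def)
  have lip: "norm (G x - G y) \<le> C * \<bar>x - y\<bar>" if "\<bar>x\<bar> \<le> b" "\<bar>y\<bar> \<le> b" for x y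
  proof -
    have "norm (G x - G y) \<le> C * norm (x - y)"
    proof (rule differentiable_bound[where S = "{-b..b}" and f' = "\<lambda>x h. h *\<^sub>R G' x"])
      fix z assume z: "z \<in> {-b..b}"
      show "(G has_derivative (\<lambda>h. h *\<^sub>R G' z)) (at z within {-b..b})"
        using G'(1)[of z] by (simp add: has_vector_derivative_def has_derivative_at_withinI)
      show "onorm (\<lambda>h. h *\<^sub>R G' z) \<le> C"
      proof (rule onorm_bound)
        show "0 \<le> C" by (simp add: C_def)
        have "norm (G' z) \<le> C" using B(2)[OF z] C2 by simp
        then show "norm (h *\<^sub>R G' z) \<le> C * norm h" for h using mult_right_mono[of "norm (G' z)" C "\<bar>h\<bar>"] by (simp add: mult.commute)
      qed
    qed (use that in auto)
    then show ?thesis by simp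
  qed
  have "norm (G x) \<le> C" if "\<bar>x\<bar> \<le> b" for x using B(1)[of x] that C2 by (auto simp: abs_le_iff)
  moreover have "C > 0" by (simp add: C_def)
  ultimately show ?thesis using lip by blast
qed

text \<open>The oriented integral covers both sides of the base point \<open>c\<close>. The angles,
  phases and integrated rates below are antiderivatives normalised at a convenient time.\<close>

lemma continuous_antiderivative:
  fixes f :: "real \<Rightarrow> real"
  assumes "continuous_on UNIV f"
  obtains g where "g c = 0" "\<And>x. (g has_real_derivative f x) (at x)"
proof -
  have D: "((\<lambda>x. LBINT y=c..x. f y) has_real_derivative f x) (at x)" for x
  proof -
  define a b where "a = min c x - 1" "b = max c x + 1"
  have "((\<lambda>u. LBINT y=c..u. f y) has_vector_derivative f x) (at x within {a..b})"
    by (rule interval_integral_FTC2) (use assms in \<open>auto simp: a_b_def intro: continuous_on_subset\<close>)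
  moreover have "x \<in> interior {a..b}" by (auto simp: a_b_def)
  ultimately show "((\<lambda>x. LBINT y=c..x. f y) has_real_derivative f x) (at x)"
    by (metis at_within_interior has_real_derivative_iff_has_vector_derivative)
  qed
  show ?thesis by (rule that[of "\<lambda>x. LBINT y=c..x. f y"]) (use D in auto)
qed

section \<open>Bumps, steps and cutoffs built from exp(-1/x)\<close>

definition flat :: "real poly \<Rightarrow> real \<Rightarrow> real" where
  "flat p x = (if x > 0 then poly p (1 / x) * exp (- 1 / x) else 0)"

lemma flat_tendsto_0: "((\<lambda>x. poly p (1 / x) * exp (- 1 / x)) \<longlongrightarrow> 0) (at_right (0::real))"
proof -
  have m: "((\<lambda>y::real. y ^ k / exp y) \<longlongrightarrow> 0) at_top" for k by (rule tendsto_power_div_exp_0)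
  have "((\<lambda>y. poly p y / exp y) \<longlongrightarrow> 0) at_top"
  proof -
    have "((\<lambda>y. \<Sum>i\<le>degree p. coeff p i * (y ^ i / exp y)) \<longlongrightarrow> (\<Sum>i\<le>degree p. coeff p i * 0)) at_top"
      by (intro tendsto_intros m)
    then show ?thesis by (simp add: poly_altdef sum_divide_distrib)
  qed
  then have "((\<lambda>x. poly p (inverse x) / exp (inverse x)) \<longlongrightarrow> 0) (at_right (0::real))"
    using filterlim_compose[OF _ filterlim_inverse_at_top_right] by blast
  then show ?thesis by (simp add: exp_minus field_simps inverse_eq_divide)
qed

text \<open>The family is closed under differentiation: with y = 1/x, the derivative of p(y) exp(-y)
  in x is y^2 (p(y) - p'(y)) exp(-y). At 0 the difference quotient from the right is again of this
  form, with polynomial y p(y), so the same limit settles differentiability there.\<close>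

lemma flat_deriv: "(flat p has_real_derivative flat ([:0,0,1:] * (p - pderiv p)) x) (at x)"
proof -
  consider "x < 0" | "x = 0" | "x > 0" by linarith
  then show ?thesis
  proof cases
    case 1
    have "((\<lambda>x. 0) has_real_derivative 0) (at x)" by simp
    then have "(flat p has_real_derivative 0) (at x)"
      by (rule has_field_derivative_transform_within_open[of _ _ _ "{..<0}"]) (use 1 in \<open>auto simp: flat_def\<close>)
    then show ?thesis using 1 by (simp add: flat_def)
  next
    case 3
    have "((\<lambda>x. poly p (1 / x) * exp (- 1 / x)) has_real_derivative
        poly ([:0,0,1:] * (p - pderiv p)) (1 / x) * exp (- 1 / x)) (at x)"
      using 3 by (auto intro!: derivative_eq_intros DERIV_chain'[where g = "poly p", OF _ poly_DERIV]
          simp: field_simps power2_eq_square)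
    then have "(flat p has_real_derivative poly ([:0,0,1:] * (p - pderiv p)) (1 / x) * exp (- 1 / x)) (at x)"
      by (rule has_field_derivative_transform_within_open[of _ _ _ "{0<..}"]) (use 3 in \<open>auto simp: flat_def\<close>)
    then show ?thesis using 3 by (simp add: flat_def)
  next
    case 2
    have "((\<lambda>x. poly ([:0,1:] * p) (1 / x) * exp (- 1 / x)) \<longlongrightarrow> 0) (at_right 0)"
      by (rule flat_tendsto_0)
    then have r: "((\<lambda>h. (flat p h - flat p 0) / h) \<longlongrightarrow> 0) (at_right 0)"
      by (rule Lim_transform_eventually) (auto simp: flat_def eventually_at_filter)
    have l: "((\<lambda>h. (flat p h - flat p 0) / h) \<longlongrightarrow> 0) (at_left 0)"
      by (rule Lim_transform_eventually[of "\<lambda>_. 0"]) (auto simp: flat_def eventually_at_filter)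
    have "((\<lambda>h. (flat p h - flat p 0) / h) \<longlongrightarrow> 0) (at 0)"
      using l r by (simp add: filterlim_split_at)
    then show ?thesis using 2 unfolding DERIV_def by (simp add: flat_def)
  qed
qed

lemma smoothR_flat: "smoothR (flat p)"
proof -
  define g where "g k = flat (((\<lambda>p. [:0,0,1:] * (p - pderiv p)) ^^ k) p)" for k
  have "smoothR (g 0)"
    by (rule smoothR_seqI)
      (auto simp only: g_def funpow.simps o_apply has_real_derivative_iff_has_vector_derivative[symmetric] flat_deriv)
  then show ?thesis by (simp add: g_def)
qed

definition bump :: "real \<Rightarrow> real" where
  "bump x = flat 1 (1 - x) * flat 1 (1 + x) / (flat 1 1)\<^sup>2"

lemma bump_0: "bump 0 = 1"
  by (simp add: bump_def flat_def power2_eq_square)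

lemma bump_outside: "\<bar>x\<bar> \<ge> 1 \<Longrightarrow> bump x = 0"
  by (auto simp: bump_def flat_def)

lemma bump_nonneg: "bump x \<ge> 0"
  by (auto simp: bump_def flat_def)

lemma bump_le_1: "bump x \<le> 1"
proof (cases "\<bar>x\<bar> < 1")
  case True
  then have x: "0 < 1 - x" "0 < 1 + x" by auto
  \<comment> \<open>The exponents add, and their sum is smallest at x = 0; hence the bump is largest
    there.\<close>
  have "2 \<le> 1/(1-x) + 1/(1+x)"
  proof -
    have p: "(1-x)*(1+x) \<le> 1" "(1-x)*(1+x) > 0" using x mult_pos_pos[OF x] by (auto simp: algebra_simps)
    have "1/(1-x) + 1/(1+x) = 2 / ((1-x)*(1+x))" using x by (simp add: divide_simps)
    also have "\<dots> \<ge> 2" using p by (simp add: le_divide_eq)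
    finally show ?thesis .
  qed
  then have "exp (- 1/(1-x)) * exp (- 1/(1+x)) \<le> exp (-2)"
    unfolding exp_add[symmetric] by simp
  moreover have "(exp (-1::real))\<^sup>2 = exp (-2)" by (simp add: power2_eq_square exp_add[symmetric])
  ultimately show ?thesis using x by (simp add: bump_def flat_def)
next
  case False then show ?thesis by (simp add: bump_outside)
qed

lemma smoothR_bump: "smoothR bump"
  unfolding bump_def by (intro smoothR_divide smoothR_mult smoothR_compose[OF smoothR_flat] smoothR_add smoothR_diff) auto

lemma smooth_step_exists:
  "\<exists>S::real\<Rightarrow>real. smoothR S \<and> mono S \<and> (\<forall>x\<le>0. S x = 0) \<and> (\<forall>x\<ge>1. S x = 1)"
proof -
  define b where "b x = flat 1 x * flat 1 (1 - x)" for x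
  have sb: "smoothR b" unfolding b_def
    by (intro smoothR_mult smoothR_compose[OF smoothR_flat] smoothR_flat smoothR_diff) auto
  then obtain g where g: "g 0 = 0" "\<And>x. (g has_real_derivative b x) (at x)"
    using continuous_antiderivative[OF smoothR_continuous] by blast
  have bnn: "b x \<ge> 0" for x by (simp add: b_def flat_def)
  have mono: "g x \<le> g y" if "x \<le> y" for x y
    using DERIV_nonneg_imp_nondecreasing[OF that] g(2) bnn by blast
  have c: "g x = g y" if "x \<le> y" "\<And>z. x \<le> z \<Longrightarrow> z \<le> y \<Longrightarrow> b z = 0" for x y
  proof (cases "x = y")
    case False
    then have "x < y" using that by simp
    moreover have "(g has_real_derivative 0) (at z)" if "x < z" "z < y" for z using g(2)[of z] that \<open>\<And>z. x \<le> z \<Longrightarrow> z \<le> y \<Longrightarrow> b z = 0\<close> by (metis less_imp_le)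
    moreover have "continuous_on {x..y} g" by (meson g(2) DERIV_isCont continuous_at_imp_continuous_on)
    ultimately show ?thesis using DERIV_isconst_end by metis
  qed simp
  have g0: "g x = 0" if "x \<le> 0" for x using c[OF that] g(1) by (simp add: b_def flat_def)
  have g1: "g x = g 1" if "1 \<le> x" for x using c[OF that] by (simp add: b_def flat_def)
  have pos: "g 1 > 0"
  proof -
    have "\<exists>z>0. z < 1 \<and> g 1 - g 0 = (1 - 0) * b z"
      by (rule MVT2) (use g(2) in auto)
    then show ?thesis using g(1) by (auto simp: b_def flat_def)
  qed
  have "smoothR (\<lambda>x. g x / g 1)"
    by (intro smoothR_divide smoothR_antideriv[OF _ sb]) (use g(2) in \<open>simp add: has_real_derivative_iff_has_vector_derivative\<close>)
  moreover have "\<forall>x\<ge>1. g x / g 1 = 1"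
  proof (intro allI impI)
    fix x :: real assume "1 \<le> x"
    then show "g x / g 1 = 1" using g1[of x] pos by simp
  qed
  ultimately show ?thesis
    by (intro exI[of _ "\<lambda>x. g x / g 1"]) (use pos g0 mono in \<open>auto simp: mono_def divide_right_mono\<close>)
qed

definition ustep :: "real \<Rightarrow> real" where
  "ustep = (SOME S. smoothR S \<and> mono S \<and> (\<forall>x\<le>0. S x = 0) \<and> (\<forall>x\<ge>1. S x = 1))"

definition step :: "real \<Rightarrow> real \<Rightarrow> real \<Rightarrow> real" where
  "step a b x = ustep ((x - a) / (b - a))"

lemma ustep: "smoothR ustep" "mono ustep" "x \<le> 0 \<Longrightarrow> ustep x = 0" "x \<ge> 1 \<Longrightarrow> ustep x = 1"
  using someI_ex[OF smooth_step_exists] by (simp_all add: ustep_def)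

lemma smoothR_step: "smoothR (step a b)"
  unfolding step_def by (intro smoothR_compose[OF ustep(1)] smoothR_divide smoothR_diff) auto

lemma step_eq_0: "a < b \<Longrightarrow> x \<le> a \<Longrightarrow> step a b x = 0"
  unfolding step_def by (rule ustep) (simp add: divide_nonpos_pos)

lemma step_eq_1: "a < b \<Longrightarrow> x \<ge> b \<Longrightarrow> step a b x = 1"
  unfolding step_def by (rule ustep) (simp add: le_divide_eq)

lemma step_bounds: "0 \<le> step a b x" "step a b x \<le> 1"
proof -
  have "ustep y \<ge> 0" for y using monoD[OF ustep(2), of "min 0 y" y] ustep(3)[of "min 0 y"] by simp
  moreover have "ustep y \<le> 1" for y using monoD[OF ustep(2), of y "max 1 y"] ustep(4)[of "max 1 y"] by simp
  ultimately show "0 \<le> step a b x" "step a b x \<le> 1" by (auto simp: step_def)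
qed

text \<open>An antiderivative of a plateau function with values in [0, 1] that is 1 on [-1, 1] and 0
  outside [-2, 2]. Truncating a coordinate must not enlarge the Lipschitz constant, hence slope at
  most 1; monotonicity puts all difference quotients into [0, 1], which keeps the factor of Q under
  control in \<open>lip_EE\<close>.\<close>

lemma cutoff_exists:
  "\<exists>H::real\<Rightarrow>real. smoothR H \<and> (\<forall>x. \<bar>x\<bar> \<le> 1 \<longrightarrow> H x = x) \<and> (\<forall>x. \<bar>H x\<bar> \<le> 2)
     \<and> (\<forall>x y. x \<le> y \<longrightarrow> 0 \<le> H y - H x \<and> H y - H x \<le> y - x)"
proof -
  define b where "b x = step (-2) (-1) x * step (-2) (-1) (- x)" for x
  have sb: "smoothR b" unfolding b_def
    by (intro smoothR_mult smoothR_compose[OF smoothR_step] smoothR_step smoothR_minus) auto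
  then obtain g where g: "g 0 = 0" "\<And>x. (g has_real_derivative b x) (at x)"
    using continuous_antiderivative[OF smoothR_continuous] by blast
  have bb: "0 \<le> b x" "b x \<le> 1" for x using step_bounds by (auto simp: b_def mult_le_one)
  have up: "0 \<le> g y - g x \<and> g y - g x \<le> y - x" if "x \<le> y" for x y
  proof -
    have "g x \<le> g y" using DERIV_nonneg_imp_nondecreasing[OF that] g(2) bb by blast
    moreover have "x - g x \<le> y - g y"
    proof (rule DERIV_nonneg_imp_nondecreasing[OF that])
      fix z show "\<exists>y. ((\<lambda>x. x - g x) has_real_derivative y) (at z) \<and> 0 \<le> y"
        using DERIV_diff[OF DERIV_ident g(2)] bb(2)[of z] by (intro exI[of _ "1 - b z"]) auto
    qed
    ultimately show ?thesis by auto
  qed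
  have id: "g x = x" if "\<bar>x\<bar> \<le> 1" for x
  proof -
    have D: "((\<lambda>x. g x - x) has_real_derivative 0) (at z)" if "\<bar>z\<bar> \<le> 1" for z
      using DERIV_diff[OF g(2)[of z] DERIV_ident] that by (auto simp: b_def step_eq_1 abs_le_iff)
    have "\<exists>c. \<forall>x\<in>{-1..1}. g x - x = c"
      by (rule has_field_derivative_zero_constant)
        (auto intro!: has_field_derivative_at_within[OF D] simp: abs_le_iff)
    then obtain c where c: "\<forall>x\<in>{-1..1}. g x - x = c" by blast
    have "g x - x = c" "g 0 - 0 = c" using bspec[OF c, of x] bspec[OF c, of 0] that by (auto simp: abs_le_iff)
    then show ?thesis using g(1) by simp
  qed
  have c: "g x = g y" if "x \<le> y" "\<And>z. x \<le> z \<Longrightarrow> z \<le> y \<Longrightarrow> b z = 0" for x y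
  proof (cases "x = y")
    case False
    then have "x < y" using that by simp
    moreover have "(g has_real_derivative 0) (at z)" if "x < z" "z < y" for z using g(2)[of z] that \<open>\<And>z. x \<le> z \<Longrightarrow> z \<le> y \<Longrightarrow> b z = 0\<close> by (metis less_imp_le)
    moreover have "continuous_on {x..y} g" by (meson g(2) DERIV_isCont continuous_at_imp_continuous_on)
    ultimately show ?thesis using DERIV_isconst_end by metis
  qed simp
  have le2: "g x \<le> 2" for x
  proof (cases "x \<le> 2")
    case True
    then show ?thesis using up[of "min 0 x" "x"] up[of "x" 0] g(1) up[of 0 x] by (cases "x \<ge> 0") auto
  next
    case False
    then have "g 2 = g x" by (intro c) (auto simp: b_def step_eq_0)
    then show ?thesis using up[of 0 2] g(1) by simp
  qed
  have ge2: "g x \<ge> -2" for x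
  proof (cases "x \<ge> -2")
    case True
    then show ?thesis using up[of "x" 0] g(1) up[of 0 x] by (cases "x \<ge> 0") auto
  next
    case False
    then have "g x = g (-2)" by (intro c) (auto simp: b_def step_eq_0)
    then show ?thesis using up[of "-2" 0] g(1) by simp
  qed
  have "smoothR g"
    by (intro smoothR_antideriv[OF _ sb]) (use g(2) in \<open>simp add: has_real_derivative_iff_has_vector_derivative\<close>)
  moreover have "\<bar>g x\<bar> \<le> 2" for x using le2[of x] ge2[of x] by linarith
  ultimately show ?thesis using id up by blast
qed

definition cutoff :: "real \<Rightarrow> real" where
  "cutoff = (SOME H. smoothR H \<and> (\<forall>x. \<bar>x\<bar> \<le> 1 \<longrightarrow> H x = x) \<and> (\<forall>x. \<bar>H x\<bar> \<le> 2)
     \<and> (\<forall>x y. x \<le> y \<longrightarrow> 0 \<le> H y - H x \<and> H y - H x \<le> y - x))"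

lemma cutoff:
  "smoothR cutoff" "\<bar>x\<bar> \<le> 1 \<Longrightarrow> cutoff x = x" "\<bar>cutoff x\<bar> \<le> 2"
  "x \<le> y \<Longrightarrow> 0 \<le> cutoff y - cutoff x \<and> cutoff y - cutoff x \<le> y - x"
  using someI_ex[OF cutoff_exists] unfolding cutoff_def[symmetric] by simp_all

text \<open>The logarithmically slow decay \<open>- 1 \<le> 2 s \<gamma>'(s)\<close> keeps both eigenvalues \<open>\<gamma>\<close> and
  \<open>\<gamma> + 2 s \<gamma>'\<close> of the derivative of \<open>v \<mapsto> \<gamma>(|v|^2) v\<close> in \<open>[-1, 1]\<close>.\<close>
lemma radial_cutoff_exists:
  "\<exists>(\<gamma>::real\<Rightarrow>real) \<gamma>' s0. smoothR \<gamma> \<and> (\<forall>s\<le>1. \<gamma> s = 1) \<and> (\<forall>s. 0 \<le> \<gamma> s \<and> \<gamma> s \<le> 1)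
     \<and> s0 > 1 \<and> (\<forall>s\<ge>s0. \<gamma> s = 0)
     \<and> (\<forall>s. (\<gamma> has_real_derivative \<gamma>' s) (at s)) \<and> (\<forall>s\<ge>0. \<gamma>' s \<le> 0 \<and> -1 \<le> 2 * s * \<gamma>' s)"
proof -
  \<comment> \<open>A smooth stand-in for 1/s: for s > 1 it is exp(-1/(s-1)) / (s-1). It obeys s
    b(s) \<le> 1, yet its integral \<open>l\<close> grows at least like a multiple of the logarithm,
    so \<gamma> can reach 0 as slowly as required.\<close>
  define b where "b s = flat [:0,1:] (s - 1)" for s
  have sb: "smoothR b" unfolding b_def by (intro smoothR_compose[OF smoothR_flat] smoothR_diff) auto
  then obtain l where l: "l 1 = 0" "\<And>x. (l has_real_derivative b x) (at x)"
    using continuous_antiderivative[OF smoothR_continuous] by blast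
  have sl: "smoothR l"
    by (intro smoothR_antideriv[OF _ sb]) (use l(2) in \<open>simp add: has_real_derivative_iff_has_vector_derivative\<close>)
  have bnn: "0 \<le> b s" for s by (auto simp: b_def flat_def)
  have bs: "s * b s \<le> 1" if "s \<ge> 0" for s
  proof (cases "s > 1")
    case True
    have "1 + 1 / (s - 1) \<le> exp (1 / (s - 1))" by (rule exp_ge_add_one_self)
    then have "s / (s - 1) \<le> exp (1 / (s - 1))" using True by (simp add: field_simps)
    then have "s / (s - 1) * exp (- 1 / (s - 1)) \<le> exp (1 / (s - 1)) * exp (- 1 / (s - 1))"
      by (intro mult_right_mono) auto
    also have "\<dots> = 1" by (simp add: exp_add[symmetric] add_divide_distrib[symmetric])
    finally show ?thesis using True by (simp add: b_def flat_def)
  qed (simp add: b_def flat_def)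
  have lmono: "l x \<le> l y" if "x \<le> y" for x y
    using DERIV_nonneg_imp_nondecreasing[OF that] l(2) bnn by blast
  have l0: "l x = 0" if "x \<le> 1" for x
  proof -
    have "(l has_real_derivative 0) (at z)" if "z \<le> 1" for z using l(2)[of z] that by (simp add: b_def flat_def)
    then have "\<exists>c. \<forall>x\<in>{..1}. l x = c"
      by (intro has_field_derivative_zero_constant) (auto intro: has_field_derivative_at_within)
    then show ?thesis using l(1) that by auto
  qed
  have lower: "l x \<ge> exp (-1) * ln x - exp (-1) * ln 2" if "x \<ge> 2" for x
  proof -
    have "l 2 - exp (-1) * ln 2 \<le> l x - exp (-1) * ln x"
    proof (rule DERIV_nonneg_imp_nondecreasing[OF that])
      fix y :: real assume y: "2 \<le> y" "y \<le> x"
      have "exp (-1) * (1/y) \<le> b y"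
      proof -
        have "exp (-1) / y \<le> exp (- 1 / (y-1)) / (y - 1)"
          using y by (intro frac_le) (auto simp: field_simps)
        then show ?thesis using y by (simp add: b_def flat_def)
      qed
      then show "\<exists>D. ((\<lambda>a. l a - exp (- 1) * ln a) has_real_derivative D) (at y) \<and> 0 \<le> D"
        using y DERIV_diff[OF l(2)[of y] DERIV_cmult[OF DERIV_ln_divide[of y]]] by (intro exI[of _ "b y - exp (-1) * (1/y)"]) auto
    qed
    then show ?thesis using lmono[of 1 2] l(1) by simp
  qed
  obtain S' where S': "\<And>x. (ustep has_real_derivative S' x) (at x)" "smoothR S'"
    using smoothR_real_derivE[OF ustep(1)] by blast
  obtain C where C: "C > 0" "\<And>x. \<bar>x\<bar> \<le> 2 \<Longrightarrow> norm (S' x) \<le> C"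
    using smoothR_bounded_on_Icc[OF S'(2), of 2] by blast
  have Snn: "S' x \<ge> 0" for x
  proof (rule ccontr)
    assume "\<not> ?thesis"
    then have "S' x < 0" by simp
    then obtain d where d: "d > 0" "\<And>h. 0 < h \<Longrightarrow> h < d \<Longrightarrow> ustep (x + h) < ustep x"
      using DERIV_neg_dec_right[OF S'(1)] by blast
    from d(2)[of "d/2"] d(1) monoD[OF ustep(2), of x "x + d/2"] show False by simp
  qed
  have Sout: "S' x = 0" if "x > 1" for x
  proof -
    have "(ustep has_real_derivative 0) (at x)"
      by (rule has_field_derivative_transform_within_open[of "\<lambda>_. 1" _ _ "{1<..}"]) (use that ustep(4) in auto)
    then show ?thesis using S'(1) DERIV_unique by blast
  qed
  \<comment> \<open>\<open>C\<close> bounds the slope of the step, so 2 s times the slope of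
    \<gamma> is at most 2 k C s b(s) \<le> 1 in size.\<close>
  define k where "k = 1 / (2 * C)"
  have k: "k > 0" using C by (simp add: k_def)
  define \<gamma> where "\<gamma> s = 1 - ustep (k * l s)" for s
  define \<gamma>' where "\<gamma>' s = - (S' (k * l s) * (k * b s))" for s
  have SC: "S' (k * l s) \<le> C" for s
  proof (cases "k * l s \<le> 1")
    case True
    moreover have "l s \<ge> 0" using lmono[of "min 1 s" s] l0[of "min 1 s"] by auto
    ultimately show ?thesis using C(2)[of "k * l s"] k by auto
  qed (use Sout C in auto)
  have d: "(\<gamma> has_real_derivative \<gamma>' s) (at s)" for s
    unfolding \<gamma>_def \<gamma>'_def
    using DERIV_diff[OF DERIV_const[of 1] DERIV_chain'[OF DERIV_cmult[OF l(2)[of s], of k] S'(1)]] by (simp add: mult.commute)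
  have "\<gamma>' s \<le> 0 \<and> -1 \<le> 2 * s * \<gamma>' s" if "s \<ge> 0" for s
  proof
    show "\<gamma>' s \<le> 0" using Snn bnn k by (simp add: \<gamma>'_def)
    have "2 * k * (S' (k * l s) * (s * b s)) \<le> 2 * k * (C * 1)"
      using Snn SC bs[OF that] k C that bnn by (intro mult_left_mono mult_mono) auto
    also have "\<dots> = 1" using C by (simp add: k_def)
    finally show "-1 \<le> 2 * s * \<gamma>' s" by (simp add: \<gamma>'_def algebra_simps)
  qed
  moreover have "smoothR \<gamma>" unfolding \<gamma>_def
    by (intro smoothR_diff smoothR_compose[OF ustep(1)] smoothR_mult sl) auto
  moreover have "0 \<le> \<gamma> s \<and> \<gamma> s \<le> 1" for s
    using step_bounds[of 0 1 "k * l s"] by (simp add: \<gamma>_def step_def)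
  moreover have "\<gamma> s = 1" if "s \<le> 1" for s using l0[OF that] ustep(3) by (simp add: \<gamma>_def)
  moreover have "\<exists>s0>1. \<forall>s\<ge>s0. \<gamma> s = 0"
  proof -
    \<comment> \<open>Solves k exp(-1) (ln s0 - ln 2) = 1: here the lower bound for \<open>l\<close>
      has carried the argument of the step up to 1.\<close>
    define s0 where "s0 = 2 * exp (exp 1 / k)"
    have s02: "s0 \<ge> 2" using k by (simp add: s0_def)
    have "\<gamma> s = 0" if "s \<ge> s0" for s
    proof -
      have "exp (-1) * ln s0 - exp (-1) * ln 2 = 1 / k"
        using k by (simp add: s0_def ln_mult algebra_simps exp_minus)
      then have "1 / k \<le> l s0" using lower[OF s02] by simp
      then have "1 / k \<le> l s" using lmono[OF that] by simp
      then have "1 \<le> k * l s" using k by (simp add: field_simps)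
      then show ?thesis using ustep(4) by (simp add: \<gamma>_def)
    qed
    then show ?thesis using s02 by (intro exI[of _ s0]) auto
  qed
  ultimately show ?thesis using d by blast
qed

section \<open>A calculus for infinitely differentiable maps\<close>

text \<open>Derivatives are forms on lists, as in \<open>C_infinity\<close>. The direction of the
  new derivative is the head of the list; the other entries range over the unit ball, so the
  estimate is one in operator norm.\<close>

definition isd :: "nat \<Rightarrow> ('a::real_normed_vector \<Rightarrow> 'a list \<Rightarrow> 'b::real_normed_vector) \<Rightarrow> ('a \<Rightarrow> 'a list \<Rightarrow> 'b) \<Rightarrow> bool" where
  "isd k M M' \<longleftrightarrow> (\<forall>x. \<forall>\<epsilon>>0. \<exists>\<delta>>0. \<forall>h. norm h < \<delta> \<longrightarrow>
        (\<forall>hs. length hs = k \<and> (\<forall>v\<in>set hs. norm v \<le> 1) \<longrightarrow>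
          norm (M (x + h) hs - M x hs - M' x (h # hs)) \<le> \<epsilon> * norm h))"

text \<open>The order n counts down while the degree k goes up, so closure properties follow by
  induction on n for fields of forms of every degree. One sequence of derivatives for all orders is
  extracted only at the end.\<close>

primrec Cml :: "nat \<Rightarrow> nat \<Rightarrow> ('a::real_normed_vector \<Rightarrow> 'a list \<Rightarrow> 'b::real_normed_vector) \<Rightarrow> bool" where
  "Cml 0 k M \<longleftrightarrow> (\<forall>x. multilinear_bounded k (M x))"
| "Cml (Suc n) k M \<longleftrightarrow> (\<forall>x. multilinear_bounded k (M x)) \<and> (\<exists>M'. isd k M M' \<and> Cml n (Suc k) M')"

definition Csmooth :: "('a::real_normed_vector \<Rightarrow> 'b::real_normed_vector) \<Rightarrow> bool" where
  "Csmooth f \<longleftrightarrow> (\<forall>n. Cml n 0 (\<lambda>x hs. f x))"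

lemma isdD:
  "isd k M M' \<Longrightarrow> e > 0 \<Longrightarrow> \<exists>\<delta>>0. \<forall>h hs. norm h < \<delta> \<longrightarrow> length hs = k \<longrightarrow> (\<forall>v\<in>set hs. norm v \<le> 1) \<longrightarrow>
     norm (M (x + h) hs - M x hs - M' x (h # hs)) \<le> e * norm h"
  unfolding isd_def by (simp add: imp_conjL)

lemma mb_linear: "multilinear_bounded k M \<Longrightarrow> length hs1 + length hs2 + 1 = k \<Longrightarrow> linear (\<lambda>h. M (hs1 @ h # hs2))"
  by (simp add: multilinear_bounded_def)

lemma mb_bound:
  assumes "multilinear_bounded k M"
  shows "\<exists>B>0. \<forall>hs. length hs = k \<longrightarrow> norm (M hs) \<le> B * prod_list (map norm hs)"
proof -
  obtain B where B: "\<And>hs. length hs = k \<Longrightarrow> norm (M hs) \<le> B * prod_list (map norm hs)"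
    using assms by (auto simp: multilinear_bounded_def)
  have "prod_list (map norm hs) \<ge> 0" for hs :: "'a list" by (induction hs) auto
  then have "norm (M hs) \<le> max 1 B * prod_list (map norm hs)" if "length hs = k" for hs
    by (rule order_trans[OF B[OF that] mult_right_mono[rotated]]) auto
  then show ?thesis by (intro exI[of _ "max 1 B"]) auto
qed

lemma mb_unit_bound:
  assumes "multilinear_bounded k M"
  shows "\<exists>B>0. (\<forall>hs. length hs = k \<longrightarrow> (\<forall>v\<in>set hs. norm v \<le> 1) \<longrightarrow> norm (M hs) \<le> B) \<and>
    (\<forall>h hs. length hs + 1 = k \<longrightarrow> (\<forall>v\<in>set hs. norm v \<le> 1) \<longrightarrow> norm (M (h # hs)) \<le> B * norm h)"
proof -
  obtain B where B: "B > 0" "\<And>hs. length hs = k \<Longrightarrow> norm (M hs) \<le> B * prod_list (map norm hs)"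
    using mb_bound[OF assms] by blast
  have p: "prod_list (map norm hs) \<le> 1 \<and> 0 \<le> prod_list (map norm hs)" if "\<forall>v\<in>set hs. norm v \<le> 1" for hs :: "'a list"
    using that by (induction hs) (auto intro!: mult_le_one)
  have "norm (M hs) \<le> B" if a: "length hs = k" "\<forall>v\<in>set hs. norm v \<le> 1" for hs
  proof -
    have "norm (M hs) \<le> B * prod_list (map norm hs)" using B(2) a by blast
    also have "\<dots> \<le> B * 1" using p[OF a(2)] B(1) by (intro mult_left_mono) auto
    finally show ?thesis by simp
  qed
  moreover have "norm (M (h # hs)) \<le> B * norm h" if a: "length hs + 1 = k" "\<forall>v\<in>set hs. norm v \<le> 1" for h hs
  proof -
    have "norm (M (h # hs)) \<le> B * (norm h * prod_list (map norm hs))" using B(2)[of "h # hs"] a by simp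
    also have "\<dots> \<le> B * (norm h * 1)" using B(1) p[OF a(2)] by (intro mult_left_mono) auto
    finally show ?thesis by simp
  qed
  ultimately show ?thesis using B(1) by blast
qed

lemma mb_cong:
  assumes "\<And>hs. length hs = k \<Longrightarrow> M hs = N hs"
  shows "multilinear_bounded k M \<longleftrightarrow> multilinear_bounded k N"
proof -
  have "(\<lambda>h. M (hs1 @ h # hs2)) = (\<lambda>h. N (hs1 @ h # hs2))" if "length hs1 + length hs2 + 1 = k" for hs1 hs2
    using assms that by auto
  then show ?thesis unfolding multilinear_bounded_def using assms by (simp cong: conj_cong)
qed

lemma isd_cong:
  assumes "\<And>x hs. length hs = k \<Longrightarrow> M x hs = N x hs" "\<And>x hs. length hs = Suc k \<Longrightarrow> M' x hs = N' x hs"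
  shows "isd k M M' \<Longrightarrow> isd k N N'"
  unfolding isd_def using assms by (simp cong: conj_cong)

lemma Cml_cong:
  assumes "\<And>x hs. length hs = k \<Longrightarrow> M x hs = N x hs" "Cml n k M"
  shows "Cml n k N"
proof (cases n)
  case 0
  then show ?thesis using assms mb_cong[of k "M _" "N _"] by simp
next
  case (Suc m)
  then obtain M' where M': "isd k M M'" "Cml m (Suc k) M'" using assms(2) by auto
  have "isd k N M'" by (rule isd_cong[OF _ _ M'(1)]) (use assms in auto)
  moreover have "multilinear_bounded k (N x)" for x
    using assms(2) Suc mb_cong[of k "M x" "N x"] assms(1) by auto
  ultimately show ?thesis using Suc M'(2) by auto
qed

lemma Cml_mb: "Cml n k M \<Longrightarrow> multilinear_bounded k (M x)"
  by (cases n) auto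

lemma Cml_Suc_imp: "Cml (Suc n) k M \<Longrightarrow> Cml n k M"
proof (induction n arbitrary: k M)
  case (Suc n)
  then obtain M' where M': "isd k M M'" "Cml (Suc n) (Suc k) M'" "\<forall>x. multilinear_bounded k (M x)" by auto
  then have "Cml n (Suc k) M'" using Suc.IH by blast
  with M' show ?case by auto
qed simp

lemma mb_scale:
  assumes "multilinear_bounded k M" "length hs1 + length hs2 = k"
  shows "M (hs1 @ map (\<lambda>v. c *\<^sub>R v) hs2) = c ^ length hs2 *\<^sub>R M (hs1 @ hs2)"
  using assms(2)
proof (induction hs2 arbitrary: hs1)
  case (Cons h hs2)
  have "M (hs1 @ map (\<lambda>v. c *\<^sub>R v) (h # hs2)) = c *\<^sub>R M ((hs1 @ [h]) @ map (\<lambda>v. c *\<^sub>R v) hs2)"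
    using linear_scale[OF mb_linear[OF assms(1), of hs1 "map (\<lambda>v. c *\<^sub>R v) hs2"], of c h] Cons.prems by simp
  also have "M ((hs1 @ [h]) @ map (\<lambda>v. c *\<^sub>R v) hs2) = c ^ length hs2 *\<^sub>R M ((hs1 @ [h]) @ hs2)"
    using Cons.prems by (intro Cons.IH) auto
  finally show ?case by simp
qed simp

text \<open>Determines the derivative form by derivatives in one real variable and so makes it
  unique. \<open>isd\<close> controls only unit vectors; the fixed arguments are therefore divided
  by a common R, which multilinearity returns as R^k.\<close>

lemma isd_directional:
  assumes d: "isd k M M'" and mb: "\<And>x. multilinear_bounded k (M x)" "\<And>x. multilinear_bounded (Suc k) (M' x)"
    and l: "length hs = k"
  shows "((\<lambda>s. M (x + s *\<^sub>R h) hs) has_vector_derivative M' x (h # hs)) (at 0)"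
proof -
  define R where "R = 1 + sum_list (map norm hs)"
  have snn: "sum_list (map norm l) \<ge> 0" for l :: "'a list" by (induction l) auto
  have R: "R > 0" using snn[of hs] by (simp add: R_def)
  have nR: "norm v \<le> R" if "v \<in> set hs" for v
    using that member_le_sum_list[of "norm v" "map norm hs"] by (force simp: R_def)
  define gs where "gs = map (\<lambda>v. (1/R) *\<^sub>R v) hs"
  have gs: "length gs = k" "\<forall>v\<in>set gs. norm v \<le> 1"
    using R nR l by (auto simp: gs_def field_simps)
  have hs: "hs = map (\<lambda>v. R *\<^sub>R v) gs" using R by (simp add: gs_def o_def)
  have sc: "M y hs = R ^ k *\<^sub>R M y gs" "M' y (h # hs) = R ^ k *\<^sub>R M' y (h # gs)" for y h :: 'a
    using mb_scale[OF mb(1)[of y], of "[]" gs R] mb_scale[OF mb(2)[of y], of "[h]" gs R] gs hs by auto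
  have lin: "M' x ((s *\<^sub>R h) # hs) = s *\<^sub>R M' x (h # hs)" for s
    using linear_scale[OF mb_linear[OF mb(2), of "[]" hs x], of s h] l by simp
  show ?thesis
    unfolding has_vector_derivative_def has_derivative_at_alt
  proof (intro conjI allI impI)
    show "bounded_linear (\<lambda>s. s *\<^sub>R M' x (h # hs))" by (rule bounded_linear_scaleR_left)
    fix e :: real assume e: "e > 0"
    define e' where "e' = e / (R ^ k * (norm h + 1))"
    have e': "e' > 0" using e R by (simp add: e'_def add_nonneg_pos)
    obtain \<delta> where \<delta>: "\<delta> > 0" "\<And>h hs. norm h < \<delta> \<Longrightarrow> length hs = k \<Longrightarrow> \<forall>v\<in>set hs. norm v \<le> 1 \<Longrightarrow>
       norm (M (x + h) hs - M x hs - M' x (h # hs)) \<le> e' * norm h"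
      using isdD[OF d e', of x] by blast
    show "\<exists>d>0. \<forall>y. norm (y - 0) < d \<longrightarrow> norm (M (x + y *\<^sub>R h) hs - M (x + 0 *\<^sub>R h) hs - (y - 0) *\<^sub>R M' x (h # hs)) \<le> e * norm (y - 0)"
    proof (intro exI[of _ "\<delta> / (norm h + 1)"] conjI allI impI)
      show "\<delta> / (norm h + 1) > 0" using \<delta> by (simp add: add_nonneg_pos)
      fix y :: real assume y: "norm (y - 0) < \<delta> / (norm h + 1)"
      have "norm (y *\<^sub>R h) \<le> \<bar>y\<bar> * (norm h + 1)" by (simp add: algebra_simps)
      also have "\<dots> < \<delta>" using y by (simp add: pos_less_divide_eq add_nonneg_pos)
      finally have "norm (M (x + y *\<^sub>R h) gs - M x gs - M' x ((y *\<^sub>R h) # gs)) \<le> e' * norm (y *\<^sub>R h)"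
        using \<delta>(2) gs by blast
      then have "R ^ k * norm (M (x + y *\<^sub>R h) gs - M x gs - M' x ((y *\<^sub>R h) # gs)) \<le> R ^ k * (e' * (\<bar>y\<bar> * norm h))"
        using R by (intro mult_left_mono) auto
      also have "R ^ k * norm (M (x + y *\<^sub>R h) gs - M x gs - M' x ((y *\<^sub>R h) # gs))
          = norm (M (x + y *\<^sub>R h) hs - M x hs - y *\<^sub>R M' x (h # hs))"
        using R norm_scaleR[of "R ^ k" "M (x + y *\<^sub>R h) gs - M x gs - M' x ((y *\<^sub>R h) # gs)"] lin[of y]
          by (simp add: sc scaleR_diff_right)
      also have "R ^ k * (e' * (\<bar>y\<bar> * norm h)) = e * \<bar>y\<bar> * (norm h / (norm h + 1))"
        using R by (simp add: e'_def)
      also have "\<dots> \<le> e * \<bar>y\<bar> * 1" using e by (intro mult_left_mono) (auto simp: divide_le_eq add_nonneg_pos)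
      finally show "norm (M (x + y *\<^sub>R h) hs - M (x + 0 *\<^sub>R h) hs - (y - 0) *\<^sub>R M' x (h # hs)) \<le> e * norm (y - 0)"
        by simp
    qed
  qed
qed

text \<open>\<open>Cml n\<close> provides a chain of n derivatives that might depend on n. The
  directional derivative \<open>dd\<close> is a canonical choice that agrees with each of these
  chains on lists of the right length, so its iterates serve all orders at once.\<close>

lemma Csmooth_imp_C_infinity:
  assumes "Csmooth f"
  shows "C_infinity f"
proof -
  define dd :: "('a \<Rightarrow> 'a list \<Rightarrow> 'b) \<Rightarrow> 'a \<Rightarrow> 'a list \<Rightarrow> 'b" where
    "dd M x hs = vector_derivative (\<lambda>s. M (x + s *\<^sub>R hd hs) (tl hs)) (at 0)" for M x hs
  have dd_eq: "dd M x hs = M' x hs" if "isd k M M'" "Cml n k M" "Cml n (Suc k) M'" "length hs = Suc k" for k n M M' x hs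
    using isd_directional[OF that(1) Cml_mb[OF that(2)] Cml_mb[OF that(3)], of "tl hs" x "hd hs"] that(4)
    unfolding dd_def by (cases hs) (auto intro: vector_derivative_at)
  have step: "isd k M (dd M) \<and> (\<forall>n. Cml n (Suc k) (dd M))" if "\<forall>n. Cml n k M" for k and M :: "'a \<Rightarrow> 'a list \<Rightarrow> 'b"
  proof -
    have "Cml n (Suc k) (dd M) \<and> isd k M (dd M)" for n
    proof -
      have "Cml (Suc n) k M" using that by blast
      then obtain M' where M': "isd k M M'" "Cml n (Suc k) M'" by auto
      have eq: "M' x hs = dd M x hs" if "length hs = Suc k" for x hs
        using dd_eq[OF M'(1) _ M'(2) that] \<open>\<forall>n. Cml n k M\<close> by simp
      show ?thesis using Cml_cong[OF eq M'(2)] isd_cong[OF _ eq M'(1)] by blast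
    qed
    then show ?thesis by blast
  qed
  define D where "D k = (dd ^^ k) (\<lambda>x hs. f x)" for k
  have D: "\<forall>n. Cml n k (D k)" for k
  proof (induction k)
    case 0 show ?case using assms by (simp add: D_def Csmooth_def)
  next
    case (Suc k) show ?case using step[OF Suc] by (simp add: D_def)
  qed
  have "isd k (D k) (D (Suc k))" for k using step[OF D[of k]] by (simp add: D_def)
  moreover have "multilinear_bounded k (D k x)" for k x using D Cml_mb by blast
  moreover have "D 0 x [] = f x" for x by (simp add: D_def)
  ultimately show ?thesis unfolding C_infinity_def isd_def by blast
qed

section \<open>Closure of smooth maps under sums, products and composition\<close>

lemma mb_zero: "multilinear_bounded k (\<lambda>hs. 0)"
  by (auto simp: multilinear_bounded_def intro!: exI[of _ 0] linear_zero)

lemma Cml_const: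
  assumes "multilinear_bounded k M"
  shows "Cml n k (\<lambda>x. M)"
  using assms
proof (induction n arbitrary: k M)
  case (Suc n)
  have "isd k (\<lambda>x. M) (\<lambda>x hs. 0)" by (auto simp: isd_def intro!: exI[of _ 1])
  then show ?case using Suc mb_zero by auto
qed simp

lemma Csmooth_const: "Csmooth (\<lambda>x. c)"
  unfolding Csmooth_def
  by (intro allI Cml_const) (auto simp: multilinear_bounded_def)

lemma Csmooth_linear:
  assumes "bounded_linear f"
  shows "Csmooth f"
  unfolding Csmooth_def
proof
  fix n
  interpret bounded_linear f by fact
  obtain K where K: "\<And>x. norm (f x) \<le> norm x * K" using bounded by blast
  have mb0: "multilinear_bounded 0 (\<lambda>hs. c)" for c :: 'b by (auto simp: multilinear_bounded_def)
  show "Cml n 0 (\<lambda>x hs. f x)"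
  proof (cases n)
    case (Suc m)
    have "multilinear_bounded (Suc 0) (\<lambda>hs. f (hd hs))"
      unfolding multilinear_bounded_def
    proof (intro conjI allI impI exI[of _ K])
      fix hs1 hs2 :: "'a list" assume "length hs1 + length hs2 + 1 = Suc 0"
      then show "linear (\<lambda>h. f (hd (hs1 @ h # hs2)))" by (simp add: linear_axioms)
    next
      fix hs :: "'a list" assume "length hs = Suc 0"
      then show "norm (f (hd hs)) \<le> K * prod_list (map norm hs)"
        using K by (cases hs) (auto simp: mult.commute)
    qed
    then have "Cml m (Suc 0) (\<lambda>x hs. f (hd hs))" by (rule Cml_const)
    moreover have "isd 0 (\<lambda>x hs. f x) (\<lambda>x hs. f (hd hs))"
      by (auto simp: isd_def add intro!: exI[of _ 1])
    ultimately show ?thesis using Suc mb0 by auto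
  qed (simp add: mb0)
qed

lemma mb_add:
  assumes "multilinear_bounded k M" "multilinear_bounded k N"
  shows "multilinear_bounded k (\<lambda>hs. M hs + N hs)"
proof -
  obtain A B where "\<And>hs. length hs = k \<Longrightarrow> norm (M hs) \<le> A * prod_list (map norm hs)"
     "\<And>hs. length hs = k \<Longrightarrow> norm (N hs) \<le> B * prod_list (map norm hs)"
    using assms by (auto simp: multilinear_bounded_def)
  then have "norm (M hs + N hs) \<le> (A + B) * prod_list (map norm hs)" if "length hs = k" for hs
    using that norm_triangle_ineq[of "M hs" "N hs"] by (fastforce simp: algebra_simps)
  moreover have "linear (\<lambda>h. M (hs1 @ h # hs2) + N (hs1 @ h # hs2))" if "length hs1 + length hs2 + 1 = k" for hs1 hs2
    by (intro linear_compose_add mb_linear[OF assms(1) that] mb_linear[OF assms(2) that])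
  ultimately show ?thesis unfolding multilinear_bounded_def by blast
qed

lemma Cml_add:
  assumes "Cml n k M" "Cml n k N"
  shows "Cml n k (\<lambda>x hs. M x hs + N x hs)"
  using assms
proof (induction n arbitrary: k M N)
  case 0 then show ?case by (simp add: mb_add)
next
  case (Suc n)
  then obtain M' N' where d: "isd k M M'" "Cml n (Suc k) M'" "isd k N N'" "Cml n (Suc k) N'" by auto
  have "isd k (\<lambda>x hs. M x hs + N x hs) (\<lambda>x hs. M' x hs + N' x hs)"
    unfolding isd_def
  proof (intro allI impI)
    fix x and e :: real assume "e > 0"
    then have e2: "e / 2 > 0" by simp
    obtain d1 where d1: "d1 > 0" "\<And>h hs. norm h < d1 \<Longrightarrow> length hs = k \<Longrightarrow> \<forall>v\<in>set hs. norm v \<le> 1 \<Longrightarrow>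
       norm (M (x + h) hs - M x hs - M' x (h # hs)) \<le> e / 2 * norm h"
      using isdD[OF d(1) e2, of x] by blast
    obtain d2 where d2: "d2 > 0" "\<And>h hs. norm h < d2 \<Longrightarrow> length hs = k \<Longrightarrow> \<forall>v\<in>set hs. norm v \<le> 1 \<Longrightarrow>
       norm (N (x + h) hs - N x hs - N' x (h # hs)) \<le> e / 2 * norm h"
      using isdD[OF d(3) e2, of x] by blast
    show "\<exists>\<delta>>0. \<forall>h. norm h < \<delta> \<longrightarrow> (\<forall>hs. length hs = k \<and> (\<forall>v\<in>set hs. norm v \<le> 1) \<longrightarrow>
          norm (M (x + h) hs + N (x + h) hs - (M x hs + N x hs) - (M' x (h # hs) + N' x (h # hs))) \<le> e * norm h)"
    proof (intro exI[of _ "min d1 d2"] conjI allI impI)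
      fix h :: 'a and hs :: "'a list" assume h: "norm h < min d1 d2" "length hs = k \<and> (\<forall>v\<in>set hs. norm v \<le> 1)"
      have "norm (M (x + h) hs + N (x + h) hs - (M x hs + N x hs) - (M' x (h # hs) + N' x (h # hs)))
         = norm ((M (x + h) hs - M x hs - M' x (h # hs)) + (N (x + h) hs - N x hs - N' x (h # hs)))"
        by (simp add: algebra_simps)
      also have "\<dots> \<le> e / 2 * norm h + e / 2 * norm h"
        by (rule norm_triangle_le, rule add_mono) (use d1 d2 h in auto)
      finally show "norm (M (x + h) hs + N (x + h) hs - (M x hs + N x hs) - (M' x (h # hs) + N' x (h # hs))) \<le> e * norm h"
        by simp
    qed (use d1 d2 in auto)
  qed
  moreover have "multilinear_bounded k (\<lambda>hs. M x hs + N x hs)" for x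
    using Suc.prems by (intro mb_add) auto
  ultimately show ?case using Suc.IH[OF d(2,4)] by auto
qed

lemma Csmooth_add: "Csmooth f \<Longrightarrow> Csmooth g \<Longrightarrow> Csmooth (\<lambda>x. f x + g x)"
  unfolding Csmooth_def using Cml_add by blast

text \<open>Differentiating a product distributes the k directions over the two factors.
  \<open>I\<close> records the slots that went to one factor; a new direction enters as slot 0 and
  shifts the others by \<open>Suc\<close>.\<close>

definition sel_len :: "nat \<Rightarrow> nat set \<Rightarrow> nat \<Rightarrow> bool" where
  "sel_len k I a \<longleftrightarrow> card {i. i < k \<and> i \<in> I} = a"

lemma sel_lenD: "sel_len k I a \<Longrightarrow> length hs = k \<Longrightarrow> length (nths hs I) = a"
  by (simp add: sel_len_def length_nths)

lemma sel_len_Suc: "sel_len k I a \<Longrightarrow> sel_len (Suc k) (Suc ` I) a"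
proof -
  have "{i. i < Suc k \<and> i \<in> Suc ` I} = Suc ` {i. i < k \<and> i \<in> I}" by auto
  then show "sel_len k I a \<Longrightarrow> sel_len (Suc k) (Suc ` I) a" by (simp add: sel_len_def card_image)
qed

lemma sel_len_insert: "sel_len k I a \<Longrightarrow> sel_len (Suc k) (insert 0 (Suc ` I)) (Suc a)"
proof -
  have "{i. i < Suc k \<and> i \<in> insert 0 (Suc ` I)} = insert 0 (Suc ` {i. i < k \<and> i \<in> I})" by auto
  then show "sel_len k I a \<Longrightarrow> sel_len (Suc k) (insert 0 (Suc ` I)) (Suc a)" by (simp add: sel_len_def card_image)
qed

lemma nths_shift: "nths (h # hs) (Suc ` I) = nths hs I" "nths (h # hs) (insert 0 (Suc ` I)) = h # nths hs I"
proof -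
  have "{j. Suc j \<in> Suc ` I} = I" "{j. Suc j \<in> insert 0 (Suc ` I)} = I" by auto
  then show "nths (h # hs) (Suc ` I) = nths hs I" "nths (h # hs) (insert 0 (Suc ` I)) = h # nths hs I"
    by (simp_all add: nths_Cons)
qed

lemma compl_shift: "- (Suc ` I) = insert 0 (Suc ` (- I))" "- (insert 0 (Suc ` I)) = Suc ` (- I)"
proof -
  have "x = 0 \<or> (\<exists>y. x = Suc y)" for x by (cases x) auto
  then show "- (Suc ` I) = insert 0 (Suc ` (- I))" "- (insert 0 (Suc ` I)) = Suc ` (- I)" by fastforce+
qed

lemma prod_list_nths:
  "prod_list (map norm hs) = prod_list (map norm (nths hs I)) * prod_list (map norm (nths hs (- I)))"
  for hs :: "'a::real_normed_vector list"
proof (induction hs arbitrary: I)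
  case (Cons h hs)
  have "{j. Suc j \<in> - I} = - {j. Suc j \<in> I}" by auto
  then show ?case using Cons[of "{j. Suc j \<in> I}"] by (auto simp: nths_Cons)
qed simp

lemma set_nths_unit: "\<forall>v\<in>set hs. norm v \<le> 1 \<Longrightarrow> \<forall>v\<in>set (nths hs I). norm v \<le> 1"
  using set_nths_subset[of hs I] by auto

context bounded_bilinear
begin

definition tensor :: "nat set \<Rightarrow> ('x \<Rightarrow> 'x list \<Rightarrow> 'a) \<Rightarrow> ('x \<Rightarrow> 'x list \<Rightarrow> 'b) \<Rightarrow> 'x \<Rightarrow> 'x list \<Rightarrow> 'c" where
  "tensor I M N x hs = prod (M x (nths hs I)) (N x (nths hs (- I)))"

lemma mb_tensor:
  fixes M :: "'x::real_normed_vector \<Rightarrow> 'x list \<Rightarrow> 'a" and N :: "'x \<Rightarrow> 'x list \<Rightarrow> 'b"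
  assumes "multilinear_bounded a (M x)" "multilinear_bounded b (N x)" "sel_len k I a" "sel_len k (- I) b"
  shows "multilinear_bounded k (tensor I M N x)"
proof -
  obtain A where A: "A > 0" "\<And>hs. length hs = a \<Longrightarrow> norm (M x hs) \<le> A * prod_list (map norm hs)"
    using mb_bound[OF assms(1)] by blast
  obtain B where B: "B > 0" "\<And>hs. length hs = b \<Longrightarrow> norm (N x hs) \<le> B * prod_list (map norm hs)"
    using mb_bound[OF assms(2)] by blast
  obtain K where K: "K > 0" "\<And>a b. norm (prod a b) \<le> norm a * norm b * K"
    using pos_bounded by blast
  have pn: "prod_list (map norm hs) \<ge> 0" for hs :: "'x list" by (induction hs) auto
  have "norm (tensor I M N x hs) \<le> (A * B * K) * prod_list (map norm hs)" if "length hs = k" for hs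
  proof -
    have "norm (tensor I M N x hs) \<le> norm (M x (nths hs I)) * norm (N x (nths hs (- I))) * K"
      unfolding tensor_def by (rule K)
    also have "\<dots> \<le> (A * prod_list (map norm (nths hs I))) * (B * prod_list (map norm (nths hs (- I)))) * K"
      using A B K pn sel_lenD[OF assms(3) that] sel_lenD[OF assms(4) that]
      by (intro mult_right_mono mult_mono) (auto intro: mult_nonneg_nonneg less_imp_le)
    finally show ?thesis by (subst prod_list_nths[of hs I]) (simp add: algebra_simps)
  qed
  moreover have "linear (\<lambda>h. tensor I M N x (hs1 @ h # hs2))" if l: "length hs1 + length hs2 + 1 = k" for hs1 hs2
  proof -
    define J where "J = {j. j + length hs1 + 1 \<in> I}"
    have J2: "{j. Suc (j + length hs1) \<in> I} = J" "{j. Suc (j + length hs1) \<in> - I} = - J" by (auto simp: J_def)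
    have len: "length (nths (hs1 @ h # hs2) I) = a" "length (nths (hs1 @ h # hs2) (- I)) = b" for h
      using sel_lenD[OF assms(3), of "hs1 @ h # hs2"] sel_lenD[OF assms(4), of "hs1 @ h # hs2"] l by auto
    show ?thesis
    proof (cases "length hs1 \<in> I")
      case True
      then have e: "nths (hs1 @ h # hs2) I = nths hs1 I @ h # nths hs2 J"
        "nths (hs1 @ h # hs2) (- I) = nths hs1 (- I) @ nths hs2 (- J)" for h
        using J2 by (auto simp: nths_append nths_Cons)
      have L: "linear (\<lambda>h. M x (nths hs1 I @ h # nths hs2 J))"
        by (rule mb_linear[OF assms(1)]) (use len(1)[of 0] e(1) in simp)
      have "linear (\<lambda>h. prod (M x (nths hs1 I @ h # nths hs2 J)) (N x (nths hs1 (- I) @ nths hs2 (- J))))"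
        by (rule linear_compose[OF L bounded_linear.linear[OF bounded_linear_left], unfolded o_def])
      then show ?thesis unfolding tensor_def e .
    next
      case False
      then have e: "nths (hs1 @ h # hs2) I = nths hs1 I @ nths hs2 J"
        "nths (hs1 @ h # hs2) (- I) = nths hs1 (- I) @ h # nths hs2 (- J)" for h
        using J2 by (auto simp: nths_append nths_Cons)
      have L: "linear (\<lambda>h. N x (nths hs1 (- I) @ h # nths hs2 (- J)))"
        by (rule mb_linear[OF assms(2)]) (use len(2)[of 0] e(2) in simp)
      have "linear (\<lambda>h. prod (M x (nths hs1 I @ nths hs2 J)) (N x (nths hs1 (- I) @ h # nths hs2 (- J))))"
        by (rule linear_compose[OF L bounded_linear.linear[OF bounded_linear_right], unfolded o_def])
      then show ?thesis unfolding tensor_def e .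
    qed
  qed
  ultimately show ?thesis unfolding multilinear_bounded_def by blast
qed

text \<open>Leibniz rule: the new slot joins one factor or the other. Both terms are tensors again,
  so the class is closed under differentiation up to sums, as the induction in
  \<open>Cml_tensor\<close> requires.\<close>

lemma isd_tensor:
  fixes M M' :: "'x::real_normed_vector \<Rightarrow> 'x list \<Rightarrow> 'a" and N N' :: "'x \<Rightarrow> 'x list \<Rightarrow> 'b"
  assumes mb: "\<And>x. multilinear_bounded a (M x)" "\<And>x. multilinear_bounded b (N x)"
    "\<And>x. multilinear_bounded (Suc a) (M' x)" "\<And>x. multilinear_bounded (Suc b) (N' x)"
    and sl: "sel_len k I a" "sel_len k (- I) b"
    and d: "isd a M M'" "isd b N N'"
  shows "isd k (tensor I M N) (\<lambda>x hs. tensor (insert 0 (Suc ` I)) M' N x hs + tensor (Suc ` I) M N' x hs)"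
  unfolding isd_def
proof (intro allI impI)
  fix x and e :: real assume e: "e > 0"
  obtain K where K: "K > 0" "\<And>a b. norm (prod a b) \<le> norm a * norm b * K" using pos_bounded by blast
  obtain A where A: "A > 0" "\<And>hs. length hs = a \<Longrightarrow> \<forall>v\<in>set hs. norm v \<le> 1 \<Longrightarrow> norm (M x hs) \<le> A"
    using mb_unit_bound[OF mb(1)[of x]] by blast
  obtain B where B: "B > 0" "\<And>hs. length hs = b \<Longrightarrow> \<forall>v\<in>set hs. norm v \<le> 1 \<Longrightarrow> norm (N x hs) \<le> B"
    using mb_unit_bound[OF mb(2)[of x]] by blast
  obtain A' where A': "A' > 0" "\<And>h hs. length hs + 1 = Suc a \<Longrightarrow> \<forall>v\<in>set hs. norm v \<le> 1 \<Longrightarrow> norm (M' x (h # hs)) \<le> A' * norm h"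
    using mb_unit_bound[OF mb(3)[of x]] by blast
  obtain B' where B': "B' > 0" "\<And>h hs. length hs + 1 = Suc b \<Longrightarrow> \<forall>v\<in>set hs. norm v \<le> 1 \<Longrightarrow> norm (N' x (h # hs)) \<le> B' * norm h"
    using mb_unit_bound[OF mb(4)[of x]] by blast
  \<comment> \<open>The remainder is the sum of \<Delta>M times N(x+h), M'(h) times N(x+h) - N(x),
    and M times \<Delta>N. \<open>e1\<close> serves the outer terms; the middle one is quadratic in
    h and is handled by \<open>d3\<close>.\<close>
  define e1 where "e1 = min 1 (e / (3 * K * (B + B' + 1 + A)))"
  have pos: "3 * K * (B + B' + 1 + A) > 0" using A B A' B' K by simp
  have e1: "e1 > 0" "e1 \<le> 1" "e1 * K * (B + B' + 1) \<le> e / 3" "e1 * K * A \<le> e / 3"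
  proof -
    show "e1 > 0" "e1 \<le> 1" using e pos by (auto simp: e1_def)
    have "e1 \<le> e / (3 * K * (B + B' + 1 + A))" by (simp add: e1_def)
    then have s: "e1 * (K * (B + B' + 1 + A)) \<le> e / 3" using pos by (simp add: pos_le_divide_eq algebra_simps)
    have "e1 * K * (B + B' + 1) \<le> e1 * (K * (B + B' + 1 + A))" "e1 * K * A \<le> e1 * (K * (B + B' + 1 + A))"
      using \<open>e1 > 0\<close> K A B B' by (auto simp: algebra_simps)
    with s show "e1 * K * (B + B' + 1) \<le> e / 3" "e1 * K * A \<le> e / 3" by linarith+
  qed
  obtain d1 where d1: "d1 > 0" "\<And>h hs. norm h < d1 \<Longrightarrow> length hs = a \<Longrightarrow> \<forall>v\<in>set hs. norm v \<le> 1 \<Longrightarrow>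
       norm (M (x + h) hs - M x hs - M' x (h # hs)) \<le> e1 * norm h"
    using isdD[OF d(1) e1(1), of x] by blast
  obtain d2 where d2: "d2 > 0" "\<And>h hs. norm h < d2 \<Longrightarrow> length hs = b \<Longrightarrow> \<forall>v\<in>set hs. norm v \<le> 1 \<Longrightarrow>
       norm (N (x + h) hs - N x hs - N' x (h # hs)) \<le> e1 * norm h"
    using isdD[OF d(2) e1(1), of x] by blast
  define d3 where "d3 = e / 3 / (K * A' * (B' + 1))"
  have d3: "d3 > 0" using e K A' B' by (simp add: d3_def)
  show "\<exists>\<delta>>0. \<forall>h. norm h < \<delta> \<longrightarrow> (\<forall>hs. length hs = k \<and> (\<forall>v\<in>set hs. norm v \<le> 1) \<longrightarrow>
     norm (tensor I M N (x + h) hs - tensor I M N x hs -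
        (tensor (insert 0 (Suc ` I)) M' N x (h # hs) + tensor (Suc ` I) M N' x (h # hs))) \<le> e * norm h)"
  proof (intro exI[of _ "min (min d1 d2) (min d3 1)"] conjI allI impI)
    show "min (min d1 d2) (min d3 1) > 0" using d1 d2 d3 by simp
    fix h :: 'x and hs :: "'x list"
    assume h: "norm h < min (min d1 d2) (min d3 1)" and hs: "length hs = k \<and> (\<forall>v\<in>set hs. norm v \<le> 1)"
    define u v where "u = nths hs I" and "v = nths hs (- I)"
    have u: "length u = a" "\<forall>w\<in>set u. norm w \<le> 1" and v: "length v = b" "\<forall>w\<in>set v. norm w \<le> 1"
      using sel_lenD[OF sl(1)] sel_lenD[OF sl(2)] hs set_nths_unit by (auto simp: u_def v_def)
    define \<Delta>M \<Delta>N where "\<Delta>M = M (x + h) u - M x u - M' x (h # u)" and "\<Delta>N = N (x + h) v - N x v - N' x (h # v)"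
    have D: "norm \<Delta>M \<le> e1 * norm h" "norm \<Delta>N \<le> e1 * norm h"
      using d1 d2 u v h by (auto simp: \<Delta>M_def \<Delta>N_def)
    have nd: "norm (N (x + h) v - N x v) \<le> (B' + 1) * norm h"
    proof -
      have "N (x + h) v - N x v = \<Delta>N + N' x (h # v)" by (simp add: \<Delta>N_def)
      then have "norm (N (x + h) v - N x v) \<le> e1 * norm h + B' * norm h"
        using norm_triangle_mono[OF D(2) B'(2)[of v h]] v by simp
      also have "\<dots> \<le> 1 * norm h + B' * norm h" using e1 by (intro add_mono mult_right_mono) auto
      finally show ?thesis by (simp add: algebra_simps)
    qed
    have nN: "norm (N (x + h) v) \<le> B + B' + 1"
    proof -
      have "norm (N (x + h) v) \<le> norm (N (x + h) v - N x v) + norm (N x v)"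
        using norm_triangle_ineq[of "N (x + h) v - N x v" "N x v"] by simp
      moreover have "(B' + 1) * norm h \<le> (B' + 1) * 1"
        using h B' by (intro mult_left_mono) auto
      moreover have "norm (N x v) \<le> B" using B(2) v by blast
      ultimately show ?thesis using nd by simp
    qed
    have "tensor I M N (x + h) hs - tensor I M N x hs -
        (tensor (insert 0 (Suc ` I)) M' N x (h # hs) + tensor (Suc ` I) M N' x (h # hs))
      = prod \<Delta>M (N (x + h) v) + prod (M' x (h # u)) (N (x + h) v - N x v) + prod (M x u) \<Delta>N"
      by (simp add: tensor_def compl_shift nths_shift u_def[symmetric] v_def[symmetric] \<Delta>M_def \<Delta>N_def
          add_left add_right diff_left diff_right algebra_simps)
    also have "norm \<dots> \<le> e / 3 * norm h + e / 3 * norm h + e / 3 * norm h"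
    proof (intro norm_triangle_mono)
      have "norm (prod \<Delta>M (N (x + h) v)) \<le> (e1 * norm h) * (B + B' + 1) * K"
        by (rule order_trans[OF K(2)], intro mult_right_mono mult_mono D nN) (use e1 K in auto)
      also have "\<dots> = (e1 * K * (B + B' + 1)) * norm h" by simp
      also have "\<dots> \<le> e / 3 * norm h" by (intro mult_right_mono e1) auto
      finally show "norm (prod \<Delta>M (N (x + h) v)) \<le> e / 3 * norm h" .
      have "norm (prod (M x u) \<Delta>N) \<le> A * (e1 * norm h) * K"
        by (rule order_trans[OF K(2)], intro mult_right_mono mult_mono D A u) (use A K in auto)
      also have "\<dots> = (e1 * K * A) * norm h" by simp
      also have "\<dots> \<le> e / 3 * norm h" by (intro mult_right_mono e1) auto
      finally show "norm (prod (M x u) \<Delta>N) \<le> e / 3 * norm h" .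
      have "norm (prod (M' x (h # u)) (N (x + h) v - N x v)) \<le> (A' * norm h) * ((B' + 1) * norm h) * K"
        by (rule order_trans[OF K(2)], intro mult_right_mono mult_mono nd A') (use A' K u in auto)
      also have "\<dots> = (K * A' * (B' + 1)) * norm h * norm h" by simp
      also have "\<dots> \<le> (K * A' * (B' + 1)) * norm h * d3"
        by (rule mult_left_mono) (use h K A' B' in auto)
      also have "\<dots> = e / 3 * norm h"
      proof -
        have "K * A' * (B' + 1) \<noteq> 0" using K A' B' by simp
        then have "(K * A' * (B' + 1)) * d3 = e / 3" unfolding d3_def by simp
        then show ?thesis by (metis mult.assoc mult.commute)
      qed
      finally show "norm (prod (M' x (h # u)) (N (x + h) v - N x v)) \<le> e / 3 * norm h" .
    qed
    finally show "norm (tensor I M N (x + h) hs - tensor I M N x hs -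
        (tensor (insert 0 (Suc ` I)) M' N x (h # hs) + tensor (Suc ` I) M N' x (h # hs))) \<le> e * norm h"
      by simp
  qed
qed

lemma Cml_tensor:
  fixes M :: "'x::real_normed_vector \<Rightarrow> 'x list \<Rightarrow> 'a" and N :: "'x \<Rightarrow> 'x list \<Rightarrow> 'b"
  assumes "Cml n a M" "Cml n b N" "sel_len k I a" "sel_len k (- I) b"
  shows "Cml n k (tensor I M N)"
  using assms
proof (induction n arbitrary: a b k M N I)
  case 0
  have "multilinear_bounded k (tensor I M N x)" for x
    by (rule mb_tensor[OF _ _ 0(3,4)]) (use 0 in auto)
  then show ?case by simp
next
  case (Suc n)
  then obtain M' N' where d: "isd a M M'" "Cml n (Suc a) M'" "isd b N N'" "Cml n (Suc b) N'" by auto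
  note sl = Suc.prems(3,4)
  have "Cml n (Suc k) (tensor (insert 0 (Suc ` I)) M' N)"
    by (rule Suc.IH[OF d(2) Cml_Suc_imp[OF Suc.prems(2)]]) (use sel_len_insert sel_len_Suc sl in \<open>simp_all add: compl_shift\<close>)
  moreover have "Cml n (Suc k) (tensor (Suc ` I) M N')"
    by (rule Suc.IH[OF Cml_Suc_imp[OF Suc.prems(1)] d(4)]) (use sel_len_insert sel_len_Suc sl in \<open>simp_all add: compl_shift\<close>)
  ultimately have "Cml n (Suc k) (\<lambda>x hs. tensor (insert 0 (Suc ` I)) M' N x hs + tensor (Suc ` I) M N' x hs)"
    by (rule Cml_add)
  moreover have "isd k (tensor I M N) (\<lambda>x hs. tensor (insert 0 (Suc ` I)) M' N x hs + tensor (Suc ` I) M N' x hs)"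
    by (rule isd_tensor[OF Cml_mb[OF Suc.prems(1)] Cml_mb[OF Suc.prems(2)] Cml_mb[OF d(2)] Cml_mb[OF d(4)] sl d(1) d(3)])
  moreover have "multilinear_bounded k (tensor I M N x)" for x
    by (rule mb_tensor[OF Cml_mb[OF Suc.prems(1)] Cml_mb[OF Suc.prems(2)] sl])
  ultimately show ?case by auto
qed

lemma Csmooth_prod:
  fixes f :: "'x::real_normed_vector \<Rightarrow> 'a" and g :: "'x \<Rightarrow> 'b"
  assumes "Csmooth f" "Csmooth g"
  shows "Csmooth (\<lambda>x. prod (f x) (g x))"
  unfolding Csmooth_def
proof
  fix n
  have "Cml n 0 (tensor {} (\<lambda>x hs. f x) (\<lambda>x hs. g x))"
    by (rule Cml_tensor[of n 0 _ 0]) (use assms in \<open>auto simp: Csmooth_def sel_len_def\<close>)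
  moreover have "tensor {} (\<lambda>x hs. f x) (\<lambda>x hs. g x) = (\<lambda>x hs. prod (f x) (g x))"
    by (simp add: tensor_def fun_eq_iff)
  ultimately show "Cml n 0 (\<lambda>x hs. prod (f x) (g x))" by simp
qed

end

lemma isd0_has_derivative:
  assumes "isd 0 M M'" "multilinear_bounded (Suc 0) (M' x)"
  shows "((\<lambda>x. M x []) has_derivative (\<lambda>h. M' x [h])) (at x)"
  unfolding has_derivative_at_alt
proof (intro conjI allI impI)
  obtain B where B: "\<And>h hs. length hs + 1 = Suc 0 \<Longrightarrow> \<forall>v\<in>set hs. norm v \<le> 1 \<Longrightarrow> norm (M' x (h # hs)) \<le> B * norm h"
    using mb_unit_bound[OF assms(2)] by blast
  have "linear (\<lambda>h. M' x [h])" using mb_linear[OF assms(2), of "[]" "[]"] by simp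
  then show "bounded_linear (\<lambda>h. M' x [h])"
    unfolding bounded_linear_def bounded_linear_axioms_def
    using B[of "[]"] by (auto simp: mult.commute intro!: exI[of _ B])
  fix e :: real assume e: "e > 0"
  obtain d where d: "d > 0" "\<And>h hs. norm h < d \<Longrightarrow> length hs = 0 \<Longrightarrow> \<forall>v\<in>set hs. norm v \<le> 1 \<Longrightarrow>
     norm (M (x + h) hs - M x hs - M' x (h # hs)) \<le> e * norm h"
    using isdD[OF assms(1) e, of x] by blast
  show "\<exists>d>0. \<forall>y. norm (y - x) < d \<longrightarrow> norm (M y [] - M x [] - M' x [y - x]) \<le> e * norm (y - x)"
    by (rule exI[of _ d]) (use d(1) d(2)[of "_ - x" "[]"] in auto)
qed

lemma has_derivative_isd0:
  assumes "\<And>x. (f has_derivative (\<lambda>h. M' x [h])) (at x)"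
  shows "isd 0 (\<lambda>x hs. f x) M'"
  unfolding isd_def
proof (intro allI impI)
  fix x and e :: real assume "e > 0"
  then obtain d where d: "d > 0" "\<And>y. norm (y - x) < d \<Longrightarrow> norm (f y - f x - M' x [y - x]) \<le> e * norm (y - x)"
    using assms[of x] unfolding has_derivative_at_alt by blast
  show "\<exists>\<delta>>0. \<forall>h. norm h < \<delta> \<longrightarrow> (\<forall>hs. length hs = 0 \<and> (\<forall>v\<in>set hs. norm v \<le> 1) \<longrightarrow>
          norm (f (x + h) - f x - M' x (h # hs)) \<le> e * norm h)"
    by (rule exI[of _ d]) (use d(1) d(2)[of "x + _"] in auto)
qed

text \<open>By the chain rule the derivative is the product of the derivative P of \<phi> with G'
  composed with \<phi>. All slots belong to P, and G' is again smooth, so induction with \<phi>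
  fixed and G varying closes.\<close>

lemma Csmooth_compose:
  fixes \<phi> :: "'x::real_normed_vector \<Rightarrow> real"
  assumes "smoothR G" "Csmooth \<phi>"
  shows "Csmooth (\<lambda>x. G (\<phi> x))"
  unfolding Csmooth_def
proof
  fix n
  show "Cml n 0 (\<lambda>x hs. G (\<phi> x))" using assms(1)
  proof (induction n arbitrary: G)
    case 0 show ?case by (auto simp: multilinear_bounded_def)
  next
    case (Suc n)
    obtain G' where G': "\<And>x. (G has_vector_derivative G' x) (at x)" "smoothR G'"
      using smoothR_derivE[OF Suc.prems] by blast
    have "Cml (Suc n) 0 (\<lambda>x hs. \<phi> x)" using assms(2) by (simp add: Csmooth_def)
    then obtain P where P: "isd 0 (\<lambda>x hs. \<phi> x) P" "Cml n (Suc 0) P" by auto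
    have ch: "((\<lambda>x. G (\<phi> x)) has_derivative (\<lambda>h. P x [h] *\<^sub>R G' (\<phi> x))) (at x)" for x
      using diff_chain_at[OF isd0_has_derivative[OF P(1) Cml_mb[OF P(2)]] G'(1)[unfolded has_vector_derivative_def]]
      by (simp add: o_def)
    have "Cml n (Suc 0) (bounded_bilinear.tensor scaleR UNIV P (\<lambda>x hs. G' (\<phi> x)))"
      by (rule bounded_bilinear.Cml_tensor[OF bounded_bilinear_scaleR P(2) Suc.IH[OF G'(2)]])
        (auto simp: sel_len_def)
    moreover have "isd 0 (\<lambda>x hs. G (\<phi> x)) (bounded_bilinear.tensor scaleR UNIV P (\<lambda>x hs. G' (\<phi> x)))"
      by (rule has_derivative_isd0) (simp add: bounded_bilinear.tensor_def[OF bounded_bilinear_scaleR] ch)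
    moreover have "multilinear_bounded 0 (\<lambda>hs. G (\<phi> x))" for x by (auto simp: multilinear_bounded_def)
    ultimately show ?case by auto
  qed
qed

lemmas Csmooth_scaleR = bounded_bilinear.Csmooth_prod[OF bounded_bilinear_scaleR]
lemmas Csmooth_mult = bounded_bilinear.Csmooth_prod[OF bounded_bilinear_mult]
lemmas Csmooth_inner = bounded_bilinear.Csmooth_prod[OF bounded_bilinear_inner]

lemma Csmooth_bounded_linear_comp:
  assumes "bounded_linear T" "Csmooth f"
  shows "Csmooth (\<lambda>x. T (f x))"
proof -
  have "bounded_bilinear (\<lambda>(c::real) y. c *\<^sub>R T y)"
    using bounded_bilinear.comp[OF bounded_bilinear_scaleR bounded_linear_ident assms(1)] by simp
  from bounded_bilinear.Csmooth_prod[OF this Csmooth_const[of 1] assms(2)] show ?thesis by simp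
qed

lemma Csmooth_minus: "Csmooth f \<Longrightarrow> Csmooth (\<lambda>x. - f x)"
  by (rule Csmooth_bounded_linear_comp[OF bounded_linear_minus[OF bounded_linear_ident]])

lemma Csmooth_diff: "Csmooth f \<Longrightarrow> Csmooth g \<Longrightarrow> Csmooth (\<lambda>x. f x - g x)"
  using Csmooth_add[of f "\<lambda>x. - g x"] Csmooth_minus[of g] by simp

section \<open>Complete normed spaces\<close>

text \<open>A type of sort \<open>{real_normed_vector, complete_space}\<close> is not syntactically of class \<open>banach\<close>.
  Library facts about Banach spaces are transferred through the isometric embedding of the space
  as constant functions into a type of bounded continuous functions.\<close>

instance bcontfun :: (metric_space, "{complete_space, real_normed_vector}") banach ..

definition emb :: "'a::{real_normed_vector,complete_space} \<Rightarrow> real \<Rightarrow>\<^sub>C 'a" where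
  "emb x = const_bcontfun x"

definition ext :: "(real \<Rightarrow>\<^sub>C 'a) \<Rightarrow> 'a::{real_normed_vector,complete_space}" where
  "ext w = apply_bcontfun w 0"

lemma ext_emb [simp]: "ext (emb x) = x"
  by (simp add: ext_def emb_def const_bcontfun.rep_eq)

lemma norm_emb [simp]: "norm (emb x) = norm x"
proof (rule antisym)
  show "norm (emb x) \<le> norm x"
    by (rule norm_bound) (simp add: emb_def const_bcontfun.rep_eq)
  show "norm x \<le> norm (emb x)"
    using norm_bounded[of "emb x" 0] by (simp add: emb_def const_bcontfun.rep_eq)
qed

lemma bounded_linear_emb: "bounded_linear emb"
proof
  fix x y :: 'a and r :: real
  show "emb (x + y) = emb x + emb y" "emb (r *\<^sub>R x) = r *\<^sub>R emb x"
    by (rule bcontfun_eqI, simp add: emb_def const_bcontfun.rep_eq plus_bcontfun.rep_eq scaleR_bcontfun.rep_eq)+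
  show "\<exists>K. \<forall>x::'a. norm (emb x) \<le> norm x * K" by (intro exI[of _ 1]) simp
qed

lemma bounded_linear_ext: "bounded_linear ext"
proof
  fix x y :: "real \<Rightarrow>\<^sub>C 'a" and r :: real
  show "ext (x + y) = ext x + ext y" "ext (r *\<^sub>R x) = r *\<^sub>R ext x"
    by (simp_all add: ext_def plus_bcontfun.rep_eq scaleR_bcontfun.rep_eq)
  show "\<exists>K. \<forall>x::real \<Rightarrow>\<^sub>C 'a. norm (ext x) \<le> norm x * K"
    by (intro exI[of _ 1]) (simp add: ext_def norm_bounded)
qed

lemma emb_cont: "continuous_on A f \<Longrightarrow> continuous_on A (\<lambda>x. emb (f x))"
  by (rule bounded_linear.continuous_on[OF bounded_linear_emb])

lemma summable_CauchyI:
  fixes f :: "nat \<Rightarrow> 'a::{real_normed_vector,complete_space}"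
  assumes "\<And>e. e > 0 \<Longrightarrow> \<exists>N. \<forall>m\<ge>N. \<forall>n. norm (sum f {m..<n}) < e"
  shows "summable f"
proof -
  have "norm (sum (\<lambda>i. emb (f i)) A) = norm (sum f A)" for A
    using linear_sum[OF bounded_linear.linear[OF bounded_linear_emb], of f A] norm_emb by metis
  then have "summable (\<lambda>i. emb (f i))" unfolding summable_Cauchy using assms by simp
  from bounded_linear.summable[OF bounded_linear_ext this] show ?thesis by simp
qed

lemma summable_norm_complete:
  fixes f :: "nat \<Rightarrow> 'a::{real_normed_vector,complete_space}"
  assumes "summable (\<lambda>n. norm (f n))"
  shows "summable f"
proof -
  have "summable (\<lambda>n. emb (f n))" by (rule summable_norm_cancel) (simp add: assms)
  from bounded_linear.summable[OF bounded_linear_ext this] show ?thesis by simp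
qed

lemma emb_integral: "(f has_integral I) A \<Longrightarrow> ((\<lambda>x. emb (f x)) has_integral emb I) A"
  using has_integral_linear[OF _ bounded_linear_emb, of f I A] by (simp add: o_def)

lemma ext_integral: "((\<lambda>x. emb (f x)) has_integral I) A \<Longrightarrow> (f has_integral ext I) A"
  using has_integral_linear[OF _ bounded_linear_ext, of "\<lambda>x. emb (f x)" I A] by (simp add: o_def)

lemma integrable_cont:
  fixes f :: "real \<Rightarrow> 'a::{real_normed_vector,complete_space}"
  assumes "continuous_on {a..b} f"
  shows "f integrable_on {a..b}"
  using integrable_continuous_real[OF emb_cont[OF assms]] ext_integral unfolding integrable_on_def by blast

lemma norm_integral_le:
  fixes f :: "real \<Rightarrow> 'a::{real_normed_vector,complete_space}"
  assumes f: "(f has_integral I) {a..b}" and g: "g integrable_on {a..b}"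
    and le: "\<And>x. x \<in> {a..b} \<Longrightarrow> norm (f x) \<le> g x"
  shows "norm I \<le> integral {a..b} g"
proof -
  have "norm (integral {a..b} (\<lambda>x. emb (f x))) \<le> integral {a..b} g"
    by (rule integral_norm_bound_integral) (use emb_integral[OF f] g le in auto)
  then show ?thesis using integral_unique[OF emb_integral[OF f]] by simp
qed

lemma emb_integral_eq: "f integrable_on A \<Longrightarrow> integral A (\<lambda>x. emb (f x)) = emb (integral A f)"
  by (intro integral_unique emb_integral integrable_integral)

lemma integral_cont_param:
  fixes f :: "'b::topological_space \<Rightarrow> real \<Rightarrow> 'a::{real_normed_vector,complete_space}"
  assumes c: "continuous_on (U \<times> {a..b}) (\<lambda>(t, x). f t x)"
  shows "continuous_on U (\<lambda>t. integral {a..b} (f t))"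
proof -
  have "continuous_on U (\<lambda>t. integral (cbox a b) (\<lambda>x. emb (f t x)))"
    by (rule integral_continuous_on_param) (use emb_cont[OF c] in \<open>simp add: case_prod_beta\<close>)
  then have "continuous_on U (\<lambda>t. ext (integral (cbox a b) (\<lambda>x. emb (f t x))))"
    by (rule bounded_linear.continuous_on[OF bounded_linear_ext])
  moreover have "ext (integral (cbox a b) (\<lambda>x. emb (f t x))) = integral {a..b} (f t)" if "t \<in> U" for t
  proof -
    have "continuous_on {a..b} (\<lambda>x. (t, x))" by (intro continuous_on_Pair continuous_on_const continuous_on_id)
    then have "continuous_on {a..b} (f t)"
      using continuous_on_compose2[OF c, of "{a..b}" "\<lambda>x. (t, x)"] that by auto
    then show ?thesis by (simp add: emb_integral_eq integrable_cont)
  qed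
  ultimately show ?thesis by (simp cong: continuous_on_cong)
qed

lemma has_integral_split:
  fixes f :: "real \<Rightarrow> 'a::{real_normed_vector,complete_space}"
  assumes "a \<le> c" "c \<le> b" "(f has_integral I) {a..b}" "(f has_integral J) {a..c}"
  shows "(f has_integral (I - J)) {c..b}"
proof -
  let ?g = "\<lambda>x. emb (f x)"
  have g: "(?g has_integral emb I) {a..b}" "(?g has_integral emb J) {a..c}"
    using assms emb_integral by blast+
  have "?g integrable_on {c..b}"
    by (rule integrable_subinterval_real[of _ a b]) (use g assms in auto)
  then obtain K where K: "(?g has_integral K) {c..b}" by blast
  have "(?g has_integral (emb J + K)) {a..b}" by (rule has_integral_combine[OF assms(1,2) g(2) K])
  then have "emb J + K = emb I" using g(1) has_integral_unique by blast
  moreover have "emb (I - J) = emb I - emb J"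
    by (rule linear_diff[OF bounded_linear.linear[OF bounded_linear_emb]])
  ultimately have "emb J + K = emb J + emb (I - J)" by simp
  then have "K = emb (I - J)" by simp
  then show ?thesis using ext_integral[OF K] by simp
qed

section \<open>Orthonormal sequences\<close>

text \<open>Weighted permutation of coordinates. The semigroup, the tails, the projection to the
  chain, the rate shifts and the exchanges all have this form, so a single norm bound, by the
  largest weight, covers them.\<close>

definition wperm :: "(nat \<Rightarrow> 'a::real_inner) \<Rightarrow> (nat \<Rightarrow> real) \<Rightarrow> (nat \<Rightarrow> nat) \<Rightarrow> 'a \<Rightarrow> 'a" where
  "wperm f \<xi> \<sigma> u = (\<Sum>j. (\<xi> j * inner u (f (\<sigma> j))) *\<^sub>R f j)"

locale ons =
  fixes f :: "nat \<Rightarrow> 'a::{real_inner,complete_space}"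
  assumes on: "inner (f m) (f n) = (if m = n then 1 else 0)"
begin

lemma inner_sum_ons: "finite A \<Longrightarrow> inner (\<Sum>i\<in>A. a i *\<^sub>R f i) (f k) = (if k \<in> A then a k else 0)"
proof -
  assume A: "finite A"
  have "inner (\<Sum>i\<in>A. a i *\<^sub>R f i) (f k) = (\<Sum>i\<in>A. if i = k then a i else 0)"
    unfolding inner_sum_left by (rule sum.cong) (auto simp: on)
  then show ?thesis using A by (simp add: sum.delta)
qed

lemma norm_sum_ons: "finite A \<Longrightarrow> (norm (\<Sum>i\<in>A. a i *\<^sub>R f i))\<^sup>2 = (\<Sum>i\<in>A. (a i)\<^sup>2)"
proof -
  assume A: "finite A"
  have "inner p (\<Sum>i\<in>A. a i *\<^sub>R f i) = (\<Sum>i\<in>A. a i * inner p (f i))" for p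
    by (simp add: inner_sum_right)
  then have "(norm (\<Sum>i\<in>A. a i *\<^sub>R f i))\<^sup>2 = (\<Sum>i\<in>A. a i * inner (\<Sum>i\<in>A. a i *\<^sub>R f i) (f i))"
    unfolding power2_norm_eq_inner .
  also have "\<dots> = (\<Sum>i\<in>A. (a i)\<^sup>2)"
    by (rule sum.cong) (auto simp: inner_sum_ons[OF A] power2_eq_square)
  finally show ?thesis .
qed

lemma summable_ons:
  assumes "summable (\<lambda>n. (a n)\<^sup>2)"
  shows "summable (\<lambda>n. a n *\<^sub>R f n)"
proof (rule summable_CauchyI)
  fix e :: real assume e: "e > 0"
  then have "e\<^sup>2 > 0" by simp
  then obtain N where N: "\<forall>m\<ge>N. \<forall>n. norm (\<Sum>i=m..<n. (a i)\<^sup>2) < e\<^sup>2"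
    using assms unfolding summable_Cauchy by blast
  have "norm (\<Sum>i=m..<n. a i *\<^sub>R f i) < e" if "m \<ge> N" for m n
  proof -
    have "(norm (\<Sum>i=m..<n. a i *\<^sub>R f i))\<^sup>2 < e\<^sup>2"
      using N that by (simp add: norm_sum_ons sum_nonneg)
    then show ?thesis using e by (simp add: power2_less_imp_less)
  qed
  then show "\<exists>N. \<forall>m\<ge>N. \<forall>n. norm (\<Sum>i=m..<n. a i *\<^sub>R f i) < e" by blast
qed

lemma inner_suminf_ons:
  assumes "summable (\<lambda>n. (a n)\<^sup>2)"
  shows "inner (\<Sum>n. a n *\<^sub>R f n) y = (\<Sum>n. a n * inner (f n) y)" "summable (\<lambda>n. a n * inner (f n) y)"
  using bounded_linear.suminf[OF bounded_linear_inner_left[of y] summable_ons[OF assms]]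
    bounded_linear.summable[OF bounded_linear_inner_left[of y] summable_ons[OF assms]] by simp_all

lemma coord_suminf_ons:
  assumes "summable (\<lambda>n. (a n)\<^sup>2)"
  shows "inner (\<Sum>n. a n *\<^sub>R f n) (f k) = a k"
proof -
  have "inner (\<Sum>n. a n *\<^sub>R f n) (f k) = (\<Sum>n. if n = k then a n else 0)"
    unfolding inner_suminf_ons[OF assms] by (rule arg_cong[where f = suminf]) (auto simp: on)
  also have "\<dots> = a k" using suminf_finite[of "{k}" "\<lambda>n. if n = k then a n else 0"] by simp
  finally show ?thesis .
qed

lemma norm_suminf_ons:
  assumes "summable (\<lambda>n. (a n)\<^sup>2)"
  shows "(norm (\<Sum>n. a n *\<^sub>R f n))\<^sup>2 = (\<Sum>n. (a n)\<^sup>2)"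
  unfolding power2_norm_eq_inner inner_suminf_ons(1)[OF assms]
  by (rule arg_cong[where f = suminf]) (auto simp: inner_commute[of "f _"] coord_suminf_ons[OF assms] power2_eq_square)

lemma bessel: "summable (\<lambda>n. (inner u (f n))\<^sup>2)" "(\<Sum>n. (inner u (f n))\<^sup>2) \<le> (norm u)\<^sup>2"
proof -
  have b: "(\<Sum>n<N. (inner u (f n))\<^sup>2) \<le> (norm u)\<^sup>2" for N
  proof -
    define p where "p = (\<Sum>n<N. inner u (f n) *\<^sub>R f n)"
    have "inner u p = (\<Sum>n<N. (inner u (f n))\<^sup>2)" by (simp add: p_def inner_sum_right power2_eq_square)
    moreover have "inner p p = (\<Sum>n<N. (inner u (f n))\<^sup>2)"
      using norm_sum_ons[of "{..<N}" "\<lambda>n. inner u (f n)"] by (simp add: p_def power2_norm_eq_inner)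
    moreover have "0 \<le> inner (u - p) (u - p)" by simp
    ultimately show ?thesis by (simp add: inner_diff_left inner_diff_right inner_commute power2_norm_eq_inner)
  qed
  show "summable (\<lambda>n. (inner u (f n))\<^sup>2)"
    by (rule summableI_nonneg_bounded[OF _ b]) auto
  then show "(\<Sum>n. (inner u (f n))\<^sup>2) \<le> (norm u)\<^sup>2" using b by (intro suminf_le_const)
qed

lemma wperm_sq:
  assumes "\<And>j. \<bar>\<xi> j\<bar> \<le> X" "inj \<sigma>"
  shows "summable (\<lambda>j. (\<xi> j * inner u (f (\<sigma> j)))\<^sup>2)" "(\<Sum>j. (\<xi> j * inner u (f (\<sigma> j)))\<^sup>2) \<le> (X * norm u)\<^sup>2"
proof -
  have r: "summable (\<lambda>j. (inner u (f (\<sigma> j)))\<^sup>2)" "(\<Sum>j. (inner u (f (\<sigma> j)))\<^sup>2) \<le> (\<Sum>n. (inner u (f n))\<^sup>2)"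
    using summable_reindex[OF bessel(1) assms(2)] suminf_reindex_mono[OF bessel(1) assms(2)] by (auto simp: o_def)
  have le: "(\<xi> j * inner u (f (\<sigma> j)))\<^sup>2 \<le> X\<^sup>2 * (inner u (f (\<sigma> j)))\<^sup>2" for j
    unfolding power_mult_distrib
    by (intro mult_right_mono) (use assms(1)[of j] abs_le_square_iff[of "\<xi> j" X] in auto)
  show s: "summable (\<lambda>j. (\<xi> j * inner u (f (\<sigma> j)))\<^sup>2)"
    by (rule summable_comparison_test'[OF summable_mult[OF r(1), of "X\<^sup>2"]]) (use le in auto)
  have "(\<Sum>j. (\<xi> j * inner u (f (\<sigma> j)))\<^sup>2) \<le> (\<Sum>j. X\<^sup>2 * (inner u (f (\<sigma> j)))\<^sup>2)"
    by (rule suminf_le[OF le s summable_mult[OF r(1)]])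
  also have "\<dots> = X\<^sup>2 * (\<Sum>j. (inner u (f (\<sigma> j)))\<^sup>2)" by (rule suminf_mult[OF r(1)])
  also have "\<dots> \<le> X\<^sup>2 * (norm u)\<^sup>2" using r(2) bessel(2)[of u] by (intro mult_left_mono) auto
  finally show "(\<Sum>j. (\<xi> j * inner u (f (\<sigma> j)))\<^sup>2) \<le> (X * norm u)\<^sup>2" by (simp add: power_mult_distrib)
qed

context
  fixes \<xi> :: "nat \<Rightarrow> real" and X :: real and \<sigma> :: "nat \<Rightarrow> nat"
  assumes \<xi>: "\<And>j. \<bar>\<xi> j\<bar> \<le> X" and \<sigma>: "inj \<sigma>"
begin

lemma wperm_coord: "inner (wperm f \<xi> \<sigma> u) (f k) = \<xi> k * inner u (f (\<sigma> k))"
  unfolding wperm_def by (rule coord_suminf_ons[OF wperm_sq(1)[OF \<xi> \<sigma>]])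

lemma wperm_orth: "(\<And>j. inner (f j) y = 0) \<Longrightarrow> inner (wperm f \<xi> \<sigma> u) y = 0"
  unfolding wperm_def using inner_suminf_ons(1)[OF wperm_sq(1)[OF \<xi> \<sigma>, where u = u], where y = y] by simp

lemma wperm_norm: "norm (wperm f \<xi> \<sigma> u) \<le> X * norm u"
proof -
  have "X \<ge> 0" using \<xi>[of 0] by simp
  moreover have "(norm (wperm f \<xi> \<sigma> u))\<^sup>2 \<le> (X * norm u)\<^sup>2"
    unfolding wperm_def norm_suminf_ons[OF wperm_sq(1)[OF \<xi> \<sigma>]] by (rule wperm_sq(2)[OF \<xi> \<sigma>])
  ultimately show ?thesis using power2_le_imp_le[of "norm (wperm f \<xi> \<sigma> u)" "X * norm u"] by simp
qed

lemma wperm_sums: "(\<lambda>j. (\<xi> j * inner u (f (\<sigma> j))) *\<^sub>R f j) sums wperm f \<xi> \<sigma> u"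
  unfolding wperm_def by (rule summable_sums[OF summable_ons[OF wperm_sq(1)[OF \<xi> \<sigma>]]])

lemma wperm_bounded_linear: "bounded_linear (wperm f \<xi> \<sigma>)"
proof
  fix u v show "wperm f \<xi> \<sigma> (u + v) = wperm f \<xi> \<sigma> u + wperm f \<xi> \<sigma> v"
    using sums_add[OF wperm_sums[of u] wperm_sums[of v]] sums_unique2[OF wperm_sums[of "u + v"]]
    by (simp add: inner_add_left algebra_simps)
next
  fix r u show "wperm f \<xi> \<sigma> (r *\<^sub>R u) = r *\<^sub>R wperm f \<xi> \<sigma> u"
    using sums_scaleR_right[OF wperm_sums[of u], of r] sums_unique2[OF wperm_sums[of "r *\<^sub>R u"]]
    by (simp add: algebra_simps)
next
  show "\<exists>K. \<forall>x. norm (wperm f \<xi> \<sigma> x) \<le> norm x * K" using wperm_norm by (auto simp: mult.commute)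
qed

end

lemma wperm_lincomb:
  assumes "\<And>j. \<bar>\<xi> j\<bar> \<le> X" "\<And>j. \<bar>\<zeta> j\<bar> \<le> Z" "inj \<sigma>"
  shows "wperm f (\<lambda>j. a * \<xi> j + b * \<zeta> j) \<sigma> u = a *\<^sub>R wperm f \<xi> \<sigma> u + b *\<^sub>R wperm f \<zeta> \<sigma> u"
proof -
  have "(\<lambda>j. ((a * \<xi> j + b * \<zeta> j) * inner u (f (\<sigma> j))) *\<^sub>R f j) sums (a *\<^sub>R wperm f \<xi> \<sigma> u + b *\<^sub>R wperm f \<zeta> \<sigma> u)"
    using sums_add[OF sums_scaleR_right[OF wperm_sums[OF assms(1,3), where u = u], of a] sums_scaleR_right[OF wperm_sums[OF assms(2,3), where u = u], of b]]
    by (simp add: algebra_simps)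
  then show ?thesis unfolding wperm_def[of f "\<lambda>j. a * \<xi> j + b * \<zeta> j"] by (simp add: sums_iff)
qed

end

locale onb = ons +
  assumes dense: "closure (span (range f)) = UNIV"
begin

lemma orth_all_zero:
  assumes "\<And>n. inner z (f n) = 0"
  shows "z = 0"
proof -
  have "subspace {v. inner z v = 0}"
    by (auto simp: subspace_def inner_add_right)
  then have "span (range f) \<subseteq> {v. inner z v = 0}"
    using assms by (intro span_minimal) auto
  moreover have "closed {v. inner z v = 0}" by (intro closed_Collect_eq continuous_intros)
  ultimately have "closure (span (range f)) \<subseteq> {v. inner z v = 0}" by (rule closure_minimal)
  then have "inner z z = 0" using dense by blast
  then show ?thesis by simp
qed

lemma coord_eqI:
  assumes "\<And>n. inner x (f n) = inner y (f n)"
  shows "x = y"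
  using orth_all_zero[of "x - y"] assms by (simp add: inner_diff_left)

lemma expansion: "(\<lambda>n. inner u (f n) *\<^sub>R f n) sums u"
proof -
  have "u = (\<Sum>n. inner u (f n) *\<^sub>R f n)"
    by (rule coord_eqI) (simp add: coord_suminf_ons[OF bessel(1)])
  then show ?thesis using summable_sums[OF summable_ons[OF bessel(1)[of u]]] by simp
qed

end

section \<open>Mild solutions\<close>

lemma gronwall:
  fixes \<phi> :: "real \<Rightarrow> real"
  assumes c: "continuous_on {0..T} \<phi>" and L: "L \<ge> 0"
    and le: "\<And>t. t \<in> {0..T} \<Longrightarrow> \<phi> t \<le> a + L * integral {0..t} \<phi>" and t: "t \<in> {0..T}"
  shows "\<phi> t \<le> a * exp (L * t)"
proof -
  define \<psi> where "\<psi> t = (a + L * integral {0..t} \<phi>) * exp (- L * t)" for t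
  have d: "(\<psi> has_real_derivative (L * \<phi> s - L * (a + L * integral {0..s} \<phi>)) * exp (- L * s)) (at s within {0..t})"
    if "s \<in> {0..t}" for s
  proof -
    have "((\<lambda>u. integral {0..u} \<phi>) has_real_derivative \<phi> s) (at s within {0..t})"
      using t that by (intro integral_has_real_derivative continuous_on_subset[OF c]) auto
    then show ?thesis unfolding \<psi>_def
      by (auto intro!: derivative_eq_intros simp: algebra_simps)
  qed
  have "\<psi> t \<le> \<psi> 0"
  proof (rule DERIV_nonpos_imp_decreasing_open[of 0 t \<psi>])
    show "0 \<le> t" using t by simp
    fix s assume s: "0 < s" "s < t"
    have "(\<psi> has_real_derivative (L * \<phi> s - L * (a + L * integral {0..s} \<phi>)) * exp (- L * s)) (at s)"
      using d[of s] s at_within_interior[of s "{0..t}"] by simp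
    moreover have "(L * \<phi> s - L * (a + L * integral {0..s} \<phi>)) * exp (- L * s) \<le> 0"
    proof -
      have "L * \<phi> s \<le> L * (a + L * integral {0..s} \<phi>)" using le[of s] s t L by (intro mult_left_mono) auto
      then show ?thesis by (simp add: mult_nonpos_nonneg)
    qed
    ultimately show "\<exists>y. (\<psi> has_real_derivative y) (at s) \<and> y \<le> 0" by blast
  next
    show "continuous_on {0..t} \<psi>" using d by (rule DERIV_continuous_on)
  qed
  then have "\<psi> t * exp (L * t) \<le> a * exp (L * t)" by (simp add: \<psi>_def)
  then show ?thesis using le[OF t] by (simp add: \<psi>_def exp_minus mult.assoc)
qed

locale spectral = onb e for e :: "nat \<Rightarrow> 'a::{real_inner,complete_space}" +
  fixes lam :: "nat \<Rightarrow> real"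
  assumes lam_pos: "0 < lam 0" and lam_mono: "mono lam" and lam_top: "filterlim lam at_top sequentially"
begin

abbreviation "S \<equiv> spec_exp e lam"

lemma lam_ge: "lam 0 \<le> lam n" "lam n > 0"
  using lam_pos monoD[OF lam_mono, of 0 n] by auto

lemma S_wperm: "S t = wperm e (\<lambda>n. exp (- t * lam n)) id"
  by (simp add: fun_eq_iff spec_exp_def wperm_def)

lemma S_coeff: "t \<ge> 0 \<Longrightarrow> \<bar>exp (- t * lam n)\<bar> \<le> exp (- t * lam 0)"
  using lam_ge(1)[of n] by (simp add: mult_left_mono)

lemma S_coord: "t \<ge> 0 \<Longrightarrow> inner (S t u) (e n) = exp (- t * lam n) * inner u (e n)"
  unfolding S_wperm using wperm_coord[OF S_coeff, of t id] by simp

lemma S_norm: "t \<ge> 0 \<Longrightarrow> norm (S t u) \<le> exp (- t * lam 0) * norm u"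
  unfolding S_wperm by (rule wperm_norm[OF S_coeff]) auto

lemma S_norm': "t \<ge> 0 \<Longrightarrow> norm (S t u) \<le> norm u"
proof -
  assume t: "t \<ge> 0"
  have "exp (- t * lam 0) * norm u \<le> 1 * norm u" using t lam_pos by (intro mult_right_mono) auto
  then show ?thesis using S_norm[OF t, of u] by simp
qed

lemma S_bl: "t \<ge> 0 \<Longrightarrow> bounded_linear (S t)"
  unfolding S_wperm by (rule wperm_bounded_linear[OF S_coeff]) auto

lemma S_diff: "t \<ge> 0 \<Longrightarrow> S t (u - v) = S t u - S t v"
  using bounded_linear.linear[OF S_bl] linear_diff by blast

lemma S_0: "S 0 u = u"
  by (rule coord_eqI) (simp add: S_coord)

lemma S_add: "s \<ge> 0 \<Longrightarrow> t \<ge> 0 \<Longrightarrow> S (s + t) u = S s (S t u)"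
  by (rule coord_eqI) (simp add: S_coord exp_add[symmetric] algebra_simps mult.assoc[symmetric])

lemma S_cont: "continuous_on {0..} (\<lambda>t. S t u)"
proof (rule uniform_limit_theorem)
  show "\<forall>\<^sub>F N in sequentially. continuous_on {0..} (\<lambda>t. \<Sum>n<N. (exp (- t * lam n) * inner u (e n)) *\<^sub>R e n)"
    by (intro always_eventually allI continuous_intros)
  show "uniform_limit {0..} (\<lambda>N t. \<Sum>n<N. (exp (- t * lam n) * inner u (e n)) *\<^sub>R e n) (\<lambda>t. S t u) sequentially"
    unfolding uniform_limit_iff
  proof (intro allI impI)
    fix r :: real assume r: "r > 0"
    define p where "p N = (\<Sum>n<N. inner u (e n) *\<^sub>R e n)" for N
    have "p \<longlonglongrightarrow> u" using expansion[of u] by (simp add: sums_def p_def[abs_def])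
    then have "\<forall>\<^sub>F N in sequentially. dist (p N) u < r" using r tendstoD by blast
    then show "\<forall>\<^sub>F N in sequentially. \<forall>t\<in>{0..}. dist (\<Sum>n<N. (exp (- t * lam n) * inner u (e n)) *\<^sub>R e n) (S t u) < r"
    proof eventually_elim
      case (elim N)
      show ?case
      proof
        fix t :: real assume "t \<in> {0..}"
        then have t: "t \<ge> 0" by simp
        have "(\<Sum>n<N. (exp (- t * lam n) * inner u (e n)) *\<^sub>R e n) = S t (p N)"
          by (rule coord_eqI) (simp add: S_coord[OF t] inner_sum_ons p_def)
        then have "norm ((\<Sum>n<N. (exp (- t * lam n) * inner u (e n)) *\<^sub>R e n) - S t u) \<le> norm (p N - u)"
          using S_norm'[OF t, of "p N - u"] by (simp add: S_diff[OF t])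
        then show "dist (\<Sum>n<N. (exp (- t * lam n) * inner u (e n)) *\<^sub>R e n) (S t u) < r"
          using elim by (simp add: dist_norm)
      qed
    qed
  qed
qed simp

text \<open>Strong continuity in t is combined with the contraction bound in x, which is uniform in
  t; the semigroup is not norm continuous at t = 0.\<close>

lemma S_cont_joint: "continuous_on ({0..} \<times> UNIV) (\<lambda>(t, x). S t x)"
  unfolding continuous_on_sequentially
proof (intro ballI allI impI)
  fix x :: "nat \<Rightarrow> real \<times> 'a" and a assume a: "a \<in> {0..} \<times> UNIV" "(\<forall>n. x n \<in> {0..} \<times> UNIV) \<and> x \<longlonglongrightarrow> a"
  define s y where "s n = fst (x n)" and "y n = snd (x n)" for n
  have s: "s n \<ge> 0" for n using a by (auto simp: s_def mem_Times_iff)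
  have lim: "s \<longlonglongrightarrow> fst a" "y \<longlonglongrightarrow> snd a" using a(2) by (auto simp: s_def[abs_def] y_def[abs_def] intro: tendsto_fst tendsto_snd)
  have "(\<lambda>n. S (s n) (snd a)) \<longlonglongrightarrow> S (fst a) (snd a)"
    using S_cont[of "snd a"] a(1) s lim(1) unfolding continuous_on_sequentially by (auto simp: o_def mem_Times_iff)
  moreover have "(\<lambda>n. S (s n) (y n - snd a)) \<longlonglongrightarrow> 0"
  proof (rule Lim_null_comparison)
    show "\<forall>\<^sub>F n in sequentially. norm (S (s n) (y n - snd a)) \<le> norm (y n - snd a)"
      using S_norm' s by auto
    show "(\<lambda>n. norm (y n - snd a)) \<longlonglongrightarrow> 0" using lim(2) by (simp add: LIM_zero tendsto_norm_zero)
  qed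
  ultimately have "(\<lambda>n. S (s n) (y n - snd a) + S (s n) (snd a)) \<longlonglongrightarrow> 0 + S (fst a) (snd a)" by (intro tendsto_add)
  moreover have "S (s n) (y n - snd a) + S (s n) (snd a) = S (s n) (y n)" for n by (simp add: S_diff[OF s])
  ultimately have "(\<lambda>n. S (s n) (y n)) \<longlonglongrightarrow> S (fst a) (snd a)" by simp
  then show "((\<lambda>(t, x). S t x) \<circ> x) \<longlonglongrightarrow> (\<lambda>(t, x). S t x) a"
    by (simp add: o_def s_def y_def case_prod_beta)
qed

lemma S_comp_cont:
  assumes "continuous_on A h" "continuous_on A g" "\<And>x. x \<in> A \<Longrightarrow> h x \<ge> 0"
  shows "continuous_on A (\<lambda>x. S (h x) (g x))"
  using continuous_on_compose2[OF S_cont_joint continuous_on_Pair[OF assms(1,2)]] assms(3) by auto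

lemma duh_integrand_cont:
  assumes "continuous_on {0..t} g"
  shows "continuous_on {0..t} (\<lambda>s. S (t - s) (g s))"
  by (rule S_comp_cont) (use assms in \<open>auto intro!: continuous_intros\<close>)

lemma duh_integrable:
  assumes "continuous_on {0..t} g"
  shows "(\<lambda>s. S (t - s) (g s)) integrable_on {0..t}"
  by (rule integrable_cont[OF duh_integrand_cont[OF assms]])

lemma duh_cont:
  assumes g: "continuous_on {0..} g"
  shows "continuous_on {0..} (\<lambda>t. integral {0..t} (\<lambda>s. S (t - s) (g s)))"
proof -
  \<comment> \<open>The substitution s = t r fixes the interval of integration, so that continuity
    in t becomes continuity of an integral in a parameter.\<close>
  have eq: "integral {0..t} (\<lambda>s. S (t - s) (g s)) = t *\<^sub>R integral {0..1} (\<lambda>r. S (t * (1 - r)) (g (t * r)))"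
    if "t \<in> {0..}" for t
  proof (cases "t = 0")
    case False
    then have t: "t > 0" using that by simp
    have "((\<lambda>s. S (t - s) (g s)) has_integral integral {0..t} (\<lambda>s. S (t - s) (g s))) (cbox 0 t)"
      using duh_integrable[OF continuous_on_subset[OF g]] by (auto simp: integrable_integral)
    from has_integral_affinity[OF this, of t 0]
    have "((\<lambda>r. S (t - t * r) (g (t * r))) has_integral (1 / t) *\<^sub>R integral {0..t} (\<lambda>s. S (t - s) (g s))) ((\<lambda>x. x / t) ` {0..t})"
      using t by simp
    moreover have "(\<lambda>x. x / t) ` {0..t} = {0..1}"
    proof -
      have "r \<in> (\<lambda>x. x / t) ` {0..t}" if "r \<in> {0..1}" for r
        using that t by (intro image_eqI[of _ _ "r * t"]) (auto simp: mult_left_le_one_le)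
      then show ?thesis using t by auto
    qed
    ultimately have "((\<lambda>r. S (t * (1 - r)) (g (t * r))) has_integral (1 / t) *\<^sub>R integral {0..t} (\<lambda>s. S (t - s) (g s))) {0..1}"
      by (simp add: algebra_simps)
    then show ?thesis using t by (simp add: integral_unique)
  qed simp
  have "continuous_on {0..} (\<lambda>t. integral {0..1} (\<lambda>r. S (t * (1 - r)) (g (t * r))))"
  proof (rule integral_cont_param)
    have "continuous_on ({0..} \<times> {0..1}) (\<lambda>p. S (fst p * (1 - snd p)) (g (fst p * snd p)))"
      by (rule S_comp_cont) (auto intro!: continuous_intros continuous_on_compose2[OF g])
    then show "continuous_on ({0..} \<times> {0..1}) (\<lambda>(t, r). S (t * (1 - r)) (g (t * r)))"
      by (simp add: case_prod_beta)
  qed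
  then have "continuous_on {0..} (\<lambda>t. t *\<^sub>R integral {0..1} (\<lambda>r. S (t * (1 - r)) (g (t * r))))"
    by (intro continuous_intros) simp
  then show ?thesis by (rule continuous_on_eq) (simp add: eq)
qed

definition mild_on :: "real \<Rightarrow> ('a \<Rightarrow> 'a) \<Rightarrow> 'a \<Rightarrow> (real \<Rightarrow> 'a) \<Rightarrow> bool" where
  "mild_on T F u0 u \<longleftrightarrow> continuous_on {0..T} u \<and> u 0 = u0 \<and>
     (\<forall>t\<in>{0..T}. ((\<lambda>s. S (t - s) (F (u s))) has_integral (u t - S t u0)) {0..t})"

lemma mild_solution_on: "mild_solution e lam F u0 u \<Longrightarrow> mild_on T F u0 u"
  unfolding mild_solution_def mild_on_def by (auto intro: continuous_on_subset)

text \<open>Uniqueness and Lipschitz dependence at once. It lives on a finite interval so that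
  explicitly constructed pieces of trajectories can be recognised as the semiflow.\<close>

lemma mild_dist:
  assumes L: "L-lipschitz_on UNIV F" and u: "mild_on T F a u" and v: "mild_on T F b v" and t: "t \<in> {0..T}"
  shows "norm (u t - v t) \<le> norm (a - b) * exp (L * t)"
proof (rule gronwall[OF _ _ _ t, where \<phi> = "\<lambda>t. norm (u t - v t)" and L = L])
  have c: "continuous_on {0..T} u" "continuous_on {0..T} v" using u v by (auto simp: mild_on_def)
  then show "continuous_on {0..T} (\<lambda>t. norm (u t - v t))" by (intro continuous_intros)
  show L0: "L \<ge> 0" using L by (rule lipschitz_on_nonneg)
  fix t assume t: "t \<in> {0..T}"
  have i: "((\<lambda>s. S (t - s) (F (u s)) - S (t - s) (F (v s))) has_integral ((u t - S t a) - (v t - S t b))) {0..t}"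
    using u v t unfolding mild_on_def by (intro has_integral_diff) auto
  have ci: "continuous_on {0..t} (\<lambda>s. L * norm (u s - v s))"
    using t by (intro continuous_intros continuous_on_subset[OF c(1)] continuous_on_subset[OF c(2)]) auto
  have "norm ((u t - S t a) - (v t - S t b)) \<le> integral {0..t} (\<lambda>s. L * norm (u s - v s))"
  proof (rule norm_integral_le[OF i])
    show "(\<lambda>s. L * norm (u s - v s)) integrable_on {0..t}" by (rule integrable_continuous_real[OF ci])
    fix s assume s: "s \<in> {0..t}"
    have "norm (S (t - s) (F (u s)) - S (t - s) (F (v s))) \<le> norm (F (u s) - F (v s))"
      using S_norm'[of "t - s" "F (u s) - F (v s)"] s by (simp add: S_diff)
    also have "\<dots> \<le> L * norm (u s - v s)" using lipschitz_on_normD[OF L] by simp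
    finally show "norm (S (t - s) (F (u s)) - S (t - s) (F (v s))) \<le> L * norm (u s - v s)" .
  qed
  moreover have "norm (S t a - S t b) \<le> norm (a - b)"
    using S_norm'[of t "a - b"] t by (simp add: S_diff)
  moreover have "u t - v t = ((u t - S t a) - (v t - S t b)) + (S t a - S t b)" by simp
  ultimately show "norm (u t - v t) \<le> norm (a - b) + L * integral {0..t} (\<lambda>t. norm (u t - v t))"
    using norm_triangle_ineq[of "(u t - S t a) - (v t - S t b)" "S t a - S t b"] by simp
qed

lemma mild_exists:
  assumes L: "L-lipschitz_on UNIV F" and K: "\<And>x. norm (F x) \<le> K"
  shows "\<exists>u. mild_solution e lam F u0 u"
proof -
  have L0: "L \<ge> 0" using L by (rule lipschitz_on_nonneg)
  have K0: "K \<ge> 0" using K[of 0] norm_ge_zero order_trans by blast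
  have Fc: "continuous_on A F" for A using lipschitz_on_continuous_on[OF L] continuous_on_subset by blast
  \<comment> \<open>Weighted fixed point argument: the unknown is W = exp(-c t) u, on which the
    Duhamel map contracts with factor L / c \<le> 1/2. Boundedness of F keeps W in the space of
    bounded functions, and \<open>max 0 t\<close> extends it to negative times.\<close>
  define c where "c = 2 * L + 1"
  have c: "c > 0" using L0 by (simp add: c_def)
  define G where "G W t = integral {0..t} (\<lambda>s. S (t - s) (F (exp (c * s) *\<^sub>R apply_bcontfun W s)))" for W :: "real \<Rightarrow>\<^sub>C 'a" and t
  define \<Phi>0 where "\<Phi>0 W t = exp (- c * max 0 t) *\<^sub>R (S (max 0 t) u0 + G W (max 0 t))" for W t
  have gc: "continuous_on A (\<lambda>s. F (exp (c * s) *\<^sub>R apply_bcontfun W s))" for A and W :: "real \<Rightarrow>\<^sub>C 'a"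
    by (intro continuous_on_compose2[OF Fc[of UNIV]] continuous_intros) auto
  have Gb: "norm (G W t) \<le> t * K" if "t \<ge> 0" for W t
  proof -
    have "norm (G W t) \<le> integral {0..t} (\<lambda>s. K)" unfolding G_def
    proof (rule norm_integral_le[OF integrable_integral[OF duh_integrable[OF gc]]])
      fix s assume "s \<in> {0..t}"
      then show "norm (S (t - s) (F (exp (c * s) *\<^sub>R apply_bcontfun W s))) \<le> K"
        using order_trans[OF S_norm' K] by simp
    qed (rule integrable_const_ivl)
    then show ?thesis using that by (simp add: mult.commute)
  qed
  have te: "exp (- c * t) * t \<le> 1 / c" if "t \<ge> 0" for t
  proof -
    have "c * t \<le> exp (c * t)" using exp_ge_add_one_self[of "c * t"] by linarith
    then have "exp (- c * t) * (c * t) \<le> exp (- c * t) * exp (c * t)" by (intro mult_left_mono) auto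
    also have "\<dots> = 1" by (simp add: exp_add[symmetric])
    finally show ?thesis using c by (simp add: field_simps)
  qed
  have bc: "\<Phi>0 W \<in> bcontfun" for W
  proof (rule bcontfun_normI)
    have "continuous_on UNIV (\<lambda>t. G W (max 0 t))" unfolding G_def
      by (rule continuous_on_compose2[OF duh_cont[OF gc]]) (auto intro!: continuous_intros)
    moreover have "continuous_on UNIV (\<lambda>t. S (max 0 t) u0)"
      by (rule S_comp_cont) (auto intro!: continuous_intros)
    ultimately show "continuous_on UNIV (\<Phi>0 W)" unfolding \<Phi>0_def by (intro continuous_intros)
    fix t :: real
    let ?t = "max 0 t"
    have "norm (\<Phi>0 W t) \<le> exp (- c * ?t) * (norm u0 + ?t * K)"
      unfolding \<Phi>0_def norm_scaleR
      using norm_triangle_mono[OF S_norm'[of ?t u0] Gb[of ?t W]] by (simp add: mult_left_mono)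
    also have "\<dots> = exp (- c * ?t) * norm u0 + (exp (- c * ?t) * ?t) * K" by (simp add: algebra_simps)
    also have "\<dots> \<le> 1 * norm u0 + (1 / c) * K"
      using c K0 te[of ?t] by (intro add_mono mult_right_mono) auto
    finally show "norm (\<Phi>0 W t) \<le> 1 * norm u0 + (1 / c) * K" .
  qed
  define \<Phi> where "\<Phi> W = Bcontfun (\<Phi>0 W)" for W
  have ap: "apply_bcontfun (\<Phi> W) = \<Phi>0 W" for W by (simp add: \<Phi>_def Bcontfun_inverse[OF bc])
  have "dist (\<Phi> V) (\<Phi> W) \<le> (1/2) * dist V W" for V W
  proof (rule dist_bound)
    fix t :: real
    let ?t = "max 0 t"
    define d where "d = dist V W"
    have "norm (G V ?t - G W ?t) \<le> integral {0..?t} (\<lambda>s. L * d * exp (c * s))"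
    proof -
      have "((\<lambda>s. S (?t - s) (F (exp (c * s) *\<^sub>R apply_bcontfun V s)) - S (?t - s) (F (exp (c * s) *\<^sub>R apply_bcontfun W s)))
          has_integral (G V ?t - G W ?t)) {0..?t}"
        unfolding G_def by (intro has_integral_diff integrable_integral duh_integrable gc)
      then show "norm (G V ?t - G W ?t) \<le> integral {0..?t} (\<lambda>s. L * d * exp (c * s))"
      proof (rule norm_integral_le)
        show "(\<lambda>s. L * d * exp (c * s)) integrable_on {0..?t}" by (intro integrable_continuous_real continuous_intros)
        fix s assume s: "s \<in> {0..?t}"
        let ?a = "exp (c * s) *\<^sub>R apply_bcontfun V s" and ?b = "exp (c * s) *\<^sub>R apply_bcontfun W s"
        have "norm (S (?t - s) (F ?a) - S (?t - s) (F ?b)) \<le> norm (F ?a - F ?b)"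
          using S_norm'[of "?t - s" "F ?a - F ?b"] s by (simp add: S_diff)
        also have "\<dots> \<le> L * norm (?a - ?b)" using lipschitz_on_normD[OF L] by simp
        also have "norm (?a - ?b) = exp (c * s) * dist (apply_bcontfun V s) (apply_bcontfun W s)"
          by (simp add: scaleR_diff_right[symmetric] dist_norm)
        also have "L * \<dots> \<le> L * (exp (c * s) * d)"
          unfolding d_def using L0 by (intro mult_left_mono dist_bounded) auto
        finally show "norm (S (?t - s) (F ?a) - S (?t - s) (F ?b)) \<le> L * d * exp (c * s)" by (simp add: mult_ac)
      qed
    qed
    also have "integral {0..?t} (\<lambda>s. L * d * exp (c * s)) = L * d * (exp (c * ?t) / c - 1 / c)"
    proof -
      have "((\<lambda>s. L * d * exp (c * s)) has_integral (L * d * (exp (c * ?t) / c) - L * d * (exp (c * 0) / c))) {0..?t}"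
        by (rule fundamental_theorem_of_calculus)
          (use c in \<open>auto intro!: derivative_eq_intros simp: has_real_derivative_iff_has_vector_derivative[symmetric]\<close>)
      moreover have "L * d * (exp (c * ?t) / c) - L * d * (exp (c * 0) / c) = L * d * (exp (c * ?t) / c - 1 / c)"
        by (simp add: right_diff_distrib)
      ultimately show ?thesis by (metis integral_unique)
    qed
    also have "\<dots> \<le> L * d * (exp (c * ?t) / c)" using L0 c by (intro mult_left_mono) (auto simp: d_def)
    finally have g: "norm (G V ?t - G W ?t) \<le> L * d * (exp (c * ?t) / c)" .
    have "dist (apply_bcontfun (\<Phi> V) t) (apply_bcontfun (\<Phi> W) t) = exp (- c * ?t) * norm (G V ?t - G W ?t)"
      unfolding ap dist_norm \<Phi>0_def scaleR_diff_right[symmetric] by simp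
    also have "\<dots> \<le> exp (- c * ?t) * (L * d * (exp (c * ?t) / c))" by (intro mult_left_mono g) auto
    also have "\<dots> = (L / c) * d" by (simp add: exp_minus)
    also have "\<dots> \<le> (1/2) * d" using c L0 by (intro mult_right_mono) (auto simp: d_def c_def field_simps)
    finally show "dist (apply_bcontfun (\<Phi> V) t) (apply_bcontfun (\<Phi> W) t) \<le> 1 / 2 * dist V W" by (simp add: d_def)
  qed
  then have "\<exists>!W. \<Phi> W = W" by (intro banach_fix_type[of "1/2"]) auto
  then obtain W where W: "\<Phi> W = W" by blast
  define u where "u t = exp (c * t) *\<^sub>R apply_bcontfun W t" for t
  have ut: "u t = S t u0 + G W t" if "t \<ge> 0" for t
  proof -
    have "apply_bcontfun W t = \<Phi>0 W t" using ap[of W] W by simp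
    then show ?thesis using that by (simp add: u_def \<Phi>0_def exp_add[symmetric])
  qed
  have "mild_solution e lam F u0 u"
    unfolding mild_solution_def
  proof (intro conjI allI impI)
    have "continuous_on UNIV (apply_bcontfun W)" using apply_bcontfun[of W] by (simp add: bcontfun_def)
    then show "continuous_on {0..} u" unfolding u_def[abs_def]
      by (intro continuous_intros) (rule continuous_on_subset, auto)
    show "u 0 = u0" using ut[of 0] by (simp add: G_def S_0)
    fix t :: real assume t: "t \<ge> 0"
    have "((\<lambda>s. S (t - s) (F (u s))) has_integral G W t) {0..t}"
      unfolding G_def u_def by (rule integrable_integral[OF duh_integrable[OF gc]])
    then show "((\<lambda>s. S (t - s) (F (u s))) has_integral (u t - S t u0)) {0..t}" using ut[OF t] by simp
  qed
  then show ?thesis by blast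
qed

end

locale semiflow = spectral +
  fixes F :: "'a \<Rightarrow> 'a" and L K :: real
  assumes F_lip: "L-lipschitz_on UNIV F" and F_bdd: "norm (F x) \<le> K"
begin

abbreviation "T \<equiv> sg e lam F"

lemma sg_mild_on:
  assumes "mild_on T' F a u" "t \<in> {0..T'}"
  shows "T t a = u t"
proof -
  obtain w where w: "mild_solution e lam F a w" using mild_exists[OF F_lip F_bdd] by blast
  have eq: "v t = u t" if "mild_solution e lam F a v" for v
    using mild_dist[OF F_lip mild_solution_on[OF that] assms] by simp
  show ?thesis unfolding sg_def
  proof (rule the_equality)
    show "\<exists>v. mild_solution e lam F a v \<and> v t = u t" using w eq[OF w] by blast
    show "x = u t" if "\<exists>v. mild_solution e lam F a v \<and> v t = x" for x using that eq by blast
  qed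
qed

lemma sg_mild: "mild_solution e lam F a (\<lambda>t. T t a)"
proof -
  obtain w where w: "mild_solution e lam F a w" using mild_exists[OF F_lip F_bdd] by blast
  have eq: "T t a = w t" if "t \<ge> 0" for t
    using sg_mild_on[OF mild_solution_on[OF w], of t t] that by simp
  have "((\<lambda>s. S (t - s) (F (T s a))) has_integral (T t a - S t a)) {0..t}" if "t \<ge> 0" for t
  proof -
    have "((\<lambda>s. S (t - s) (F (w s))) has_integral (w t - S t a)) {0..t}" using w that by (simp add: mild_solution_def)
    then show ?thesis using has_integral_eq[of "{0..t}" "\<lambda>s. S (t - s) (F (w s))" "\<lambda>s. S (t - s) (F (T s a))"] eq that by simp
  qed
  moreover have "continuous_on {0..} (\<lambda>t. T t a)"
    by (rule continuous_on_eq[of _ w]) (use w eq in \<open>auto simp: mild_solution_def\<close>)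
  moreover have "T 0 a = a" using w eq by (simp add: mild_solution_def)
  ultimately show ?thesis by (simp add: mild_solution_def)
qed

lemma sg_add:
  assumes "s \<ge> 0" "t \<ge> 0"
  shows "T (s + t) a = T t (T s a)"
proof -
  define u where "u t = T t a" for t
  have u: "mild_solution e lam F a u" using sg_mild by (simp add: u_def[abs_def])
  have uc: "continuous_on {0..} u" using u by (simp add: mild_solution_def)
  have "mild_solution e lam F (u s) (\<lambda>r. u (s + r))"
    unfolding mild_solution_def
  proof (intro conjI allI impI)
    show "continuous_on {0..} (\<lambda>r. u (s + r))"
      by (rule continuous_on_compose2[OF uc]) (use assms in \<open>auto intro!: continuous_intros\<close>)
    fix t :: real assume t: "t \<ge> 0"
    let ?f = "\<lambda>r. S (s + t - r) (F (u r))"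
    have f1: "(?f has_integral (u (s + t) - S (s + t) a)) {0..s + t}"
      using u assms t by (simp add: mild_solution_def)
    have "((\<lambda>r. S (s - r) (F (u r))) has_integral (u s - S s a)) {0..s}"
      using u assms by (simp add: mild_solution_def)
    then have "((\<lambda>r. S t (S (s - r) (F (u r)))) has_integral S t (u s - S s a)) {0..s}"
      using has_integral_linear[OF _ S_bl[OF t], of "\<lambda>r. S (s - r) (F (u r))" "u s - S s a" "{0..s}"] by (simp add: o_def)
    moreover have "S t (S (s - r) (F (u r))) = ?f r" if "r \<in> {0..s}" for r
      using S_add[of t "s - r" "F (u r)"] t that by (simp add: algebra_simps)
    ultimately have f2: "(?f has_integral S t (u s - S s a)) {0..s}"
      using has_integral_eq[of "{0..s}" "\<lambda>r. S t (S (s - r) (F (u r)))" ?f] by blast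
    define I where "I = u (s + t) - S (s + t) a - S t (u s - S s a)"
    have I: "(?f has_integral I) {s..s + t}"
      unfolding I_def by (rule has_integral_split[OF _ _ f1 f2]) (use assms t in auto)
    have "S (s + t) a = S t (S s a)" using S_add[of t s a] t assms by (simp add: add.commute)
    then have "I = u (s + t) - S t (u s)" using S_diff[OF t] by (simp add: I_def algebra_simps)
    then have "(?f has_integral (u (s + t) - S t (u s))) (cbox s (s + t))" using I by simp
    from has_integral_affinity[OF this, of 1 s]
    have "((\<lambda>r. S (s + t - (r + s)) (F (u (r + s)))) has_integral (u (s + t) - S t (u s))) ((\<lambda>x. x - s) ` {s..s + t})"
      by (simp add: add.commute)
    moreover have "(\<lambda>x. x - s) ` {s..s + t} = {0..t}"
    proof -
      have "r \<in> (\<lambda>x. x - s) ` {s..s + t}" if "r \<in> {0..t}" for r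
        using that by (intro image_eqI[of _ _ "r + s"]) auto
      then show ?thesis by auto
    qed
    ultimately show "((\<lambda>r. S (t - r) (F (u (s + r)))) has_integral (u (s + t) - S t (u s))) {0..t}"
      by (simp add: add.commute)
  qed simp
  from sg_mild_on[OF mild_solution_on[OF this], of t t] show ?thesis using assms by (simp add: u_def)
qed

lemma sg_cont: "t \<ge> 0 \<Longrightarrow> continuous_on UNIV (T t)"
proof -
  assume t: "t \<ge> 0"
  have "norm (T t x - T t y) \<le> exp (L * t) * norm (x - y)" for x y
    using mild_dist[OF F_lip mild_solution_on[OF sg_mild[of x]] mild_solution_on[OF sg_mild[of y]], of t t] t
    by (simp add: mult.commute)
  then have "(exp (L * t))-lipschitz_on UNIV (T t)" by (intro lipschitz_onI) (auto simp: dist_norm)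
  then show ?thesis by (rule lipschitz_on_continuous_on)
qed

end

section \<open>Global attractors\<close>

text \<open>The attractor is the limit set of the absorbing compact set. Its last clause captures
  every point that is reached at all integer times from one bounded set; this is how explicit orbits
  that exist for all negative times are placed in the attractor.\<close>

lemma attractor_abstract:
  fixes T :: "real \<Rightarrow> 'a::metric_space \<Rightarrow> 'a"
  assumes add: "\<And>s t x. 0 \<le> s \<Longrightarrow> 0 \<le> t \<Longrightarrow> T (s + t) x = T t (T s x)"
    and cont: "\<And>t. 0 \<le> t \<Longrightarrow> continuous_on UNIV (T t)"
    and K: "compact K" and absb: "\<And>B. bounded B \<Longrightarrow> \<exists>t0\<ge>0. \<forall>t\<ge>t0. \<forall>b\<in>B. T t b \<in> K"
  shows "\<exists>A. compact A \<and> (\<forall>t\<ge>0. T t ` A = A) \<and>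
     (\<forall>B. bounded B \<longrightarrow> (\<forall>\<epsilon>>0. \<exists>t0\<ge>0. \<forall>t\<ge>t0. \<forall>b\<in>B. infdist (T t b) A < \<epsilon>)) \<and>
     (\<forall>z x. bounded (range z) \<longrightarrow> (\<forall>n. T (real n) (z n) = x) \<longrightarrow> x \<in> A)"
proof -
  define A where "A = {y. \<exists>t x. (\<forall>n. t n \<ge> real n) \<and> (\<forall>n. x n \<in> K) \<and> (\<lambda>n. T (t n) (x n)) \<longlonglongrightarrow> y}"
  have AI: "y \<in> A" if "\<And>n. t n \<ge> real n" "\<And>n. x n \<in> K" "(\<lambda>n. T (t n) (x n)) \<longlonglongrightarrow> y" for t x y
    unfolding A_def using that by (auto intro!: exI[of _ t] exI[of _ x])
  obtain tK where tK: "tK \<ge> 0" "\<And>t b. t \<ge> tK \<Longrightarrow> b \<in> K \<Longrightarrow> T t b \<in> K"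
    using absb[OF compact_imp_bounded[OF K]] by blast
  have Tlim: "(\<lambda>n. T s (w n)) \<longlonglongrightarrow> T s y" if "w \<longlonglongrightarrow> y" "s \<ge> 0" for w y s
    using cont[OF that(2)] that(1) unfolding continuous_on_sequentially by (auto simp: o_def)
  have AK: "A \<subseteq> K"
  proof
    fix y assume "y \<in> A"
    then obtain t x where tx: "\<And>n. t n \<ge> real n" "\<And>n. x n \<in> K" "(\<lambda>n. T (t n) (x n)) \<longlonglongrightarrow> y"
      by (auto simp: A_def)
    have "T (t n) (x n) \<in> K" if "n \<ge> nat \<lceil>tK\<rceil>" for n
      using tK(2)[of "t n" "x n"] tx(1)[of n] tx(2)[of n] that by linarith
    then have "\<forall>\<^sub>F n in sequentially. T (t n) (x n) \<in> K" unfolding eventually_sequentially by blast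
    then show "y \<in> K" by (rule Lim_in_closed_set[OF compact_imp_closed[OF K] _ _ tx(3)]) simp
  qed
  \<comment> \<open>Asymptotic compactness: B is inside K after time t1, and the time that remains
    still tends to infinity, so sequences started in any bounded set accumulate at points of
    A.\<close>
  have star: "\<exists>r y. strict_mono r \<and> y \<in> A \<and> (\<lambda>n. T (t (r n)) (x (r n))) \<longlonglongrightarrow> y"
    if t: "\<And>n. t n \<ge> real n" and x: "\<And>n. x n \<in> B" and B: "bounded B" for t and x :: "nat \<Rightarrow> 'a" and B
  proof -
    obtain t1 where t1: "t1 \<ge> 0" "\<And>t b. t \<ge> t1 \<Longrightarrow> b \<in> B \<Longrightarrow> T t b \<in> K"
      using absb[OF B] by blast
    define N where "N = nat \<lceil>t1\<rceil> + nat \<lceil>tK\<rceil>"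
    have N: "real N \<ge> t1 + tK" unfolding N_def of_nat_add using t1(1) tK(1) by (intro add_mono) auto
    define s x' where "s n = t (n + N) - t1" and "x' n = T t1 (x (n + N))" for n
    have s: "s n \<ge> real n + tK" for n using t[of "n + N"] N by (simp add: s_def)
    have x': "x' n \<in> K" for n using t1 x by (auto simp: x'_def)
    have eq: "T (s n) (x' n) = T (t (n + N)) (x (n + N))" for n
      using add[of t1 "s n" "x (n + N)"] t1 s[of n] tK(1) by (simp add: s_def x'_def)
    have "tK \<le> s n" for n using s[of n] of_nat_0_le_iff[of n, where ?'a = real] by linarith
    then have "\<forall>n. T (s n) (x' n) \<in> K" using tK(2) x' by blast
    have cK: "\<forall>f::nat \<Rightarrow> 'a. (\<forall>n. f n \<in> K) \<longrightarrow> (\<exists>l\<in>K. \<exists>r::nat \<Rightarrow> nat. strict_mono r \<and> (f \<circ> r) \<longlonglongrightarrow> l)"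
      using K unfolding compact_def .
    have "\<exists>l\<in>K. \<exists>r::nat \<Rightarrow> nat. strict_mono r \<and> ((\<lambda>n. T (s n) (x' n)) \<circ> r) \<longlonglongrightarrow> l"
      by (rule mp[OF spec[OF cK, of "\<lambda>n. T (s n) (x' n)"]]) fact
    then obtain y r where yr: "strict_mono r" "((\<lambda>n. T (s n) (x' n)) \<circ> r) \<longlonglongrightarrow> y"
      by blast
    have "s (r n) \<ge> real n" for n using s[of "r n"] seq_suble[OF yr(1), of n] tK(1) by simp
    then have "y \<in> A" unfolding A_def using yr(2) x'
      by (auto intro!: exI[of _ "\<lambda>n. s (r n)"] exI[of _ "\<lambda>n. x' (r n)"] simp: o_def)
    moreover have "strict_mono (\<lambda>n. r n + N)" using yr(1) by (simp add: strict_mono_def)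
    moreover have "(\<lambda>n. T (t (r n + N)) (x (r n + N))) \<longlonglongrightarrow> y" using yr(2) by (simp add: o_def eq)
    ultimately show ?thesis by blast
  qed
  have "closed A"
    unfolding closed_sequential_limits
  proof (intro allI impI)
    fix f l assume f: "(\<forall>n. f n \<in> A) \<and> f \<longlonglongrightarrow> l"
    have "\<exists>t x. t \<ge> real n \<and> x \<in> K \<and> dist (T t x) (f n) < 1 / (real n + 1)" for n
    proof -
      have "f n \<in> A" using f by blast
      then obtain t x where tx: "\<And>n. t n \<ge> real n" "\<And>n. x n \<in> K" "(\<lambda>k. T (t k) (x k)) \<longlonglongrightarrow> f n"
        by (auto simp: A_def)
      then obtain k0 where k0: "\<And>k. k \<ge> k0 \<Longrightarrow> dist (T (t k) (x k)) (f n) < 1 / (real n + 1)"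
        unfolding lim_sequentially by (metis add_pos_nonneg add.commute divide_pos_pos of_nat_0_le_iff zero_less_one)
      then have "dist (T (t (max k0 n)) (x (max k0 n))) (f n) < 1 / (real n + 1)" by simp
      moreover have "t (max k0 n) \<ge> real n" using tx(1)[of "max k0 n"] by simp
      ultimately show ?thesis using tx(2) by blast
    qed
    then obtain t x where tx: "\<And>n. t n \<ge> real n" "\<And>n. x n \<in> K" "\<And>n. dist (T (t n) (x n)) (f n) < 1 / (real n + 1)"
      by metis
    have "(\<lambda>n. dist (T (t n) (x n)) (f n)) \<longlonglongrightarrow> 0"
    proof (rule Lim_null_comparison)
      show "\<forall>\<^sub>F n in sequentially. norm (dist (T (t n) (x n)) (f n)) \<le> 1 / (real n + 1)"
        using tx(3) by (auto intro!: always_eventually less_imp_le)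
      show "(\<lambda>n. 1 / (real n + 1)) \<longlonglongrightarrow> 0" using LIMSEQ_inverse_real_of_nat by (simp add: inverse_eq_divide add.commute)
    qed
    moreover have "(\<lambda>n. dist (f n) l) \<longlonglongrightarrow> 0" using f by (simp add: tendsto_dist_iff[symmetric])
    ultimately have lim0: "(\<lambda>n. dist (T (t n) (x n)) (f n) + dist (f n) l) \<longlonglongrightarrow> 0 + 0" by (rule tendsto_add)
    have "(\<lambda>n. dist (T (t n) (x n)) l) \<longlonglongrightarrow> 0"
    proof (rule Lim_null_comparison)
      show "\<forall>\<^sub>F n in sequentially. norm (dist (T (t n) (x n)) l) \<le> dist (T (t n) (x n)) (f n) + dist (f n) l"
        using dist_triangle[of "T (t _) (x _)" l "f _"] by (intro always_eventually allI) simp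
    qed (use lim0 in simp)
    then have "(\<lambda>n. T (t n) (x n)) \<longlonglongrightarrow> l" by (subst tendsto_dist_iff)
    then show "l \<in> A" using tx by (auto simp: A_def)
  qed
  then have h1: "compact A" using AK K by (metis compact_Int_closed inf.absorb_iff2)
  have h2: "T s ` A = A" if s: "s \<ge> 0" for s
  proof
    show "T s ` A \<subseteq> A"
    proof safe
      fix y assume "y \<in> A"
      then obtain t x where tx: "\<And>n. t n \<ge> real n" "\<And>n. x n \<in> K" "(\<lambda>n. T (t n) (x n)) \<longlonglongrightarrow> y"
        by (auto simp: A_def)
      have "t n \<ge> 0" for n using tx(1)[of n] of_nat_0_le_iff order_trans by blast
      then have "T s (T (t n) (x n)) = T (t n + s) (x n)" for n using add s by simp
      then have "(\<lambda>n. T (t n + s) (x n)) \<longlonglongrightarrow> T s y" using Tlim[OF tx(3) s] by simp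
      moreover have "t n + s \<ge> real n" for n using tx(1)[of n] s by simp
      ultimately show "T s y \<in> A" by (intro AI[of "\<lambda>n. t n + s" x] tx(2))
    qed
    show "A \<subseteq> T s ` A"
    proof
      fix y assume "y \<in> A"
      then obtain t x where tx: "\<And>n. t n \<ge> real n" "\<And>n. x n \<in> K" "(\<lambda>n. T (t n) (x n)) \<longlonglongrightarrow> y"
        by (auto simp: A_def)
      define N where "N = nat \<lceil>s\<rceil>"
      have N: "real N \<ge> s" using s by (simp add: N_def)
      define t' where "t' n = t (n + N) - s" for n
      have t': "t' n \<ge> real n" for n using tx(1)[of "n + N"] N by (simp add: t'_def)
      obtain r z where rz: "strict_mono r" "z \<in> A" "(\<lambda>n. T (t' (r n)) (x (r n + N))) \<longlonglongrightarrow> z"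
        using star[OF t', of "\<lambda>n. x (n + N)" K] tx(2) compact_imp_bounded[OF K] by auto
      have "T s (T (t' (r n)) (x (r n + N))) = T (t (r n + N)) (x (r n + N))" for n
        using add[of "t' (r n)" s] t'[of "r n"] s by (simp add: t'_def)
      then have "(\<lambda>n. T (t (r n + N)) (x (r n + N))) \<longlonglongrightarrow> T s z" using Tlim[OF rz(3) s] by simp
      moreover have "(\<lambda>n. T (t (r n + N)) (x (r n + N))) \<longlonglongrightarrow> y"
        using LIMSEQ_subseq_LIMSEQ[OF tx(3), of "\<lambda>n. r n + N"] rz(1) by (simp add: o_def strict_mono_def)
      ultimately have "y = T s z" using LIMSEQ_unique by blast
      then show "y \<in> T s ` A" using rz(2) by blast
    qed
  qed
  have h3: "\<exists>t0\<ge>0. \<forall>t\<ge>t0. \<forall>b\<in>B. infdist (T t b) A < \<epsilon>" if B: "bounded B" and e: "\<epsilon> > 0" for B \<epsilon>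
  proof (rule ccontr)
    assume neg: "\<not> ?thesis"
    have "\<exists>t b. t \<ge> real n \<and> b \<in> B \<and> infdist (T t b) A \<ge> \<epsilon>" for n
      using neg by (metis not_less of_nat_0_le_iff)
    then obtain t b where tb: "\<And>n. t n \<ge> real n" "\<And>n. b n \<in> B" "\<And>n. infdist (T (t n) (b n)) A \<ge> \<epsilon>" by metis
    obtain r y where ry: "y \<in> A" "(\<lambda>n. T (t (r n)) (b (r n))) \<longlonglongrightarrow> y"
      using star[of t b B, OF tb(1,2) B] by blast
    obtain n where "dist (T (t (r n)) (b (r n))) y < \<epsilon>"
      using ry(2) e unfolding lim_sequentially by blast
    moreover have "infdist (T (t (r n)) (b (r n))) A \<le> dist (T (t (r n)) (b (r n))) y"
      by (rule infdist_le[OF ry(1)])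
    ultimately show False using tb(3)[of "r n"] by simp
  qed
  have h4: "x \<in> A" if z: "bounded (range z)" "\<And>n. T (real n) (z n) = x" for z :: "nat \<Rightarrow> 'a" and x
  proof -
    obtain r y where ry: "y \<in> A" "(\<lambda>n. T (real (r n)) (z (r n))) \<longlonglongrightarrow> y"
      using star[of real z "range z"] z(1) by auto
    then have "(\<lambda>n. x) \<longlonglongrightarrow> y" using z(2) by simp
    then have "x = y" using LIMSEQ_unique tendsto_const by blast
    then show ?thesis using ry by simp
  qed
  show ?thesis
  proof (intro exI[of _ A] conjI allI impI)
    fix z :: "nat \<Rightarrow> 'a" and x assume "bounded (range z)" "\<forall>n. T (real n) (z n) = x"
    then show "x \<in> A" using h4[of z x] by simp
  qed (simp_all add: h1 h2 h3)
qed

section \<open>Compactness from the damping of high modes\<close>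

context spectral
begin

definition tail :: "nat \<Rightarrow> 'a \<Rightarrow> 'a" where
  "tail N = wperm e (\<lambda>n. if n < N then 0 else 1) id"

lemma tail_coord: "inner (tail N u) (e n) = (if n < N then 0 else inner u (e n))"
  unfolding tail_def by (subst wperm_coord[of _ 1]) auto

lemma tail_bl: "bounded_linear (tail N)"
  unfolding tail_def by (rule wperm_bounded_linear[of _ 1]) auto

lemma tail_S: "s \<ge> 0 \<Longrightarrow> norm (tail N (S s u)) \<le> exp (- s * lam N) * norm u"
proof -
  assume s: "s \<ge> 0"
  have b: "\<bar>if n < N then 0 else exp (- s * lam n)\<bar> \<le> exp (- s * lam N)" for n
    using monoD[OF lam_mono, of N n] s by (auto simp: mult_left_mono)
  have "tail N (S s u) = wperm e (\<lambda>n. if n < N then 0 else exp (- s * lam n)) id u"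
    by (rule coord_eqI) (simp add: tail_coord S_coord[OF s] wperm_coord[OF b])
  then show ?thesis using wperm_norm[OF b, where \<sigma> = id and u = u] by simp
qed

text \<open>Finite-dimensional cubes written as sums of segments, so that compactness follows by
  induction on the dimension.\<close>

primrec box :: "real \<Rightarrow> nat \<Rightarrow> 'a set" where
  "box R 0 = {0}"
| "box R (Suc N) = {x + y | x y. x \<in> box R N \<and> y \<in> (\<lambda>a. a *\<^sub>R e N) ` {-R..R}}"

lemma compact_box: "compact (box R N)"
proof (induction N)
  case (Suc N)
  have "compact ((\<lambda>a. a *\<^sub>R e N) ` {-R..R})"
    by (intro compact_continuous_image continuous_intros) auto
  then show ?case using compact_sums[OF Suc] by simp
qed simp

lemma sum_in_box: "(\<And>n. \<bar>a n\<bar> \<le> R) \<Longrightarrow> (\<Sum>n<N. a n *\<^sub>R e n) \<in> box R N"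
proof (induction N)
  case (Suc N)
  have "a N *\<^sub>R e N \<in> (\<lambda>a. a *\<^sub>R e N) ` {-R..R}" using Suc.prems[of N] by (intro imageI) (auto simp: abs_le_iff)
  then show ?case using Suc.IH[OF Suc.prems] by (simp del: image_iff) blast
qed simp

lemma compact_closure_tail:
  assumes "bounded Y" "\<And>\<epsilon>. \<epsilon> > 0 \<Longrightarrow> \<exists>N. \<forall>u\<in>Y. norm (tail N u) \<le> \<epsilon>"
  shows "compact (closure Y)"
  unfolding compact_eq_totally_bounded
proof (intro conjI allI impI)
  show "complete (closure Y)" by (simp add: complete_eq_closed)
  fix \<epsilon> :: real assume e: "\<epsilon> > 0"
  then obtain N where N: "\<And>u. u \<in> Y \<Longrightarrow> norm (tail N u) \<le> \<epsilon> / 4"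
    using assms(2)[of "\<epsilon> / 4"] by auto
  obtain R where R: "\<And>u. u \<in> Y \<Longrightarrow> norm u \<le> R" using assms(1) by (auto simp: bounded_iff)
  obtain k where k: "finite k" "box R N \<subseteq> (\<Union>x\<in>k. ball x (\<epsilon> / 4))"
    using compact_box[of R N] e unfolding compact_eq_totally_bounded by (meson divide_pos_pos zero_less_numeral)
  have "closure Y \<subseteq> (\<Union>x\<in>k. ball x \<epsilon>)"
  proof
    fix u assume "u \<in> closure Y"
    then obtain y where y: "y \<in> Y" "dist y u < \<epsilon> / 4"
      using e unfolding closure_approachable by (meson divide_pos_pos zero_less_numeral)
    have "\<bar>inner y (e n)\<bar> \<le> R" for n
      using Cauchy_Schwarz_ineq2[of y "e n"] R[OF y(1)] on[of n n] by (simp add: norm_eq_sqrt_inner)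
    then have "(\<Sum>n<N. inner y (e n) *\<^sub>R e n) \<in> box R N" by (rule sum_in_box)
    moreover have "y = (\<Sum>n<N. inner y (e n) *\<^sub>R e n) + tail N y"
      by (rule coord_eqI) (simp add: inner_add_left inner_sum_ons tail_coord)
    ultimately obtain b where b: "b \<in> box R N" "y = b + tail N y" by blast
    then obtain x where x: "x \<in> k" "dist x b < \<epsilon> / 4" using k by auto
    have "dist b y \<le> \<epsilon> / 4" using N[OF y(1)] b(2) by (simp add: dist_norm) (metis add_diff_cancel_left' norm_minus_commute)
    then have "dist x u < \<epsilon>" using x(2) y(2) dist_triangle[of x u b] dist_triangle[of b u y] e by linarith
    then show "u \<in> (\<Union>x\<in>k. ball x \<epsilon>)" using x(1) by auto
  qed
  then show "\<exists>k. finite k \<and> closure Y \<subseteq> (\<Union>x\<in>k. ball x \<epsilon>)" using k(1) by blast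
qed

end

context semiflow
begin

text \<open>The observable q is left general: the identity gives an absorbing ball, and the tails
  give K / lam N up to a transient, which is small for large N and yields compactness.\<close>

lemma sg_decay:
  fixes q :: "'a \<Rightarrow> 'a"
  assumes q: "bounded_linear q" and c: "c > 0" and t: "t \<ge> 0"
    and qS: "\<And>s x. s \<ge> 0 \<Longrightarrow> norm (q (S s x)) \<le> exp (- s * c) * norm x"
  shows "norm (q (T t a)) \<le> exp (- t * c) * norm a + K / c"
proof -
  have K: "K \<ge> 0" using F_bdd[of 0] norm_ge_zero order_trans by blast
  have "((\<lambda>s. S (t - s) (F (T s a))) has_integral (T t a - S t a)) {0..t}"
    using sg_mild[of a] t by (simp add: mild_solution_def)
  then have i: "((\<lambda>s. q (S (t - s) (F (T s a)))) has_integral q (T t a - S t a)) {0..t}"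
    using has_integral_linear[OF _ q, of "\<lambda>s. S (t - s) (F (T s a))" "T t a - S t a" "{0..t}"] by (simp add: o_def)
  have j: "((\<lambda>s. K * exp ((s - t) * c)) has_integral (K * exp ((t - t) * c) / c - K * exp ((0 - t) * c) / c)) {0..t}"
    by (rule fundamental_theorem_of_calculus)
      (use c t in \<open>auto intro!: derivative_eq_intros simp: has_real_derivative_iff_has_vector_derivative[symmetric]\<close>)
  have "norm (q (T t a - S t a)) \<le> integral {0..t} (\<lambda>s. K * exp ((s - t) * c))"
  proof (rule norm_integral_le[OF i])
    show "(\<lambda>s. K * exp ((s - t) * c)) integrable_on {0..t}" using j by blast
    fix s assume s: "s \<in> {0..t}"
    have "norm (q (S (t - s) (F (T s a)))) \<le> exp (- (t - s) * c) * K"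
      by (rule order_trans[OF qS mult_left_mono[OF F_bdd]]) (use s in auto)
    then show "norm (q (S (t - s) (F (T s a)))) \<le> K * exp ((s - t) * c)" by (simp add: mult.commute algebra_simps)
  qed
  also have "\<dots> \<le> K / c" using integral_unique[OF j] K c by simp
  finally have "norm (q (T t a) - q (S t a)) \<le> K / c"
    using linear_diff[OF bounded_linear.linear[OF q]] by simp
  then show ?thesis using qS[OF t, of a] norm_triangle_sub[of "q (T t a)" "q (S t a)"] by simp
qed

lemma attractor_exists:
  "\<exists>A. global_attractor e lam F A \<and> (\<forall>z x. bounded (range z) \<longrightarrow> (\<forall>n. T (real n) (z n) = x) \<longrightarrow> x \<in> A)"
proof -
  have K: "K \<ge> 0" using F_bdd[of 0] norm_ge_zero order_trans by blast
  define R where "R = K / lam 0 + 1"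
  define Y where "Y = T 1 ` cball 0 R"
  have nT: "norm (T t a) \<le> exp (- t * lam 0) * norm a + K / lam 0" if "t \<ge> 0" for t a
    using sg_decay[of "\<lambda>x. x", OF bounded_linear_ident lam_pos that] S_norm by simp
  have R0: "R \<ge> 0" using K lam_pos by (simp add: R_def)
  have "bounded Y"
  proof (rule boundedI)
    fix y assume "y \<in> Y"
    then obtain a where a: "y = T 1 a" "norm a \<le> R" by (auto simp: Y_def)
    have "exp (- 1 * lam 0) * norm a \<le> 1 * R" using a lam_pos R0 by (intro mult_mono) auto
    then show "norm y \<le> R + K / lam 0" using nT[of 1 a] a by simp
  qed
  moreover have "\<exists>N. \<forall>u\<in>Y. norm (tail N u) \<le> \<epsilon>" if e: "\<epsilon> > 0" for \<epsilon>
  proof -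
    have "((\<lambda>x. (R + K) / x) \<longlongrightarrow> 0) at_top"
      by (intro tendsto_divide_0[OF tendsto_const] filterlim_at_top_imp_at_infinity filterlim_ident)
    then have "(\<lambda>n. (R + K) / lam n) \<longlonglongrightarrow> 0" using lam_top by (rule filterlim_compose)
    then obtain N where N: "norm ((R + K) / lam N - 0) < \<epsilon>" using e unfolding LIMSEQ_iff by blast
    have "norm (tail N (T 1 a)) \<le> \<epsilon>" if a: "norm a \<le> R" for a
    proof -
      have "lam N * exp (- lam N) \<le> 1"
      proof -
        have "lam N \<le> exp (lam N)" using exp_ge_add_one_self[of "lam N"] by linarith
        then show ?thesis
          using mult_right_mono[of "lam N" "exp (lam N)" "exp (- lam N)"] by (simp add: exp_add[symmetric])
      qed
      then have "exp (- lam N) \<le> 1 / lam N" using lam_ge(2)[of N] by (simp add: field_simps)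
      then have "exp (- 1 * lam N) * norm a \<le> (1 / lam N) * R" using a R0 lam_ge(2)[of N] by (intro mult_mono) auto
      then have "norm (tail N (T 1 a)) \<le> (R + K) / lam N"
        using sg_decay[OF tail_bl lam_ge(2) _ tail_S, of 1 N a] by (simp add: add_divide_distrib)
      moreover have "(R + K) / lam N < \<epsilon>" using N by (simp only: diff_zero real_norm_def abs_less_iff)
      ultimately show ?thesis by simp
    qed
    then show ?thesis by (intro exI[of _ N]) (auto simp: Y_def)
  qed
  ultimately have Kc: "compact (closure Y)" by (rule compact_closure_tail)
  have absb: "\<exists>t0\<ge>0. \<forall>t\<ge>t0. \<forall>b\<in>B. T t b \<in> closure Y" if B: "bounded B" for B
  proof -
    obtain M where M: "M > 0" "\<And>b. b \<in> B \<Longrightarrow> norm b \<le> M" using B by (auto simp: bounded_pos)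
    define t1 where "t1 = \<bar>ln M\<bar> / lam 0"
    have t1: "t1 \<ge> 0" using lam_pos by (simp add: t1_def)
    have "T t b \<in> closure Y" if t: "t \<ge> t1 + 1" and b: "b \<in> B" for t b
    proof -
      have "t1 * lam 0 \<le> (t - 1) * lam 0" using t lam_pos by (intro mult_right_mono) auto
      then have "exp (- (t - 1) * lam 0) \<le> exp (- t1 * lam 0)" by (simp add: algebra_simps)
      also have "\<dots> \<le> exp (- ln M)" using lam_pos by (simp add: t1_def)
      also have "\<dots> = 1 / M" using M by (simp add: exp_minus inverse_eq_divide)
      finally have "exp (- (t - 1) * lam 0) * norm b \<le> (1 / M) * M" using M(1) M(2)[OF b] by (intro mult_mono) auto
      then have "norm (T (t - 1) b) \<le> R" using nT[of "t - 1" b] t t1 M(1) by (simp add: R_def)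
      then have "T 1 (T (t - 1) b) \<in> Y" by (auto simp: Y_def)
      moreover have "T 1 (T (t - 1) b) = T t b" using sg_add[of "t - 1" 1 b] t t1 by simp
      ultimately show ?thesis using closure_subset by auto
    qed
    then show ?thesis using t1 by (intro exI[of _ "t1 + 1"]) auto
  qed
  obtain A where A: "compact A" "\<forall>t\<ge>0. T t ` A = A"
     "\<forall>B. bounded B \<longrightarrow> (\<forall>\<epsilon>>0. \<exists>t0\<ge>0. \<forall>t\<ge>t0. \<forall>b\<in>B. infdist (T t b) A < \<epsilon>)"
     "\<forall>z x. bounded (range z) \<longrightarrow> (\<forall>n. T (real n) (z n) = x) \<longrightarrow> x \<in> A"
    using attractor_abstract[of T "closure Y", OF sg_add sg_cont Kc absb] by auto
  then show ?thesis unfolding global_attractor_def by (intro exI[of _ A]) blast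
qed

end

section \<open>The logarithmic doubling dimension\<close>

lemma finite_ball_cover:
  assumes "compact (X::'a::metric_space set)" "\<epsilon> > 0"
  shows "\<exists>C. C \<subseteq> X \<and> finite C \<and> X \<subseteq> (\<Union>c\<in>C. ball c \<epsilon>)"
proof -
  have "X \<subseteq> (\<Union>c\<in>X. ball c \<epsilon>)" using assms(2) by auto
  then show ?thesis using compactE_image[OF assms(1), of X "\<lambda>c. ball c \<epsilon>"] by (metis open_ball)
qed

lemma cover_num_attained:
  assumes "compact (X::'a::metric_space set)" "\<epsilon> > 0" "B \<subseteq> X"
  shows "\<exists>C. C \<subseteq> X \<and> finite C \<and> card C = cover_num \<epsilon> B X \<and> B \<subseteq> (\<Union>c\<in>C. ball c \<epsilon>)"
proof -
  obtain C where "C \<subseteq> X" "finite C" "X \<subseteq> (\<Union>c\<in>C. ball c \<epsilon>)" using finite_ball_cover[OF assms(1,2)] by blast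
  then have "\<exists>n C. C \<subseteq> X \<and> finite C \<and> card C = n \<and> B \<subseteq> (\<Union>c\<in>C. ball c \<epsilon>)" using assms(3) by blast
  then show ?thesis unfolding cover_num_def by (rule LeastI_ex)
qed

lemma cover_num_le:
  assumes "C \<subseteq> X" "finite C" "B \<subseteq> (\<Union>c\<in>C. ball c \<epsilon>)"
  shows "cover_num \<epsilon> B X \<le> card C"
  unfolding cover_num_def by (rule Least_le) (use assms in blast)

lemma doubling_fn_upper:
  assumes X: "compact (X::'a::metric_space set)" and e: "\<epsilon> > 0" and x: "x \<in> X"
  shows "real (cover_num (\<epsilon> / 2) (X \<inter> ball x \<epsilon>) X) \<le> doubling_fn \<epsilon> X"
  unfolding doubling_fn_def
proof (rule cSUP_upper[OF x])
  obtain C where "C \<subseteq> X" "finite C" "X \<subseteq> (\<Union>c\<in>C. ball c (\<epsilon> / 2))" using finite_ball_cover[OF X, of "\<epsilon> / 2"] e by auto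
  then have "cover_num (\<epsilon> / 2) (X \<inter> ball x \<epsilon>) X \<le> card C" for x by (intro cover_num_le) auto
  then show "bdd_above ((\<lambda>x. real (cover_num (\<epsilon> / 2) (X \<inter> ball x \<epsilon>) X)) ` X)" by (auto intro!: bdd_aboveI[of _ "real (card C)"])
qed

lemma doubling_fn_ge_1:
  assumes X: "compact (X::'a::metric_space set)" and e: "\<epsilon> > 0" and x: "x \<in> X"
  shows "doubling_fn \<epsilon> X \<ge> 1"
proof -
  obtain C where C: "finite C" "card C = cover_num (\<epsilon> / 2) (X \<inter> ball x \<epsilon>) X" "X \<inter> ball x \<epsilon> \<subseteq> (\<Union>c\<in>C. ball c (\<epsilon> / 2))"
    using cover_num_attained[OF X, of "\<epsilon> / 2" "X \<inter> ball x \<epsilon>"] e by auto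
  have "x \<in> X \<inter> ball x \<epsilon>" using x e by simp
  then have "C \<noteq> {}" using C(3) by auto
  then have "card C \<ge> 1" using C(1) by (simp add: Suc_leI card_gt_0_iff)
  then show ?thesis using doubling_fn_upper[OF X e x] C(2) by linarith
qed

text \<open>Each ball of the current cover is covered anew by balls of half the radius, so the
  cardinalities multiply.\<close>

lemma doubling_chain:
  assumes X: "compact (X::'a::metric_space set)" and e: "\<epsilon> > 0" and D: "\<And>j. j < J \<Longrightarrow> doubling_fn (\<epsilon> / 2 ^ j) X \<le> D" "D \<ge> 0"
    and x: "x \<in> X"
  shows "\<exists>C. C \<subseteq> X \<and> finite C \<and> real (card C) \<le> D ^ J \<and> X \<inter> ball x \<epsilon> \<subseteq> (\<Union>c\<in>C. ball c (\<epsilon> / 2 ^ J))"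
  using D(1)
proof (induction J)
  case 0
  show ?case by (rule exI[of _ "{x}"]) (use x in auto)
next
  case (Suc J)
  then obtain C where C: "C \<subseteq> X" "finite C" "real (card C) \<le> D ^ J" "X \<inter> ball x \<epsilon> \<subseteq> (\<Union>c\<in>C. ball c (\<epsilon> / 2 ^ J))"
    by auto
  define r where "r = \<epsilon> / 2 ^ J"
  have r: "r > 0" "\<epsilon> / 2 ^ Suc J = r / 2" using e by (auto simp: r_def)
  have "\<forall>c\<in>C. \<exists>E. E \<subseteq> X \<and> finite E \<and> card E = cover_num (r / 2) (X \<inter> ball c r) X \<and> X \<inter> ball c r \<subseteq> (\<Union>c\<in>E. ball c (r / 2))"
    using cover_num_attained[OF X, of "r / 2"] r by auto
  then obtain E where E: "\<And>c. c \<in> C \<Longrightarrow> E c \<subseteq> X \<and> finite (E c) \<and> card (E c) = cover_num (r / 2) (X \<inter> ball c r) X \<and> X \<inter> ball c r \<subseteq> (\<Union>c\<in>E c. ball c (r / 2))"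
    by metis
  have cE: "real (card (E c)) \<le> D" if "c \<in> C" for c
    using doubling_fn_upper[OF X r(1), of c] E[OF that] C(1) that Suc.prems[of J] by (auto simp: r_def)
  have "card (\<Union>c\<in>C. E c) \<le> (\<Sum>c\<in>C. card (E c))" by (rule card_UN_le[OF C(2)])
  then have "real (card (\<Union>c\<in>C. E c)) \<le> (\<Sum>c\<in>C. real (card (E c)))" by (metis of_nat_le_iff of_nat_sum)
  also have "\<dots> \<le> (\<Sum>c\<in>C. D)" by (intro sum_mono cE)
  also have "\<dots> = real (card C) * D" by simp
  also have "\<dots> \<le> D ^ J * D" using C(3) D(2) by (intro mult_right_mono) auto
  finally have "real (card (\<Union>c\<in>C. E c)) \<le> D ^ Suc J" by (simp add: mult.commute)
  moreover have "X \<inter> ball x \<epsilon> \<subseteq> (\<Union>c\<in>(\<Union>c\<in>C. E c). ball c (\<epsilon> / 2 ^ Suc J))"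
  proof
    fix y assume y: "y \<in> X \<inter> ball x \<epsilon>"
    then obtain c where c: "c \<in> C" "y \<in> ball c r" using C(4) by (auto simp: r_def)
    then have "y \<in> X \<inter> ball c r" using y by simp
    then have "y \<in> (\<Union>c\<in>E c. ball c (r / 2))" using E[OF c(1)] by blast
    then show "y \<in> (\<Union>c\<in>(\<Union>c\<in>C. E c). ball c (\<epsilon> / 2 ^ Suc J))" using c(1) unfolding r(2) by blast
  qed
  ultimately show ?case using E C(2) by (intro exI[of _ "\<Union>c\<in>C. E c"]) blast
qed

text \<open>Read contrapositively for the cubes: too many separated points in one ball force one of
  the J doubling numbers on the way to be large. The factor 2 in the separation prevents two points
  from sharing a ball.\<close>

lemma separated_card_le:
  assumes X: "compact (X::'a::metric_space set)" and e: "\<epsilon> > 0" and D: "\<And>j. j < J \<Longrightarrow> doubling_fn (\<epsilon> / 2 ^ j) X \<le> D" "D \<ge> 0"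
    and x: "x \<in> X" and Z: "finite Z" "Z \<subseteq> X \<inter> ball x \<epsilon>"
    and sep: "\<And>y z. y \<in> Z \<Longrightarrow> z \<in> Z \<Longrightarrow> y \<noteq> z \<Longrightarrow> dist y z \<ge> 2 * (\<epsilon> / 2 ^ J)"
  shows "real (card Z) \<le> D ^ J"
proof -
  obtain C where C: "finite C" "real (card C) \<le> D ^ J" "X \<inter> ball x \<epsilon> \<subseteq> (\<Union>c\<in>C. ball c (\<epsilon> / 2 ^ J))"
    using doubling_chain[OF X e D x] by blast
  have "\<forall>z\<in>Z. \<exists>c\<in>C. dist c z < \<epsilon> / 2 ^ J" using C(3) Z(2) by (fastforce simp: subset_iff)
  then obtain g where g: "\<And>z. z \<in> Z \<Longrightarrow> g z \<in> C" "\<And>z. z \<in> Z \<Longrightarrow> dist (g z) z < \<epsilon> / 2 ^ J" by metis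
  have "inj_on g Z"
  proof (rule inj_onI, rule ccontr)
    fix y z assume yz: "y \<in> Z" "z \<in> Z" "g y = g z" "y \<noteq> z"
    have "dist y z \<le> dist (g y) y + dist (g y) z" by (metis dist_commute dist_triangle)
    also have "\<dots> < \<epsilon> / 2 ^ J + \<epsilon> / 2 ^ J" using g(2)[OF yz(1)] g(2)[OF yz(2)] yz(3) by (intro add_strict_mono) auto
    finally show False using sep[OF yz(1,2,4)] by simp
  qed
  then have "card Z \<le> card C" using g(1) C(1) by (intro card_inj_on_le[of g]) auto
  then show ?thesis using C(2) by linarith
qed

lemma dim_logD_eq_infI:
  assumes "\<And>R \<eta>. \<eta> > 0 \<Longrightarrow> \<exists>\<epsilon>. 0 < \<epsilon> \<and> \<epsilon> < \<eta> \<and> R \<le> ln (doubling_fn \<epsilon> X) / ln (ln (1 / \<epsilon>))"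
  shows "dim_logD (X::'a::metric_space set) = \<infinity>"
proof (rule ereal_top)
  fix R :: real
  show "ereal R \<le> dim_logD X"
    unfolding dim_logD_def Limsup_def
  proof (rule INF_greatest)
    fix P :: "real \<Rightarrow> bool" assume "P \<in> {P. eventually P (at_right 0)}"
    then obtain b where b: "b > 0" "\<And>y. 0 < y \<Longrightarrow> y < b \<Longrightarrow> P y" by (auto simp: eventually_at_right[OF zero_less_one])
    obtain \<epsilon> where e: "0 < \<epsilon>" "\<epsilon> < b" "R \<le> ln (doubling_fn \<epsilon> X) / ln (ln (1 / \<epsilon>))" using assms[OF b(1)] by blast
    have "ereal R \<le> ereal (ln (doubling_fn \<epsilon> X) / ln (ln (1 / \<epsilon>)))" using e by simp
    also have "\<dots> \<le> (SUP x\<in>Collect P. ereal (ln (doubling_fn x X) / ln (ln (1 / x))))" using b(2) e by (intro SUP_upper) auto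
    finally show "ereal R \<le> (SUP x\<in>Collect P. ereal (ln (doubling_fn x X) / ln (ln (1 / x))))" .
  qed
qed

lemma dim_logD_less_infI:
  assumes "\<eta> > 0" "\<And>\<epsilon>. 0 < \<epsilon> \<Longrightarrow> \<epsilon> < \<eta> \<Longrightarrow> ln (doubling_fn \<epsilon> X) / ln (ln (1 / \<epsilon>)) \<le> R"
  shows "dim_logD (X::'a::metric_space set) \<noteq> \<infinity>"
proof -
  have "dim_logD X \<le> ereal R" unfolding dim_logD_def
  proof (rule Limsup_bounded)
    show "\<forall>\<^sub>F \<epsilon> in at_right 0. ereal (ln (doubling_fn \<epsilon> X) / ln (ln (1 / \<epsilon>))) \<le> ereal R"
      unfolding eventually_at_right[OF zero_less_one] using assms by (intro exI[of _ \<eta>]) auto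
  qed
  then show ?thesis by auto
qed

section \<open>Log-Lipschitz charts bound the doubling dimension\<close>

lemma dist_N_ge: "i < N \<Longrightarrow> \<bar>p i - q i\<bar> \<le> dist_N N p q"
  unfolding dist_N_def by (rule real_le_rsqrt) (simp add: member_le_sum[of i "{..<N}" "\<lambda>i. (p i - q i)\<^sup>2"])

lemma dist_N_le: "(\<And>i. i < N \<Longrightarrow> \<bar>p i - q i\<bar> \<le> s) \<Longrightarrow> dist_N N p q \<le> real N * s"
proof -
  assume a: "\<And>i. i < N \<Longrightarrow> \<bar>p i - q i\<bar> \<le> s"
  have "dist_N N p q \<le> (\<Sum>i<N. \<bar>p i - q i\<bar>)"
    unfolding dist_N_def using L2_set_le_sum_abs[of "\<lambda>i. p i - q i" "{..<N}"] by (simp add: L2_set_def)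
  also have "\<dots> \<le> (\<Sum>i<N. s)" by (intro sum_mono) (use a in auto)
  finally show ?thesis by simp
qed

text \<open>Pigeonhole with cells of side s: two points in one cell are at distance at most N s. The
  floors lie between -k - 1 and k, whence 2k + 2 cells per axis.\<close>

lemma grid_count:
  fixes \<phi> :: "'b \<Rightarrow> nat \<Rightarrow> real"
  assumes Z: "finite Z" and s: "s > 0" and k: "\<rho> / s \<le> real k"
    and near: "\<And>z. z \<in> Z \<Longrightarrow> dist_N N (\<phi> z) p0 \<le> \<rho>"
    and sep: "\<And>y z. y \<in> Z \<Longrightarrow> z \<in> Z \<Longrightarrow> y \<noteq> z \<Longrightarrow> dist_N N (\<phi> y) (\<phi> z) > real N * s"
  shows "card Z \<le> (2 * k + 2) ^ N"
proof -
  define g where "g z = restrict (\<lambda>i. \<lfloor>(\<phi> z i - p0 i) / s\<rfloor>) {..<N}" for z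
  have "inj_on g Z"
  proof (rule inj_onI, rule ccontr)
    fix y z assume yz: "y \<in> Z" "z \<in> Z" "g y = g z" "y \<noteq> z"
    have "\<bar>\<phi> y i - \<phi> z i\<bar> \<le> s" if "i < N" for i
    proof -
      have "\<lfloor>(\<phi> y i - p0 i) / s\<rfloor> = \<lfloor>(\<phi> z i - p0 i) / s\<rfloor>"
        using fun_cong[OF yz(3), of i] that by (simp add: g_def)
      then have "\<bar>(\<phi> y i - p0 i) / s - (\<phi> z i - p0 i) / s\<bar> < 1" by linarith
      moreover have "(\<phi> y i - p0 i) / s - (\<phi> z i - p0 i) / s = (\<phi> y i - \<phi> z i) / s" by (simp add: diff_divide_distrib)
      ultimately have "\<bar>\<phi> y i - \<phi> z i\<bar> / s < 1" using s by (simp add: abs_divide)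
      then show ?thesis using s by (simp add: divide_less_eq)
    qed
    then have "dist_N N (\<phi> y) (\<phi> z) \<le> real N * s" by (rule dist_N_le)
    then show False using sep[OF yz(1,2,4)] by simp
  qed
  moreover have "g ` Z \<subseteq> PiE {..<N} (\<lambda>i. {- int k - 1..int k})"
  proof (rule image_subsetI, rule PiE_I)
    fix z i assume z: "z \<in> Z" and "i \<in> {..<N}"
    then have i: "i < N" by simp
    have "\<bar>\<phi> z i - p0 i\<bar> \<le> \<rho>" using dist_N_ge[OF i, of "\<phi> z" p0] near[OF z] by simp
    then have "\<bar>(\<phi> z i - p0 i) / s\<bar> \<le> real k" 
      using order_trans[OF divide_right_mono[of "\<bar>\<phi> z i - p0 i\<bar>" \<rho> s] k] s by (simp add: abs_divide)
    then have "- int k - 1 \<le> \<lfloor>(\<phi> z i - p0 i) / s\<rfloor>" "\<lfloor>(\<phi> z i - p0 i) / s\<rfloor> \<le> int k" by linarith+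
    then show "g z i \<in> {- int k - 1..int k}" using i by (simp add: g_def)
  qed (simp add: g_def)
  ultimately have "card Z \<le> card (PiE {..<N} (\<lambda>i. {- int k - 1..int k}))"
    by (intro card_inj_on_le[of g]) (auto intro: finite_PiE)
  also have "\<dots> = (2 * k + 2) ^ N"
  proof -
    have "card {- int k - 1..int k} = 2 * k + 2" by (simp add: nat_eq_iff)
    then show ?thesis by (simp add: card_PiE)
  qed
  finally show ?thesis .
qed

text \<open>A separated subset of B of maximal size is a net, and its points lie in X, as the
  centres in \<open>cover_num\<close> must.\<close>

lemma cover_num_le_separated:
  assumes "compact (X::'a::metric_space set)" "r > 0" "B \<subseteq> X"
    and bd: "\<And>Z. finite Z \<Longrightarrow> Z \<subseteq> B \<Longrightarrow> (\<And>y z. y \<in> Z \<Longrightarrow> z \<in> Z \<Longrightarrow> y \<noteq> z \<Longrightarrow> dist y z \<ge> r) \<Longrightarrow> card Z \<le> n"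
  shows "cover_num r B X \<le> n"
proof -
  define P where "P Z \<longleftrightarrow> finite Z \<and> Z \<subseteq> B \<and> (\<forall>y\<in>Z. \<forall>z\<in>Z. y \<noteq> z \<longrightarrow> dist y z \<ge> r)" for Z
  have "P {}" by (simp add: P_def)
  moreover have "\<forall>Z. P Z \<longrightarrow> card Z < Suc n" using bd by (auto simp: P_def le_imp_less_Suc)
  ultimately obtain Z where Z: "P Z" "\<And>W. P W \<Longrightarrow> card W \<le> card Z"
    using ex_has_greatest_nat[of P "{}" card "Suc n"] by auto
  have "B \<subseteq> (\<Union>c\<in>Z. ball c r)"
  proof (rule ccontr)
    assume "\<not> ?thesis"
    then obtain b where "b \<in> B" "b \<notin> (\<Union>c\<in>Z. ball c r)" by blast
    then have b: "b \<in> B" "\<And>c. c \<in> Z \<Longrightarrow> dist c b \<ge> r" by (auto simp: not_less)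
    then have "b \<notin> Z" using assms(2) by (metis dist_self not_less)
    moreover have "P (insert b Z)" using Z(1) b by (auto simp: P_def dist_commute)
    ultimately show False using Z(2)[of "insert b Z"] Z(1) by (simp add: P_def)
  qed
  then have "cover_num r B X \<le> card Z" using Z(1) assms(3) by (intro cover_num_le) (auto simp: P_def)
  then show ?thesis using bd Z(1) unfolding P_def by (meson le_trans)
qed

text \<open>Inverts the log-Lipschitz inequality. If \<delta> \<ge> \<epsilon>^2, the logarithm is
  at most 3 ln(1/\<epsilon>). If \<delta> < \<epsilon>^2, the right side of the hypothesis is
  O(\<delta>^(3/4)) = O(\<epsilon>^(3/2)), hence below \<epsilon>/2 for small \<epsilon>, and this
  case cannot occur.\<close>

lemma loglip_inverse_bound:
  fixes C \<gamma> :: real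
  assumes C: "C > 0" and g: "\<gamma> > 0"
  shows "\<exists>\<eta>>0. \<forall>\<epsilon> \<delta>. 0 < \<epsilon> \<longrightarrow> \<epsilon> < \<eta> \<longrightarrow> 0 < \<delta> \<longrightarrow> \<delta> < C \<longrightarrow>
     \<epsilon> / 2 \<le> C * \<delta> * ln (C / \<delta>) powr \<gamma> \<longrightarrow> \<epsilon> / (2 * C * (3 * ln (1 / \<epsilon>)) powr \<gamma>) \<le> \<delta>"
proof -
  \<comment> \<open>With this exponent the bound ln y \<le> y^a / a, raised to the power \<gamma>,
    costs only \<delta>^(-1/4).\<close>
  define a where "a = 1 / (4 * \<gamma>)"
  have a: "a > 0" "a * \<gamma> = 1/4" using g by (auto simp: a_def)
  define B where "B = 1 + C * (C powr (1/4)) * (1 / a) powr \<gamma>"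
  have B: "B > 1" using C a by (simp add: B_def)
  define \<eta> where "\<eta> = min (min (1/2) (1 / C)) (1 / (4 * B\<^sup>2))"
  have eta: "\<eta> > 0" "\<eta> \<le> 1/2" "\<eta> \<le> 1 / C" "\<eta> \<le> 1 / (4 * B\<^sup>2)" using B C by (auto simp: \<eta>_def)
  have "\<epsilon> / (2 * C * (3 * ln (1 / \<epsilon>)) powr \<gamma>) \<le> \<delta>"
    if e: "0 < \<epsilon>" "\<epsilon> < \<eta>" and d: "0 < \<delta>" "\<delta> < C" and le: "\<epsilon> / 2 \<le> C * \<delta> * ln (C / \<delta>) powr \<gamma>" for \<epsilon> \<delta>
  proof (cases "\<delta> \<ge> \<epsilon>\<^sup>2")
    case True
    have l: "ln (1 / \<epsilon>) > 0" using e eta by simp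
    have "\<epsilon> \<le> 1 / C" using e eta by linarith
    then have "C \<le> 1 / \<epsilon>" using e C by (simp add: field_simps)
    then have "C / \<delta> \<le> (1 / \<epsilon>) / \<epsilon>\<^sup>2" using True C e d by (intro frac_le) auto
    then have "ln (C / \<delta>) \<le> ln ((1 / \<epsilon>) ^ 3)" using C d e by (subst ln_le_cancel_iff) (auto simp: power_one_over power2_eq_square power3_eq_cube)
    also have "\<dots> = 3 * ln (1 / \<epsilon>)" using e by (subst ln_realpow) auto
    finally have "ln (C / \<delta>) powr \<gamma> \<le> (3 * ln (1 / \<epsilon>)) powr \<gamma>" using d C g by (intro powr_mono2) auto
    then have "C * \<delta> * ln (C / \<delta>) powr \<gamma> \<le> C * \<delta> * (3 * ln (1 / \<epsilon>)) powr \<gamma>" using C d by (intro mult_left_mono) auto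
    then have "\<epsilon> / 2 \<le> C * \<delta> * (3 * ln (1 / \<epsilon>)) powr \<gamma>" using le by simp
    moreover have "(3 * ln (1 / \<epsilon>)) powr \<gamma> > 0" using l by simp
    ultimately show ?thesis using C by (subst pos_divide_le_eq) (auto simp: mult_ac)
  next
    case False
    have "ln (C / \<delta>) \<le> (C / \<delta>) powr a / a" using d a C by (intro ln_powr_bound) auto
    then have "ln (C / \<delta>) powr \<gamma> \<le> ((C / \<delta>) powr a / a) powr \<gamma>" using d g by (intro powr_mono2) auto
    also have "\<dots> = ((C / \<delta>) powr a * (1 / a)) powr \<gamma>" by simp
    also have "\<dots> = ((C / \<delta>) powr a) powr \<gamma> * (1 / a) powr \<gamma>" by (rule powr_mult)
    also have "\<dots> = (C / \<delta>) powr (1/4) * (1 / a) powr \<gamma>" by (simp only: powr_powr a)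
    finally have "C * \<delta> * ln (C / \<delta>) powr \<gamma> \<le> C * \<delta> * ((C / \<delta>) powr (1/4) * (1 / a) powr \<gamma>)"
      using C d by (intro mult_left_mono) auto
    also have "\<dots> = (C * C powr (1/4) * (1 / a) powr \<gamma>) * \<delta> powr (3/4)"
    proof -
      have "\<delta> powr (3/4) * \<delta> powr (1/4) = \<delta>" using d by (simp add: powr_add[symmetric])
      then have "\<delta> powr (3/4) = \<delta> / \<delta> powr (1/4)" using d by (simp add: field_simps)
      then show ?thesis using C d by (simp add: powr_divide mult_ac)
    qed
    also have "\<dots> \<le> B * \<delta> powr (3/4)" by (intro mult_right_mono) (auto simp: B_def)
    also have "\<dots> \<le> B * (\<epsilon>\<^sup>2) powr (3/4)" using False d B by (intro mult_left_mono powr_mono2) auto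
    also have "(\<epsilon>\<^sup>2) powr (3/4) = \<epsilon> * sqrt \<epsilon>"
    proof -
      have "(\<epsilon>\<^sup>2) powr (3/4) = \<epsilon> powr (3/2)" using e by (simp add: powr_numeral[symmetric] powr_powr del: powr_numeral)
      also have "\<dots> = \<epsilon> powr 1 * \<epsilon> powr (1/2)" using powr_add[of \<epsilon> 1 "1/2"] by simp
      finally show ?thesis using e by (simp add: powr_half_sqrt)
    qed
    finally have "\<epsilon> / 2 \<le> B * (\<epsilon> * sqrt \<epsilon>)" using le by simp
    then have "1 / 2 \<le> B * sqrt \<epsilon>" using e by (simp add: field_simps)
    moreover have "sqrt \<epsilon> < sqrt (1 / (4 * B\<^sup>2))" using e eta by simp
    moreover have "sqrt (1 / (4 * B\<^sup>2)) = 1 / (2 * B)" using B by (simp add: real_sqrt_divide real_sqrt_mult)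
    ultimately show ?thesis using B by (simp add: field_simps)
  qed
  then show ?thesis using eta(1) by blast
qed

text \<open>In a chart the \<epsilon>-ball has size \<epsilon> times a power of ln(1/\<epsilon>),
  while \<epsilon>/2-separated points stay apart by \<epsilon> divided by such a power. Counting
  cells bounds the doubling number by a power of ln(1/\<epsilon>), so its logarithm is a bounded
  multiple of ln ln(1/\<epsilon>). The radius r0 is common to all centres.\<close>

lemma dim_logD_charts:
  assumes X: "compact (X::'a::metric_space set)" and ne: "X \<noteq> {}" and r0: "r0 > 0"
    and C: "C > 0" "\<gamma> > 0" "C' > 0" "\<gamma>' > 0"
    and ch: "\<And>x. x \<in> X \<Longrightarrow> \<exists>\<phi>. \<forall>y\<in>X \<inter> ball x r0. \<forall>z\<in>X \<inter> ball x r0. y \<noteq> z \<longrightarrow>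
       dist y z < C \<and> dist_N N (\<phi> y) (\<phi> z) \<le> C * dist y z * ln (C / dist y z) powr \<gamma> \<and>
       0 < dist_N N (\<phi> y) (\<phi> z) \<and> dist_N N (\<phi> y) (\<phi> z) < C' \<and>
       dist y z \<le> C' * dist_N N (\<phi> y) (\<phi> z) * ln (C' / dist_N N (\<phi> y) (\<phi> z)) powr \<gamma>'"
  shows "dim_logD X \<noteq> \<infinity>"
proof -
  obtain \<eta>1 where eta1: "\<eta>1 > 0" "\<And>\<epsilon> \<delta>. 0 < \<epsilon> \<Longrightarrow> \<epsilon> < \<eta>1 \<Longrightarrow> 0 < \<delta> \<Longrightarrow> \<delta> < C' \<Longrightarrow>
     \<epsilon> / 2 \<le> C' * \<delta> * ln (C' / \<delta>) powr \<gamma>' \<Longrightarrow> \<epsilon> / (2 * C' * (3 * ln (1 / \<epsilon>)) powr \<gamma>') \<le> \<delta>"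
    using loglip_inverse_bound[OF C(3,4)] by blast
  define c where "c = (4 * C * C' * (real N + 1)) * (3 powr \<gamma> * 3 powr \<gamma>')"
  have c: "c > 0" using C by (simp add: c_def)
  \<comment> \<open>exp(-exp 1) gives ln ln(1/\<epsilon>) \<ge> 1, so that constants can be absorbed
    into multiples of it; 1/(2C) bounds the logarithm in the chart by 3 ln(1/\<epsilon>), and r0
    keeps the ball inside one chart.\<close>
  define \<eta> where "\<eta> = min (min \<eta>1 (exp (- exp 1))) (min r0 (1 / (2 * C)))"
  have eta: "\<eta> > 0" "\<eta> \<le> \<eta>1" "\<eta> \<le> exp (- exp 1)" "\<eta> \<le> r0" "\<eta> \<le> 1 / (2 * C)" using eta1 r0 C by (auto simp: \<eta>_def)
  define Q where "Q = real N * (ln (2 * c + 4) + (\<gamma> + \<gamma>'))"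
  show ?thesis
  proof (rule dim_logD_less_infI[OF eta(1)])
    fix \<epsilon> :: real assume e: "0 < \<epsilon>" "\<epsilon> < \<eta>"
    define l where "l = ln (1 / \<epsilon>)"
    have l: "l \<ge> exp 1"
    proof -
      have "ln \<epsilon> \<le> ln (exp (- exp 1))" using e eta by (subst ln_le_cancel_iff) auto
      then show ?thesis using e by (simp add: l_def ln_div)
    qed
    have l1: "l \<ge> 1" using l exp_ge_add_one_self[of 1] by linarith
    have lnl: "ln l \<ge> 1" using l l1 by (subst ln_ge_iff) auto
    define k where "k = nat \<lceil>c * l powr (\<gamma> + \<gamma>')\<rceil>"
    have lp: "l powr (\<gamma> + \<gamma>') \<ge> 1" using l1 C by (intro ge_one_powr_ge_zero) auto
    have k: "c * l powr (\<gamma> + \<gamma>') \<le> real k" "real k \<le> c * l powr (\<gamma> + \<gamma>') + 1"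
      using c lp by (auto simp: k_def) 
    have cov: "cover_num (\<epsilon> / 2) (X \<inter> ball x \<epsilon>) X \<le> (2 * k + 2) ^ N" if x: "x \<in> X" for x
    proof (rule cover_num_le_separated[OF X])
      obtain \<phi> where \<phi>: "\<And>y z. y \<in> X \<inter> ball x r0 \<Longrightarrow> z \<in> X \<inter> ball x r0 \<Longrightarrow> y \<noteq> z \<Longrightarrow>
       dist y z < C \<and> dist_N N (\<phi> y) (\<phi> z) \<le> C * dist y z * ln (C / dist y z) powr \<gamma> \<and>
       0 < dist_N N (\<phi> y) (\<phi> z) \<and> dist_N N (\<phi> y) (\<phi> z) < C' \<and>
       dist y z \<le> C' * dist_N N (\<phi> y) (\<phi> z) * ln (C' / dist_N N (\<phi> y) (\<phi> z)) powr \<gamma>'"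
        using ch[OF x] by blast
      fix Z assume Z: "finite Z" "Z \<subseteq> X \<inter> ball x \<epsilon>" and sep: "\<And>y z. y \<in> Z \<Longrightarrow> z \<in> Z \<Longrightarrow> y \<noteq> z \<Longrightarrow> dist y z \<ge> \<epsilon> / 2"
      have Zr: "z \<in> X \<inter> ball x r0" if "z \<in> Z" for z using that Z(2) e eta by auto
      define \<rho>' where "\<rho>' = \<epsilon> / (2 * C' * (3 * l) powr \<gamma>')"
      define \<rho> where "\<rho> = C * (2 * \<epsilon>) * (3 * l) powr \<gamma>"
      define s where "s = \<rho>' / (real N + 1)"
      have rp: "\<rho>' > 0" "s > 0" "\<rho> > 0" using e C l1 by (auto simp: \<rho>'_def s_def \<rho>_def)
      show "card Z \<le> (2 * k + 2) ^ N"
      proof (cases "Z = {}")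
        case False
        then obtain z0 where z0: "z0 \<in> Z" by blast
        show ?thesis
        proof (rule grid_count[where \<phi> = \<phi> and ?p0.0 = "\<phi> z0" and s = s and \<rho> = \<rho>, OF Z(1) rp(2)])
          have "\<rho> / s = (4 * C * C' * (real N + 1)) * ((3 * l) powr \<gamma> * (3 * l) powr \<gamma>')"
            using e C l1 by (simp add: \<rho>_def s_def \<rho>'_def field_simps)
          also have "\<dots> = c * l powr (\<gamma> + \<gamma>')" using l1 by (simp add: c_def powr_mult powr_add mult_ac)
          finally show "\<rho> / s \<le> real k" using k by simp
          fix y assume y: "y \<in> Z"
          show "dist_N N (\<phi> y) (\<phi> z0) \<le> \<rho>"
          proof (cases "y = z0")
            case True then show ?thesis using rp by (simp add: dist_N_def)
          next
            case False
            define d where "d = dist y z0"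
            have d: "d \<ge> \<epsilon> / 2" using sep[OF y z0 False] by (simp add: d_def)
            have d2: "d \<le> 2 * \<epsilon>" 
            proof -
              have "dist x y < \<epsilon>" "dist x z0 < \<epsilon>" using y z0 Z(2) by auto
              then show ?thesis using dist_triangle[of y z0 x] by (simp add: d_def dist_commute)
            qed
            have dC: "d < C" "dist_N N (\<phi> y) (\<phi> z0) \<le> C * d * ln (C / d) powr \<gamma>" using \<phi>[OF Zr[OF y] Zr[OF z0] False] by (auto simp: d_def)
            have d0: "d > 0" using d e by simp
            have "\<epsilon> \<le> 1 / (2 * C)" using e eta by linarith
            then have eC: "2 * C \<le> 1 / \<epsilon>" using e C by (simp add: field_simps)
            have "C / d \<le> C / (\<epsilon> / 2)" using d e C by (intro divide_left_mono) auto
            also have "\<dots> = 2 * C * (1 / \<epsilon>)" by simp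
            also have "\<dots> \<le> (1 / \<epsilon>) * (1 / \<epsilon>)" using eC e by (intro mult_right_mono) auto
            also have "\<dots> \<le> (1 / \<epsilon>) ^ 3"
            proof -
              have "\<epsilon> \<le> exp (- exp 1)" using e eta by simp
              also have "\<dots> \<le> exp 0" by (subst exp_le_cancel_iff) simp
              finally have "1 / \<epsilon> \<ge> 1" using e by simp
              then have "(1 / \<epsilon>) ^ 2 \<le> (1 / \<epsilon>) ^ 3" by (intro power_increasing) auto
              then show ?thesis by (simp add: power2_eq_square)
            qed
            finally have "ln (C / d) \<le> ln ((1 / \<epsilon>) ^ 3)" using C d0 e by (subst ln_le_cancel_iff) auto
            also have "\<dots> = 3 * l" using e by (subst ln_realpow) (auto simp: l_def)
            finally have "ln (C / d) powr \<gamma> \<le> (3 * l) powr \<gamma>" using C d0 dC by (intro powr_mono2) auto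
            then have "C * d * ln (C / d) powr \<gamma> \<le> C * (2 * \<epsilon>) * (3 * l) powr \<gamma>" using C d2 d0 by (intro mult_mono) auto
            then show ?thesis using dC by (simp add: \<rho>_def)
          qed
          fix z assume z: "z \<in> Z" "y \<noteq> z"
          note p = \<phi>[OF Zr[OF y] Zr[OF z(1)] z(2)]
          have "\<rho>' \<le> dist_N N (\<phi> y) (\<phi> z)" unfolding \<rho>'_def l_def
            by (rule eta1(2)) (use e eta p sep[OF y z] in auto)
          moreover have "real N * s < \<rho>'" using rp by (simp add: s_def field_simps)
          ultimately show "dist_N N (\<phi> y) (\<phi> z) > real N * s" by simp
        qed
      qed simp
    qed (use e in auto)
    have "doubling_fn \<epsilon> X \<le> real ((2 * k + 2) ^ N)"
      unfolding doubling_fn_def by (rule cSUP_least[OF ne]) (use cov in \<open>simp only: of_nat_le_iff\<close>)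
    also have "\<dots> \<le> ((2 * c + 4) * l powr (\<gamma> + \<gamma>')) ^ N"
    proof -
      have "real (2 * k + 2) \<le> 2 * (c * l powr (\<gamma> + \<gamma>') + 1) + 2" using k(2) by simp
      also have "\<dots> \<le> (2 * c + 4) * l powr (\<gamma> + \<gamma>')" using lp by (simp add: algebra_simps)
      finally show ?thesis unfolding of_nat_power by (intro power_mono) auto
    qed
    finally have D: "doubling_fn \<epsilon> X \<le> ((2 * c + 4) * l powr (\<gamma> + \<gamma>')) ^ N" .
    obtain x where "x \<in> X" using ne by blast
    then have "doubling_fn \<epsilon> X \<ge> 1" using doubling_fn_ge_1[OF X e(1)] by blast
    then have "ln (doubling_fn \<epsilon> X) \<le> ln (((2 * c + 4) * l powr (\<gamma> + \<gamma>')) ^ N)"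
      using D by (subst ln_le_cancel_iff) auto
    also have "\<dots> = real N * (ln (2 * c + 4) + (\<gamma> + \<gamma>') * ln l)"
      using c l1 lp by (subst ln_realpow) (auto simp: ln_mult ln_powr)
    also have "\<dots> \<le> real N * (ln (2 * c + 4) * ln l + (\<gamma> + \<gamma>') * ln l)"
      using c lnl C by (intro mult_left_mono add_mono) (auto simp: mult_le_cancel_left1)
    also have "\<dots> = Q * ln l" by (simp add: Q_def algebra_simps)
    finally show "ln (doubling_fn \<epsilon> X) / ln (ln (1 / \<epsilon>)) \<le> Q" using lnl by (simp add: l_def[symmetric] pos_divide_le_eq)
  qed
qed

lemma dist_N_pos:
  assumes "p \<in> eucl_N N" "q \<in> eucl_N N" "p \<noteq> q"
  shows "dist_N N p q > 0"
proof -
  obtain i where i: "p i \<noteq> q i" using assms(3) by auto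
  then have "i < N" using assms(1,2) by (auto simp: eucl_N_def not_le intro: ccontr)
  then show ?thesis using dist_N_ge[of i N p q] i by simp
qed

text \<open>The constants C and \<gamma> are common to all charts but the radii are not; a Lebesgue
  number of the cover of the compact set supplies the uniform radius.\<close>

lemma no_loglip_manifold:
  assumes X: "compact (X::'a::metric_space set)" and ne: "X \<noteq> {}" and inf: "dim_logD X = \<infinity>" and sub: "X \<subseteq> M"
  shows "\<not> loglip_manifold N M"
proof
  assume "loglip_manifold N M"
  then obtain C \<gamma> where m: "\<forall>x\<in>M. \<exists>r>0. \<exists>\<phi>.
      \<phi> ` (M \<inter> ball x r) \<subseteq> eucl_N N \<and> inj_on \<phi> (M \<inter> ball x r) \<and>
      loglip dist (dist_N N) C \<gamma> (M \<inter> ball x r) \<phi> \<and>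
      loglip (dist_N N) dist C \<gamma> (\<phi> ` (M \<inter> ball x r)) (the_inv_into (M \<inter> ball x r) \<phi>)"
    unfolding loglip_manifold_def by meson
  obtain x0 where x0: "x0 \<in> X" using ne by blast
  then have C: "C > 0" "\<gamma> > 0" using m sub unfolding loglip_def by blast+
  define \<C> where "\<C> = {ball x r | x r. x \<in> M \<and> r > 0 \<and> (\<exists>\<phi>.
      \<phi> ` (M \<inter> ball x r) \<subseteq> eucl_N N \<and> inj_on \<phi> (M \<inter> ball x r) \<and>
      loglip dist (dist_N N) C \<gamma> (M \<inter> ball x r) \<phi> \<and>
      loglip (dist_N N) dist C \<gamma> (\<phi> ` (M \<inter> ball x r)) (the_inv_into (M \<inter> ball x r) \<phi>))}"
  have cov: "X \<subseteq> \<Union>\<C>"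
  proof
    fix x assume "x \<in> X"
    then have "x \<in> M" using sub by blast
    then obtain r where "r > 0" "ball x r \<in> \<C>" using m unfolding \<C>_def by blast
    then show "x \<in> \<Union>\<C>" by (meson UnionI centre_in_ball)
  qed
  have op: "\<And>B. B \<in> \<C> \<Longrightarrow> open B" by (auto simp: \<C>_def)
  have "\<C> \<noteq> {}" using cov x0 by auto
  then obtain \<delta> where \<delta>: "\<delta> > 0" "\<And>T. T \<subseteq> X \<Longrightarrow> diameter T < \<delta> \<Longrightarrow> \<exists>B\<in>\<C>. T \<subseteq> B"
    using Lebesgue_number_lemma[OF X _ cov op] by metis
  have "dim_logD X \<noteq> \<infinity>"
  proof (rule dim_logD_charts[OF X ne _ C C])
    show "\<delta> / 3 > 0" using \<delta> by simp
    fix x assume x: "x \<in> X"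
    have "diameter (X \<inter> ball x (\<delta> / 3)) \<le> 2 * (\<delta> / 3)"
    proof -
      have dd: "dist y z \<le> 2 * (\<delta> / 3)" if "y \<in> X \<inter> ball x (\<delta> / 3)" "z \<in> X \<inter> ball x (\<delta> / 3)" for y z
        using that dist_triangle[of y z x] by (simp add: dist_commute)
      show ?thesis
      proof (cases "X \<inter> ball x (\<delta> / 3) = {}")
        case False
        then show ?thesis
          unfolding diameter_def if_not_P[OF False] by (intro cSUP_least) (use dd in auto)
      qed (use \<delta>(1) in \<open>simp add: diameter_def\<close>)
    qed
    then obtain B where B: "B \<in> \<C>" "X \<inter> ball x (\<delta> / 3) \<subseteq> B" using \<delta>(2)[of "X \<inter> ball x (\<delta> / 3)"] \<delta>(1) by auto
    then obtain x' r \<phi> where p: "B = ball x' r" "\<phi> ` (M \<inter> ball x' r) \<subseteq> eucl_N N" "inj_on \<phi> (M \<inter> ball x' r)"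
      "loglip dist (dist_N N) C \<gamma> (M \<inter> ball x' r) \<phi>"
      "loglip (dist_N N) dist C \<gamma> (\<phi> ` (M \<inter> ball x' r)) (the_inv_into (M \<inter> ball x' r) \<phi>)"
      unfolding \<C>_def by blast
    show "\<exists>\<phi>. \<forall>y\<in>X \<inter> ball x (\<delta> / 3). \<forall>z\<in>X \<inter> ball x (\<delta> / 3). y \<noteq> z \<longrightarrow>
       dist y z < C \<and> dist_N N (\<phi> y) (\<phi> z) \<le> C * dist y z * ln (C / dist y z) powr \<gamma> \<and>
       0 < dist_N N (\<phi> y) (\<phi> z) \<and> dist_N N (\<phi> y) (\<phi> z) < C \<and>
       dist y z \<le> C * dist_N N (\<phi> y) (\<phi> z) * ln (C / dist_N N (\<phi> y) (\<phi> z)) powr \<gamma>"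
    proof (intro exI[of _ \<phi>] ballI impI)
      fix y z assume "y \<in> X \<inter> ball x (\<delta> / 3)" "z \<in> X \<inter> ball x (\<delta> / 3)" and yz: "y \<noteq> z"
      then have i: "y \<in> M \<inter> ball x' r" "z \<in> M \<inter> ball x' r" using B(2) p(1) sub by auto
      have ne: "\<phi> y \<noteq> \<phi> z" using inj_onD[OF p(3) _ i] yz by blast
      have "dist_N N (\<phi> y) (\<phi> z) > 0" by (rule dist_N_pos) (use p(2) i ne in auto)
      moreover have "dist y z < C \<and> dist_N N (\<phi> y) (\<phi> z) \<le> C * dist y z * ln (C / dist y z) powr \<gamma>"
        using p(4) i yz unfolding loglip_def by blast
      moreover have "dist_N N (\<phi> y) (\<phi> z) < C \<and> dist y z \<le> C * dist_N N (\<phi> y) (\<phi> z) * ln (C / dist_N N (\<phi> y) (\<phi> z)) powr \<gamma>"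
        using p(5) ne i the_inv_into_f_f[OF p(3) i(1)] the_inv_into_f_f[OF p(3) i(2)] unfolding loglip_def
        by (metis imageI)
      ultimately show "dist y z < C \<and> dist_N N (\<phi> y) (\<phi> z) \<le> C * dist y z * ln (C / dist y z) powr \<gamma> \<and>
       0 < dist_N N (\<phi> y) (\<phi> z) \<and> dist_N N (\<phi> y) (\<phi> z) < C \<and>
       dist y z \<le> C * dist_N N (\<phi> y) (\<phi> z) * ln (C / dist_N N (\<phi> y) (\<phi> z)) powr \<gamma>" by blast
    qed
  qed
  then show False using inf by blast
qed

lemma finite_orthonormal_basis:
  assumes "finite (B::'a::real_inner set)"
  shows "\<exists>n (b::nat \<Rightarrow> 'a). (\<forall>i<n. \<forall>j<n. inner (b i) (b j) = (if i = j then 1 else 0)) \<and> span B = span (b ` {..<n})"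
  using assms
proof (induction B)
  case empty
  show ?case by (rule exI[of _ 0]) auto
next
  case (insert a B)
  then obtain n and b :: "nat \<Rightarrow> 'a" where b: "\<And>i j. i < n \<Longrightarrow> j < n \<Longrightarrow> inner (b i) (b j) = (if i = j then 1 else 0)" "span B = span (b ` {..<n})"
    by blast
  define p where "p = (\<Sum>i<n. inner a (b i) *\<^sub>R b i)"
  define a' where "a' = a - p"
  have p: "p \<in> span (b ` {..<n})" unfolding p_def by (intro span_sum span_scale span_base) auto
  have orth: "inner a' (b j) = 0" if "j < n" for j
  proof -
    have "inner p (b j) = (\<Sum>i<n. if i = j then inner a (b i) else 0)"
      unfolding p_def inner_sum_left by (rule sum.cong) (auto simp: b(1) that)
    then show ?thesis using that by (simp add: a'_def inner_diff_left)
  qed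
  show ?case
  proof (cases "a' = 0")
    case True
    then have "a \<in> span B" using p b(2) by (simp add: a'_def)
    then have "span (insert a B) = span B" by (rule span_redundant)
    then show ?thesis using b by (intro exI[of _ n] exI[of _ b]) auto
  next
    case False
    define b' where "b' i = (if i < n then b i else a' /\<^sub>R norm a')" for i
    have "inner (b' i) (b' j) = (if i = j then 1 else 0)" if "i < Suc n" "j < Suc n" for i j
      using that False orth[of i] orth[of j] b(1)[of i j]
      by (auto simp: b'_def inner_commute[of _ a'] less_Suc_eq power2_norm_eq_inner[symmetric] power2_eq_square)
    moreover have "span (insert a B) = span (b' ` {..<Suc n})"
    proof -
      have im: "b' ` {..<Suc n} = insert (a' /\<^sub>R norm a') (b ` {..<n})"
        by (auto simp: b'_def less_Suc_eq image_iff lessThan_Suc)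
      have "span (insert a B) = span (insert a (b ` {..<n}))" using b(2) by (simp add: span_insert)
      also have "\<dots> = span (insert (a' /\<^sub>R norm a') (b ` {..<n}))"
      proof (rule span_eq[THEN iffD2], intro conjI)
        have "a = norm a' *\<^sub>R (a' /\<^sub>R norm a') + p" using False by (simp add: a'_def)
        moreover have "p \<in> span (insert (a' /\<^sub>R norm a') (b ` {..<n}))" using p span_mono[OF subset_insertI] by blast
        moreover have "norm a' *\<^sub>R (a' /\<^sub>R norm a') \<in> span (insert (a' /\<^sub>R norm a') (b ` {..<n}))" by (intro span_scale span_base) simp
        ultimately have "a \<in> span (insert (a' /\<^sub>R norm a') (b ` {..<n}))" using span_add by metis
        then show "insert a (b ` {..<n}) \<subseteq> span (insert (a' /\<^sub>R norm a') (b ` {..<n}))" by (auto intro: span_base)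
        have "p \<in> span (insert a (b ` {..<n}))" using p span_mono[OF subset_insertI] by blast
        then have "a' \<in> span (insert a (b ` {..<n}))" unfolding a'_def by (intro span_diff) (auto intro: span_base)
        then have "a' /\<^sub>R norm a' \<in> span (insert a (b ` {..<n}))" by (rule span_scale)
        then show "insert (a' /\<^sub>R norm a') (b ` {..<n}) \<subseteq> span (insert a (b ` {..<n}))" by (auto intro: span_base)
      qed
      finally show ?thesis using im by simp
    qed
    ultimately show ?thesis by (intro exI[of _ "Suc n"] exI[of _ b']) blast
  qed
qed

text \<open>Orthonormal coordinates on the range turn P into one global chart: P is 1-Lipschitz, and
  the inverse is log-Lipschitz by assumption.\<close>

lemma no_loglip_Mane_proj:
  assumes X: "compact (X::'a::real_inner set)" and ne: "X \<noteq> {}" and inf: "dim_logD X = \<infinity>"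
  shows "\<not> loglip_Mane_proj P X"
proof
  assume "loglip_Mane_proj P X"
  then obtain V B C \<gamma> where V: "subspace V" "finite B" "span B = V"
    and P: "\<And>x. P x \<in> V" "\<And>x v. v \<in> V \<Longrightarrow> inner (x - P x) v = 0" and inj: "inj_on P X"
    and ll: "loglip dist dist C \<gamma> (P ` X) (the_inv_into X P)"
    unfolding loglip_Mane_proj_def fin_orth_proj_def by blast
  obtain N and b :: "nat \<Rightarrow> 'a" where b: "\<And>i j. i < N \<Longrightarrow> j < N \<Longrightarrow> inner (b i) (b j) = (if i = j then 1 else 0)" "V = span (b ` {..<N})"
    using finite_orthonormal_basis[OF V(2)] V(3) by blast
  have nrm: "(norm v)\<^sup>2 = (\<Sum>i<N. (inner v (b i))\<^sup>2)" if v: "v \<in> V" for v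
  proof -
    define w where "w = (\<Sum>i<N. inner v (b i) *\<^sub>R b i)"
    have "inner (v - w) (b j) = 0" if "j < N" for j
    proof -
      have "inner w (b j) = (\<Sum>i<N. if i = j then inner v (b i) else 0)"
        unfolding w_def inner_sum_left by (rule sum.cong) (auto simp: b(1) that)
      then show ?thesis using that by (simp add: inner_diff_left)
    qed
    then have "b ` {..<N} \<subseteq> {u. inner (v - w) u = 0}" by auto
    moreover have "subspace {u. inner (v - w) u = 0}" by (auto simp: subspace_def inner_add_right)
    ultimately have "V \<subseteq> {u. inner (v - w) u = 0}" unfolding b(2) by (rule span_minimal)
    moreover have "w \<in> V" unfolding w_def b(2) by (intro span_sum span_scale span_base) auto
    ultimately have "inner (v - w) (v - w) = 0" using v by (simp add: inner_diff_right subset_iff)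
    then have vw: "v = w" by simp
    have "inner v v = (\<Sum>i<N. inner v (b i) * inner v (b i))"
      by (subst (2) vw) (simp add: w_def inner_sum_right)
    then show ?thesis unfolding power2_norm_eq_inner by (simp add: power2_eq_square)
  qed
  define \<phi> where "\<phi> x i = (if i < N then inner (P x) (b i) else 0)" for x i
  have dN: "dist_N N (\<phi> x) (\<phi> y) = dist (P x) (P y)" for x y
  proof -
    have "P x - P y \<in> V" using P(1) V(1) by (simp add: subspace_diff)
    from nrm[OF this] have "(\<Sum>i<N. (\<phi> x i - \<phi> y i)\<^sup>2) = (norm (P x - P y))\<^sup>2"
      by (simp add: \<phi>_def inner_diff_left)
    then show ?thesis by (simp add: dist_N_def dist_norm)
  qed
  have P1: "dist (P x) (P y) \<le> dist x y" for x y
  proof -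
    define u where "u = P x - P y"
    have u: "u \<in> V" unfolding u_def using P(1) V(1) by (simp add: subspace_diff)
    have "inner (x - y) u = inner u u"
      using P(2)[OF u, of x] P(2)[OF u, of y] by (simp add: u_def inner_diff_left inner_diff_right)
    then have "(norm u)\<^sup>2 \<le> norm (x - y) * norm u" using norm_cauchy_schwarz[of "x - y" u] by (simp add: power2_norm_eq_inner)
    then have "norm u \<le> norm (x - y)" by (cases "u = 0") (auto simp: power2_eq_square)
    then show ?thesis by (simp add: u_def dist_norm)
  qed
  obtain R where R: "\<And>x y. x \<in> X \<Longrightarrow> y \<in> X \<Longrightarrow> dist x y \<le> R"
    using compact_imp_bounded[OF X] diameter_bounded_bound by blast
  obtain x0 where x0: "x0 \<in> X" using ne by blast
  have R0: "R \<ge> 0" using R[OF x0 x0] by simp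
  \<comment> \<open>The factor exp 1 forces ln(C1 / d) \<ge> 1 for all distances d \<le> R, so a
    1-Lipschitz map is log-Lipschitz with constant C1 and exponent 1.\<close>
  define C1 where "C1 = exp 1 * (R + 1)"
  have C1: "C1 \<ge> R + 1" using R0 exp_ge_add_one_self[of 1] by (simp add: C1_def)
  have C: "C > 0" "\<gamma> > 0" using ll by (auto simp: loglip_def)
  have "dim_logD X \<noteq> \<infinity>"
  proof (rule dim_logD_charts[OF X ne zero_less_one _ zero_less_one C])
    show "C1 > 0" using C1 R0 by simp
    fix x assume x: "x \<in> X"
    show "\<exists>\<phi>. \<forall>y\<in>X \<inter> ball x 1. \<forall>z\<in>X \<inter> ball x 1. y \<noteq> z \<longrightarrow>
       dist y z < C1 \<and> dist_N N (\<phi> y) (\<phi> z) \<le> C1 * dist y z * ln (C1 / dist y z) powr 1 \<and>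
       0 < dist_N N (\<phi> y) (\<phi> z) \<and> dist_N N (\<phi> y) (\<phi> z) < C \<and>
       dist y z \<le> C * dist_N N (\<phi> y) (\<phi> z) * ln (C / dist_N N (\<phi> y) (\<phi> z)) powr \<gamma>"
    proof (intro exI[of _ \<phi>] ballI impI)
      fix y z assume "y \<in> X \<inter> ball x 1" "z \<in> X \<inter> ball x 1" and yz: "y \<noteq> z"
      then have i: "y \<in> X" "z \<in> X" by auto
      define d where "d = dist y z"
      have d: "d > 0" "d \<le> R" using yz R[OF i] by (auto simp: d_def)
      have ne: "P y \<noteq> P z" using inj_onD[OF inj _ i] yz by blast
      have "exp 1 * d \<le> C1" unfolding C1_def using d by (intro mult_left_mono) auto
      then have "exp 1 \<le> C1 / d" using d by (simp add: field_simps)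
      then have l1: "1 \<le> ln (C1 / d)" using d C1 R0 by (subst ln_ge_iff) auto
      have "dist (P y) (P z) \<le> 1 * d * 1" using P1[of y z] by (simp add: d_def)
      also have "\<dots> \<le> C1 * d * ln (C1 / d)" using l1 C1 R0 d by (intro mult_mono) auto
      finally have "dist_N N (\<phi> y) (\<phi> z) \<le> C1 * d * ln (C1 / d) powr 1" using l1 by (simp add: dN)
      moreover have "d < C1" using d C1 by simp
      moreover have "0 < dist_N N (\<phi> y) (\<phi> z)" using ne by (simp add: dN)
      moreover have "dist (P y) (P z) < C \<and> dist y z \<le> C * dist (P y) (P z) * ln (C / dist (P y) (P z)) powr \<gamma>"
        using ll ne i the_inv_into_f_f[OF inj i(1)] the_inv_into_f_f[OF inj i(2)] unfolding loglip_def
        by (metis imageI)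
      ultimately show "dist y z < C1 \<and> dist_N N (\<phi> y) (\<phi> z) \<le> C1 * dist y z * ln (C1 / dist y z) powr 1 \<and>
       0 < dist_N N (\<phi> y) (\<phi> z) \<and> dist_N N (\<phi> y) (\<phi> z) < C \<and>
       dist y z \<le> C * dist_N N (\<phi> y) (\<phi> z) * ln (C / dist_N N (\<phi> y) (\<phi> z)) powr \<gamma>"
        by (simp add: dN d_def)
    qed
  qed
  then show False using inf by blast
qed

section \<open>Uniformly bounded and Lipschitz families\<close>

text \<open>One constant for all \<epsilon> \<le> 1. After multiplication by \<epsilon> such a
  family adds only O(\<epsilon>) to the Lipschitz constant, whatever products of cutoffs it
  contains; the bound on the values is carried along because the product rule uses it.\<close>

definition UBL :: "(real \<Rightarrow> 'a::real_normed_vector \<Rightarrow> 'b::real_normed_vector) \<Rightarrow> bool" where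
  "UBL R \<longleftrightarrow> (\<exists>C. C \<ge> 0 \<and> (\<forall>\<epsilon> u v. 0 < \<epsilon> \<longrightarrow> \<epsilon> \<le> 1 \<longrightarrow>
      norm (R \<epsilon> u) \<le> C \<and> norm (R \<epsilon> u - R \<epsilon> v) \<le> C * norm (u - v)))"

lemma UBLI: "C \<ge> 0 \<Longrightarrow> (\<And>\<epsilon> u. 0 < \<epsilon> \<Longrightarrow> \<epsilon> \<le> 1 \<Longrightarrow> norm (R \<epsilon> u) \<le> C) \<Longrightarrow>
    (\<And>\<epsilon> u v. 0 < \<epsilon> \<Longrightarrow> \<epsilon> \<le> 1 \<Longrightarrow> norm (R \<epsilon> u - R \<epsilon> v) \<le> C * norm (u - v)) \<Longrightarrow> UBL R"
  unfolding UBL_def by blast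

lemma UBLE:
  assumes "UBL R"
  obtains C where "C \<ge> 0" "\<And>\<epsilon> u. 0 < \<epsilon> \<Longrightarrow> \<epsilon> \<le> 1 \<Longrightarrow> norm (R \<epsilon> u) \<le> C"
    "\<And>\<epsilon> u v. 0 < \<epsilon> \<Longrightarrow> \<epsilon> \<le> 1 \<Longrightarrow> norm (R \<epsilon> u - R \<epsilon> v) \<le> C * norm (u - v)"
  using assms unfolding UBL_def by blast

lemma UBL_const: "UBL (\<lambda>\<epsilon> u. c)"
  by (rule UBLI[of "norm c"]) auto

lemma UBL_add: 
  assumes "UBL f" "UBL g"
  shows "UBL (\<lambda>\<epsilon> u. f \<epsilon> u + g \<epsilon> u)"
proof (rule UBLE[OF assms(1)], rule UBLE[OF assms(2)])
  fix C D assume C: "C \<ge> 0" "\<And>\<epsilon> u. 0 < \<epsilon> \<Longrightarrow> \<epsilon> \<le> 1 \<Longrightarrow> norm (f \<epsilon> u) \<le> C"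
    "\<And>\<epsilon> u v. 0 < \<epsilon> \<Longrightarrow> \<epsilon> \<le> 1 \<Longrightarrow> norm (f \<epsilon> u - f \<epsilon> v) \<le> C * norm (u - v)"
  and D: "D \<ge> 0" "\<And>\<epsilon> u. 0 < \<epsilon> \<Longrightarrow> \<epsilon> \<le> 1 \<Longrightarrow> norm (g \<epsilon> u) \<le> D"
    "\<And>\<epsilon> u v. 0 < \<epsilon> \<Longrightarrow> \<epsilon> \<le> 1 \<Longrightarrow> norm (g \<epsilon> u - g \<epsilon> v) \<le> D * norm (u - v)"
  show ?thesis
  proof (rule UBLI[of "C + D"])
    fix \<epsilon> :: real and u v assume e: "0 < \<epsilon>" "\<epsilon> \<le> 1"
    show "norm (f \<epsilon> u + g \<epsilon> u) \<le> C + D" by (rule norm_triangle_mono[OF C(2)[OF e] D(2)[OF e]])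
    have "f \<epsilon> u + g \<epsilon> u - (f \<epsilon> v + g \<epsilon> v) = (f \<epsilon> u - f \<epsilon> v) + (g \<epsilon> u - g \<epsilon> v)" by simp
    moreover have "norm ((f \<epsilon> u - f \<epsilon> v) + (g \<epsilon> u - g \<epsilon> v)) \<le> C * norm (u - v) + D * norm (u - v)"
      by (rule norm_triangle_mono[OF C(3)[OF e] D(3)[OF e]])
    ultimately show "norm (f \<epsilon> u + g \<epsilon> u - (f \<epsilon> v + g \<epsilon> v)) \<le> (C + D) * norm (u - v)"
      by (simp add: algebra_simps)
  qed (use C D in auto)
qed

lemma UBL_bilinear:
  assumes p: "bounded_bilinear prd" and "UBL f" "UBL g"
  shows "UBL (\<lambda>\<epsilon> u. prd (f \<epsilon> u) (g \<epsilon> u))"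
proof (rule UBLE[OF assms(2)], rule UBLE[OF assms(3)])
  interpret bounded_bilinear prd by fact
  fix C D assume C: "C \<ge> 0" "\<And>\<epsilon> u. 0 < \<epsilon> \<Longrightarrow> \<epsilon> \<le> 1 \<Longrightarrow> norm (f \<epsilon> u) \<le> C"
    "\<And>\<epsilon> u v. 0 < \<epsilon> \<Longrightarrow> \<epsilon> \<le> 1 \<Longrightarrow> norm (f \<epsilon> u - f \<epsilon> v) \<le> C * norm (u - v)"
  and D: "D \<ge> 0" "\<And>\<epsilon> u. 0 < \<epsilon> \<Longrightarrow> \<epsilon> \<le> 1 \<Longrightarrow> norm (g \<epsilon> u) \<le> D"
    "\<And>\<epsilon> u v. 0 < \<epsilon> \<Longrightarrow> \<epsilon> \<le> 1 \<Longrightarrow> norm (g \<epsilon> u - g \<epsilon> v) \<le> D * norm (u - v)"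
  obtain K where K: "K > 0" "\<And>a b. norm (prd a b) \<le> norm a * norm b * K" using pos_bounded by blast
  have CDK: "0 \<le> C * D * K" using C(1) D(1) K(1) by simp
  show ?thesis
  proof (rule UBLI[of "2 * (C * D * K)"])
    show "0 \<le> 2 * (C * D * K)" using CDK by simp
    fix \<epsilon> :: real and u v assume e: "0 < \<epsilon>" "\<epsilon> \<le> 1"
    have "norm (prd (f \<epsilon> u) (g \<epsilon> u)) \<le> C * D * K"
      by (rule order_trans[OF K(2)], intro mult_right_mono mult_mono C(2) D(2) e) (use C(1) K in auto)
    then show "norm (prd (f \<epsilon> u) (g \<epsilon> u)) \<le> 2 * (C * D * K)" using CDK by simp
    have "norm (prd (f \<epsilon> u - f \<epsilon> v) (g \<epsilon> u)) \<le> (C * norm (u - v)) * D * K"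
      by (rule order_trans[OF K(2)], intro mult_right_mono mult_mono C(3) D(2) e) (use C(1) K in auto)
    moreover have "norm (prd (f \<epsilon> v) (g \<epsilon> u - g \<epsilon> v)) \<le> C * (D * norm (u - v)) * K"
      by (rule order_trans[OF K(2)], intro mult_right_mono mult_mono C(2) D(3) e) (use C(1) K in auto)
    moreover have "prd (f \<epsilon> u) (g \<epsilon> u) - prd (f \<epsilon> v) (g \<epsilon> v) = prd (f \<epsilon> u - f \<epsilon> v) (g \<epsilon> u) + prd (f \<epsilon> v) (g \<epsilon> u - g \<epsilon> v)"
      by (simp add: diff_left diff_right)
    ultimately show "norm (prd (f \<epsilon> u) (g \<epsilon> u) - prd (f \<epsilon> v) (g \<epsilon> v)) \<le> 2 * (C * D * K) * norm (u - v)"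
      using norm_triangle_ineq[of "prd (f \<epsilon> u - f \<epsilon> v) (g \<epsilon> u)" "prd (f \<epsilon> v) (g \<epsilon> u - g \<epsilon> v)"]
      by (simp add: algebra_simps)
  qed
qed

lemmas UBL_scaleR = UBL_bilinear[OF bounded_bilinear_scaleR]
lemmas UBL_mult = UBL_bilinear[OF bounded_bilinear_mult]
lemmas UBL_inner = UBL_bilinear[OF bounded_bilinear_inner]

lemma UBL_minus: "UBL f \<Longrightarrow> UBL (\<lambda>\<epsilon> u. - f \<epsilon> u)"
  using UBL_scaleR[OF UBL_const[of "-1"], of f] by simp

lemma UBL_diff: "UBL f \<Longrightarrow> UBL g \<Longrightarrow> UBL (\<lambda>\<epsilon> u. f \<epsilon> u - g \<epsilon> u)"
  using UBL_add[OF _ UBL_minus, of f g] by simp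

lemma UBL_power2:
  fixes f :: "real \<Rightarrow> 'a::real_normed_vector \<Rightarrow> real"
  shows "UBL f \<Longrightarrow> UBL (\<lambda>\<epsilon> u. (f \<epsilon> u)\<^sup>2)"
  unfolding power2_eq_square by (rule UBL_mult)

lemma UBL_bounded_linear:
  assumes "bounded_linear T" "UBL f"
  shows "UBL (\<lambda>\<epsilon> u. T (f \<epsilon> u))"
proof -
  have "bounded_bilinear (\<lambda>(c::real) y. c *\<^sub>R T y)"
    using bounded_bilinear.comp[OF bounded_bilinear_scaleR bounded_linear_ident assms(1)] by simp
  from UBL_bilinear[OF this UBL_const[of 1] assms(2)] show ?thesis by simp
qed

lemma UBL_compose:
  fixes f :: "real \<Rightarrow> 'a::real_normed_vector \<Rightarrow> real"
  assumes G: "smoothR G" and "UBL f"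
  shows "UBL (\<lambda>\<epsilon> u. G (f \<epsilon> u))"
proof (rule UBLE[OF assms(2)])
  fix C assume C: "C \<ge> 0" "\<And>\<epsilon> u. 0 < \<epsilon> \<Longrightarrow> \<epsilon> \<le> 1 \<Longrightarrow> norm (f \<epsilon> u) \<le> C"
    "\<And>\<epsilon> u v. 0 < \<epsilon> \<Longrightarrow> \<epsilon> \<le> 1 \<Longrightarrow> norm (f \<epsilon> u - f \<epsilon> v) \<le> C * norm (u - v)"
  obtain D where D: "D > 0" "\<And>x. \<bar>x\<bar> \<le> C \<Longrightarrow> norm (G x) \<le> D"
    "\<And>x y. \<bar>x\<bar> \<le> C \<Longrightarrow> \<bar>y\<bar> \<le> C \<Longrightarrow> norm (G x - G y) \<le> D * \<bar>x - y\<bar>"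
    using smoothR_bounded_on_Icc[OF G, of C] by blast
  show ?thesis
  proof (rule UBLI[of "D + D * C"])
    show "0 \<le> D + D * C" using D C by simp
    fix \<epsilon> :: real and u v assume e: "0 < \<epsilon>" "\<epsilon> \<le> 1"
    have f: "\<bar>f \<epsilon> u\<bar> \<le> C" for u using C(2)[OF e] by simp
    show "norm (G (f \<epsilon> u)) \<le> D + D * C" using D(2)[OF f, of u] mult_nonneg_nonneg[of D C] D(1) C(1) by linarith
    have "norm (G (f \<epsilon> u) - G (f \<epsilon> v)) \<le> D * \<bar>f \<epsilon> u - f \<epsilon> v\<bar>" by (rule D(3)[OF f f])
    also have "\<dots> \<le> D * (C * norm (u - v))" using D C(3)[OF e, of u v] by (intro mult_left_mono) auto
    also have "\<dots> \<le> (D + D * C) * norm (u - v)" using D by (simp add: algebra_simps)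
    finally show "norm (G (f \<epsilon> u) - G (f \<epsilon> v)) \<le> (D + D * C) * norm (u - v)" .
  qed
qed

section \<open>Cutoff functions\<close>

definition ustep' :: "real \<Rightarrow> real" where
  "ustep' = (SOME g. (\<forall>x. (ustep has_real_derivative g x) (at x)) \<and> smoothR g)"

lemma ustep': "(ustep has_real_derivative ustep' x) (at x)" "smoothR ustep'"
proof -
  have "\<exists>g. (\<forall>x. (ustep has_real_derivative g x) (at x)) \<and> smoothR g"
    using smoothR_real_derivE[OF ustep(1)] by blast
  from someI_ex[OF this] show "(ustep has_real_derivative ustep' x) (at x)" "smoothR ustep'"
    by (simp_all add: ustep'_def)
qed

lemma ustep'_0: "x \<le> 0 \<or> x \<ge> 1 \<Longrightarrow> ustep' x = 0"
proof -
  have b: "0 \<le> ustep y" "ustep y \<le> 1" for y using step_bounds[of 0 1 y] by (simp_all add: step_def)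
  assume "x \<le> 0 \<or> x \<ge> 1"
  then show ?thesis
  proof
    assume "x \<le> 0"
    then show ?thesis using DERIV_local_min[OF ustep'(1) zero_less_one, of x] ustep(3)[of x] b by simp
  next
    assume "x \<ge> 1"
    then show ?thesis using DERIV_local_max[OF ustep'(1) zero_less_one, of x] ustep(4)[of x] b by simp
  qed
qed

definition step' :: "real \<Rightarrow> real \<Rightarrow> real \<Rightarrow> real" where
  "step' a b x = ustep' ((x - a) / (b - a)) / (b - a)"

lemma step_deriv: "(step a b has_real_derivative step' a b x) (at x)"
proof -
  have "((\<lambda>x. (x - a) / (b - a)) has_real_derivative 1 / (b - a)) (at x)"
    using DERIV_cdivide[OF DERIV_diff[OF DERIV_ident DERIV_const[of a]], where c = "b - a"] by simp
  from DERIV_chain2[OF ustep'(1) this] show ?thesis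
    unfolding step_def[abs_def] step'_def by simp
qed

lemma smoothR_step': "smoothR (step' a b)"
  unfolding step'_def by (intro smoothR_divide smoothR_compose[OF ustep'(2)] smoothR_diff) auto

lemma step'_0: "a < b \<Longrightarrow> x \<le> a \<or> x \<ge> b \<Longrightarrow> step' a b x = 0"
  unfolding step'_def by (subst ustep'_0) (auto simp: divide_nonpos_pos le_divide_eq)

definition rgam :: "real \<Rightarrow> real" where
  "rgam = (SOME \<gamma>. \<exists>\<gamma>' s0. smoothR \<gamma> \<and> (\<forall>s\<le>1. \<gamma> s = 1) \<and> (\<forall>s. 0 \<le> \<gamma> s \<and> \<gamma> s \<le> 1)
     \<and> s0 > 1 \<and> (\<forall>s\<ge>s0. \<gamma> s = 0)
     \<and> (\<forall>s. (\<gamma> has_real_derivative \<gamma>' s) (at s)) \<and> (\<forall>s\<ge>0. \<gamma>' s \<le> 0 \<and> -1 \<le> 2 * s * \<gamma>' s))"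

lemma rgam_ex: "\<exists>\<gamma>' s0. smoothR rgam \<and> (\<forall>s\<le>1. rgam s = 1) \<and> (\<forall>s. 0 \<le> rgam s \<and> rgam s \<le> 1)
     \<and> s0 > 1 \<and> (\<forall>s\<ge>s0. rgam s = 0)
     \<and> (\<forall>s. (rgam has_real_derivative \<gamma>' s) (at s)) \<and> (\<forall>s\<ge>0. \<gamma>' s \<le> 0 \<and> -1 \<le> 2 * s * \<gamma>' s)"
  unfolding rgam_def by (rule someI_ex[OF radial_cutoff_exists])

definition crad :: "real \<Rightarrow> 'a::real_inner \<Rightarrow> 'a" where
  "crad \<delta> v = rgam (inner v v / \<delta>\<^sup>2) *\<^sub>R v"

lemma crad_id: "\<delta> > 0 \<Longrightarrow> norm v \<le> \<delta> \<Longrightarrow> crad \<delta> v = v"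
proof -
  assume "\<delta> > 0" "norm v \<le> \<delta>"
  then have "inner v v \<le> \<delta>\<^sup>2" unfolding power2_norm_eq_inner[symmetric] by (intro power_mono) auto
  then have "inner v v / \<delta>\<^sup>2 \<le> 1" using \<open>\<delta> > 0\<close> by simp
  then show ?thesis using rgam_ex by (auto simp: crad_def)
qed

lemma crad_bounded: "\<exists>C>0. \<forall>\<delta> (v::'a::real_inner). \<delta> > 0 \<longrightarrow> norm (crad \<delta> v) \<le> C * \<delta>"
proof -
  obtain s0 where s0: "s0 > 1" "\<And>s. s \<ge> s0 \<Longrightarrow> rgam s = 0" "\<And>s. 0 \<le> rgam s \<and> rgam s \<le> 1" using rgam_ex by blast
  have "norm (crad \<delta> v) \<le> sqrt s0 * \<delta>" if d: "\<delta> > 0" for \<delta> and v :: 'a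
  proof (cases "inner v v / \<delta>\<^sup>2 \<ge> s0")
    case True then show ?thesis using s0 d by (simp add: crad_def)
  next
    case False
    then have "inner v v \<le> s0 * \<delta>\<^sup>2" using d by (simp add: not_le divide_less_eq)
    then have "norm v \<le> sqrt (s0 * \<delta>\<^sup>2)" unfolding norm_eq_sqrt_inner by (rule real_sqrt_le_mono)
    then have "norm v \<le> sqrt s0 * \<delta>" using d by (simp add: real_sqrt_mult)
    moreover have "rgam (inner v v / \<delta>\<^sup>2) * norm v \<le> 1 * norm v" using s0(3) by (intro mult_right_mono) auto
    ultimately show ?thesis using s0(3) by (simp add: crad_def)
  qed
  then show ?thesis using s0(1) by (intro exI[of _ "sqrt s0"]) auto
qed

text \<open>The derivative has the eigenvalue a = \<open>rgam\<close> on directions orthogonal to v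
  and a + 2 k |v|^2 along v, and the slow decay of \<open>rgam\<close> puts both into [-1, 1].
  Splitting by the sign of a + k |v|^2 in the formula for the squared norm avoids decomposing
  h.\<close>

lemma crad_lipschitz:
  fixes v w :: "'a::real_inner"
  assumes d: "\<delta> > 0"
  shows "norm (crad \<delta> v - crad \<delta> w) \<le> norm (v - w)"
proof -
  obtain \<gamma>' where g: "\<And>s. (rgam has_real_derivative \<gamma>' s) (at s)" "\<And>s. s \<ge> 0 \<Longrightarrow> \<gamma>' s \<le> 0 \<and> -1 \<le> 2 * s * \<gamma>' s"
    and b: "\<And>s. 0 \<le> rgam s \<and> rgam s \<le> 1" using rgam_ex by blast
  have "norm (crad \<delta> v - crad \<delta> w) \<le> 1 * norm (v - w)"
  proof (rule differentiable_bound[of UNIV _ "\<lambda>v h. rgam (inner v v / \<delta>\<^sup>2) *\<^sub>R h + (\<gamma>' (inner v v / \<delta>\<^sup>2) * (2 * inner v h / \<delta>\<^sup>2)) *\<^sub>R v"])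
    fix v :: 'a
    let ?s = "inner v v / \<delta>\<^sup>2"
    have s: "?s \<ge> 0" by simp
    have "((\<lambda>v. inner v v / \<delta>\<^sup>2) has_derivative (\<lambda>h. 2 * inner v h / \<delta>\<^sup>2)) (at v)"
    proof -
      have "((\<lambda>v. inner v v * (1 / \<delta>\<^sup>2)) has_derivative (\<lambda>h. (inner v h + inner h v) * (1 / \<delta>\<^sup>2))) (at v)"
        by (intro has_derivative_mult_left has_derivative_inner has_derivative_ident)
      moreover have "(\<lambda>h. (inner v h + inner h v) * (1 / \<delta>\<^sup>2)) = (\<lambda>h. 2 * inner v h / \<delta>\<^sup>2)"
        by (simp add: fun_eq_iff inner_commute)
      ultimately show ?thesis by simp
    qed
    from has_derivative_compose[OF this g(1)[unfolded has_field_derivative_def]]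
    have "((\<lambda>v. rgam (inner v v / \<delta>\<^sup>2)) has_derivative (\<lambda>h. \<gamma>' ?s * (2 * inner v h / \<delta>\<^sup>2))) (at v)" .
    from has_derivative_scaleR[OF this has_derivative_ident]
    show "(crad \<delta> has_derivative (\<lambda>h. rgam ?s *\<^sub>R h + (\<gamma>' ?s * (2 * inner v h / \<delta>\<^sup>2)) *\<^sub>R v)) (at v within UNIV)"
      unfolding crad_def[abs_def] by simp
    show "onorm (\<lambda>h. rgam ?s *\<^sub>R h + (\<gamma>' ?s * (2 * inner v h / \<delta>\<^sup>2)) *\<^sub>R v) \<le> 1"
    proof (rule onorm_bound)
      fix h :: 'a
      define a k where "a = rgam ?s" and "k = \<gamma>' ?s / \<delta>\<^sup>2"
      have a: "0 \<le> a" "a \<le> 1" using b by (auto simp: a_def)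
      have k: "k \<le> 0" "-1 \<le> 2 * (k * inner v v)" using g(2)[OF s] d by (auto simp: k_def divide_nonpos_pos mult_ac)
      have "(norm (a *\<^sub>R h + (2 * k * inner v h) *\<^sub>R v))\<^sup>2 = a\<^sup>2 * inner h h + 4 * k * (a + k * inner v v) * (inner v h)\<^sup>2"
        unfolding power2_norm_eq_inner by (simp add: inner_add_left inner_add_right inner_commute power2_eq_square algebra_simps)
      also have "\<dots> \<le> inner h h"
      proof (cases "a + k * inner v v \<ge> 0")
        case True
        then have "4 * k * (a + k * inner v v) \<le> 0" using mult_nonpos_nonneg[of "4 * k" "a + k * inner v v"] k True by simp
        then have "4 * k * (a + k * inner v v) * (inner v h)\<^sup>2 \<le> 0" by (rule mult_nonpos_nonneg) simp
        moreover have "a\<^sup>2 * inner h h \<le> 1 * inner h h" using a by (intro mult_right_mono power_le_one) auto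
        ultimately show ?thesis by simp
      next
        case False
        have cs: "(inner v h)\<^sup>2 \<le> inner v v * inner h h" by (rule Cauchy_Schwarz_ineq)
        have "0 \<le> 4 * k * (a + k * inner v v)" using k False by (simp add: mult_nonpos_nonpos)
        then have "4 * k * (a + k * inner v v) * (inner v h)\<^sup>2 \<le> 4 * k * (a + k * inner v v) * (inner v v * inner h h)"
          using cs by (intro mult_left_mono)
        then have "a\<^sup>2 * inner h h + 4 * k * (a + k * inner v v) * (inner v h)\<^sup>2 \<le> (a + 2 * (k * inner v v))\<^sup>2 * inner h h"
          by (simp add: power2_eq_square algebra_simps)
        also have "\<dots> \<le> 1 * inner h h"
        proof (rule mult_right_mono)
          have "k * inner v v \<le> 0" using k by (simp add: mult_nonpos_nonneg)
          then have "\<bar>a + 2 * (k * inner v v)\<bar> \<le> 1" using a k(2) by (auto simp: abs_le_iff)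
          then show "(a + 2 * (k * inner v v))\<^sup>2 \<le> 1" by (simp add: abs_square_le_1)
        qed simp
        finally show ?thesis by simp
      qed
      finally have "norm (a *\<^sub>R h + (2 * k * inner v h) *\<^sub>R v) \<le> norm h"
        unfolding power2_norm_eq_inner[symmetric] by (rule power2_le_imp_le) simp
      then show "norm (rgam ?s *\<^sub>R h + (\<gamma>' ?s * (2 * inner v h / \<delta>\<^sup>2)) *\<^sub>R v) \<le> 1 * norm h"
        by (simp add: a_def k_def mult_ac)
    qed simp
  qed auto
  then show ?thesis by simp
qed

lemma cutoff_lipschitz: "\<bar>cutoff x - cutoff y\<bar> \<le> \<bar>x - y\<bar>"
  using cutoff(4)[of x y] cutoff(4)[of y x] by (cases "x \<le> y") auto

lemma cutoff_quotient: "\<exists>\<tau>. 0 \<le> \<tau> \<and> \<tau> \<le> 1 \<and> cutoff x - cutoff y = \<tau> * (x - y)"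
proof (cases "x = y")
  case False
  have "0 \<le> (cutoff x - cutoff y) / (x - y)" "(cutoff x - cutoff y) / (x - y) \<le> 1"
    using cutoff(4)[of x y] cutoff(4)[of y x] False
    by (cases "x \<le> y"; auto simp: divide_le_eq zero_le_divide_iff not_le)+
  then show ?thesis using False by (intro exI[of _ "(cutoff x - cutoff y) / (x - y)"]) auto
qed (intro exI[of _ 0]; simp)

section \<open>Windows of the mechanisms and the planar field\<close>

definition chi3 :: "real \<Rightarrow> real" where "chi3 = step (1/5) (2/5)"
definition chir :: "real \<Rightarrow> real" where "chir = step (1/2) (3/5)"
definition al :: "real \<Rightarrow> real" where "al = step (1/4) (1/2)"
text \<open>As p grows along the corridor, the windows follow one another: the kick in (1/10, 1/5),
  the damping of \<open>e 1\<close> switched on in (1/5, 3/10), the exchange of \<open>e 1\<close>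
  with \<open>f 0\<close> in (3/10, 2/5), the damping switched off in (2/5, 1/2).\<close>

definition ap :: "real \<Rightarrow> real" where "ap p = step (1/5) (3/10) p * (1 - step (2/5) (1/2) p)"
definition Sp :: "real \<Rightarrow> real" where "Sp p = pi / 2 * step (3/10) (2/5) p"
definition Sp' :: "real \<Rightarrow> real" where "Sp' p = pi / 2 * step' (3/10) (2/5) p"
text \<open>In the upper half plane p decreases through [-1/8, 1/8], in the lower one it increases;
  so \<open>Su\<close> there and \<open>Sl\<close> here both run from 0 to pi/2 along the
  orbit.\<close>

definition Su :: "real \<Rightarrow> real" where "Su p = pi / 2 * (1 - step (-1/8) (1/8) p)"
definition Su' :: "real \<Rightarrow> real" where "Su' p = - (pi / 2 * step' (-1/8) (1/8) p)"
definition Sl :: "real \<Rightarrow> real" where "Sl p = pi / 2 * step (-1/8) (1/8) p"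
definition Sl' :: "real \<Rightarrow> real" where "Sl' p = pi / 2 * step' (-1/8) (1/8) p"
definition chq :: "real \<Rightarrow> real" where "chq q = step (-1/4) (-1/8) q * step (-1/4) (-1/8) (- q)"
definition chk :: "real \<Rightarrow> real" where "chk p = bump (20 * (p - 3/20))"

lemma smoothR_cutoffs:
  "smoothR chi3" "smoothR chir" "smoothR al" "smoothR ap" "smoothR Sp'" "smoothR Su'" "smoothR Sl'" "smoothR chq" "smoothR chk"
  unfolding chi3_def chir_def al_def ap_def[abs_def] Sp'_def[abs_def] Su'_def[abs_def] Sl'_def[abs_def] chq_def[abs_def] chk_def[abs_def]
  by (intro smoothR_step smoothR_mult smoothR_diff smoothR_minus smoothR_step' smoothR_const smoothR_ident
      smoothR_compose[OF smoothR_step] smoothR_compose[OF smoothR_bump])+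

lemma S_derivs: "(Sp has_real_derivative Sp' x) (at x)" "(Su has_real_derivative Su' x) (at x)" "(Sl has_real_derivative Sl' x) (at x)"
  unfolding Sp_def[abs_def] Sp'_def Su_def[abs_def] Su'_def Sl_def[abs_def] Sl'_def
  by (auto intro!: derivative_eq_intros step_deriv)

text \<open>Where P^2 + Q^2 \<le> 1/5, the field is (P (1 - P^2), 0): Q is a free parameter that the
  motion of P does not see. Where P^2 + Q^2 \<ge> 2/5, it is the radial field r (1 - r^2) plus a
  rotation that fades in between 1/2 and 3/5 and then has speed 1.\<close>

definition fG0 :: "real \<Rightarrow> real \<Rightarrow> real" where
  "fG0 P Q = P * (1 - P\<^sup>2) - chi3 (P\<^sup>2 + Q\<^sup>2) * (P * Q\<^sup>2) - chir (P\<^sup>2 + Q\<^sup>2) * Q"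
definition fG1 :: "real \<Rightarrow> real \<Rightarrow> real" where
  "fG1 P Q = chi3 (P\<^sup>2 + Q\<^sup>2) * (Q * (1 - (P\<^sup>2 + Q\<^sup>2))) + chir (P\<^sup>2 + Q\<^sup>2) * P"
text \<open>The velocity, up to \<epsilon>, of the exchange angle: \<open>Sp'\<close> times the
  corridor speed P (1 - P^2), and likewise below with \<open>Su'\<close>, \<open>Sl'\<close> and
  \<open>fG0\<close>. Thus the accumulated angle is a function of P, exactly pi/2 after the
  passage.\<close>

definition betap :: "real \<Rightarrow> real \<Rightarrow> real" where
  "betap P Q = Sp' P * (P * (1 - P\<^sup>2)) * chq Q"
definition beta1 :: "real \<Rightarrow> real \<Rightarrow> real" where
  "beta1 P Q = al Q * Su' P * fG0 P Q"
definition beta2 :: "real \<Rightarrow> real \<Rightarrow> real" where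
  "beta2 P Q = al (- Q) * Sl' P * fG0 P Q"

lemmas UBL_intros = UBL_add UBL_diff UBL_mult UBL_scaleR UBL_inner UBL_minus UBL_const UBL_power2
  UBL_compose[OF smoothR_cutoffs(1)] UBL_compose[OF smoothR_cutoffs(2)] UBL_compose[OF smoothR_cutoffs(3)]
  UBL_compose[OF smoothR_cutoffs(4)] UBL_compose[OF smoothR_cutoffs(5)] UBL_compose[OF smoothR_cutoffs(6)]
  UBL_compose[OF smoothR_cutoffs(7)] UBL_compose[OF smoothR_cutoffs(8)] UBL_compose[OF smoothR_cutoffs(9)]

lemma Csmooth_power2:
  fixes f :: "'a::real_normed_vector \<Rightarrow> real"
  shows "Csmooth f \<Longrightarrow> Csmooth (\<lambda>u. (f u)\<^sup>2)"
  unfolding power2_eq_square by (rule Csmooth_mult)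

lemmas Csmooth_intros = Csmooth_add Csmooth_diff Csmooth_mult Csmooth_scaleR Csmooth_inner Csmooth_minus Csmooth_const Csmooth_power2
  Csmooth_compose[OF smoothR_cutoffs(1)] Csmooth_compose[OF smoothR_cutoffs(2)] Csmooth_compose[OF smoothR_cutoffs(3)]
  Csmooth_compose[OF smoothR_cutoffs(4)] Csmooth_compose[OF smoothR_cutoffs(5)] Csmooth_compose[OF smoothR_cutoffs(6)]
  Csmooth_compose[OF smoothR_cutoffs(7)] Csmooth_compose[OF smoothR_cutoffs(8)] Csmooth_compose[OF smoothR_cutoffs(9)]

section \<open>The nonlinearity\<close>

text \<open>The two matchings of the chain. The second leaves 0 fixed, which makes it the turning
  point of descending modes. The signs \<open>\<zeta>1\<close> and \<open>\<zeta>2\<close> make the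
  exchanges antisymmetric, hence rotations.\<close>

definition \<sigma>1 :: "nat \<Rightarrow> nat" where "\<sigma>1 j = (if even j then j + 1 else j - 1)"
definition \<sigma>2 :: "nat \<Rightarrow> nat" where "\<sigma>2 j = (if j = 0 then 0 else if odd j then j + 1 else j - 1)"
definition \<zeta>1 :: "nat \<Rightarrow> real" where "\<zeta>1 j = (if even j then -1 else 1)"
definition \<zeta>2 :: "nat \<Rightarrow> real" where "\<zeta>2 j = (if j = 0 then 0 else if odd j then -1 else 1)"

lemma \<sigma>_invol: "\<sigma>1 (\<sigma>1 j) = j" "\<sigma>2 (\<sigma>2 j) = j"
  by (auto simp: \<sigma>1_def \<sigma>2_def elim!: oddE evenE)

lemma inj_\<sigma>: "inj \<sigma>1" "inj \<sigma>2"
  by (metis \<sigma>_invol injI)+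

lemma \<zeta>_bound: "\<bar>\<zeta>1 j\<bar> \<le> 1" "\<bar>\<zeta>2 j\<bar> \<le> 1"
  by (auto simp: \<zeta>1_def \<zeta>2_def)

text \<open>\<open>c 0 = 2\<close> because modes 0 and 1 carry the plane. \<open>L1\<close> is the
  Lipschitz cost of the fast part; the final constant exceeds it by terms that can be made
  small.\<close>

locale design = spectral +
  fixes c :: "nat \<Rightarrow> nat" and G g0 L1 :: real
  assumes c_mono: "strict_mono c" and c_0: "c 0 = 2"
    and gap_le: "lam (c (Suc j)) - lam (c j) \<le> G" and gap_ge: "g0 \<le> lam (c (Suc j)) - lam (c j)"
    and g0_pos: "g0 > 0" and gap_first: "lam 2 - lam 1 \<le> G" and lam1_le: "lam 1 \<le> L1" and G_le: "G / 2 \<le> L1"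
begin

abbreviation "f j \<equiv> e (c j)"
abbreviation "mu j \<equiv> lam (c j)"

lemma c_ge: "c j \<ge> 2" "c j \<noteq> 0" "c j \<noteq> Suc 0"
  using c_mono c_0 strict_mono_less_eq[of c 0 j] by auto

lemma c_inj: "c i = c j \<longleftrightarrow> i = j"
  using c_mono strict_mono_eq by blast

sublocale ch: ons "\<lambda>j. e (c j)"
  by unfold_locales (simp add: on c_inj)

definition m1 :: "nat \<Rightarrow> real" where "m1 j = (mu j + mu (\<sigma>1 j)) / 2"
text \<open>At j = 0 the partner is \<open>e 1\<close> rather than a chain mode: in the corridor
  \<open>e 1\<close> and \<open>f 0\<close> are given this common rate, so the parameter passes over
  by a pure rotation.\<close>

definition m2 :: "nat \<Rightarrow> real" where "m2 j = (if j = 0 then (lam 1 + mu 0) / 2 else (mu j + mu (\<sigma>2 j)) / 2)"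

lemma m_\<sigma>: "m1 (\<sigma>1 j) = m1 j" "m2 (\<sigma>2 j) = m2 j"
  by (auto simp: m1_def m2_def \<sigma>_invol add.commute) (auto simp: \<sigma>2_def split: if_splits)

lemma gap_abs: "\<bar>mu (Suc j) - mu j\<bar> \<le> G"
  using gap_le[of j] gap_ge[of j] g0_pos by auto

lemma G_pos: "G > 0"
  using gap_le[of 0] gap_ge[of 0] g0_pos by linarith

lemma m_near: "\<bar>mu j - m1 j\<bar> \<le> G / 2" "\<bar>mu j - m2 j\<bar> \<le> G / 2"
proof -
  have a: "\<bar>mu j - mu (\<sigma>1 j)\<bar> \<le> G"
    using gap_abs[of j] gap_abs[of "j - 1"] by (cases j) (auto simp: \<sigma>1_def abs_minus_commute)
  then show "\<bar>mu j - m1 j\<bar> \<le> G / 2" by (simp add: m1_def abs_le_iff field_simps)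
  have b: "\<bar>mu j - mu (\<sigma>2 j)\<bar> \<le> G" if "j \<noteq> 0"
    using gap_abs[of j] gap_abs[of "j - 1"] that by (cases j) (auto simp: \<sigma>2_def abs_minus_commute)
  have "lam 1 \<le> lam 2" using monoD[OF lam_mono, of 1 2] by simp
  then show "\<bar>mu j - m2 j\<bar> \<le> G / 2" using b gap_first c_0 by (auto simp: m2_def abs_le_iff field_simps)
qed

lemma m_pos: "m1 j > 0" "m2 j > 0"
  using lam_ge(2)[of "c j"] lam_ge(2)[of "c (\<sigma>1 j)"] lam_ge(2)[of "c (\<sigma>2 j)"] lam_ge(2)[of 1] lam_ge(2)[of "c 0"] by (auto simp: m1_def m2_def)

definition pr :: "'a \<Rightarrow> 'a" where "pr = wperm (\<lambda>j. e (c j)) (\<lambda>_. 1) id"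
definition D1 :: "'a \<Rightarrow> 'a" where "D1 = wperm (\<lambda>j. e (c j)) (\<lambda>j. mu j - m1 j) id"
definition D2 :: "'a \<Rightarrow> 'a" where "D2 = wperm (\<lambda>j. e (c j)) (\<lambda>j. mu j - m2 j) id"
definition J1 :: "'a \<Rightarrow> 'a" where "J1 = wperm (\<lambda>j. e (c j)) \<zeta>1 \<sigma>1"
definition J2 :: "'a \<Rightarrow> 'a" where "J2 = wperm (\<lambda>j. e (c j)) \<zeta>2 \<sigma>2"

lemmas ops = pr_def D1_def D2_def J1_def J2_def

lemma bl_ops: "bounded_linear pr" "bounded_linear D1" "bounded_linear D2" "bounded_linear J1" "bounded_linear J2"
  unfolding ops
  by (rule ch.wperm_bounded_linear[of _ 1], simp, simp,
      rule ch.wperm_bounded_linear[of _ "G / 2"], rule m_near, simp,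
      rule ch.wperm_bounded_linear[of _ "G / 2"], rule m_near, simp,
      rule ch.wperm_bounded_linear[of _ 1], rule \<zeta>_bound, rule inj_\<sigma>,
      rule ch.wperm_bounded_linear[of _ 1], rule \<zeta>_bound, rule inj_\<sigma>)

lemma coord_ops:
  "inner (pr u) (f j) = inner u (f j)" "inner (D1 u) (f j) = (mu j - m1 j) * inner u (f j)"
  "inner (D2 u) (f j) = (mu j - m2 j) * inner u (f j)" "inner (J1 u) (f j) = \<zeta>1 j * inner u (f (\<sigma>1 j))"
  "inner (J2 u) (f j) = \<zeta>2 j * inner u (f (\<sigma>2 j))"
  unfolding ops
  using ch.wperm_coord[of "\<lambda>_. 1" 1 id u j] ch.wperm_coord[of "\<lambda>j. mu j - m1 j" "G / 2" id u j, OF m_near(1)]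
    ch.wperm_coord[of "\<lambda>j. mu j - m2 j" "G / 2" id u j, OF m_near(2)]
    ch.wperm_coord[of \<zeta>1 1 \<sigma>1 u j, OF \<zeta>_bound(1) inj_\<sigma>(1)] ch.wperm_coord[of \<zeta>2 1 \<sigma>2 u j, OF \<zeta>_bound(2) inj_\<sigma>(2)]
  by simp_all

lemma off_ops:
  assumes "k \<notin> range c"
  shows "inner (pr u) (e k) = 0" "inner (D1 u) (e k) = 0" "inner (D2 u) (e k) = 0" "inner (J1 u) (e k) = 0" "inner (J2 u) (e k) = 0"
proof -
  have o: "inner (f j) (e k) = 0" for j using assms by (auto simp: on)
  show "inner (pr u) (e k) = 0" unfolding ops by (rule ch.wperm_orth[of _ 1]) (auto simp: o)
  show "inner (D1 u) (e k) = 0" unfolding ops by (rule ch.wperm_orth[OF m_near(1)]) (auto simp: o)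
  show "inner (D2 u) (e k) = 0" unfolding ops by (rule ch.wperm_orth[OF m_near(2)]) (auto simp: o)
  show "inner (J1 u) (e k) = 0" unfolding ops by (rule ch.wperm_orth[OF \<zeta>_bound(1) inj_\<sigma>(1)]) (auto simp: o)
  show "inner (J2 u) (e k) = 0" unfolding ops by (rule ch.wperm_orth[OF \<zeta>_bound(2) inj_\<sigma>(2)]) (auto simp: o)
qed

lemma not_range_c: "0 \<notin> range c" "Suc 0 \<notin> range c"
  using c_ge by (metis rangeE)+

lemma norm_e: "norm (e k) = 1"
  by (simp add: norm_eq_sqrt_inner on)

lemma D_mix_norm:
  assumes "0 \<le> a" "a \<le> 1"
  shows "norm (a *\<^sub>R D1 w + (1 - a) *\<^sub>R D2 w) \<le> L1 * norm w"
proof -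
  have b: "\<bar>a * (mu j - m1 j) + (1 - a) * (mu j - m2 j)\<bar> \<le> G / 2" for j
  proof -
    have "\<bar>a * (mu j - m1 j) + (1 - a) * (mu j - m2 j)\<bar> \<le> a * \<bar>mu j - m1 j\<bar> + (1 - a) * \<bar>mu j - m2 j\<bar>"
      using assms abs_triangle_ineq[of "a * (mu j - m1 j)" "(1 - a) * (mu j - m2 j)"] by (simp add: abs_mult)
    also have "\<dots> \<le> a * (G / 2) + (1 - a) * (G / 2)" using assms m_near[of j] by (intro add_mono mult_left_mono) auto
    also have "\<dots> = G / 2" using distrib_right[of a "1 - a" "G / 2"] by simp
    finally show ?thesis .
  qed
  have "a *\<^sub>R D1 w + (1 - a) *\<^sub>R D2 w = wperm (\<lambda>j. e (c j)) (\<lambda>j. a * (mu j - m1 j) + (1 - a) * (mu j - m2 j)) id w"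
    unfolding ops using ch.wperm_lincomb[OF m_near(1) m_near(2), where \<sigma> = id and a = a and b = "1 - a" and u = w] by simp
  then have "norm (a *\<^sub>R D1 w + (1 - a) *\<^sub>R D2 w) \<le> (G / 2) * norm w"
    using ch.wperm_norm[OF b, where \<sigma> = id and u = w] by simp
  also have "\<dots> \<le> L1 * norm w" by (intro mult_right_mono G_le) simp
  finally show ?thesis .
qed

lemma norm_split: "(inner u (e 0))\<^sup>2 + (inner u (e 1))\<^sup>2 + (norm (pr u))\<^sup>2 \<le> (norm u)\<^sup>2"
proof -
  have n1: "Suc 0 \<notin> range c" "0 \<notin> range c" using not_range_c by auto
  have pp: "inner u (pr u) = inner (pr u) (pr u)"
  proof -
    have "inner (u - pr u) (pr v) = 0" for v
      using ch.wperm_orth[of "\<lambda>_. 1" 1 id "u - pr u" v] by (simp add: pr_def[symmetric] inner_commute inner_diff_left inner_diff_right coord_ops(1)[of u, unfolded inner_commute[of _ "f _"]] )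
    then show ?thesis by (simp add: inner_diff_left)
  qed
  define r where "r = u - inner u (e 0) *\<^sub>R e 0 - inner u (e 1) *\<^sub>R e 1 - pr u"
  have z: "inner (e 0) (pr u) = 0" "inner (e 1) (pr u) = 0" "inner (pr u) (e 0) = 0" "inner (pr u) (e 1) = 0"
    using off_ops(1)[OF n1(1), of u] off_ops(1)[OF n1(2), of u] by (simp_all add: inner_commute[of "e _" "pr u"])
  have "0 \<le> inner r r" by simp
  also have "inner r r = (norm u)\<^sup>2 - (inner u (e 0))\<^sup>2 - (inner u (e 1))\<^sup>2 - (norm (pr u))\<^sup>2"
    unfolding r_def power2_norm_eq_inner
    by (simp add: inner_diff_left inner_diff_right on z[unfolded One_nat_def] pp inner_commute[of "pr u" u] inner_commute[of "e _" u] power2_eq_square)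
  finally show ?thesis by simp
qed

definition Pc :: "'a \<Rightarrow> real" where "Pc u = cutoff (inner u (e 0))"
definition Qc :: "'a \<Rightarrow> real" where "Qc u = cutoff (inner u (e 1))"
definition hd\<^sub>c :: "real \<Rightarrow> 'a \<Rightarrow> real" where "hd\<^sub>c \<epsilon> u = \<epsilon> * cutoff (Qc u / \<epsilon>)"
text \<open>Truncation at the scale \<epsilon>, as in \<open>hd\<^sub>c\<close>: in
  \<open>EE\<close> these quantities are multiplied by windows in P and Q, and the derivatives of
  the windows then cost only O(\<epsilon>). Wherever such a term acts on the orbits of interest, the
  truncation is inactive.\<close>

definition Wc :: "real \<Rightarrow> 'a \<Rightarrow> 'a" where "Wc \<epsilon> u = crad \<epsilon> (pr u)"

text \<open>\<open>EE\<close> cancels \<open>lam 0\<close> and \<open>lam 1\<close>, shifts the chain to the rates \<open>m1\<close> (upper half turns) or \<open>m2\<close>, and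
  inside the corridor gives \<open>e 1\<close> the rate \<open>m2 0\<close> of \<open>f 0\<close>. The slow part \<open>RR\<close> contains the planar field, the exchange \<open>betap\<close>
  of \<open>e 1\<close> with \<open>f 0\<close> at the end of the corridor, and the exchanges \<open>beta1\<close>, \<open>beta2\<close> of chain modes.\<close>

definition RR :: "real \<Rightarrow> 'a \<Rightarrow> 'a" where
  "RR \<epsilon> u = fG0 (Pc u) (Qc u) *\<^sub>R e 0 + (fG1 (Pc u) (Qc u) - betap (Pc u) (Qc u) * inner (Wc \<epsilon> u) (f 0)) *\<^sub>R e 1
     + beta1 (Pc u) (Qc u) *\<^sub>R J1 (Wc \<epsilon> u) + beta2 (Pc u) (Qc u) *\<^sub>R J2 (Wc \<epsilon> u)
     + (betap (Pc u) (Qc u) * hd\<^sub>c \<epsilon> u) *\<^sub>R f 0"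

definition EE :: "real \<Rightarrow> 'a \<Rightarrow> 'a" where
  "EE \<epsilon> u = (lam 0 * Pc u) *\<^sub>R e 0 + (lam 1 * Qc u - m2 0 * (ap (Pc u) * chq (Qc u)) * hd\<^sub>c \<epsilon> u) *\<^sub>R e 1
     + (al (Qc u) *\<^sub>R D1 (Wc \<epsilon> u) + (1 - al (Qc u)) *\<^sub>R D2 (Wc \<epsilon> u))"

definition F0 :: "real \<Rightarrow> 'a \<Rightarrow> 'a" where "F0 \<epsilon> u = EE \<epsilon> u + \<epsilon> *\<^sub>R RR \<epsilon> u"

lemma coord_lip: "\<bar>inner u (e k) - inner v (e k)\<bar> \<le> norm (u - v)"
  using Cauchy_Schwarz_ineq2[of "u - v" "e k"] by (simp add: inner_diff_left norm_e)

lemma PQ_lip: "\<bar>Pc u - Pc v\<bar> \<le> \<bar>inner (u - v) (e 0)\<bar>" "\<bar>Qc u - Qc v\<bar> \<le> \<bar>inner (u - v) (e 1)\<bar>"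
  unfolding Pc_def Qc_def inner_diff_left by (rule cutoff_lipschitz)+

lemma PQ_lip2: "norm (Pc u - Pc v) \<le> 2 * norm (u - v)" "norm (Qc u - Qc v) \<le> 2 * norm (u - v)"
  using PQ_lip[of u v] coord_lip[of u 0 v] coord_lip[of u 1 v] norm_ge_zero[of "u - v"]
  unfolding inner_diff_left real_norm_def by linarith+

lemma UBL_PQ: "UBL (\<lambda>\<epsilon>. Pc)" "UBL (\<lambda>\<epsilon>. Qc)"
  by (rule UBLI[of 2], use cutoff(3) PQ_lip2 in \<open>simp_all add: Pc_def Qc_def\<close>)+

lemma hd_lip: "\<epsilon> > 0 \<Longrightarrow> \<exists>\<tau>. 0 \<le> \<tau> \<and> \<tau> \<le> 1 \<and> hd\<^sub>c \<epsilon> u - hd\<^sub>c \<epsilon> v = \<tau> * (Qc u - Qc v)"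
proof -
  assume e: "\<epsilon> > 0"
  obtain \<tau> where t: "0 \<le> \<tau>" "\<tau> \<le> 1" "cutoff (Qc u / \<epsilon>) - cutoff (Qc v / \<epsilon>) = \<tau> * (Qc u / \<epsilon> - Qc v / \<epsilon>)"
    using cutoff_quotient by blast
  have "hd\<^sub>c \<epsilon> u - hd\<^sub>c \<epsilon> v = \<epsilon> * (\<tau> * (Qc u / \<epsilon> - Qc v / \<epsilon>))"
    unfolding t(3)[symmetric] by (simp add: hd\<^sub>c_def right_diff_distrib)
  also have "\<dots> = \<tau> * (Qc u - Qc v)" using e by (simp add: right_diff_distrib)
  finally show ?thesis using t by blast
qed

lemma hd_bound: "\<epsilon> > 0 \<Longrightarrow> \<bar>hd\<^sub>c \<epsilon> u\<bar> \<le> 2 * \<epsilon>"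
  using cutoff(3)[of "Qc u / \<epsilon>"] by (simp add: hd\<^sub>c_def abs_mult)

lemma UBL_hd: "UBL hd\<^sub>c"
proof (rule UBLI[of 2])
  fix \<epsilon> :: real and u v :: 'a assume e: "0 < \<epsilon>" "\<epsilon> \<le> 1"
  show "norm (hd\<^sub>c \<epsilon> u) \<le> 2" using hd_bound[OF e(1), of u] e by simp
  obtain \<tau> where t: "0 \<le> \<tau>" "\<tau> \<le> 1" "hd\<^sub>c \<epsilon> u - hd\<^sub>c \<epsilon> v = \<tau> * (Qc u - Qc v)" using hd_lip[OF e(1)] by blast
  have "\<tau> * \<bar>Qc u - Qc v\<bar> \<le> 1 * norm (u - v)"
    using t PQ_lip(2)[of u v] coord_lip[of u 1 v] by (intro mult_mono) (auto simp: inner_diff_left)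
  moreover have "norm (hd\<^sub>c \<epsilon> u - hd\<^sub>c \<epsilon> v) = \<tau> * \<bar>Qc u - Qc v\<bar>" using t by (simp add: abs_mult)
  ultimately show "norm (hd\<^sub>c \<epsilon> u - hd\<^sub>c \<epsilon> v) \<le> 2 * norm (u - v)" using norm_ge_zero[of "u - v"] by linarith
qed simp

lemma pr_le: "norm (pr u) \<le> norm u"
  unfolding pr_def using ch.wperm_norm[of "\<lambda>_. 1" 1 id u] by simp

lemma W_lip: "\<epsilon> > 0 \<Longrightarrow> norm (Wc \<epsilon> u - Wc \<epsilon> v) \<le> norm (pr (u - v))"
  unfolding Wc_def using crad_lipschitz[of \<epsilon> "pr u" "pr v"] linear_diff[OF bounded_linear.linear[OF bl_ops(1)], of u v] by simp

lemma W_bound: "\<exists>C>0. \<forall>\<epsilon>>0. \<forall>u. norm (Wc \<epsilon> u) \<le> C * \<epsilon>"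
  unfolding Wc_def using crad_bounded by blast

lemma UBL_W: "UBL Wc"
proof -
  obtain C where C: "C > 0" "\<And>\<epsilon> u. \<epsilon> > 0 \<Longrightarrow> norm (Wc \<epsilon> u) \<le> C * \<epsilon>" using W_bound by blast
  show ?thesis
  proof (rule UBLI[of "C + 1"])
    fix \<epsilon> :: real and u v :: 'a assume e: "0 < \<epsilon>" "\<epsilon> \<le> 1"
    have "C * \<epsilon> \<le> C * 1" using C e by (intro mult_left_mono) auto
    then show "norm (Wc \<epsilon> u) \<le> C + 1" using C(2)[OF e(1), of u] by simp
    have "norm (Wc \<epsilon> u - Wc \<epsilon> v) \<le> 1 * norm (u - v)" using order_trans[OF W_lip[OF e(1)] pr_le] by simp
    also have "\<dots> \<le> (C + 1) * norm (u - v)" using C by (intro mult_right_mono) auto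
    finally show "norm (Wc \<epsilon> u - Wc \<epsilon> v) \<le> (C + 1) * norm (u - v)" .
  qed (use C in auto)
qed

lemmas UBL_base = UBL_PQ UBL_hd UBL_W
  UBL_bounded_linear[OF bl_ops(2)] UBL_bounded_linear[OF bl_ops(3)] UBL_bounded_linear[OF bl_ops(4)] UBL_bounded_linear[OF bl_ops(5)]

lemma UBL_RR: "UBL RR"
  unfolding RR_def[abs_def] fG0_def fG1_def betap_def beta1_def beta2_def
  by (intro UBL_intros UBL_base)

lemma UBL_EE: "UBL EE"
  unfolding EE_def[abs_def] by (intro UBL_intros UBL_base)

lemma Csmooth_PQ: "Csmooth Pc" "Csmooth Qc"
  unfolding Pc_def[abs_def] Qc_def[abs_def]
  by (intro Csmooth_compose[OF cutoff(1)] Csmooth_linear bounded_linear_inner_left)+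

lemma Csmooth_hd: "\<epsilon> > 0 \<Longrightarrow> Csmooth (hd\<^sub>c \<epsilon>)"
  unfolding hd\<^sub>c_def[abs_def] divide_inverse
  by (intro Csmooth_intros Csmooth_compose[OF cutoff(1)] Csmooth_PQ)

lemma Csmooth_W: "Csmooth (Wc \<epsilon>)"
proof -
  have "smoothR rgam" using rgam_ex by blast
  then show ?thesis
    unfolding Wc_def[abs_def] crad_def divide_inverse
    by (intro Csmooth_intros Csmooth_compose[of rgam] Csmooth_linear bl_ops(1))
qed

lemma Csmooth_F0: "\<epsilon> > 0 \<Longrightarrow> Csmooth (F0 \<epsilon>)"
  unfolding F0_def[abs_def] EE_def RR_def fG0_def fG1_def betap_def beta1_def beta2_def
  by (intro Csmooth_intros Csmooth_PQ Csmooth_hd Csmooth_W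
    Csmooth_bounded_linear_comp[OF bl_ops(2)] Csmooth_bounded_linear_comp[OF bl_ops(3)]
    Csmooth_bounded_linear_comp[OF bl_ops(4)] Csmooth_bounded_linear_comp[OF bl_ops(5)])

text \<open>The difference splits into X, with the windows frozen at u, and Z1, Z2, where they vary.
  X is block diagonal for the orthogonal splitting into \<open>e 0\<close>, \<open>e 1\<close> and
  the chain, so each block may use the full constant L1. Z1 and Z2 contain truncated factors of size
  O(\<epsilon>).\<close>

lemma lip_EE:
  "\<exists>C\<ge>0. \<forall>\<epsilon> u v. 0 < \<epsilon> \<longrightarrow> \<epsilon> \<le> 1 \<longrightarrow> norm (EE \<epsilon> u - EE \<epsilon> v) \<le> (L1 + C * \<epsilon>) * norm (u - v)"
proof -
  have L1: "L1 > 0" using G_le G_pos by simp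
  define AA where "AA u = ap (Pc u) * chq (Qc u)" for u
  have AA01: "0 \<le> AA u \<and> AA u \<le> 1" for u
    unfolding AA_def ap_def chq_def using step_bounds by (auto intro!: mult_le_one mult_nonneg_nonneg)
  have al01: "0 \<le> al q \<and> al q \<le> 1" for q unfolding al_def using step_bounds by simp
  have "UBL (\<lambda>\<epsilon>. AA)" unfolding AA_def[abs_def] by (intro UBL_intros UBL_base)
  then obtain CA where CA: "CA \<ge> 0" "\<And>\<epsilon> u v. 0 < \<epsilon> \<Longrightarrow> \<epsilon> \<le> (1::real) \<Longrightarrow> norm (AA u - AA v) \<le> CA * norm (u - v)"
    by (rule UBLE) auto
  have "UBL (\<lambda>\<epsilon> u. al (Qc u))" by (intro UBL_intros UBL_base)
  then obtain Ca where Ca: "Ca \<ge> 0" "\<And>\<epsilon> u v. 0 < \<epsilon> \<Longrightarrow> \<epsilon> \<le> (1::real) \<Longrightarrow> norm (al (Qc u) - al (Qc v)) \<le> Ca * norm (u - v)"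
    by (rule UBLE) auto
  obtain CW where CW: "CW > 0" "\<And>\<epsilon> u. \<epsilon> > 0 \<Longrightarrow> norm (Wc \<epsilon> u) \<le> CW * \<epsilon>" using W_bound by blast
  define C where "C = m2 0 * CA * 2 + Ca * (2 * L1 * CW)"
  have C0: "C \<ge> 0" using CA(1) Ca(1) CW(1) L1 m_pos(2)[of 0] by (simp add: C_def)
  have "norm (EE \<epsilon> u - EE \<epsilon> v) \<le> (L1 + C * \<epsilon>) * norm (u - v)" if e: "0 < \<epsilon>" "\<epsilon> \<le> 1" for \<epsilon> u v
  proof -
    obtain \<tau> where t: "0 \<le> \<tau>" "\<tau> \<le> 1" "hd\<^sub>c \<epsilon> u - hd\<^sub>c \<epsilon> v = \<tau> * (Qc u - Qc v)" using hd_lip[OF e(1)] by blast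
    define dW where "dW = Wc \<epsilon> u - Wc \<epsilon> v"
    define a where "a = al (Qc u)"
    define x where "x = lam 0 * (Pc u - Pc v)"
    define y where "y = (lam 1 - m2 0 * (AA u * \<tau>)) * (Qc u - Qc v)"
    define z where "z = a *\<^sub>R D1 dW + (1 - a) *\<^sub>R D2 dW"
    define X where "X = x *\<^sub>R e 0 + y *\<^sub>R e 1 + z"
    define Z1 where "Z1 = - (m2 0 * (AA u - AA v) * hd\<^sub>c \<epsilon> v)"
    define Z2 where "Z2 = (al (Qc u) - al (Qc v)) *\<^sub>R (D1 (Wc \<epsilon> v) - D2 (Wc \<epsilon> v))"
    note lin = bounded_linear.linear[OF bl_ops(2)] bounded_linear.linear[OF bl_ops(3)]
    have eq: "EE \<epsilon> u - EE \<epsilon> v = X + Z1 *\<^sub>R e 1 + Z2"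
    proof -
      have q: "y + Z1 = (lam 1 * Qc u - m2 0 * AA u * hd\<^sub>c \<epsilon> u) - (lam 1 * Qc v - m2 0 * AA v * hd\<^sub>c \<epsilon> v)"
      proof -
        have "y = lam 1 * (Qc u - Qc v) - m2 0 * AA u * (\<tau> * (Qc u - Qc v))" by (simp add: y_def algebra_simps)
        then show ?thesis unfolding t(3)[symmetric] Z1_def by (simp add: algebra_simps)
      qed
      have w: "z + Z2 = (al (Qc u) *\<^sub>R D1 (Wc \<epsilon> u) + (1 - al (Qc u)) *\<^sub>R D2 (Wc \<epsilon> u)) - (al (Qc v) *\<^sub>R D1 (Wc \<epsilon> v) + (1 - al (Qc v)) *\<^sub>R D2 (Wc \<epsilon> v))"
        unfolding z_def Z2_def dW_def a_def linear_diff[OF lin(1)] linear_diff[OF lin(2)] by (simp add: algebra_simps)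
      have "X + Z1 *\<^sub>R e 1 + Z2 = x *\<^sub>R e 0 + (y + Z1) *\<^sub>R e 1 + (z + Z2)" by (simp add: X_def scaleR_add_left)
      then show ?thesis unfolding q w by (simp add: EE_def x_def AA_def algebra_simps)
    qed
    have oz: "inner z (e 0) = 0" "inner z (e 1) = 0"
      using off_ops[OF not_range_c(1)] off_ops[OF not_range_c(2)] by (simp_all add: z_def inner_add_left)
    have "(norm X)\<^sup>2 = x\<^sup>2 + y\<^sup>2 + (norm z)\<^sup>2"
      unfolding X_def power2_norm_eq_inner
      by (simp add: inner_add_left inner_add_right on oz[unfolded One_nat_def] inner_commute[of "e _" z] power2_eq_square)
    also have "\<dots> \<le> (L1 * inner (u - v) (e 0))\<^sup>2 + (L1 * inner (u - v) (e 1))\<^sup>2 + (L1 * norm (pr (u - v)))\<^sup>2"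
    proof (intro add_mono)
      have "lam 0 \<le> L1" using lam_ge(1)[of 1] lam1_le by simp
      then have "\<bar>lam 0\<bar> * \<bar>Pc u - Pc v\<bar> \<le> L1 * \<bar>inner (u - v) (e 0)\<bar>" using PQ_lip(1)[of u v] lam_ge(2)[of 0] by (intro mult_mono) auto
      then show "x\<^sup>2 \<le> (L1 * inner (u - v) (e 0))\<^sup>2" using L1 by (simp add: x_def abs_le_square_iff[symmetric] abs_mult)
      \<comment> \<open>The window and the difference quotient \<tau> lie in [0, 1], so the factor
        of Q lies between lam 1 - m2 0 = -(lam 2 - lam 1)/2 and lam 1.\<close>
      have "lam 1 \<le> lam 2" using monoD[OF lam_mono, of 1 2] by simp
      then have m0: "lam 1 - m2 0 \<ge> - (G / 2)" "m2 0 \<ge> 0" using gap_first c_0 m_pos(2)[of 0] by (auto simp: m2_def field_simps)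
      have "0 \<le> AA u * \<tau>" "AA u * \<tau> \<le> 1" using AA01[of u] t by (auto intro: mult_le_one)
      then have "0 \<le> m2 0 * (AA u * \<tau>)" "m2 0 * (AA u * \<tau>) \<le> m2 0" using m0(2) by (auto intro: mult_left_le)
      then have "\<bar>lam 1 - m2 0 * (AA u * \<tau>)\<bar> \<le> L1" using m0(1) G_le lam1_le by (auto simp: abs_le_iff)
      then have "\<bar>lam 1 - m2 0 * (AA u * \<tau>)\<bar> * \<bar>Qc u - Qc v\<bar> \<le> L1 * \<bar>inner (u - v) (e 1)\<bar>" using PQ_lip(2)[of u v] L1 by (intro mult_mono) auto
      then show "y\<^sup>2 \<le> (L1 * inner (u - v) (e 1))\<^sup>2" using L1 by (simp add: y_def abs_le_square_iff[symmetric] abs_mult)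
      have "norm z \<le> L1 * norm dW" unfolding z_def by (rule D_mix_norm) (use al01 in \<open>auto simp: a_def\<close>)
      also have "\<dots> \<le> L1 * norm (pr (u - v))" unfolding dW_def using L1 W_lip[OF e(1)] by (intro mult_left_mono) auto
      finally show "(norm z)\<^sup>2 \<le> (L1 * norm (pr (u - v)))\<^sup>2" by (rule power_mono) simp
    qed
    also have "\<dots> = L1\<^sup>2 * ((inner (u - v) (e 0))\<^sup>2 + (inner (u - v) (e 1))\<^sup>2 + (norm (pr (u - v)))\<^sup>2)"
      by (simp only: power_mult_distrib distrib_left)
    also have "\<dots> \<le> L1\<^sup>2 * (norm (u - v))\<^sup>2" by (intro mult_left_mono norm_split) simp
    finally have "(norm X)\<^sup>2 \<le> (L1 * norm (u - v))\<^sup>2" by (simp add: power_mult_distrib)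
    then have nX: "norm X \<le> L1 * norm (u - v)" by (rule power2_le_imp_le) (use L1 in simp)
    have nZ1: "norm (Z1 *\<^sub>R e 1) \<le> (m2 0 * CA * 2 * \<epsilon>) * norm (u - v)"
    proof -
      have "\<bar>m2 0\<bar> * \<bar>AA u - AA v\<bar> * \<bar>hd\<^sub>c \<epsilon> v\<bar> \<le> m2 0 * (CA * norm (u - v)) * (2 * \<epsilon>)"
        using CA(2)[OF e, of u v] hd_bound[OF e(1), of v] m_pos(2)[of 0] CA(1) by (intro mult_mono) auto
      moreover have "norm (Z1 *\<^sub>R e 1) = \<bar>m2 0\<bar> * \<bar>AA u - AA v\<bar> * \<bar>hd\<^sub>c \<epsilon> v\<bar>"
        by (simp add: Z1_def norm_e[unfolded One_nat_def] norm_e abs_mult)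
      ultimately show ?thesis by (simp add: mult_ac)
    qed
    have nZ2: "norm Z2 \<le> (Ca * (2 * L1 * CW) * \<epsilon>) * norm (u - v)"
    proof -
      have "norm (D1 w) \<le> L1 * norm w" "norm (D2 w) \<le> L1 * norm w" for w
        using D_mix_norm[of 1 w] D_mix_norm[of 0 w] by auto
      then have "norm (D1 (Wc \<epsilon> v) - D2 (Wc \<epsilon> v)) \<le> L1 * norm (Wc \<epsilon> v) + L1 * norm (Wc \<epsilon> v)"
        by (intro order_trans[OF norm_triangle_ineq4] add_mono)
      also have "\<dots> \<le> 2 * L1 * (CW * \<epsilon>)" using CW(2)[OF e(1), of v] L1 by simp
      finally have "\<bar>al (Qc u) - al (Qc v)\<bar> * norm (D1 (Wc \<epsilon> v) - D2 (Wc \<epsilon> v)) \<le> (Ca * norm (u - v)) * (2 * L1 * (CW * \<epsilon>))"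
        using Ca(2)[OF e, of u v] Ca(1) by (intro mult_mono) auto
      moreover have "norm Z2 = \<bar>al (Qc u) - al (Qc v)\<bar> * norm (D1 (Wc \<epsilon> v) - D2 (Wc \<epsilon> v))" by (simp add: Z2_def)
      ultimately show ?thesis by (simp add: mult_ac)
    qed
    have "norm (X + Z1 *\<^sub>R e 1 + Z2) \<le> L1 * norm (u - v) + (m2 0 * CA * 2 * \<epsilon>) * norm (u - v) + (Ca * (2 * L1 * CW) * \<epsilon>) * norm (u - v)"
      by (intro norm_triangle_mono nX nZ1 nZ2)
    then show ?thesis unfolding eq by (simp add: C_def algebra_simps)
  qed
  then show ?thesis using C0 by blast
qed

lemma lip_F0: "\<exists>C\<ge>0. \<forall>\<epsilon> u v. 0 < \<epsilon> \<longrightarrow> \<epsilon> \<le> 1 \<longrightarrow> norm (F0 \<epsilon> u - F0 \<epsilon> v) \<le> (L1 + C * \<epsilon>) * norm (u - v)"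
proof -
  obtain C where C: "C \<ge> 0" "\<And>\<epsilon> u v. 0 < \<epsilon> \<Longrightarrow> \<epsilon> \<le> 1 \<Longrightarrow> norm (EE \<epsilon> u - EE \<epsilon> v) \<le> (L1 + C * \<epsilon>) * norm (u - v)"
    using lip_EE by blast
  obtain D where D: "D \<ge> 0" "\<And>\<epsilon> u v. 0 < \<epsilon> \<Longrightarrow> \<epsilon> \<le> 1 \<Longrightarrow> norm (RR \<epsilon> u - RR \<epsilon> v) \<le> D * norm (u - v)"
    using UBL_RR by (rule UBLE) auto
  have "norm (F0 \<epsilon> u - F0 \<epsilon> v) \<le> (L1 + (C + D) * \<epsilon>) * norm (u - v)" if e: "0 < \<epsilon>" "\<epsilon> \<le> 1" for \<epsilon> u v
  proof -
    have "F0 \<epsilon> u - F0 \<epsilon> v = (EE \<epsilon> u - EE \<epsilon> v) + \<epsilon> *\<^sub>R (RR \<epsilon> u - RR \<epsilon> v)"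
      by (simp add: F0_def algebra_simps)
    moreover have "norm (\<epsilon> *\<^sub>R (RR \<epsilon> u - RR \<epsilon> v)) \<le> \<epsilon> * (D * norm (u - v))"
      using D(2)[OF e] e by (simp add: mult_left_mono)
    ultimately have "norm (F0 \<epsilon> u - F0 \<epsilon> v) \<le> (L1 + C * \<epsilon>) * norm (u - v) + \<epsilon> * (D * norm (u - v))"
      using norm_triangle_mono[OF C(2)[OF e, of u v]] by presburger
    also have "\<dots> = (L1 + (C + D) * \<epsilon>) * norm (u - v)" by (simp add: algebra_simps)
    finally show ?thesis .
  qed
  then show ?thesis using C D by (intro exI[of _ "C + D"]) auto
qed

lemma bounded_F0: "0 < \<epsilon> \<Longrightarrow> \<epsilon> \<le> 1 \<Longrightarrow> \<exists>K. \<forall>u. norm (F0 \<epsilon> u) \<le> K"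
proof -
  have "UBL F0" unfolding F0_def[abs_def]
    by (rule UBLE[OF UBL_EE], rule UBLE[OF UBL_RR], rule UBL_add[OF UBL_EE UBL_scaleR[OF _ UBL_RR]])
      (rule UBLI[of 1], auto)
  moreover assume "0 < \<epsilon>" "\<epsilon> \<le> 1"
  ultimately show ?thesis by (metis UBLE)
qed

lemma F0_coords:
  "inner (F0 \<epsilon> u) (e 0) = lam 0 * Pc u + \<epsilon> * fG0 (Pc u) (Qc u)"
  "inner (F0 \<epsilon> u) (e 1) = lam 1 * Qc u - m2 0 * (ap (Pc u) * chq (Qc u)) * hd\<^sub>c \<epsilon> u
      + \<epsilon> * (fG1 (Pc u) (Qc u) - betap (Pc u) (Qc u) * inner (Wc \<epsilon> u) (f 0))"
  "inner (F0 \<epsilon> u) (f j) = al (Qc u) * ((mu j - m1 j) * inner (Wc \<epsilon> u) (f j)) + (1 - al (Qc u)) * ((mu j - m2 j) * inner (Wc \<epsilon> u) (f j))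
      + \<epsilon> * (beta1 (Pc u) (Qc u) * (\<zeta>1 j * inner (Wc \<epsilon> u) (f (\<sigma>1 j))) + beta2 (Pc u) (Qc u) * (\<zeta>2 j * inner (Wc \<epsilon> u) (f (\<sigma>2 j)))
        + (if j = 0 then betap (Pc u) (Qc u) * hd\<^sub>c \<epsilon> u else 0))"
  "k \<noteq> 0 \<Longrightarrow> k \<noteq> 1 \<Longrightarrow> k \<notin> range c \<Longrightarrow> inner (F0 \<epsilon> u) (e k) = 0"
proof -
  note o0 = off_ops[OF not_range_c(1)] and o1 = off_ops[OF not_range_c(2)]
  show "inner (F0 \<epsilon> u) (e 0) = lam 0 * Pc u + \<epsilon> * fG0 (Pc u) (Qc u)"
    using c_ge(2)[of 0] by (simp add: F0_def EE_def RR_def inner_add_left on o0)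
  show "inner (F0 \<epsilon> u) (e 1) = lam 1 * Qc u - m2 0 * (ap (Pc u) * chq (Qc u)) * hd\<^sub>c \<epsilon> u
      + \<epsilon> * (fG1 (Pc u) (Qc u) - betap (Pc u) (Qc u) * inner (Wc \<epsilon> u) (f 0))"
    using c_ge(3)[of 0] by (simp add: F0_def EE_def RR_def inner_add_left on o1)
  have "0 \<noteq> c j" "Suc 0 \<noteq> c j" using c_ge(2,3)[of j] by auto
  then show "inner (F0 \<epsilon> u) (f j) = al (Qc u) * ((mu j - m1 j) * inner (Wc \<epsilon> u) (f j)) + (1 - al (Qc u)) * ((mu j - m2 j) * inner (Wc \<epsilon> u) (f j))
      + \<epsilon> * (beta1 (Pc u) (Qc u) * (\<zeta>1 j * inner (Wc \<epsilon> u) (f (\<sigma>1 j))) + beta2 (Pc u) (Qc u) * (\<zeta>2 j * inner (Wc \<epsilon> u) (f (\<sigma>2 j)))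
        + (if j = 0 then betap (Pc u) (Qc u) * hd\<^sub>c \<epsilon> u else 0))"
    by (simp add: F0_def EE_def RR_def inner_add_left on coord_ops c_inj)
  assume k: "k \<noteq> 0" "k \<noteq> 1" "k \<notin> range c"
  then have "0 \<noteq> k" "Suc 0 \<noteq> k" "c 0 \<noteq> k" by auto
  then show "inner (F0 \<epsilon> u) (e k) = 0"
    by (simp add: F0_def EE_def RR_def inner_add_left on off_ops[OF k(3)])
qed

end

section \<open>Smooth curves given by series\<close>

text \<open>Termwise differentiation of every order. The mean value theorem bounds the Taylor
  remainder of each term by h^2 times the majorant of order k + 2, so summability of that majorant
  gives differentiability at order k.\<close>

lemma smoothR_series:
  fixes \<phi> :: "nat \<Rightarrow> nat \<Rightarrow> real \<Rightarrow> real" and W :: "nat \<Rightarrow> 'a::{real_normed_vector,complete_space}"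
  assumes d: "\<And>k N q. (\<phi> k N has_real_derivative \<phi> (Suc k) N q) (at q)"
    and b: "\<And>k N q. \<bar>\<phi> k N q\<bar> \<le> A k N" and s: "\<And>k. summable (\<lambda>N. A k N * norm (W N))"
  shows "smoothR (\<lambda>q. \<Sum>N. \<phi> 0 N q *\<^sub>R W N)"
proof -
  have sm: "summable (\<lambda>N. a N *\<^sub>R W N) \<and> norm (\<Sum>N. a N *\<^sub>R W N) \<le> M * (\<Sum>N. A k N * norm (W N))"
    if "\<And>N. \<bar>a N\<bar> \<le> M * A k N" for a k M
  proof
    have s': "summable (\<lambda>N. M * (A k N * norm (W N)))" by (rule summable_mult[OF s])
    have le: "norm (a N *\<^sub>R W N) \<le> M * (A k N * norm (W N))" for N
      using mult_right_mono[OF that[of N], of "norm (W N)"] by (simp add: mult.assoc)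
    have sn: "summable (\<lambda>N. norm (a N *\<^sub>R W N))"
      by (rule summable_comparison_test'[OF s']) (use le in auto)
    show su: "summable (\<lambda>N. a N *\<^sub>R W N)" by (rule summable_norm_complete[OF sn])
    have lim: "(\<lambda>n. norm (\<Sum>N<n. a N *\<^sub>R W N)) \<longlonglongrightarrow> norm (\<Sum>N. a N *\<^sub>R W N)"
      using summable_LIMSEQ[OF su] by (rule tendsto_norm)
    have bd: "norm (\<Sum>N<n. a N *\<^sub>R W N) \<le> M * (\<Sum>N. A k N * norm (W N))" for n
    proof -
      have "norm (\<Sum>N<n. a N *\<^sub>R W N) \<le> (\<Sum>N<n. norm (a N *\<^sub>R W N))" by (rule norm_sum)
      also have "\<dots> \<le> (\<Sum>N. norm (a N *\<^sub>R W N))" by (rule sum_le_suminf[OF sn]) auto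
      also have "\<dots> \<le> (\<Sum>N. M * (A k N * norm (W N)))" by (rule suminf_le[OF le sn s'])
      also have "\<dots> = M * (\<Sum>N. A k N * norm (W N))" by (rule suminf_mult[OF s])
      finally show ?thesis .
    qed
    show "norm (\<Sum>N. a N *\<^sub>R W N) \<le> M * (\<Sum>N. A k N * norm (W N))"
      by (rule LIMSEQ_le_const2[OF lim]) (use bd in blast)
  qed
  define g where "g k q = (\<Sum>N. \<phi> k N q *\<^sub>R W N)" for k q
  have "(g k has_vector_derivative g (Suc k) q) (at q)" for k q
  proof -
    define B where "B = (\<Sum>N. A (Suc (Suc k)) N * norm (W N))"
    have s1: "summable (\<lambda>N. \<phi> k N q *\<^sub>R W N)" for k q using sm[of "\<lambda>N. \<phi> k N q" 1 k] b by simp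
    have rem: "\<bar>\<phi> k N (q + h) - \<phi> k N q - h * \<phi> (Suc k) N q\<bar> \<le> h\<^sup>2 * A (Suc (Suc k)) N" for N h
    proof -
      have lip: "\<bar>\<phi> (Suc k) N x - \<phi> (Suc k) N q\<bar> \<le> A (Suc (Suc k)) N * \<bar>x - q\<bar>" for x
        using field_differentiable_bound[of UNIV "\<phi> (Suc k) N" "\<phi> (Suc (Suc k)) N" "A (Suc (Suc k)) N" x q] d b by auto
      have "\<exists>x. \<bar>x - q\<bar> \<le> \<bar>h\<bar> \<and> \<phi> k N (q + h) - \<phi> k N q = h * \<phi> (Suc k) N x"
      proof (cases h "0::real" rule: linorder_cases)
        case less
        then obtain z where "q + h < z" "z < q" "\<phi> k N q - \<phi> k N (q + h) = (q - (q + h)) * \<phi> (Suc k) N z"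
          using MVT2[of "q + h" q "\<phi> k N" "\<phi> (Suc k) N"] d by auto
        then show ?thesis by (intro exI[of _ z]) auto
      next
        case greater
        then obtain z where "q < z" "z < q + h" "\<phi> k N (q + h) - \<phi> k N q = (q + h - q) * \<phi> (Suc k) N z"
          using MVT2[of q "q + h" "\<phi> k N" "\<phi> (Suc k) N"] d by auto
        then show ?thesis by (intro exI[of _ z]) auto
      qed (auto intro!: exI[of _ q])
      then obtain x where x: "\<bar>x - q\<bar> \<le> \<bar>h\<bar>" "\<phi> k N (q + h) - \<phi> k N q = h * \<phi> (Suc k) N x" by blast
      have A0: "A (Suc (Suc k)) N \<ge> 0" using b[of "Suc (Suc k)" N q] by simp
      have "\<bar>\<phi> k N (q + h) - \<phi> k N q - h * \<phi> (Suc k) N q\<bar> = \<bar>h\<bar> * \<bar>\<phi> (Suc k) N x - \<phi> (Suc k) N q\<bar>"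
        unfolding x(2) by (simp add: abs_mult[symmetric] right_diff_distrib)
      also have "\<dots> \<le> \<bar>h\<bar> * (A (Suc (Suc k)) N * \<bar>h\<bar>)"
        using lip[of x] x(1) A0 mult_left_mono[OF x(1) A0] by (intro mult_left_mono) auto
      also have "\<dots> = h\<^sup>2 * A (Suc (Suc k)) N" by (simp add: power2_eq_square)
      finally show ?thesis .
    qed
    have R: "norm (g k (q + h) - g k q - h *\<^sub>R g (Suc k) q) \<le> h\<^sup>2 * B" for h
    proof -
      have "g k (q + h) - g k q - h *\<^sub>R g (Suc k) q = (\<Sum>N. (\<phi> k N (q + h) - \<phi> k N q - h * \<phi> (Suc k) N q) *\<^sub>R W N)"
        using sums_unique[OF sums_diff[OF sums_diff[OF summable_sums[OF s1[of k "q + h"]] summable_sums[OF s1[of k q]]]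
            sums_scaleR_right[OF summable_sums[OF s1[of "Suc k" q]], of h]]]
        by (simp add: g_def scaleR_left_diff_distrib)
      then show ?thesis using sm[of "\<lambda>N. \<phi> k N (q + h) - \<phi> k N q - h * \<phi> (Suc k) N q" "h\<^sup>2" "Suc (Suc k)"] rem by (simp add: B_def)
    qed
    have B0: "B \<ge> 0" using order_trans[OF norm_ge_zero R[of 1]] by simp
    show ?thesis
      unfolding has_vector_derivative_def has_derivative_at_alt
    proof (intro conjI allI impI)
      show "bounded_linear (\<lambda>x. x *\<^sub>R g (Suc k) q)" by (rule bounded_linear_scaleR_left)
      fix e :: real assume e: "e > 0"
      show "\<exists>d>0. \<forall>y. norm (y - q) < d \<longrightarrow> norm (g k y - g k q - (y - q) *\<^sub>R g (Suc k) q) \<le> e * norm (y - q)"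
      proof (intro exI[of _ "e / (B + 1)"] conjI allI impI)
        show "e / (B + 1) > 0" using e B0 by simp
        fix y assume y: "norm (y - q) < e / (B + 1)"
        have "norm (g k y - g k q - (y - q) *\<^sub>R g (Suc k) q) \<le> \<bar>y - q\<bar> * (\<bar>y - q\<bar> * B)"
          using R[of "y - q"] by (simp add: power2_eq_square mult.assoc[symmetric])
        moreover have "\<bar>y - q\<bar> * B \<le> e"
        proof -
          have "\<bar>y - q\<bar> * (B + 1) \<le> e" using y B0 by (simp add: pos_less_divide_eq)
          then show ?thesis using abs_ge_zero[of "y - q"] by (simp add: algebra_simps)
        qed
        then have "\<bar>y - q\<bar> * (\<bar>y - q\<bar> * B) \<le> \<bar>y - q\<bar> * e" by (rule mult_left_mono) simp
        ultimately show "norm (g k y - g k q - (y - q) *\<^sub>R g (Suc k) q) \<le> e * norm (y - q)"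
          by (simp add: mult.commute)
      qed
    qed
  qed
  then have "smoothR (g 0)" by (rule smoothR_seqI)
  then show ?thesis by (simp add: g_def[abs_def])
qed

text \<open>Outside [-1, 1] the bump vanishes on an open set, so all its derivatives vanish there
  too and are globally bounded.\<close>

lemma bump_derivs:
  "\<exists>b B. b 0 = bump \<and> (\<forall>k x. (b k has_real_derivative b (Suc k) x) (at x)) \<and> (\<forall>k x. \<bar>b k x\<bar> \<le> B k)"
proof -
  obtain b where b: "b 0 = bump" "\<And>k x. (b k has_vector_derivative b (Suc k) x) (at x)" "\<And>k. smoothR (b k)"
    using smoothR_seqE[OF smoothR_bump] by blast
  have d: "(b k has_real_derivative b (Suc k) x) (at x)" for k x using b(2) by (simp add: has_real_derivative_iff_has_vector_derivative)
  have out: "b k x = 0" if "\<bar>x\<bar> > 1" for k x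
    using that
  proof (induction k arbitrary: x)
    case 0 then show ?case using bump_outside[of x] b(1) by simp
  next
    case (Suc k)
    have "open {x::real. \<bar>x\<bar> > 1}" by (intro open_Collect_less continuous_intros)
    then have "(b k has_real_derivative 0) (at x)"
      by (rule has_field_derivative_transform_within_open[of "\<lambda>_. 0", rotated]) (use Suc in auto)
    then show ?case using d DERIV_unique by blast
  qed
  have "\<exists>C. \<forall>x. \<bar>b k x\<bar> \<le> C" for k
  proof -
    obtain C where C: "C > 0" "\<And>x. \<bar>x\<bar> \<le> 1 \<Longrightarrow> norm (b k x) \<le> C" using smoothR_bounded_on_Icc[OF b(3)[of k], of 1] by blast
    have "\<bar>b k x\<bar> \<le> C" for x using C out[of x k] by (cases "\<bar>x\<bar> \<le> 1") auto
    then show ?thesis by blast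
  qed
  then obtain B where "\<And>k x. \<bar>b k x\<bar> \<le> B k" by metis
  then show ?thesis using b(1) d by blast
qed

text \<open>The \<open>N\<close>-th bump sits at \<open>\<epsilon> / (4 (N + 1))\<close>; its radius is the distance to the next centre,
  so that at each centre all other bumps vanish.\<close>

definition ctr :: "real \<Rightarrow> nat \<Rightarrow> real" where "ctr \<epsilon> N = \<epsilon> / (4 * (real N + 1))"
definition rad :: "real \<Rightarrow> nat \<Rightarrow> real" where "rad \<epsilon> N = \<epsilon> / (4 * ((real N + 1) * (real N + 2)))"

definition kick :: "real \<Rightarrow> (nat \<Rightarrow> 'a::{real_normed_vector,complete_space}) \<Rightarrow> real \<Rightarrow> 'a" where
  "kick \<epsilon> W q = (\<Sum>N. bump ((q - ctr \<epsilon> N) / rad \<epsilon> N) *\<^sub>R W N)"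

lemma rad_pos: "\<epsilon> > 0 \<Longrightarrow> rad \<epsilon> N > 0"
  by (simp add: rad_def add_pos_nonneg)

lemma ctr_rad: "ctr \<epsilon> N - ctr \<epsilon> (Suc N) = rad \<epsilon> N"
proof -
  have "real N + 1 \<noteq> 0" "real N + 2 \<noteq> 0" by linarith+
  then show ?thesis by (simp add: ctr_def rad_def divide_simps) (simp add: algebra_simps)
qed

lemma ctr_antimono: "\<epsilon> > 0 \<Longrightarrow> M \<le> N \<Longrightarrow> ctr \<epsilon> N \<le> ctr \<epsilon> M"
  by (simp add: ctr_def frac_le)

lemma ctr_separated:
  assumes e: "\<epsilon> > 0" and "N \<noteq> N'"
  shows "rad \<epsilon> N' \<le> \<bar>ctr \<epsilon> N - ctr \<epsilon> N'\<bar>"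
proof (cases "N' < N")
  case True
  then have "ctr \<epsilon> N \<le> ctr \<epsilon> (Suc N')" using ctr_antimono[OF e] by simp
  then show ?thesis using ctr_rad[of \<epsilon> N'] by simp
next
  case False
  then have "N < N'" using assms(2) by simp
  then obtain k where k: "N' = Suc k" "N \<le> k" by (cases N') auto
  have "ctr \<epsilon> k \<le> ctr \<epsilon> N" using ctr_antimono[OF e k(2)] .
  moreover have "rad \<epsilon> (Suc k) \<le> rad \<epsilon> k" unfolding rad_def using e by (intro divide_left_mono mult_left_mono mult_mono) (auto simp: add_pos_nonneg)
  ultimately show ?thesis using ctr_rad[of \<epsilon> k] k(1) by simp
qed

lemma bump_ctr: "\<epsilon> > 0 \<Longrightarrow> bump ((ctr \<epsilon> N - ctr \<epsilon> N') / rad \<epsilon> N') = (if N = N' then 1 else 0)"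
proof (cases "N = N'")
  case False
  assume e: "\<epsilon> > 0"
  have "1 \<le> \<bar>(ctr \<epsilon> N - ctr \<epsilon> N') / rad \<epsilon> N'\<bar>"
    using ctr_separated[OF e False] rad_pos[OF e, of N'] by (simp add: abs_divide le_divide_eq)
  then show ?thesis using False bump_outside by simp
qed (simp add: bump_0)

lemma kick_ctr: "\<epsilon> > 0 \<Longrightarrow> kick \<epsilon> W (ctr \<epsilon> N) = W N"
proof -
  assume e: "\<epsilon> > 0"
  have "kick \<epsilon> W (ctr \<epsilon> N) = (\<Sum>N'. if N' = N then W N' else 0)"
    unfolding kick_def bump_ctr[OF e] by (rule arg_cong[where f = suminf]) auto
  also have "\<dots> = W N" using suminf_finite[of "{N}" "\<lambda>N'. if N' = N then W N' else 0"] by simp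
  finally show ?thesis .
qed

text \<open>Support inside (0, \<epsilon>) switches the kick off on the half turns, where |Q|
  exceeds 1/4 whenever P lies in the window of the kick.\<close>

lemma kick_outside:
  assumes e: "\<epsilon> > 0" and q: "q \<le> 0 \<or> q \<ge> \<epsilon>"
  shows "kick \<epsilon> W q = 0"
proof -
  have "bump ((q - ctr \<epsilon> N) / rad \<epsilon> N) = 0" for N
  proof (rule bump_outside)
    have "rad \<epsilon> N \<le> \<bar>q - ctr \<epsilon> N\<bar>"
    proof (cases "q \<le> 0")
      case True
      have "ctr \<epsilon> (Suc N) > 0" using e by (simp add: ctr_def add_pos_nonneg)
      then show ?thesis using True ctr_rad[of \<epsilon> N] by simp
    next
      case False
      have "ctr \<epsilon> N \<le> \<epsilon> / 4" using ctr_antimono[OF e, of 0 N] by (simp add: ctr_def)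
      moreover have "rad \<epsilon> N \<le> \<epsilon> / 4"
      proof -
        have "ctr \<epsilon> (Suc N) > 0" using e by (simp add: ctr_def add_pos_nonneg)
        then show ?thesis using ctr_rad[of \<epsilon> N] calculation by simp
      qed
      ultimately show ?thesis using False q e by simp
    qed
    then show "1 \<le> \<bar>(q - ctr \<epsilon> N) / rad \<epsilon> N\<bar>" using rad_pos[OF e, of N] by (simp add: abs_divide le_divide_eq)
  qed
  then show ?thesis by (simp add: kick_def)
qed

lemma kick_props:
  fixes W :: "nat \<Rightarrow> 'a::{real_normed_vector,complete_space}"
  assumes e: "\<epsilon> > 0" and s: "\<And>j. summable (\<lambda>N. norm (W N) / rad \<epsilon> N ^ j)"
  shows "smoothR (kick \<epsilon> W)"
proof -
  obtain b B where b: "b 0 = bump" "\<And>k x. (b k has_real_derivative b (Suc k) x) (at x)" "\<And>k x. \<bar>b k x\<bar> \<le> B k"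
    using bump_derivs by blast
  define \<phi> where "\<phi> k N q = b k ((q - ctr \<epsilon> N) / rad \<epsilon> N) / rad \<epsilon> N ^ k" for k N q
  have "smoothR (\<lambda>q. \<Sum>N. \<phi> 0 N q *\<^sub>R W N)"
  proof (rule smoothR_series)
    fix k N q
    have "((\<lambda>q. (q - ctr \<epsilon> N) / rad \<epsilon> N) has_real_derivative (1 - 0) / rad \<epsilon> N) (at q)"
      by (rule DERIV_cdivide[OF DERIV_diff[OF DERIV_ident DERIV_const]])
    from DERIV_cdivide[OF DERIV_chain2[OF b(2) this]]
    show "(\<phi> k N has_real_derivative \<phi> (Suc k) N q) (at q)" unfolding \<phi>_def[abs_def] by simp
    show "\<bar>\<phi> k N q\<bar> \<le> B k / rad \<epsilon> N ^ k"
      unfolding \<phi>_def using b(3) rad_pos[OF e, of N] by (simp add: abs_divide divide_right_mono)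
    show "summable (\<lambda>N. B k / rad \<epsilon> N ^ k * norm (W N))"
      using summable_mult[OF s[of k], of "B k"] by simp
  qed
  then show ?thesis by (simp add: \<phi>_def b(1) kick_def[abs_def])
qed

text \<open>C is fixed before \<epsilon> and W, so that \<eta> can later be fitted to the room left
  in the Lipschitz constant.\<close>

lemma kick_bounds:
  fixes W :: "nat \<Rightarrow> 'a::{real_normed_vector,complete_space}"
  shows "\<exists>C>0. \<forall>\<epsilon> W \<eta>. \<epsilon> > 0 \<longrightarrow> summable (\<lambda>N. norm (W N)) \<longrightarrow> summable (\<lambda>N. norm (W N) / rad \<epsilon> N) \<longrightarrow>
    (\<Sum>N. norm (W N)) \<le> \<eta> \<longrightarrow> (\<Sum>N. norm (W N) / rad \<epsilon> N) \<le> \<eta> \<longrightarrow>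
    (\<forall>q. norm (kick \<epsilon> (W::nat\<Rightarrow>'a) q) \<le> C * \<eta>) \<and> (\<forall>q q'. norm (kick \<epsilon> W q - kick \<epsilon> W q') \<le> C * \<eta> * \<bar>q - q'\<bar>)"
proof -
  obtain b B where b: "b 0 = bump" "\<And>k x. (b k has_real_derivative b (Suc k) x) (at x)" "\<And>k x. \<bar>b k x\<bar> \<le> B k"
    using bump_derivs by blast
  define C where "C = 1 + \<bar>B 0\<bar> + \<bar>B (Suc 0)\<bar>"
  have bl: "\<bar>bump x - bump y\<bar> \<le> C * \<bar>x - y\<bar>" for x y
  proof -
    have "\<bar>bump x - bump y\<bar> \<le> B (Suc 0) * \<bar>x - y\<bar>"
      using field_differentiable_bound[of UNIV bump "b (Suc 0)" "B (Suc 0)" x y] b(2)[of 0, unfolded b(1)] b(3)[of "Suc 0"]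
      by auto
    also have "\<dots> \<le> C * \<bar>x - y\<bar>" by (intro mult_right_mono) (auto simp: C_def)
    finally show ?thesis .
  qed
  have bb: "\<bar>bump x\<bar> \<le> C" for x using b(3)[of 0 x] b(1) by (simp add: C_def)
  have tri: "summable (\<lambda>N. a N *\<^sub>R W N) \<and> norm (\<Sum>N. a N *\<^sub>R W N) \<le> M"
    if "summable m" "\<And>N. norm (a N *\<^sub>R W N) \<le> m N" "suminf m \<le> M" for a m M and W :: "nat \<Rightarrow> 'a"
  proof
    have sn: "summable (\<lambda>N. norm (a N *\<^sub>R W N))"
      by (rule summable_comparison_test'[OF that(1)]) (use that(2) in auto)
    show su: "summable (\<lambda>N. a N *\<^sub>R W N)" by (rule summable_norm_complete[OF sn])
    have lim: "(\<lambda>n. norm (\<Sum>N<n. a N *\<^sub>R W N)) \<longlonglongrightarrow> norm (\<Sum>N. a N *\<^sub>R W N)"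
      using summable_LIMSEQ[OF su] by (rule tendsto_norm)
    have bd: "norm (\<Sum>N<n. a N *\<^sub>R W N) \<le> M" for n
    proof -
      have "norm (\<Sum>N<n. a N *\<^sub>R W N) \<le> (\<Sum>N<n. norm (a N *\<^sub>R W N))" by (rule norm_sum)
      also have "\<dots> \<le> (\<Sum>N. norm (a N *\<^sub>R W N))" by (rule sum_le_suminf[OF sn]) auto
      also have "\<dots> \<le> suminf m" by (rule suminf_le[OF that(2) sn that(1)])
      finally show ?thesis using that(3) by simp
    qed
    show "norm (\<Sum>N. a N *\<^sub>R W N) \<le> M" by (rule LIMSEQ_le_const2[OF lim]) (use bd in blast)
  qed
  have C: "C > 0" by (simp add: C_def)
  have "(\<forall>q. norm (kick \<epsilon> W q) \<le> C * \<eta>) \<and> (\<forall>q q'. norm (kick \<epsilon> W q - kick \<epsilon> W q') \<le> C * \<eta> * \<bar>q - q'\<bar>)"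
    if e: "\<epsilon> > 0" and s: "summable (\<lambda>N. norm (W N))" "summable (\<lambda>N. norm (W N) / rad \<epsilon> N)"
      "(\<Sum>N. norm (W N)) \<le> \<eta>" "(\<Sum>N. norm (W N) / rad \<epsilon> N) \<le> \<eta>" for \<epsilon> \<eta> and W :: "nat \<Rightarrow> 'a"
  proof (intro conjI allI)
    fix q q' :: real
    have k: "summable (\<lambda>N. bump ((q - ctr \<epsilon> N) / rad \<epsilon> N) *\<^sub>R W N) \<and> norm (\<Sum>N. bump ((q - ctr \<epsilon> N) / rad \<epsilon> N) *\<^sub>R W N) \<le> C * \<eta>" for q
    proof (rule tri[where m = "\<lambda>N. C * norm (W N)"])
      show "summable (\<lambda>N. C * norm (W N))" by (rule summable_mult[OF s(1)])
      show "norm (bump ((q - ctr \<epsilon> N) / rad \<epsilon> N) *\<^sub>R W N) \<le> C * norm (W N)" for N using bb by (simp add: mult_right_mono)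
      show "(\<Sum>N. C * norm (W N)) \<le> C * \<eta>" using suminf_mult[OF s(1), of C] s(3) C by (simp add: mult_left_mono)
    qed
    show "norm (kick \<epsilon> W q) \<le> C * \<eta>" unfolding kick_def by (rule conjunct2[OF k])
    have "kick \<epsilon> W q - kick \<epsilon> W q' = (\<Sum>N. (bump ((q - ctr \<epsilon> N) / rad \<epsilon> N) - bump ((q' - ctr \<epsilon> N) / rad \<epsilon> N)) *\<^sub>R W N)"
      unfolding kick_def scaleR_left_diff_distrib by (rule suminf_diff[OF conjunct1[OF k] conjunct1[OF k]])
    moreover have "norm (\<Sum>N. (bump ((q - ctr \<epsilon> N) / rad \<epsilon> N) - bump ((q' - ctr \<epsilon> N) / rad \<epsilon> N)) *\<^sub>R W N) \<le> C * \<eta> * \<bar>q - q'\<bar>"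
    proof (rule tri[where m = "\<lambda>N. (C * \<bar>q - q'\<bar>) * (norm (W N) / rad \<epsilon> N)", THEN conjunct2])
      show "summable (\<lambda>N. (C * \<bar>q - q'\<bar>) * (norm (W N) / rad \<epsilon> N))" by (rule summable_mult[OF s(2)])
      fix N
      define x y where "x = (q - ctr \<epsilon> N) / rad \<epsilon> N" and "y = (q' - ctr \<epsilon> N) / rad \<epsilon> N"
      have xy: "x - y = (q - q') / rad \<epsilon> N" by (simp add: x_def y_def diff_divide_distrib)
      have "\<bar>bump x - bump y\<bar> \<le> C * \<bar>x - y\<bar>" by (rule bl)
      also have "\<dots> = C * \<bar>q - q'\<bar> / rad \<epsilon> N" unfolding xy using rad_pos[OF e, of N] by (simp add: abs_divide)
      finally have "\<bar>bump x - bump y\<bar> * norm (W N) \<le> C * \<bar>q - q'\<bar> / rad \<epsilon> N * norm (W N)" by (rule mult_right_mono) simp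
      then show "norm ((bump ((q - ctr \<epsilon> N) / rad \<epsilon> N) - bump ((q' - ctr \<epsilon> N) / rad \<epsilon> N)) *\<^sub>R W N) \<le> (C * \<bar>q - q'\<bar>) * (norm (W N) / rad \<epsilon> N)"
        unfolding x_def[symmetric] y_def[symmetric] by simp
    next
      show "(\<Sum>N. (C * \<bar>q - q'\<bar>) * (norm (W N) / rad \<epsilon> N)) \<le> C * \<eta> * \<bar>q - q'\<bar>"
        unfolding suminf_mult[OF s(2)] using mult_left_mono[OF s(4), of "C * \<bar>q - q'\<bar>"] C by (simp add: mult_ac)
    qed
    ultimately show "norm (kick \<epsilon> W q - kick \<epsilon> W q') \<le> C * \<eta> * \<bar>q - q'\<bar>" by simp
  qed
  then show ?thesis using C by blast
qed

section \<open>The base trajectory\<close>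

locale base =
  fixes \<epsilon> :: real
  assumes eps: "0 < \<epsilon>" "\<epsilon> \<le> 1/8"
begin

text \<open>Squared radius of the planar orbit: the solution of u' = 2 \<epsilon> u (1 - u) with
  u(0) = 3/5, so that the rotation has full speed from time 0 on. At time -\<open>T1\<close> it
  equals 1/2, where the rotation sets in.\<close>

definition ub :: "real \<Rightarrow> real" where "ub t = 1 / (1 + 2/3 * exp (- 2 * \<epsilon> * t))"
definition rb :: "real \<Rightarrow> real" where "rb t = sqrt (ub t)"
definition T1 :: real where "T1 = ln (3/2) / (2 * \<epsilon>)"
definition th :: "real \<Rightarrow> real" where
  "th = (SOME g. g (- T1) = 0 \<and> (\<forall>t. (g has_real_derivative \<epsilon> * chir (ub t)) (at t)))"
definition pb :: "real \<Rightarrow> real" where "pb t = rb t * cos (th t)"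
definition qb :: "real \<Rightarrow> real" where "qb t = rb t * sin (th t)"

lemma ub_bounds: "0 < ub t" "ub t < 1"
proof -
  have "1 + 2/3 * exp (- 2 * \<epsilon> * t) > 1" by simp
  then show "0 < ub t" "ub t < 1" unfolding ub_def by (auto simp: add_pos_pos)
qed

lemma rb_bounds: "0 < rb t" "rb t < 1" "(rb t)\<^sup>2 = ub t"
  using ub_bounds[of t] by (auto simp: rb_def)

lemma ub_deriv: "(ub has_real_derivative 2 * \<epsilon> * ub t * (1 - ub t)) (at t)"
proof -
  define x where "x = 2/3 * exp (- 2 * \<epsilon> * t)"
  have p: "1 + x > 0" by (simp add: x_def add_pos_pos)
  have "((\<lambda>t. 2/3 * exp (- 2 * \<epsilon> * t)) has_real_derivative x * (- 2 * \<epsilon>)) (at t)"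
    unfolding x_def by (auto intro!: derivative_eq_intros)
  from DERIV_inverse'[OF DERIV_add[OF DERIV_const[of 1] this]]
  have "((\<lambda>t. inverse (1 + 2/3 * exp (- 2 * \<epsilon> * t))) has_real_derivative - (inverse (1 + x) * (0 + x * (- 2 * \<epsilon>)) * inverse (1 + x))) (at t)"
    using p by (simp add: x_def)
  moreover have "- (inverse (1 + x) * (0 + x * (- 2 * \<epsilon>)) * inverse (1 + x)) = 2 * \<epsilon> * ub t * (1 - ub t)"
  proof -
    have u: "ub t = inverse (1 + x)" by (simp add: ub_def x_def inverse_eq_divide)
    have "x * inverse (1 + x) = 1 - inverse (1 + x)" using p by (simp add: field_simps)
    then show ?thesis unfolding u by (simp add: mult_ac)
  qed
  ultimately show ?thesis unfolding ub_def[abs_def] by (simp add: inverse_eq_divide)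
qed

lemma rb_deriv: "(rb has_real_derivative \<epsilon> * rb t * (1 - ub t)) (at t)"
proof -
  have "((\<lambda>t. sqrt (ub t)) has_real_derivative (inverse (sqrt (ub t)) / 2) * (2 * \<epsilon> * ub t * (1 - ub t))) (at t)"
    by (rule DERIV_chain2[OF DERIV_real_sqrt ub_deriv]) (rule ub_bounds)
  moreover have "(inverse (sqrt (ub t)) / 2) * (2 * \<epsilon> * ub t * (1 - ub t)) = \<epsilon> * sqrt (ub t) * (1 - ub t)"
  proof -
    have "inverse (sqrt (ub t)) * ub t = sqrt (ub t)" using real_div_sqrt[of "ub t"] ub_bounds[of t] by (simp add: divide_inverse mult.commute)
    then have "(inverse (sqrt (ub t)) * ub t) * (\<epsilon> * (1 - ub t)) = sqrt (ub t) * (\<epsilon> * (1 - ub t))" by (simp only:)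
    then show ?thesis by (simp add: mult_ac)
  qed
  ultimately show ?thesis unfolding rb_def[abs_def] by (simp only:)
qed

lemma ub_mono: "s \<le> t \<Longrightarrow> ub s \<le> ub t"
proof -
  assume "s \<le> t"
  then have "- 2 * \<epsilon> * t \<le> - 2 * \<epsilon> * s" using eps by simp
  then have "exp (- 2 * \<epsilon> * t) \<le> exp (- 2 * \<epsilon> * s)" by simp
  then show ?thesis unfolding ub_def by (intro divide_left_mono) (auto simp: add_pos_pos)
qed

lemma rb_mono: "s \<le> t \<Longrightarrow> rb s \<le> rb t"
  unfolding rb_def using ub_mono by simp

lemma ub_0: "ub 0 = 3/5"
  by (simp add: ub_def)

lemma T1_pos: "T1 > 0" using eps by (simp add: T1_def)

lemma ub_T1: "ub (- T1) = 1/2"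
  using eps by (simp add: ub_def T1_def)

lemma th_props: "th (- T1) = 0" "(th has_real_derivative \<epsilon> * chir (ub t)) (at t)"
proof -
  have "continuous_on UNIV (\<lambda>t. \<epsilon> * chir (ub t))"
  proof (intro continuous_intros)
    have "continuous_on UNIV ub" by (meson ub_deriv DERIV_isCont continuous_at_imp_continuous_on)
    then show "continuous_on UNIV (\<lambda>t. chir (ub t))"
      by (rule continuous_on_compose2[OF smoothR_continuous[OF smoothR_cutoffs(2)]]) auto
  qed
  then have "\<exists>g. g (- T1) = 0 \<and> (\<forall>t. (g has_real_derivative \<epsilon> * chir (ub t)) (at t))"
    using continuous_antiderivative by blast
  from someI_ex[OF this] show "th (- T1) = 0" "(th has_real_derivative \<epsilon> * chir (ub t)) (at t)"
    by (auto simp: th_def)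
qed

lemma chir_01: "0 \<le> chir x" "chir x \<le> 1"
  unfolding chir_def using step_bounds by auto

lemma th_mono: "s \<le> t \<Longrightarrow> th s \<le> th t \<and> th t - th s \<le> \<epsilon> * (t - s)"
proof
  assume st: "s \<le> t"
  show "th s \<le> th t"
    by (rule DERIV_nonneg_imp_nondecreasing[OF st]) (use th_props(2) chir_01 eps in \<open>fastforce intro!: mult_nonneg_nonneg\<close>)
  have "\<epsilon> * s - th s \<le> \<epsilon> * t - th t"
  proof (rule DERIV_nonneg_imp_nondecreasing[OF st])
    fix x
    have "((\<lambda>t. \<epsilon> * t - th t) has_real_derivative \<epsilon> * 1 - \<epsilon> * chir (ub x)) (at x)"
      by (intro DERIV_diff DERIV_cmult DERIV_ident th_props)
    moreover have "\<epsilon> * 1 - \<epsilon> * chir (ub x) \<ge> 0" using chir_01(2)[of "ub x"] eps by (simp add: mult_left_le)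
    ultimately show "\<exists>y. ((\<lambda>t. \<epsilon> * t - th t) has_real_derivative y) (at x) \<and> 0 \<le> y" by blast
  qed
  then show "th t - th s \<le> \<epsilon> * (t - s)" by (simp add: algebra_simps)
qed

lemma th_early: "t \<le> - T1 \<Longrightarrow> th t = 0"
proof -
  assume t: "t \<le> - T1"
  have "\<exists>c. \<forall>x\<in>{.. - T1}. th x = c"
  proof (rule has_field_derivative_zero_constant)
    fix x assume "x \<in> {.. - T1}"
    then have "chir (ub x) = 0" unfolding chir_def using ub_mono[of x "- T1"] ub_T1 by (intro step_eq_0) auto
    then show "(th has_real_derivative 0) (at x within {.. - T1})" using th_props(2)[of x] by (auto intro: has_field_derivative_at_within)
  qed simp
  then show ?thesis using th_props(1) t by auto
qed

lemma th_late: "t \<ge> 0 \<Longrightarrow> th t = th 0 + \<epsilon> * t"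
proof -
  assume t: "t \<ge> 0"
  have "\<exists>c. \<forall>x\<in>{0..}. th x - \<epsilon> * x = c"
  proof (rule has_field_derivative_zero_constant)
    fix x :: real assume "x \<in> {0..}"
    then have "chir (ub x) = 1" unfolding chir_def using ub_mono[of 0 x] ub_0 by (intro step_eq_1) auto
    then have "((\<lambda>x. th x - \<epsilon> * x) has_real_derivative \<epsilon> * 1 - \<epsilon> * 1) (at x)"
      using DERIV_diff[OF th_props(2)[of x] DERIV_cmult[OF DERIV_ident, of \<epsilon>]] by simp
    then show "((\<lambda>x. th x - \<epsilon> * x) has_real_derivative 0) (at x within {0..})" by (auto intro: has_field_derivative_at_within)
  qed simp
  then obtain c where c: "\<forall>x\<in>{0..}. th x - \<epsilon> * x = c" by blast
  have "th t - \<epsilon> * t = c" "th 0 - \<epsilon> * 0 = c" using bspec[OF c, of t] bspec[OF c, of 0] t by auto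
  then show ?thesis by simp
qed

text \<open>The angle gained before time 0 is at most \<epsilon> T1 = ln(3/2)/2 \<le> 1/4. So half
  turns counted from time 0 overshoot the exact half planes by at most 1/4, which the margins of the
  windows absorb.\<close>

lemma th_0: "0 \<le> th 0" "th 0 \<le> 1/4"
proof -
  have "ln (3/2::real) \<le> 3/2 - 1" by (rule ln_le_minus_one) simp
  then have "\<epsilon> * T1 \<le> 1/4" using eps by (simp add: T1_def)
  then show "0 \<le> th 0" "th 0 \<le> 1/4" using th_mono[of "- T1" 0] th_props(1) T1_pos by auto
qed

lemma th_mid: "t \<le> 0 \<Longrightarrow> 0 \<le> th t \<and> th t \<le> 1/4"
  using th_mono[of t 0] th_mono[of "- T1" t] th_early[of t] th_0 th_props(1) by (cases "t \<le> - T1") auto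

lemma pq_sq: "(pb t)\<^sup>2 + (qb t)\<^sup>2 = ub t"
proof -
  have "(pb t)\<^sup>2 + (qb t)\<^sup>2 = (rb t)\<^sup>2 * ((cos (th t))\<^sup>2 + (sin (th t))\<^sup>2)"
    unfolding pb_def qb_def power_mult_distrib by (simp only: distrib_left)
  then show ?thesis by (simp add: rb_bounds)
qed

lemma base_eq: "(pb has_real_derivative \<epsilon> * fG0 (pb t) (qb t)) (at t)" "(qb has_real_derivative \<epsilon> * fG1 (pb t) (qb t)) (at t)"
proof -
  \<comment> \<open>Before \<open>chi3\<close> has reached 1 the orbit still lies on the axis, where
    the terms with \<open>chi3\<close> vanish anyway.\<close>
  have chi: "chi3 (ub t) = 1 \<or> qb t = 0"
  proof (cases "ub t \<ge> 2/5")
    case True then show ?thesis unfolding chi3_def by (intro disjI1 step_eq_1) auto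
  next
    case False
    then have "t < - T1" using ub_mono[of "- T1" t] ub_T1 by (cases "t < - T1") auto
    then show ?thesis using th_early[of t] by (simp add: qb_def)
  qed
  have g0: "fG0 (pb t) (qb t) = pb t * (1 - ub t) - chir (ub t) * qb t"
  proof -
    have "pb t * (1 - (pb t)\<^sup>2) - chi3 (ub t) * pb t * (qb t)\<^sup>2 = pb t * (1 - ((pb t)\<^sup>2 + (qb t)\<^sup>2))"
      using chi by (auto simp: algebra_simps)
    then show ?thesis by (simp add: fG0_def pq_sq)
  qed
  have g1: "fG1 (pb t) (qb t) = qb t * (1 - ub t) + chir (ub t) * pb t"
    using chi by (auto simp: fG1_def pq_sq)
  have c: "((\<lambda>t. cos (th t)) has_real_derivative - sin (th t) * (\<epsilon> * chir (ub t))) (at t)"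
    "((\<lambda>t. sin (th t)) has_real_derivative cos (th t) * (\<epsilon> * chir (ub t))) (at t)"
    by (rule DERIV_chain2[OF DERIV_cos th_props(2)], rule DERIV_chain2[OF DERIV_sin th_props(2)])
  have "(pb has_real_derivative \<epsilon> * rb t * (1 - ub t) * cos (th t) + - sin (th t) * (\<epsilon> * chir (ub t)) * rb t) (at t)"
    using DERIV_mult[OF rb_deriv[of t] c(1)] unfolding pb_def[abs_def] .
  moreover have "\<epsilon> * rb t * (1 - ub t) * cos (th t) + - sin (th t) * (\<epsilon> * chir (ub t)) * rb t = \<epsilon> * fG0 (pb t) (qb t)"
    unfolding g0 by (simp add: pb_def qb_def algebra_simps)
  ultimately show "(pb has_real_derivative \<epsilon> * fG0 (pb t) (qb t)) (at t)" by simp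
  have "(qb has_real_derivative \<epsilon> * rb t * (1 - ub t) * sin (th t) + cos (th t) * (\<epsilon> * chir (ub t)) * rb t) (at t)"
    using DERIV_mult[OF rb_deriv[of t] c(2)] unfolding qb_def[abs_def] .
  moreover have "\<epsilon> * rb t * (1 - ub t) * sin (th t) + cos (th t) * (\<epsilon> * chir (ub t)) * rb t = \<epsilon> * fG1 (pb t) (qb t)"
    unfolding g1 by (simp add: pb_def qb_def algebra_simps)
  ultimately show "(qb has_real_derivative \<epsilon> * fG1 (pb t) (qb t)) (at t)" by simp
qed

lemma pq_abs: "\<bar>pb t\<bar> \<le> 1" "\<bar>qb t\<bar> \<le> 1"
proof -
  have "(pb t)\<^sup>2 \<le> 1" "(qb t)\<^sup>2 \<le> 1"
    using pq_sq[of t] ub_bounds(2)[of t] zero_le_power2[of "pb t"] zero_le_power2[of "qb t"] by linarith+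
  then show "\<bar>pb t\<bar> \<le> 1" "\<bar>qb t\<bar> \<le> 1" by (simp_all add: abs_square_le_1)
qed

end

section \<open>Trajectories with finitely many active modes\<close>

context spectral
begin

text \<open>With finitely many active modes the mild equation is variation of constants in each
  coordinate: exp(-(t - s) lam k) times the coordinate is an antiderivative of the integrand. Thus
  solving scalar equations identifies the semiflow.\<close>

lemma mild_finite:
  assumes I: "finite I" and t01: "t0 \<le> t1"
    and off: "\<And>k t. k \<notin> I \<Longrightarrow> inner (u t) (e k) = 0"
    and d: "\<And>k t. k \<in> I \<Longrightarrow> t \<in> {t0..t1} \<Longrightarrow>
      ((\<lambda>t. inner (u t) (e k)) has_real_derivative inner (F (u t)) (e k) - lam k * inner (u t) (e k)) (at t)"
    and z: "\<And>k t. k \<notin> I \<Longrightarrow> t \<in> {t0..t1} \<Longrightarrow> inner (F (u t)) (e k) = 0"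
  shows "mild_on (t1 - t0) F (u t0) (\<lambda>s. u (t0 + s))"
  unfolding mild_on_def
proof (intro conjI ballI)
  have u: "u t = (\<Sum>k\<in>I. inner (u t) (e k) *\<^sub>R e k)" for t
    by (rule coord_eqI) (use off in \<open>auto simp: inner_sum_ons[OF I]\<close>)
  have dc: "((\<lambda>s. inner (u (t0 + s)) (e k)) has_real_derivative inner (F (u (t0 + s))) (e k) - lam k * inner (u (t0 + s)) (e k)) (at s)"
    if "k \<in> I" "s \<in> {0..t1 - t0}" for k s
  proof -
    have "((\<lambda>s. t0 + s) has_real_derivative 1) (at s)" by (auto intro!: derivative_eq_intros)
    from DERIV_chain2[OF d[OF that(1), of "t0 + s"] this] show ?thesis using that(2) by simp
  qed
  have "continuous_on {0..t1 - t0} (\<lambda>s. \<Sum>k\<in>I. inner (u (t0 + s)) (e k) *\<^sub>R e k)"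
  proof (intro continuous_on_sum continuous_on_scaleR continuous_on_const)
    fix k assume "k \<in> I"
    then show "continuous_on {0..t1 - t0} (\<lambda>s. inner (u (t0 + s)) (e k))"
      by (intro continuous_at_imp_continuous_on ballI DERIV_isCont[OF dc])
  qed
  then show "continuous_on {0..t1 - t0} (\<lambda>s. u (t0 + s))" by (subst u)
  show "u (t0 + 0) = u t0" by simp
  fix t assume t: "t \<in> {0..t1 - t0}"
  define G where "G s = (\<Sum>k\<in>I. (exp (- (t - s) * lam k) * inner (u (t0 + s)) (e k)) *\<^sub>R e k)" for s
  have "((\<lambda>s. S (t - s) (F (u (t0 + s)))) has_integral (G t - G 0)) {0..t}"
  proof (rule has_integral_eq)
    let ?g = "\<lambda>k s. exp (- (t - s) * lam k) * inner (u (t0 + s)) (e k)"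
    let ?g' = "\<lambda>k s. exp (- (t - s) * lam k) * inner (F (u (t0 + s))) (e k)"
    have "((\<lambda>s. ?g' k s *\<^sub>R e k) has_integral (?g k t - ?g k 0) *\<^sub>R e k) {0..t}" if k: "k \<in> I" for k
    proof -
      have "(?g' k has_integral (?g k t - ?g k 0)) {0..t}"
      proof (rule fundamental_theorem_of_calculus)
        show "0 \<le> t" using t by simp
        fix s assume s: "s \<in> {0..t}"
        have e: "((\<lambda>s. exp (- (t - s) * lam k)) has_real_derivative exp (- (t - s) * lam k) * lam k) (at s)"
          by (auto intro!: derivative_eq_intros)
        have "s \<in> {0..t1 - t0}" using s t by auto
        from DERIV_mult[OF e dc[OF k this]]
        have "(?g k has_real_derivative ?g' k s) (at s)"
          by (simp add: algebra_simps)
        then show "(?g k has_vector_derivative ?g' k s) (at s within {0..t})"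
          by (simp add: has_real_derivative_iff_has_vector_derivative has_vector_derivative_at_within)
      qed
      from has_integral_linear[OF this bounded_linear_scaleR_left[of "e k"]] show ?thesis by (simp add: o_def)
    qed
    from has_integral_sum[OF I this]
    show "((\<lambda>s. \<Sum>k\<in>I. ?g' k s *\<^sub>R e k) has_integral (G t - G 0)) {0..t}"
      by (simp add: G_def sum_subtractf scaleR_left_diff_distrib)
    show "(\<Sum>k\<in>I. ?g' k s *\<^sub>R e k) = S (t - s) (F (u (t0 + s)))" if "s \<in> {0..t}" for s
      by (rule coord_eqI) (use that t z[of _ "t0 + s"] in \<open>auto simp: inner_sum_ons[OF I] S_coord\<close>)
  qed
  moreover have "G t = u (t0 + t)" unfolding G_def by (simp flip: u)
  moreover have "G 0 = S t (u t0)"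
    unfolding G_def by (rule coord_eqI) (use t off in \<open>auto simp: inner_sum_ons[OF I] S_coord\<close>)
  ultimately show "((\<lambda>s. S (t - s) (F (u (t0 + s)))) has_integral (u (t0 + t) - S t (u t0))) {0..t}" by simp
qed

end

locale turns = design + base

locale flow = turns +
  fixes W :: "nat \<Rightarrow> 'a" and F L K
  assumes F_def: "F = (\<lambda>u. F0 \<epsilon> u + chk (Pc u) *\<^sub>R kick \<epsilon> W (Qc u))"
    and F_lip: "L-lipschitz_on UNIV F" and F_bdd: "\<And>x. norm (F x) \<le> K"
begin

sublocale semiflow e lam F L K
  by unfold_locales (rule F_lip, rule F_bdd)

end

context design
begin

definition vec :: "real \<Rightarrow> real \<Rightarrow> (nat \<Rightarrow> real) \<Rightarrow> nat \<Rightarrow> 'a" where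
  "vec p q x B = p *\<^sub>R e 0 + q *\<^sub>R e 1 + (\<Sum>j<B. x j *\<^sub>R f j)"

lemma vec_coords:
  "inner (vec p q x B) (e 0) = p" "inner (vec p q x B) (e (Suc 0)) = q"
  "inner (vec p q x B) (f j) = (if j < B then x j else 0)"
  "k \<noteq> 0 \<Longrightarrow> k \<noteq> Suc 0 \<Longrightarrow> k \<notin> c ` {..<B} \<Longrightarrow> inner (vec p q x B) (e k) = 0"
proof -
  have s: "inner (\<Sum>j<B. x j *\<^sub>R f j) (e k) = (\<Sum>j<B. if c j = k then x j else 0)" for k
    unfolding inner_sum_left by (rule sum.cong) (auto simp: on)
  have n: "c j \<noteq> 0" "c j \<noteq> Suc 0" "0 \<noteq> c j" "Suc 0 \<noteq> c j" for j using c_ge[of j] by auto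
  show "inner (vec p q x B) (e 0) = p" "inner (vec p q x B) (e (Suc 0)) = q"
    by (simp_all add: vec_def inner_add_left s on n)
  show "inner (vec p q x B) (f j) = (if j < B then x j else 0)"
    using ch.inner_sum_ons[of "{..<B}" x j] by (simp add: vec_def inner_add_left on n)
  assume k: "k \<noteq> 0" "k \<noteq> Suc 0" "k \<notin> c ` {..<B}"
  then have "(\<Sum>j<B. if c j = k then x j else 0) = 0" by (intro sum.neutral) auto
  then show "inner (vec p q x B) (e k) = 0" using k by (simp add: vec_def inner_add_left s on)
qed

lemma Wc_vec:
  assumes "0 < \<epsilon>" "(\<Sum>j<B. \<bar>x j\<bar>) \<le> \<epsilon>"
  shows "inner (Wc \<epsilon> (vec p q x B)) (f j) = (if j < B then x j else 0)"
proof -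
  have "pr (vec p q x B) = (\<Sum>j<B. x j *\<^sub>R f j)"
  proof (rule coord_eqI)
    fix k
    show "inner (pr (vec p q x B)) (e k) = inner (\<Sum>j<B. x j *\<^sub>R f j) (e k)"
    proof (cases "k \<in> range c")
      case True
      then obtain j where "k = c j" by blast
      then show ?thesis using ch.inner_sum_ons[of "{..<B}" x j] by (simp add: coord_ops vec_coords)
    next
      case False
      then have "inner (\<Sum>j<B. x j *\<^sub>R f j) (e k) = 0" unfolding inner_sum_left by (intro sum.neutral) (auto simp: on)
      then show ?thesis using off_ops[OF False] by simp
    qed
  qed
  moreover have "norm (\<Sum>j<B. x j *\<^sub>R f j) \<le> \<epsilon>"
    using order_trans[OF norm_sum, of "\<lambda>j. x j *\<^sub>R f j" "{..<B}" \<epsilon>] assms(2) by (simp add: norm_e)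
  ultimately have "Wc \<epsilon> (vec p q x B) = (\<Sum>j<B. x j *\<^sub>R f j)" using crad_id[OF assms(1), of "\<Sum>j<B. x j *\<^sub>R f j"] by (simp add: Wc_def)
  then show ?thesis using ch.inner_sum_ons[of "{..<B}" x j] by simp
qed

end

context flow
begin

text \<open>Velocity of a chain mode in the system as seen by the ansatz: \<open>mu j\<close>
  cancels against the shift in \<open>EE\<close>, and only the paired rates \<open>m1\<close>,
  \<open>m2\<close> remain.\<close>

definition rhs :: "(nat \<Rightarrow> real) \<Rightarrow> real \<Rightarrow> real \<Rightarrow> (nat \<Rightarrow> real) \<Rightarrow> nat \<Rightarrow> real" where
  "rhs \<kappa> p q x j = - (al q * m1 j + (1 - al q) * m2 j) * x j
     + \<epsilon> * (beta1 p q * (\<zeta>1 j * x (\<sigma>1 j)) + beta2 p q * (\<zeta>2 j * x (\<sigma>2 j)) + (if j = 0 then betap p q * (\<epsilon> * cutoff (q / \<epsilon>)) else 0))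
     + chk p * \<kappa> j"

text \<open>While |p|, |q| \<le> 1 and the chain part is at most \<epsilon>, every truncation except
  that of \<open>hd\<^sub>c\<close> is inactive and F reduces to the explicit system. The sum of
  absolute values dominates the norm and is easy to propagate. The kick can be a constant vector
  \<kappa>, because q rests at a centre while the window of the kick is open.\<close>

lemma flow_trajectory:
  fixes p q :: "real \<Rightarrow> real" and x :: "nat \<Rightarrow> real \<Rightarrow> real"
  assumes t01: "t0 \<le> t1"
    and p: "\<And>t. t \<in> {t0..t1} \<Longrightarrow> (p has_real_derivative \<epsilon> * fG0 (p t) (q t)) (at t)"
    and q: "\<And>t. t \<in> {t0..t1} \<Longrightarrow> (q has_real_derivative - (m2 0 * (ap (p t) * chq (q t)) * (\<epsilon> * cutoff (q t / \<epsilon>)))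
        + \<epsilon> * (fG1 (p t) (q t) - betap (p t) (q t) * x 0 t)) (at t)"
    and x: "\<And>t j. t \<in> {t0..t1} \<Longrightarrow> j < B \<Longrightarrow> (x j has_real_derivative rhs \<kappa> (p t) (q t) (\<lambda>i. x i t) j) (at t)"
    and z: "\<And>t j. t \<in> {t0..t1} \<Longrightarrow> j \<ge> B \<Longrightarrow> x j t = 0 \<and> rhs \<kappa> (p t) (q t) (\<lambda>i. x i t) j = 0"
    and bnd: "\<And>t. t \<in> {t0..t1} \<Longrightarrow> \<bar>p t\<bar> \<le> 1 \<and> \<bar>q t\<bar> \<le> 1 \<and> (\<Sum>j<B. \<bar>x j t\<bar>) \<le> \<epsilon>"
    and kk: "\<And>t. t \<in> {t0..t1} \<Longrightarrow> chk (p t) *\<^sub>R kick \<epsilon> W (q t) = chk (p t) *\<^sub>R (\<Sum>j<B. \<kappa> j *\<^sub>R f j)"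
    and \<kappa>: "\<And>j. j \<ge> B \<Longrightarrow> \<kappa> j = 0" and B: "B > 0"
  shows "T (t1 - t0) (vec (p t0) (q t0) (\<lambda>j. x j t0) B) = vec (p t1) (q t1) (\<lambda>j. x j t1) B"
proof -
  define u where "u t = vec (p t) (q t) (\<lambda>j. x j t) B" for t
  have m: "mild_on (t1 - t0) F (u t0) (\<lambda>s. u (t0 + s))"
  proof (rule mild_finite)
    let ?I = "insert 0 (insert (Suc 0) (c ` {..<B}))"
    show "finite ?I" by simp
    show "inner (u t) (e k) = 0" if "k \<notin> ?I" for k t using that unfolding u_def by (intro vec_coords(4)) auto
    have PQ: "Pc (u t) = p t" "Qc (u t) = q t" "hd\<^sub>c \<epsilon> (u t) = \<epsilon> * cutoff (q t / \<epsilon>)" if "t \<in> {t0..t1}" for t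
      using bnd[OF that] cutoff(2) by (auto simp: Pc_def Qc_def hd\<^sub>c_def u_def vec_coords)
    have W0: "inner (Wc \<epsilon> (u t)) (f j) = x j t" if "t \<in> {t0..t1}" for t j
      using Wc_vec[OF eps(1), of "\<lambda>j. x j t" B "p t" "q t" j] bnd[OF that] z[OF that, of j] by (auto simp: u_def)
    have Fu: "F (u t) = F0 \<epsilon> (u t) + chk (p t) *\<^sub>R (\<Sum>j<B. \<kappa> j *\<^sub>R f j)" if "t \<in> {t0..t1}" for t
      using kk[OF that] by (simp add: F_def PQ[OF that])
    have ks: "inner (\<Sum>j<B. \<kappa> j *\<^sub>R f j) (e k) = 0" if "k \<notin> c ` {..<B}" for k
      unfolding inner_sum_left using that by (intro sum.neutral) (auto simp: on)
    have n: "0 \<notin> c ` {..<B}" "Suc 0 \<notin> c ` {..<B}" using not_range_c by auto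
    have kf: "inner (\<Sum>j<B. \<kappa> j *\<^sub>R f j) (f j) = \<kappa> j" for j using ch.inner_sum_ons[of "{..<B}" \<kappa> j] \<kappa>[of j] by auto
    have fj: "inner (F (u t)) (f j) = rhs \<kappa> (p t) (q t) (\<lambda>i. x i t) j + mu j * x j t" if "t \<in> {t0..t1}" for t j
    proof -
      have "inner (F (u t)) (f j) = inner (F0 \<epsilon> (u t)) (f j) + chk (p t) * \<kappa> j" unfolding Fu[OF that] by (simp add: inner_add_left kf)
      then show ?thesis unfolding F0_coords(3) PQ[OF that] W0[OF that] rhs_def by (simp add: algebra_simps)
    qed
    show "((\<lambda>t. inner (u t) (e k)) has_real_derivative inner (F (u t)) (e k) - lam k * inner (u t) (e k)) (at t)"
      if k: "k \<in> ?I" and t: "t \<in> {t0..t1}" for k t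
    proof -
      consider "k = 0" | "k = Suc 0" | j where "j < B" "k = c j" using k by auto
      then show ?thesis
      proof cases
        case 1
        have "inner (F (u t)) (e 0) - lam 0 * inner (u t) (e 0) = \<epsilon> * fG0 (p t) (q t)"
          unfolding Fu[OF t] by (simp add: inner_add_left ks[OF n(1)] F0_coords(1) PQ[OF t]) (simp add: u_def vec_coords)
        moreover have "(\<lambda>t. inner (u t) (e 0)) = p" by (simp add: u_def vec_coords)
        ultimately show ?thesis using p[OF t] 1 by simp
      next
        case 2
        have "inner (F (u t)) (e (Suc 0)) - lam (Suc 0) * inner (u t) (e (Suc 0)) = - (m2 0 * (ap (p t) * chq (q t)) * (\<epsilon> * cutoff (q t / \<epsilon>)))
            + \<epsilon> * (fG1 (p t) (q t) - betap (p t) (q t) * x 0 t)"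
          unfolding Fu[OF t] using F0_coords(2)[of \<epsilon> "u t"]
          by (simp add: inner_add_left ks[OF n(2)] PQ[OF t] W0[OF t]) (simp add: u_def vec_coords)
        moreover have "(\<lambda>t. inner (u t) (e (Suc 0))) = q" by (simp add: u_def vec_coords)
        ultimately show ?thesis using q[OF t] 2 by simp
      next
        case 3
        have "(\<lambda>t. inner (u t) (f j)) = x j" using 3 by (simp add: u_def vec_coords)
        moreover have "inner (F (u t)) (f j) - lam (c j) * inner (u t) (f j) = rhs \<kappa> (p t) (q t) (\<lambda>i. x i t) j"
          using fj[OF t, of j] 3(1) by (simp add: u_def vec_coords)
        ultimately show ?thesis using x[OF t 3(1)] 3(2) by simp
      qed
    qed
    show "inner (F (u t)) (e k) = 0" if k: "k \<notin> ?I" and t: "t \<in> {t0..t1}" for k t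
    proof (cases "k \<in> range c")
      case True
      then obtain j where j: "k = c j" by blast
      then have "j \<ge> B" using k by (auto simp: not_less[symmetric])
      then show ?thesis using fj[OF t, of j] z[OF t, of j] j by simp
    next
      case False
      then show ?thesis using k F0_coords(4)[of k \<epsilon> "u t"] ks[of k] unfolding Fu[OF t] by (auto simp: inner_add_left)
    qed
  qed (rule t01)
  have "T (t1 - t0) (u t0) = u (t0 + (t1 - t0))" by (rule sg_mild_on[OF m]) (use t01 in auto)
  then show ?thesis by (simp add: u_def)
qed

end

text \<open>Exchange within a pair by the angle \<psi>. The integrated rates M have to agree only
  while \<psi> moves; at such times M can be read off from either partner. An amplitude that moves
  from \<sigma> j to j thus pays the rate of \<sigma> j before and that of j after the exchange,
  which is the factor exp(M (\<sigma> j) t0 - M j t).\<close>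

lemma rotation_solution:
  fixes M m :: "nat \<Rightarrow> real \<Rightarrow> real" and \<sigma> :: "nat \<Rightarrow> nat" and \<zeta> x0 :: "nat \<Rightarrow> real" and t0 t :: real
  assumes M: "\<And>j. (M j has_real_derivative m j t) (at t)" and ps: "(\<psi> has_real_derivative \<psi>') (at t)"
    and eq: "\<And>j. \<psi>' \<noteq> 0 \<Longrightarrow> M (\<sigma> j) t = M j t"
    and inv: "\<And>j. \<sigma> (\<sigma> j) = j"
    and z: "\<And>j. \<sigma> j \<noteq> j \<Longrightarrow> \<zeta> j * \<zeta> (\<sigma> j) = -1" and z0: "\<And>j. \<sigma> j = j \<Longrightarrow> \<zeta> j = 0"
  defines "x \<equiv> \<lambda>j t. (if \<sigma> j = j then exp (M j t0 - M j t) * x0 j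
    else cos (\<psi> t) * exp (M j t0 - M j t) * x0 j + \<zeta> j * sin (\<psi> t) * exp (M (\<sigma> j) t0 - M j t) * x0 (\<sigma> j))"
  shows "(x j has_real_derivative - m j t * x j t + \<psi>' * (\<zeta> j * x (\<sigma> j) t)) (at t)"
proof -
  have E: "((\<lambda>t. exp (a - M j t)) has_real_derivative exp (a - M j t) * (- m j t)) (at t)" for a
    by (auto intro!: derivative_eq_intros M)
  show ?thesis
  proof (cases "\<sigma> j = j")
    case True
    then show ?thesis using DERIV_cmult_right[OF E[of "M j t0"], of "x0 j"] z0[OF True] by (simp add: x_def mult_ac)
  next
    case False
    have f: "\<sigma> (\<sigma> j) \<noteq> \<sigma> j" using False inv[of j] by simp
    have d: "(x j has_real_derivative - m j t * x j t
        + \<psi>' * (- sin (\<psi> t) * exp (M j t0 - M j t) * x0 j + \<zeta> j * cos (\<psi> t) * exp (M (\<sigma> j) t0 - M j t) * x0 (\<sigma> j))) (at t)"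
    proof -
      have c: "((\<lambda>t. cos (\<psi> t)) has_real_derivative - sin (\<psi> t) * \<psi>') (at t)"
        "((\<lambda>t. sin (\<psi> t)) has_real_derivative cos (\<psi> t) * \<psi>') (at t)"
        by (rule DERIV_chain2[OF DERIV_cos ps], rule DERIV_chain2[OF DERIV_sin ps])
      have "((\<lambda>t. cos (\<psi> t) * exp (M j t0 - M j t) * x0 j + \<zeta> j * sin (\<psi> t) * exp (M (\<sigma> j) t0 - M j t) * x0 (\<sigma> j)) has_real_derivative
         (- sin (\<psi> t) * \<psi>' * exp (M j t0 - M j t) + exp (M j t0 - M j t) * (- m j t) * cos (\<psi> t)) * x0 j
         + (\<zeta> j * (cos (\<psi> t) * \<psi>') * exp (M (\<sigma> j) t0 - M j t) + exp (M (\<sigma> j) t0 - M j t) * (- m j t) * (\<zeta> j * sin (\<psi> t))) * x0 (\<sigma> j)) (at t)"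
        by (intro DERIV_add DERIV_cmult_right DERIV_mult DERIV_cmult c E)
      then show ?thesis using False by (simp add: x_def algebra_simps)
    qed
    moreover have "\<psi>' * (- sin (\<psi> t) * exp (M j t0 - M j t) * x0 j + \<zeta> j * cos (\<psi> t) * exp (M (\<sigma> j) t0 - M j t) * x0 (\<sigma> j))
       = \<psi>' * (\<zeta> j * x (\<sigma> j) t)"
    proof (cases "\<psi>' = 0")
      case nz: False
      have "\<zeta> j * x (\<sigma> j) t = \<zeta> j * cos (\<psi> t) * exp (M (\<sigma> j) t0 - M j t) * x0 (\<sigma> j)
          + (\<zeta> j * \<zeta> (\<sigma> j)) * sin (\<psi> t) * exp (M j t0 - M j t) * x0 j"
        using f eq[OF nz, of j] inv[of j] False by (simp add: x_def distrib_left mult_ac)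
      then show ?thesis by (simp add: z[OF False])
    qed simp
    ultimately show ?thesis by (simp only:)
  qed
qed

section \<open>Half turns\<close>

lemma cutoff_values:
  "x \<le> 3/10 \<or> x \<ge> 2/5 \<Longrightarrow> Sp' x = 0" "x \<le> 3/10 \<Longrightarrow> Sp x = 0" "x \<ge> 2/5 \<Longrightarrow> Sp x = pi / 2"
  "\<bar>x\<bar> \<ge> 1/8 \<Longrightarrow> Su' x = 0" "\<bar>x\<bar> \<ge> 1/8 \<Longrightarrow> Sl' x = 0"
  "x \<ge> 1/8 \<Longrightarrow> Su x = 0" "x \<le> - (1/8) \<Longrightarrow> Su x = pi / 2" "x \<ge> 1/8 \<Longrightarrow> Sl x = pi / 2" "x \<le> - (1/8) \<Longrightarrow> Sl x = 0"
  "x \<le> 1/4 \<Longrightarrow> al x = 0" "x \<ge> 1/2 \<Longrightarrow> al x = 1"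
  "x \<le> 1/5 \<or> x \<ge> 1/2 \<Longrightarrow> ap x = 0" "\<bar>x\<bar> \<le> 1/8 \<Longrightarrow> chq x = 1" "\<bar>x\<bar> \<ge> 1/4 \<Longrightarrow> chq x = 0"
  "x \<le> 1/10 \<or> x \<ge> 1/5 \<Longrightarrow> chk x = 0" "x \<le> 1/5 \<Longrightarrow> chi3 x = 0" "x \<le> 1/2 \<Longrightarrow> chir x = 0"
proof -
  show "x \<le> 3/10 \<or> x \<ge> 2/5 \<Longrightarrow> Sp' x = 0" using step'_0[of "3/10" "2/5" x] by (simp add: Sp'_def)
  show "x \<le> 3/10 \<Longrightarrow> Sp x = 0" using step_eq_0[of "3/10" "2/5" x] by (simp add: Sp_def)
  show "x \<ge> 2/5 \<Longrightarrow> Sp x = pi / 2" using step_eq_1[of "3/10" "2/5" x] by (simp add: Sp_def)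
  show "\<bar>x\<bar> \<ge> 1/8 \<Longrightarrow> Su' x = 0" using step'_0[of "-1/8" "1/8" x] by (auto simp: Su'_def abs_if split: if_splits)
  show "\<bar>x\<bar> \<ge> 1/8 \<Longrightarrow> Sl' x = 0" using step'_0[of "-1/8" "1/8" x] by (auto simp: Sl'_def abs_if split: if_splits)
  show "x \<ge> 1/8 \<Longrightarrow> Su x = 0" "x \<ge> 1/8 \<Longrightarrow> Sl x = pi / 2" using step_eq_1[of "-1/8" "1/8" x] by (simp_all add: Su_def Sl_def)
  show "x \<le> - (1/8) \<Longrightarrow> Su x = pi / 2" "x \<le> - (1/8) \<Longrightarrow> Sl x = 0" using step_eq_0[of "-1/8" "1/8" x] by (simp_all add: Su_def Sl_def)
  show "x \<le> 1/4 \<Longrightarrow> al x = 0" using step_eq_0[of "1/4" "1/2" x] by (simp add: al_def)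
  show "x \<ge> 1/2 \<Longrightarrow> al x = 1" using step_eq_1[of "1/4" "1/2" x] by (simp add: al_def)
  show "x \<le> 1/5 \<or> x \<ge> 1/2 \<Longrightarrow> ap x = 0" using step_eq_0[of "1/5" "3/10" x] step_eq_1[of "2/5" "1/2" x] by (auto simp: ap_def)
  show "\<bar>x\<bar> \<le> 1/8 \<Longrightarrow> chq x = 1" using step_eq_1[of "-1/4" "-1/8" x] step_eq_1[of "-1/4" "-1/8" "-x"] by (simp add: chq_def abs_le_iff)
  show "\<bar>x\<bar> \<ge> 1/4 \<Longrightarrow> chq x = 0" using step_eq_0[of "-1/4" "-1/8" x] step_eq_0[of "-1/4" "-1/8" "-x"] by (auto simp: chq_def abs_if split: if_splits)
  show "x \<le> 1/10 \<or> x \<ge> 1/5 \<Longrightarrow> chk x = 0" unfolding chk_def by (rule bump_outside) (auto simp: abs_if)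
  show "x \<le> 1/5 \<Longrightarrow> chi3 x = 0" using step_eq_0[of "1/5" "2/5" x] by (simp add: chi3_def)
  show "x \<le> 1/2 \<Longrightarrow> chir x = 0" using step_eq_0[of "1/2" "3/5" x] by (simp add: chir_def)
qed

lemma al_01: "0 \<le> al x" "al x \<le> 1"
  unfolding al_def using step_bounds by auto

lemma chk_01: "0 \<le> chk x" "chk x \<le> 1"
  unfolding chk_def using bump_nonneg bump_le_1 by auto

lemma cos_sq_small: "0 \<le> x \<Longrightarrow> x \<le> 1/4 \<Longrightarrow> (cos x)\<^sup>2 \<ge> 15/16 \<and> cos x \<ge> 0 \<and> 0 \<le> sin x \<and> sin x \<le> (1/4::real)"
proof -
  assume x: "0 \<le> x" "x \<le> 1/4"
  have s: "0 \<le> sin x" "sin x \<le> 1/4" using sin_ge_zero[of x] sin_x_le_x[of x] x pi_gt3 by auto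
  then have "(sin x)\<^sup>2 \<le> (1/4)\<^sup>2" by (intro power_mono)
  then have "(cos x)\<^sup>2 \<ge> 15/16" using sin_cos_squared_add[of x] by (simp add: power2_eq_square)
  moreover have "cos x \<ge> 0" using x pi_gt3 by (intro cos_ge_zero) auto
  ultimately show ?thesis using s by blast
qed

context base
begin

definition tau :: real where "tau = pi / \<epsilon>"
text \<open>The time of half turn h at which the orbit crosses the axis p = 0: there
  \<open>alf h\<close>, the angle measured from the start of that half plane, is pi/2.\<close>

definition tst :: "nat \<Rightarrow> real" where "tst h = (real h * pi + pi / 2 - th 0) / \<epsilon>"
definition alf :: "nat \<Rightarrow> real \<Rightarrow> real" where "alf h t = th t - real h * pi"

lemma tau_pos: "tau > 0" using eps by (simp add: tau_def)

lemma alf_eq: "t \<ge> 0 \<Longrightarrow> alf h t = th 0 + \<epsilon> * (t - real h * tau)"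
  using eps th_late[of t] by (simp add: alf_def tau_def right_diff_distrib)

lemma alf_bounds:
  assumes "t \<in> {real h * tau..real (Suc h) * tau}"
  shows "t \<ge> 0" "0 \<le> alf h t" "alf h t \<le> pi + 1/4"
proof -
  have "real h * tau \<ge> 0" using tau_pos by simp
  then show t: "t \<ge> 0" using assms by simp
  have "0 \<le> \<epsilon> * (t - real h * tau)" using assms eps by simp
  moreover have "\<epsilon> * (t - real h * tau) \<le> \<epsilon> * tau" using assms eps by (intro mult_left_mono) (auto simp: algebra_simps)
  moreover have "\<epsilon> * tau = pi" using eps by (simp add: tau_def)
  ultimately show "0 \<le> alf h t" "alf h t \<le> pi + 1/4" using th_0 by (simp_all add: alf_eq[OF t])
qed

lemma pq_alf: "pb t = (-1) ^ h * (rb t * cos (alf h t))" "qb t = (-1) ^ h * (rb t * sin (alf h t))"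
proof -
  have "cos (th t) = (-1) ^ h * cos (alf h t) \<and> sin (th t) = (-1) ^ h * sin (alf h t)" 
  proof (induction h)
    case 0 then show ?case by (simp add: alf_def)
  next
    case (Suc h)
    have "alf h t = alf (Suc h) t + pi" by (simp add: alf_def algebra_simps)
    then show ?case using Suc by simp
  qed
  then show "pb t = (-1) ^ h * (rb t * cos (alf h t))" "qb t = (-1) ^ h * (rb t * sin (alf h t))"
    by (simp_all add: pb_def qb_def)
qed

lemma rb_late: "t \<ge> 0 \<Longrightarrow> (rb t)\<^sup>2 \<ge> 3/5"
  using ub_mono[of 0 t] ub_0 by (simp add: rb_bounds)

text \<open>The bound 1/4 on the overshoot is the lower threshold of \<open>al\<close>, so the
  exchange belonging to the opposite half plane stays off.\<close>

lemma qb_turn: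
  assumes "t \<in> {real h * tau..real (Suc h) * tau}"
  shows "(-1) ^ h * qb t \<ge> - (1/4)"
proof -
  have e: "(-1) ^ h * qb t = rb t * sin (alf h t)" using pq_alf(2)[of t h] by (simp add: power_mult_distrib[symmetric] mult.assoc[symmetric])
  show ?thesis
  proof (cases "alf h t \<le> pi")
    case True
    then show ?thesis unfolding e using sin_ge_zero[of "alf h t"] alf_bounds[OF assms] rb_bounds[of t] mult_nonneg_nonneg[of "rb t" "sin (alf h t)"] by linarith
  next
    case False
    have "sin (alf h t) = - sin (alf h t - pi)" by simp
    moreover have "0 \<le> sin (alf h t - pi) \<and> sin (alf h t - pi) \<le> 1/4" using cos_sq_small[of "alf h t - pi"] False alf_bounds[OF assms] by simp
    moreover have "rb t * sin (alf h t - pi) \<le> 1 * (1/4)" using rb_bounds[of t] calculation(2) by (intro mult_mono) auto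
    ultimately show ?thesis unfolding e by simp
  qed
qed

lemma alf_tst: "alf h (tst h) = pi / 2" "tst h \<ge> real h * tau" "tst h \<le> real (Suc h) * tau"
proof -
  have d: "tst h - real h * tau = (pi / 2 - th 0) / \<epsilon>" by (simp add: tst_def tau_def diff_divide_distrib add_divide_distrib)
  have p: "pi / 2 - th 0 \<ge> 0" "pi / 2 - th 0 \<le> pi" using th_0 pi_gt3 by auto
  have "(pi / 2 - th 0) / \<epsilon> \<ge> 0" "(pi / 2 - th 0) / \<epsilon> \<le> tau" unfolding tau_def using p eps by (auto intro: divide_right_mono)
  then show a: "tst h \<ge> real h * tau" "tst h \<le> real (Suc h) * tau" using d by (auto simp: algebra_simps)
  have "real h * tau \<ge> 0" using tau_pos by simp
  then have "alf h (tst h) = th 0 + \<epsilon> * (tst h - real h * tau)" using a by (intro alf_eq) simp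
  then show "alf h (tst h) = pi / 2" unfolding d using eps by simp
qed

lemma alf_mono: "0 \<le> s \<Longrightarrow> s \<le> t \<Longrightarrow> alf h s \<le> alf h t"
  using th_mono[of s t] by (simp add: alf_def)

text \<open>The exchanges act only while |p| \<le> 1/8. Then the cosine of the angle is small, and
  between t and the top it is smaller still, so |q| \<ge> 1/2 on that whole stretch and
  \<open>al\<close> has already reached 1.\<close>

lemma qb_top:
  assumes t: "t \<in> {real h * tau..real (Suc h) * tau}" and p: "\<bar>pb t\<bar> \<le> 1/8"
    and s: "t \<le> s \<and> s \<le> tst h \<or> tst h \<le> s \<and> s \<le> t"
  shows "(-1) ^ h * qb s \<ge> 1/2"
proof -
  have t0: "t \<ge> 0" by (rule alf_bounds[OF t])
  have "real h * tau \<ge> 0" using tau_pos by simp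
  then have s0: "s \<ge> 0" using s t0 alf_tst(2)[of h] by auto
  have "(pb t)\<^sup>2 \<le> (1/8)\<^sup>2" using p by (simp add: abs_le_square_iff[symmetric])
  moreover have "(pb t)\<^sup>2 = (rb t)\<^sup>2 * (cos (alf h t))\<^sup>2" unfolding pq_alf(1)[of t h] by (simp add: power_mult_distrib power_even_abs flip: power_mult)
  moreover have "3/5 * (cos (alf h t))\<^sup>2 \<le> (rb t)\<^sup>2 * (cos (alf h t))\<^sup>2" using rb_late[OF t0] by (intro mult_right_mono) auto
  ultimately have ct: "(cos (alf h t))\<^sup>2 \<le> 1/36" by (simp add: power2_eq_square)
  have tpi: "alf h t \<le> pi"
  proof (rule ccontr)
    assume "\<not> alf h t \<le> pi"
    then have "(cos (alf h t - pi))\<^sup>2 \<ge> 15/16" using cos_sq_small[of "alf h t - pi"] alf_bounds[OF t] by simp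
    then show False using ct by simp
  qed
  have "\<bar>cos (alf h s)\<bar> \<le> \<bar>cos (alf h t)\<bar> \<and> 0 \<le> alf h s \<and> alf h s \<le> pi"
    using s
  proof
    assume s: "t \<le> s \<and> s \<le> tst h"
    have a: "0 \<le> alf h t" "alf h t \<le> alf h s" "alf h s \<le> pi / 2"
      using alf_bounds[OF t] alf_mono[of t s h] alf_mono[of s "tst h" h] s t0 s0 alf_tst(1)[of h] by auto
    have "0 \<le> cos (alf h s)" using a by (intro cos_ge_zero) auto
    moreover have "cos (alf h s) \<le> cos (alf h t)" using a by (intro cos_monotone_0_pi_le) auto
    ultimately show ?thesis using a by auto
  next
    assume s: "tst h \<le> s \<and> s \<le> t"
    have "0 \<le> tst h" using \<open>real h * tau \<ge> 0\<close> alf_tst(2)[of h] by simp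
    then have a: "pi / 2 \<le> alf h s" "alf h s \<le> alf h t"
      using alf_mono[of "tst h" s h] alf_mono[of s t h] s s0 alf_tst(1)[of h] by auto
    have "cos (alf h s) \<le> cos (pi / 2)" using a tpi by (intro cos_monotone_0_pi_le) auto
    moreover have "cos (alf h t) \<le> cos (alf h s)" using a tpi pi_gt3 by (intro cos_monotone_0_pi_le) auto
    ultimately show ?thesis using a tpi pi_gt3 by auto
  qed
  then have cs: "(cos (alf h s))\<^sup>2 \<le> 1/36" and sin0: "sin (alf h s) \<ge> 0" using ct sin_ge_zero[of "alf h s"] by (auto simp: abs_le_square_iff)
  have "35/36 \<le> (sin (alf h s))\<^sup>2" using sin_cos_squared_add[of "alf h s"] cs by linarith
  then have "3/5 * (35/36) \<le> (rb s)\<^sup>2 * (sin (alf h s))\<^sup>2" using rb_late[OF s0] by (intro mult_mono) auto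
  moreover have "(1/2)\<^sup>2 \<le> 3/5 * (35/36::real)" by (simp add: power2_eq_square)
  ultimately have "(1/2)\<^sup>2 \<le> (rb s * sin (alf h s))\<^sup>2" unfolding power_mult_distrib by (rule order_trans[rotated])
  then have "1/2 \<le> rb s * sin (alf h s)" by (rule power2_le_imp_le) (use sin0 rb_bounds[of s] in simp)
  moreover have "(-1) ^ h * qb s = rb s * sin (alf h s)" using pq_alf(2)[of s h] by (simp add: power_mult_distrib[symmetric] mult.assoc[symmetric])
  ultimately show ?thesis by simp
qed

lemma pb_ends: "(-1) ^ h * pb (real h * tau) \<ge> 1/8"
proof -
  have t: "real h * tau \<ge> 0" using tau_pos by simp
  have a: "alf h (real h * tau) = th 0" using alf_eq[OF t] by simp
  have c: "(cos (th 0))\<^sup>2 \<ge> 15/16" "cos (th 0) \<ge> 0" using cos_sq_small[OF th_0] by auto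
  have "3/5 * (15/16) \<le> (rb (real h * tau))\<^sup>2 * (cos (th 0))\<^sup>2" using rb_late[OF t] c by (intro mult_mono) auto
  moreover have "(1/8)\<^sup>2 \<le> 3/5 * (15/16::real)" by (simp add: power2_eq_square)
  ultimately have "(1/8)\<^sup>2 \<le> (rb (real h * tau) * cos (th 0))\<^sup>2" unfolding power_mult_distrib by (rule order_trans[rotated])
  then have "1/8 \<le> rb (real h * tau) * cos (th 0)" by (rule power2_le_imp_le) (use c rb_bounds[of "real h * tau"] in simp)
  then show ?thesis unfolding pq_alf(1)[of "real h * tau" h] a by (simp add: power_mult_distrib[symmetric] mult.assoc[symmetric])
qed

lemma pb_before: "t \<in> {real h * tau..tst h} \<Longrightarrow> (-1) ^ h * pb t \<ge> 0"
proof -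
  assume t: "t \<in> {real h * tau..tst h}"
  then have t': "t \<in> {real h * tau..real (Suc h) * tau}" using alf_tst(3)[of h] by auto
  have "alf h t \<le> pi / 2" using alf_mono[of t "tst h" h] alf_bounds[OF t'] t alf_tst(1)[of h] by auto
  then have "0 \<le> cos (alf h t)" using alf_bounds[OF t'] by (intro cos_ge_zero) auto
  then show ?thesis using rb_bounds[of t] unfolding pq_alf(1)[of t h] by (simp add: power_mult_distrib[symmetric] mult.assoc[symmetric])
qed

text \<open>Up to the constant fixed at the top of the turn, \<open>NN h t\<close> is the time spent with the rates \<open>m2\<close>.\<close>

definition NN :: "nat \<Rightarrow> real \<Rightarrow> real" where
  "NN h = (SOME g. g (tst h) = 0 \<and> (\<forall>t. (g has_real_derivative 1 - al (qb t)) (at t)))"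

lemma NN_props: "NN h (tst h) = 0" "(NN h has_real_derivative 1 - al (qb t)) (at t)"
proof -
  have "continuous_on UNIV qb" using base_eq(2) DERIV_isCont continuous_at_imp_continuous_on by blast
  then have "continuous_on UNIV (\<lambda>t. 1 - al (qb t))"
    by (intro continuous_intros continuous_on_compose2[OF smoothR_continuous[OF smoothR_cutoffs(3)]]) auto
  then have "\<exists>g. g (tst h) = 0 \<and> (\<forall>t. (g has_real_derivative 1 - al (qb t)) (at t))"
    using continuous_antiderivative by blast
  from someI_ex[OF this] show "NN h (tst h) = 0" "(NN h has_real_derivative 1 - al (qb t)) (at t)"
    by (auto simp: NN_def)
qed

lemma NN_mono: "s \<le> t \<Longrightarrow> NN h s \<le> NN h t" "s \<le> t \<Longrightarrow> s - NN h s \<le> t - NN h t"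
proof -
  assume st: "s \<le> t"
  show "NN h s \<le> NN h t"
    by (rule DERIV_nonneg_imp_nondecreasing[OF st]) (use NN_props(2)[of h] al_01 in \<open>force intro!: exI[of _ "1 - al (qb _)"]\<close>)
  show "s - NN h s \<le> t - NN h t"
  proof (rule DERIV_nonneg_imp_nondecreasing[OF st])
    fix x
    have "((\<lambda>t. t - NN h t) has_real_derivative 1 - (1 - al (qb x))) (at x)" by (intro DERIV_diff DERIV_ident NN_props)
    then show "\<exists>y. ((\<lambda>t. t - NN h t) has_real_derivative y) (at x) \<and> 0 \<le> y" using al_01 by fastforce
  qed
qed

text \<open>Normalising at the top makes \<open>NN\<close> vanish during the entire exchange of an
  upper half turn. The integrated rates of a pair then involve only their common \<open>m1\<close>
  and agree exactly, as \<open>rotation_solution\<close> demands.\<close>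

lemma NN_0:
  assumes t: "t \<in> {real h * tau..real (Suc h) * tau}" and p: "\<bar>pb t\<bar> \<le> 1/8" and h: "even h"
  shows "NN h t = 0"
proof -
  let ?S = "closed_segment t (tst h)"
  have "\<exists>c. \<forall>x\<in>?S. NN h x = c"
  proof (rule has_field_derivative_zero_constant)
    fix x assume "x \<in> ?S"
    then have "t \<le> x \<and> x \<le> tst h \<or> tst h \<le> x \<and> x \<le> t" by (auto simp: closed_segment_eq_real_ivl split: if_splits)
    then have "qb x \<ge> 1/2" using qb_top[OF t p] h by simp
    then have "al (qb x) = 1" by (rule cutoff_values)
    then show "(NN h has_real_derivative 0) (at x within ?S)" using NN_props(2)[of h x] by (simp add: has_field_derivative_at_within)
  qed simp
  then show ?thesis using NN_props(1)[of h] by (metis ends_in_segment(1,2))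
qed

end

lemma (in design) m_near2:
  "mu j - 2 * G \<le> m1 j" "m1 j \<le> mu j + 2 * G" "mu j - 2 * G \<le> m2 j" "m2 j \<le> mu j + 2 * G"
  "mu j - 2 * G \<le> m2 (\<sigma>1 j)" "m2 (\<sigma>1 j) \<le> mu j + 2 * G"
proof -
  have a: "\<bar>mu j - m1 j\<bar> \<le> G / 2" "\<bar>mu j - m2 j\<bar> \<le> G / 2" "\<bar>mu (\<sigma>1 j) - m2 (\<sigma>1 j)\<bar> \<le> G / 2" using m_near by auto
  have "\<bar>mu (\<sigma>1 j) - mu j\<bar> \<le> G"
  proof (cases "even j")
    case True then show ?thesis using gap_abs[of j] by (simp add: \<sigma>1_def)
  next
    case False
    then obtain i where "j = Suc i" by (cases j) auto
    then show ?thesis using gap_abs[of i] False by (simp add: \<sigma>1_def abs_minus_commute)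
  qed
  then show "mu j - 2 * G \<le> m1 j" "m1 j \<le> mu j + 2 * G" "mu j - 2 * G \<le> m2 j" "m2 j \<le> mu j + 2 * G"
    "mu j - 2 * G \<le> m2 (\<sigma>1 j)" "m2 (\<sigma>1 j) \<le> mu j + 2 * G"
    using a G_pos unfolding abs_le_iff by linarith+
qed

section \<open>Paths of modes under the alternating exchanges\<close>

definition sgh :: "nat \<Rightarrow> nat \<Rightarrow> nat" where "sgh h = (if even h then \<sigma>1 else \<sigma>2)"
definition zth :: "nat \<Rightarrow> nat \<Rightarrow> real" where "zth h = (if even h then \<zeta>1 else \<zeta>2)"

lemma sgh_invol: "sgh h (sgh h j) = j"
  by (simp add: sgh_def \<sigma>_invol)

lemma sgh_le: "sgh h j \<le> j + 1" "j \<le> sgh h j + 1"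
  by (auto simp: sgh_def \<sigma>1_def \<sigma>2_def)

lemma zth_props: "sgh h j \<noteq> j \<Longrightarrow> zth h j * zth h (sgh h j) = -1" "sgh h j = j \<Longrightarrow> zth h j = 0"
  "sgh h j \<noteq> j \<Longrightarrow> \<bar>zth h j\<bar> = 1"
  using odd_pos[of j] by (auto simp: sgh_def zth_def \<sigma>1_def \<sigma>2_def \<zeta>1_def \<zeta>2_def split: if_splits)

text \<open>Position after h half turns of the amplitude that started in mode k.\<close>

primrec pth :: "nat \<Rightarrow> nat \<Rightarrow> nat" where
  "pth 0 k = k" | "pth (Suc h) k = sgh h (pth h k)"

lemma pth_inj: "pth h k = pth h k' \<longleftrightarrow> k = k'"
proof (induction h)
  case (Suc h)
  then show ?case using sgh_invol by (metis pth.simps(2))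
qed simp

lemma pth_surj: "\<exists>k. pth h k = j"
proof (induction h arbitrary: j)
  case (Suc h)
  obtain k where "pth h k = sgh h j" using Suc by blast
  then show ?case using sgh_invol by (metis pth.simps(2))
qed simp

lemma pth_0: "pth h 0 = h"
  by (induction h) (auto simp: sgh_def \<sigma>1_def \<sigma>2_def)

text \<open>The descent reaches 0 after 2i + 1 half turns. The next one is of the second kind and
  fixes 0, so the mode waits once before it climbs; hence h - (2i + 2) rather than h - (2i +
  1).\<close>

lemma pth_odd: "pth h (2 * i + 1) = (if h \<le> 2 * i + 1 then 2 * i + 1 - h else h - (2 * i + 2))"
proof (induction h)
  case (Suc h)
  show ?case
  proof (cases "h \<le> 2 * i + 1")
    case True
    have p: "pth (Suc h) (2 * i + 1) = sgh h (2 * i + 1 - h)" using Suc True by simp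
    show ?thesis
    proof (cases "h = 2 * i + 1")
      case True then show ?thesis using p by (simp add: sgh_def \<sigma>2_def)
    next
      case False
      then have "odd (2 * i + 1 - h) \<longleftrightarrow> even h" "2 * i + 1 - h \<noteq> 0" using True by auto
      then show ?thesis unfolding p using False True by (auto simp: sgh_def \<sigma>1_def \<sigma>2_def)
    qed
  next
    case False
    then have p: "pth (Suc h) (2 * i + 1) = sgh h (h - (2 * i + 2))" using Suc by simp
    have "even (h - (2 * i + 2)) \<longleftrightarrow> even h" "odd h \<Longrightarrow> h - (2 * i + 2) \<noteq> 0" using False by presburger+
    then show ?thesis unfolding p using False by (auto simp: sgh_def \<sigma>1_def \<sigma>2_def)
  qed
qed simp

section \<open>Amplitude factors of one half turn\<close>

context turns
begin

definition Mh :: "nat \<Rightarrow> nat \<Rightarrow> real \<Rightarrow> real" where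
  "Mh h j t = (if even h then m1 j * (t - NN h t) + m2 j * NN h t else m2 j * t)"
definition Mult :: "nat \<Rightarrow> nat \<Rightarrow> real" where
  "Mult h j = exp (Mh h (sgh h j) (real h * tau) - Mh h j (real (Suc h) * tau))"
definition nxt :: "nat \<Rightarrow> (nat \<Rightarrow> real) \<Rightarrow> nat \<Rightarrow> real" where
  "nxt h X j = (if sgh h j = j then 1 else zth h j) * Mult h j * X (sgh h j)"
definition psh :: "nat \<Rightarrow> real \<Rightarrow> real" where
  "psh h t = (if even h then Su (pb t) else Sl (pb t))"
definition psh' :: "nat \<Rightarrow> real \<Rightarrow> real" where
  "psh' h t = (if even h then Su' (pb t) else Sl' (pb t)) * (\<epsilon> * fG0 (pb t) (qb t))"

lemma psh_deriv: "(psh h has_real_derivative psh' h t) (at t)"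
  unfolding psh_def[abs_def] psh'_def using DERIV_chain2[OF S_derivs(2) base_eq(1)] DERIV_chain2[OF S_derivs(3) base_eq(1)] by auto

lemma turn_memI: "real h * tau \<in> {real h * tau..real (Suc h) * tau}" "real (Suc h) * tau \<in> {real h * tau..real (Suc h) * tau}"
  using tau_pos by (auto simp: algebra_simps)

lemma Mh_mono: "s \<le> t \<Longrightarrow> Mh h j s \<le> Mh h j t"
  unfolding Mh_def using NN_mono[of s t h] m_pos[of j] by (auto intro!: add_mono mult_left_mono)

lemma NN_signs: "NN h (real h * tau) \<le> 0" "NN h (real (Suc h) * tau) \<ge> 0"
  using NN_mono(1)[OF alf_tst(2), of h h] NN_mono(1)[OF alf_tst(3), of h h] by (simp_all add: NN_props)

text \<open>Before an exchange starts, the factor of the amplitude to be transferred might exceed 1,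
  but it is multiplied by a vanishing sine. Once the exchange has started, \<open>NN\<close> is
  nonnegative and the factor is at most 1.\<close>

lemma Mh_cross:
  assumes t: "t \<in> {real h * tau..real (Suc h) * tau}" and s: "sin (psh h t) \<noteq> 0"
  shows "Mh h (sgh h j) (real h * tau) \<le> Mh h j t"
proof (cases "even h")
  case True
  have N: "NN h t \<ge> 0"
  proof (cases "t \<ge> tst h")
    case True then show ?thesis using NN_mono(1)[of "tst h" t h] NN_props(1) by simp
  next
    case False
    then have "pb t \<ge> 0" using pb_before[of t h] t \<open>even h\<close> by simp
    moreover have "pb t < 1/8" using s cutoff_values(6)[of "pb t"] \<open>even h\<close> by (cases "pb t < 1/8") (auto simp: psh_def)
    ultimately show ?thesis using NN_0[OF t] \<open>even h\<close> by simp
  qed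
  have "m1 j * (real h * tau - NN h (real h * tau)) \<le> m1 j * (t - NN h t)"
    using NN_mono(2)[of "real h * tau" t h] t m_pos(1)[of j] by (intro mult_left_mono) auto
  moreover have "m2 (\<sigma>1 j) * NN h (real h * tau) \<le> 0" using NN_signs(1)[of h] m_pos(2)[of "\<sigma>1 j"] by (simp add: mult_nonneg_nonpos)
  moreover have "0 \<le> m2 j * NN h t" using N m_pos(2)[of j] by simp
  ultimately show ?thesis using True by (simp add: Mh_def sgh_def m_\<sigma>)
next
  case False
  then show ?thesis using t m_pos(2)[of j] by (simp add: Mh_def sgh_def m_\<sigma>)
qed

text \<open>The exponent is the time average of m1 j, m2 j and m2 (\<sigma>1 j), each within 2 G of
  mu j, so the final position j alone describes the factor. The resulting error is linear in the
  number of half turns, against gains that are quadratic.\<close>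

lemma Mult_bounds: "exp (- tau * (mu j + 2 * G)) \<le> Mult h j" "Mult h j \<le> exp (- tau * (mu j - 2 * G))" "Mult h j \<le> 1"
proof -
  let ?t0 = "real h * tau" and ?t1 = "real (Suc h) * tau"
  have t: "?t1 = ?t0 + tau" by (simp add: algebra_simps)
  have "\<exists>a b d. a \<ge> 0 \<and> b \<ge> 0 \<and> d \<ge> 0 \<and> a + b + d = tau \<and> Mh h (sgh h j) ?t0 - Mh h j ?t1 = - (m1 j * a + m2 j * b + m2 (\<sigma>1 j) * d)"
  proof (cases "even h")
    case True
    show ?thesis
    proof (intro exI conjI)
      show "0 \<le> (?t1 - NN h ?t1) - (?t0 - NN h ?t0)" using NN_mono(2)[of ?t0 ?t1 h] tau_pos t by simp
      show "0 \<le> NN h ?t1" "0 \<le> - NN h ?t0" using NN_signs by simp_all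
      show "((?t1 - NN h ?t1) - (?t0 - NN h ?t0)) + NN h ?t1 + - NN h ?t0 = tau" using t by simp
      show "Mh h (sgh h j) ?t0 - Mh h j ?t1 = - (m1 j * ((?t1 - NN h ?t1) - (?t0 - NN h ?t0)) + m2 j * NN h ?t1 + m2 (\<sigma>1 j) * - NN h ?t0)"
        using True unfolding Mh_def sgh_def by (simp only: if_True m_\<sigma>) (simp only: algebra_simps)
    qed
  next
    case False
    then have "Mh h (sgh h j) ?t0 - Mh h j ?t1 = - (m1 j * 0 + m2 j * tau + m2 (\<sigma>1 j) * 0)"
      by (simp add: Mh_def sgh_def m_\<sigma> algebra_simps)
    then show ?thesis using tau_pos by (intro exI[of _ 0] exI[of _ tau]) auto
  qed
  then obtain a b d where abd: "a \<ge> 0" "b \<ge> 0" "d \<ge> 0" "a + b + d = tau"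
    and M: "Mh h (sgh h j) ?t0 - Mh h j ?t1 = - (m1 j * a + m2 j * b + m2 (\<sigma>1 j) * d)" by blast
  have "m1 j * a + m2 j * b + m2 (\<sigma>1 j) * d \<le> (mu j + 2 * G) * a + (mu j + 2 * G) * b + (mu j + 2 * G) * d"
    using abd m_near2[of j] by (intro add_mono mult_right_mono) auto
  also have "\<dots> = tau * (mu j + 2 * G)" unfolding abd(4)[symmetric] by (simp add: algebra_simps)
  finally show "exp (- tau * (mu j + 2 * G)) \<le> Mult h j" unfolding Mult_def M by simp
  have "(mu j - 2 * G) * a + (mu j - 2 * G) * b + (mu j - 2 * G) * d \<le> m1 j * a + m2 j * b + m2 (\<sigma>1 j) * d"
    using abd m_near2[of j] by (intro add_mono mult_right_mono) auto
  moreover have "(mu j - 2 * G) * a + (mu j - 2 * G) * b + (mu j - 2 * G) * d = tau * (mu j - 2 * G)"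
    unfolding abd(4)[symmetric] by (simp add: algebra_simps)
  ultimately show "Mult h j \<le> exp (- tau * (mu j - 2 * G))" unfolding Mult_def M by simp
  show "Mult h j \<le> 1"
    using mult_nonneg_nonneg[OF less_imp_le[OF m_pos(1)] abd(1), of j] mult_nonneg_nonneg[OF less_imp_le[OF m_pos(2)] abd(2), of j]
      mult_nonneg_nonneg[OF less_imp_le[OF m_pos(2)] abd(3), of "\<sigma>1 j"] unfolding Mult_def M by simp
qed

lemma psh_ends: "psh h (real h * tau) = 0" "psh h (real (Suc h) * tau) = pi / 2"
proof -
  have "(-1) ^ h * pb (real h * tau) \<ge> 1/8" "(-1) ^ Suc h * pb (real (Suc h) * tau) \<ge> 1/8" using pb_ends by blast+
  then show "psh h (real h * tau) = 0" "psh h (real (Suc h) * tau) = pi / 2"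
    using cutoff_values by (cases "even h"; simp add: psh_def)+
qed

text \<open>Since p^2 + q^2 \<ge> 3/5 from time 0 on, |p| \<le> 1/2 and |q| \<le> 1/4 cannot hold
  together: the values of p used in the corridor are passed again only at large |q|.\<close>

lemma late_zero:
  assumes t: "t \<ge> 0"
  shows "ap (pb t) * chq (qb t) = 0" "betap (pb t) (qb t) = 0" "chk (pb t) = 0 \<or> \<bar>qb t\<bar> > 1/4"
proof -
  have u: "3/5 \<le> (pb t)\<^sup>2 + (qb t)\<^sup>2" using pq_sq ub_mono[OF t] ub_0 by simp
  have k: "\<not> (\<bar>pb t\<bar> \<le> 1/2 \<and> \<bar>qb t\<bar> \<le> 1/4)"
  proof
    assume "\<bar>pb t\<bar> \<le> 1/2 \<and> \<bar>qb t\<bar> \<le> 1/4"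
    then have "(pb t)\<^sup>2 \<le> (1/2)\<^sup>2" "(qb t)\<^sup>2 \<le> (1/4)\<^sup>2" by (auto simp: abs_le_square_iff[symmetric])
    then show False using u by (simp add: power2_eq_square)
  qed
  show "ap (pb t) * chq (qb t) = 0"
    using k cutoff_values(12)[of "pb t"] cutoff_values(14)[of "qb t"] by (cases "pb t \<le> 1/5 \<or> pb t \<ge> 1/2") auto
  show "betap (pb t) (qb t) = 0"
    using k cutoff_values(1)[of "pb t"] cutoff_values(14)[of "qb t"] by (cases "pb t \<le> 3/10 \<or> pb t \<ge> 2/5") (auto simp: betap_def)
  show "chk (pb t) = 0 \<or> \<bar>qb t\<bar> > 1/4"
    using k cutoff_values(15)[of "pb t"] by (cases "pb t \<le> 1/10 \<or> pb t \<ge> 1/5") auto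
qed

lemma vec_extend: "B \<le> B' \<Longrightarrow> (\<And>j. j \<ge> B \<Longrightarrow> X j = 0) \<Longrightarrow> vec p q X B = vec p q X B'"
  unfolding vec_def by (intro arg_cong2[where f = "(+)"] refl sum.mono_neutral_left) auto

end

text \<open>Only \<open>beta1\<close> acts on even half turns and only \<open>beta2\<close> on odd
  ones, and either one is the velocity of the angle \<open>psh\<close>, because the window in q is 1
  wherever this angle moves. The bound \<epsilon>/2 leaves room for counting each amplitude twice
  while a pair shares it.\<close>

lemma (in flow) half_turn:
  assumes z: "\<And>j. j \<ge> B \<Longrightarrow> X j = 0" and s: "\<And>A. finite A \<Longrightarrow> (\<Sum>j\<in>A. \<bar>X j\<bar>) \<le> \<epsilon> / 2"
  shows "T tau (vec (pb (real h * tau)) (qb (real h * tau)) X B) =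
    vec (pb (real (Suc h) * tau)) (qb (real (Suc h) * tau)) (nxt h X) (Suc B)"
proof -
  define t0 t1 where "t0 = real h * tau" and "t1 = real (Suc h) * tau"
  define x where "x j t = (if sgh h j = j then exp (Mh h j t0 - Mh h j t) * X j
    else cos (psh h t) * exp (Mh h j t0 - Mh h j t) * X j + zth h j * sin (psh h t) * exp (Mh h (sgh h j) t0 - Mh h j t) * X (sgh h j))" for j t
  define mm where "mm j t = (if even h then al (qb t) * m1 j + (1 - al (qb t)) * m2 j else m2 j)" for j t
  have Md: "(Mh h j has_real_derivative mm j t) (at t)" for j t
  proof (cases "even h")
    case True
    have "((\<lambda>t. m1 j * (t - NN h t) + m2 j * NN h t) has_real_derivative m1 j * (1 - (1 - al (qb t))) + m2 j * (1 - al (qb t))) (at t)"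
      by (intro DERIV_add DERIV_cmult DERIV_diff DERIV_ident NN_props)
    then show ?thesis using True by (simp add: Mh_def[abs_def] mm_def mult.commute)
  next
    case False
    then show ?thesis using DERIV_cmult[OF DERIV_ident, of "m2 j" t] by (simp add: Mh_def[abs_def] mm_def)
  qed
  have zx: "x j t = 0" if "j \<ge> Suc B" for j t
  proof -
    have "sgh h j \<ge> B" using sgh_le(2)[of j h] that by simp
    then show ?thesis using z that by (simp add: x_def)
  qed
  have rot: "(x j has_real_derivative - mm j t * x j t + psh' h t * (zth h j * x (sgh h j) t)) (at t)"
    if t: "t \<in> {t0..t1}" for j t
    unfolding x_def
  proof (rule rotation_solution[where M = "Mh h" and m = mm and \<psi> = "psh h" and \<psi>' = "psh' h t" and \<sigma> = "sgh h" and \<zeta> = "zth h" and ?t0.0 = t0 and ?x0.0 = X])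
    show "Mh h (sgh h j) t = Mh h j t" if "psh' h t \<noteq> 0" for j
    proof (cases "even h")
      case True
      have "\<bar>pb t\<bar> \<le> 1/8" using cutoff_values(4)[of "pb t"] that True by (cases "\<bar>pb t\<bar> \<le> 1/8") (auto simp: psh'_def)
      then have "NN h t = 0" using NN_0[of t h] t True by (simp add: t0_def t1_def)
      then show ?thesis using True by (simp add: Mh_def sgh_def m_\<sigma>)
    qed (simp add: Mh_def sgh_def m_\<sigma>)
  qed (use Md psh_deriv sgh_invol zth_props in auto)
  have rhs: "rhs (\<lambda>_. 0) (pb t) (qb t) (\<lambda>i. x i t) j = - mm j t * x j t + psh' h t * (zth h j * x (sgh h j) t)"
    if t: "t \<in> {t0..t1}" for j t
  proof -
    have t': "t \<in> {real h * tau..real (Suc h) * tau}" using t by (simp add: t0_def t1_def)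
    note b0 = late_zero(2)[OF alf_bounds(1)[OF t']]
    show ?thesis
    proof (cases "even h")
      case True
      have "- qb t \<le> 1/4" using qb_turn[OF t'] True by simp
      then have b2: "beta2 (pb t) (qb t) = 0" using cutoff_values(10)[of "- qb t"] by (simp add: beta2_def)
      have "al (qb t) * Su' (pb t) = Su' (pb t)"
      proof (cases "\<bar>pb t\<bar> \<le> 1/8")
        case p: True
        have "qb t \<ge> 1/2" using qb_top[OF t' p, of t] True linear[of t "tst h"] by auto
        then show ?thesis using cutoff_values(11) by simp
      qed (use cutoff_values(4)[of "pb t"] in auto)
      then have "beta1 (pb t) (qb t) = Su' (pb t) * fG0 (pb t) (qb t)" by (simp add: beta1_def)
      then show ?thesis using True by (simp add: rhs_def b0 b2 mm_def psh'_def zth_def sgh_def)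
    next
      case False
      have q: "qb t \<le> 1/4" using qb_turn[OF t'] False by simp
      then have b1: "beta1 (pb t) (qb t) = 0" and a: "al (qb t) = 0" using cutoff_values(10)[of "qb t"] by (auto simp: beta1_def)
      have "al (- qb t) * Sl' (pb t) = Sl' (pb t)"
      proof (cases "\<bar>pb t\<bar> \<le> 1/8")
        case p: True
        have "- qb t \<ge> 1/2" using qb_top[OF t' p, of t] False linear[of t "tst h"] by auto
        then show ?thesis using cutoff_values(11) by simp
      qed (use cutoff_values(5)[of "pb t"] in auto)
      then have "beta2 (pb t) (qb t) = Sl' (pb t) * fG0 (pb t) (qb t)" by (simp add: beta2_def)
      then show ?thesis using False by (simp add: rhs_def b0 b1 a mm_def psh'_def zth_def sgh_def)
    qed
  qed
  have "T (t1 - t0) (vec (pb t0) (qb t0) (\<lambda>j. x j t0) (Suc B)) = vec (pb t1) (qb t1) (\<lambda>j. x j t1) (Suc B)"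
  proof (rule flow_trajectory[where \<kappa> = "\<lambda>_. 0"])
    show "t0 \<le> t1" using turn_memI(2)[of h] by (simp add: t0_def t1_def)
    fix t assume t: "t \<in> {t0..t1}"
    have t': "t \<in> {real h * tau..real (Suc h) * tau}" using t by (simp add: t0_def t1_def)
    note tn = alf_bounds(1)[OF t']
    show "(pb has_real_derivative \<epsilon> * fG0 (pb t) (qb t)) (at t)" by (rule base_eq)
    show "(qb has_real_derivative - (m2 0 * (ap (pb t) * chq (qb t)) * (\<epsilon> * cutoff (qb t / \<epsilon>))) + \<epsilon> * (fG1 (pb t) (qb t) - betap (pb t) (qb t) * x 0 t)) (at t)"
      using base_eq(2)[of t] by (simp add: late_zero[OF tn])
    show "(x j has_real_derivative rhs (\<lambda>_. 0) (pb t) (qb t) (\<lambda>i. x i t) j) (at t)" for j using rot[OF t] rhs[OF t] by simp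
    show "x j t = 0 \<and> rhs (\<lambda>_. 0) (pb t) (qb t) (\<lambda>i. x i t) j = 0" if "Suc B \<le> j" for j
    proof -
      have "x (sgh h j) t = 0"
      proof (cases "sgh h j = j")
        case False
        have "sgh h j \<ge> B" using sgh_le(2)[of j h] that by simp
        then show ?thesis using False that z by (simp add: x_def sgh_invol)
      qed (use zx that in simp)
      then show ?thesis using zx[OF that] rhs[OF t, of j] by simp
    qed
    \<comment> \<open>Both factors are at most 1: by monotonicity of \<open>Mh\<close> for the
      amplitude that stays, by \<open>Mh_cross\<close> for the one that moves.\<close>
    have xb: "\<bar>x j t\<bar> \<le> \<bar>X j\<bar> + \<bar>X (sgh h j)\<bar>" for j
    proof -
      have E: "exp (Mh h j t0 - Mh h j t) \<le> 1" using Mh_mono[of t0 t h j] t by simp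
      have E': "\<bar>sin (psh h t)\<bar> * exp (Mh h (sgh h j) t0 - Mh h j t) \<le> 1"
      proof (cases "sin (psh h t) = 0")
        case False
        then have "exp (Mh h (sgh h j) t0 - Mh h j t) \<le> 1" using Mh_cross[OF t' False, of j] by (simp add: t0_def)
        then show ?thesis by (intro mult_le_one) auto
      qed simp
      show ?thesis
      proof (cases "sgh h j = j")
        case True
        then show ?thesis using mult_right_mono[OF E, of "\<bar>X j\<bar>"] by (simp add: x_def abs_mult)
      next
        case False
        have "\<bar>cos (psh h t)\<bar> * exp (Mh h j t0 - Mh h j t) \<le> 1" using E by (intro mult_le_one) auto
        then have "\<bar>cos (psh h t)\<bar> * exp (Mh h j t0 - Mh h j t) * \<bar>X j\<bar> \<le> 1 * \<bar>X j\<bar>" by (rule mult_right_mono) simp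
        moreover have "\<bar>sin (psh h t)\<bar> * exp (Mh h (sgh h j) t0 - Mh h j t) * \<bar>X (sgh h j)\<bar> \<le> 1 * \<bar>X (sgh h j)\<bar>" using E' by (rule mult_right_mono) simp
        ultimately show ?thesis
          using False abs_triangle_ineq[of "cos (psh h t) * exp (Mh h j t0 - Mh h j t) * X j" "zth h j * sin (psh h t) * exp (Mh h (sgh h j) t0 - Mh h j t) * X (sgh h j)"]
          by (simp add: x_def abs_mult zth_props(3))
      qed
    qed
    have "(\<Sum>j<Suc B. \<bar>x j t\<bar>) \<le> (\<Sum>j<Suc B. \<bar>X j\<bar>) + (\<Sum>j<Suc B. \<bar>X (sgh h j)\<bar>)"
      unfolding sum.distrib[symmetric] by (rule sum_mono) (rule xb)
    also have "(\<Sum>j<Suc B. \<bar>X (sgh h j)\<bar>) = (\<Sum>j\<in>sgh h ` {..<Suc B}. \<bar>X j\<bar>)"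
      by (subst sum.reindex) (auto intro!: inj_onI, metis sgh_invol)
    finally show "\<bar>pb t\<bar> \<le> 1 \<and> \<bar>qb t\<bar> \<le> 1 \<and> (\<Sum>j<Suc B. \<bar>x j t\<bar>) \<le> \<epsilon>"
      using pq_abs[of t] s[of "{..<Suc B}"] s[of "sgh h ` {..<Suc B}"] by simp
    show "chk (pb t) *\<^sub>R kick \<epsilon> W (qb t) = chk (pb t) *\<^sub>R (\<Sum>j<Suc B. 0 *\<^sub>R f j)"
      using late_zero(3)[OF tn] kick_outside[OF eps(1), of "qb t" W] eps by (cases "qb t \<le> 0") auto
  qed simp_all
  moreover have "t1 - t0 = tau" by (simp add: t0_def t1_def algebra_simps)
  moreover have "(\<lambda>j. x j t0) = X" using psh_ends(1)[of h] by (auto simp: fun_eq_iff x_def t0_def)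
  moreover have "(\<lambda>j. x j t1) = nxt h X"
  proof
    fix j
    have p: "psh h t1 = pi / 2" unfolding t1_def by (rule psh_ends)
    show "x j t1 = nxt h X j"
      unfolding x_def nxt_def Mult_def t0_def[symmetric] t1_def[symmetric] p by simp
  qed
  moreover have "vec (pb t0) (qb t0) X B = vec (pb t0) (qb t0) X (Suc B)" by (rule vec_extend) (use z in auto)
  ultimately show ?thesis by (simp add: t0_def t1_def)
qed

section \<open>Composition of half turns\<close>

context turns
begin

primrec XX :: "(nat \<Rightarrow> real) \<Rightarrow> nat \<Rightarrow> nat \<Rightarrow> real" where
  "XX X 0 = X" | "XX X (Suc h) = nxt h (XX X h)"
text \<open>Signed factor collected in h half turns by the amplitude that started in mode k; in
  terms of starting modes the evolution is diagonal.\<close>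

primrec cc :: "nat \<Rightarrow> nat \<Rightarrow> real" where
  "cc 0 k = 1" | "cc (Suc h) k = (if sgh h (pth h k) = pth h k then 1 else zth h (pth (Suc h) k)) * Mult h (pth (Suc h) k) * cc h k"

lemma XX_pth: "XX X h (pth h k) = cc h k * X k"
proof (induction h)
  case (Suc h)
  have "sgh h (sgh h (pth h k)) = sgh h (pth h k) \<longleftrightarrow> sgh h (pth h k) = pth h k" using sgh_invol by metis
  then show ?case using Suc by (simp add: nxt_def sgh_invol)
qed simp

lemma XX_diff: "XX X h j - XX Y h j = XX (\<lambda>k. X k - Y k) h j"
  by (induction h arbitrary: j) (auto simp: nxt_def right_diff_distrib[symmetric])

lemma Mult_pos: "Mult h j > 0"
  by (simp add: Mult_def)

lemma cc_Suc: "\<bar>cc (Suc h) k\<bar> = Mult h (pth (Suc h) k) * \<bar>cc h k\<bar>"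
proof -
  have "sgh h (sgh h (pth h k)) = sgh h (pth h k) \<longleftrightarrow> sgh h (pth h k) = pth h k" using sgh_invol by metis
  then show ?thesis using zth_props(3)[of h "sgh h (pth h k)"] Mult_pos[of h "sgh h (pth h k)"] by (simp add: abs_mult)
qed

lemma cc_bounds: "cc h k \<noteq> 0" "\<bar>cc h k\<bar> \<le> 1"
proof (induction h)
  case (Suc h)
  { case 1
    show ?case using cc_Suc[of h k] Suc(1) Mult_pos[of h "pth (Suc h) k"] by (auto simp del: cc.simps pth.simps)
  next
    case 2
    show ?case unfolding cc_Suc using Suc(2) Mult_bounds(3) Mult_pos less_imp_le by (intro mult_le_one) auto }
qed auto

lemma XX_sum:
  assumes "finite Ks" "\<And>k. k \<notin> Ks \<Longrightarrow> X k = 0" "finite A"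
  shows "(\<Sum>j\<in>A. \<bar>XX X h j\<bar>) \<le> (\<Sum>k\<in>Ks. \<bar>cc h k * X k\<bar>)"
proof -
  have z: "XX X h j = 0" if "j \<notin> pth h ` Ks" for j
  proof -
    obtain k where "pth h k = j" using pth_surj by blast
    then show ?thesis using that XX_pth[of X h k] assms(2)[of k] by auto
  qed
  have "(\<Sum>j\<in>A. \<bar>XX X h j\<bar>) = (\<Sum>j\<in>A \<inter> pth h ` Ks. \<bar>XX X h j\<bar>)"
    by (rule sum.mono_neutral_right) (use assms(3) z in auto)
  also have "\<dots> \<le> (\<Sum>j\<in>pth h ` Ks. \<bar>XX X h j\<bar>)" by (rule sum_mono2) (use assms(1) in auto)
  also have "\<dots> = (\<Sum>k\<in>Ks. \<bar>cc h k * X k\<bar>)" by (subst sum.reindex) (auto simp: inj_on_def pth_inj XX_pth)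
  finally show ?thesis .
qed

lemma XX_zero: "(\<And>j. j \<ge> B \<Longrightarrow> X j = 0) \<Longrightarrow> j \<ge> B + h \<Longrightarrow> XX X h j = 0"
proof (induction h arbitrary: j)
  case (Suc h)
  have "sgh h j \<ge> B + h" using sgh_le(2)[of j h] Suc.prems(2) by simp
  then show ?case using Suc by (simp add: nxt_def)
qed simp

end

lemma (in flow) turns_trajectory:
  assumes z: "\<And>j. j \<ge> B \<Longrightarrow> X j = 0" and s: "(\<Sum>j<B. \<bar>X j\<bar>) \<le> \<epsilon> / 2"
  shows "T (real h * tau) (vec (pb 0) (qb 0) X B) = vec (pb (real h * tau)) (qb (real h * tau)) (XX X h) (B + h)"
proof (induction h)
  case 0
  have "T 0 u = u" for u using sg_mild[of u] by (simp add: mild_solution_def)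
  then show ?case by simp
next
  case (Suc h)
  have "real (Suc h) * tau = real h * tau + tau" by (simp add: algebra_simps)
  then have "T (real (Suc h) * tau) (vec (pb 0) (qb 0) X B) = T tau (T (real h * tau) (vec (pb 0) (qb 0) X B))"
    using sg_add[of "real h * tau" tau] tau_pos by simp
  also have "\<dots> = T tau (vec (pb (real h * tau)) (qb (real h * tau)) (XX X h) (B + h))" by (simp add: Suc)
  also have "\<dots> = vec (pb (real (Suc h) * tau)) (qb (real (Suc h) * tau)) (nxt h (XX X h)) (Suc (B + h))"
  proof (rule half_turn)
    show "XX X h j = 0" if "j \<ge> B + h" for j by (rule XX_zero[OF z that])
    fix A :: "nat set" assume A: "finite A"
    have "(\<Sum>j\<in>A. \<bar>XX X h j\<bar>) \<le> (\<Sum>k<B. \<bar>cc h k * X k\<bar>)" by (rule XX_sum) (use z A in auto)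
    also have "\<dots> \<le> (\<Sum>k<B. \<bar>X k\<bar>)" using mult_right_mono[OF cc_bounds(2)] by (intro sum_mono) (auto simp: abs_mult)
    finally show "(\<Sum>j\<in>A. \<bar>XX X h j\<bar>) \<le> \<epsilon> / 2" using s by simp
  qed
  finally show ?case by simp
qed

section \<open>Orbits leaving the origin\<close>

text \<open>The point is reached at each integer time n from the orbit itself: from U (s - n) when n
  \<ge> s, and from its forward part for the finitely many smaller n.\<close>

lemma (in semiflow) backward_orbit_in_attractor:
  assumes A: "\<forall>z x. bounded (range z) \<longrightarrow> (\<forall>n. T (real n) (z n) = x) \<longrightarrow> x \<in> A"
    and U: "\<And>t. t \<le> 0 \<Longrightarrow> T (- t) (U t) = U0" and b: "bounded (U ` {..0})" and s: "s \<ge> 0"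
  shows "T s U0 \<in> A"
proof -
  define z where "z n = (if real n \<ge> s then U (s - real n) else T (s - real n) U0)" for n
  obtain m where m: "s \<le> real m" using real_arch_simple by blast
  have "range z \<subseteq> U ` {..0} \<union> z ` {..m}"
  proof
    fix y assume "y \<in> range z"
    then obtain n where n: "y = z n" by blast
    show "y \<in> U ` {..0} \<union> z ` {..m}" using n m by (cases "n \<le> m") (auto simp: z_def)
  qed
  moreover have "bounded (U ` {..0} \<union> z ` {..m})" using b by (simp add: finite_imp_bounded)
  ultimately have "bounded (range z)" using bounded_subset by blast
  moreover have "T (real n) (z n) = T s U0" for n
  proof (cases "real n \<ge> s")
    case True
    have "T (real n - s + s) (U (s - real n)) = T s (T (real n - s) (U (s - real n)))" by (rule sg_add) (use True s in auto)
    also have "T (real n - s) (U (s - real n)) = U0" using U[of "s - real n"] True by simp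
    finally show ?thesis using True by (simp add: z_def)
  next
    case False
    then show ?thesis using sg_add[of "s - real n" "real n" U0] by (simp add: z_def)
  qed
  ultimately show ?thesis using A by blast
qed

section \<open>Timing of the corridor\<close>

context base
begin

lemma ub_at: "a > 0 \<Longrightarrow> ub (- (ln a / (2 * \<epsilon>))) = 1 / (1 + 2/3 * a)"
  using eps by (simp add: ub_def)

lemma rb_leI: "0 \<le> a \<Longrightarrow> ub t \<le> a\<^sup>2 \<Longrightarrow> rb t \<le> a"
  using power2_le_imp_le[of "rb t" a] by (simp add: rb_bounds)

lemma rb_geI: "0 \<le> a \<Longrightarrow> a\<^sup>2 \<le> ub t \<Longrightarrow> a \<le> rb t"
  using power2_le_imp_le[of a "rb t"] rb_bounds[of t] by simp

text \<open>The kick begins at time -T2, when the radius is 1/10; at time -\<open>T5\<close> the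
  radius is 1/5, where the kick ends and the damping of \<open>e 1\<close> begins. The numbers 297/2
  and 36 solve 1 + 2a/3 = 100 and 1 + 2a/3 = 25.\<close>

definition T2 :: real where "T2 = ln (297/2) / (2 * \<epsilon>)"
definition T5 :: real where "T5 = ln 36 / (2 * \<epsilon>)"
definition ZZ :: "real \<Rightarrow> real" where
  "ZZ = (SOME g. g (- T2) = 0 \<and> (\<forall>t. (g has_real_derivative chk (rb t)) (at t)))"
text \<open>Duhamel integral of the kick for a mode of rate m; the factor exp(-m t) turns it into
  the response of that mode.\<close>

definition gC :: "real \<Rightarrow> real \<Rightarrow> real" where
  "gC m = (SOME g. g (- T2) = 0 \<and> (\<forall>t. (g has_real_derivative exp (m * t) * chk (rb t)) (at t)))"
definition AT :: "real \<Rightarrow> real" where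
  "AT = (SOME g. g (- T5) = 0 \<and> (\<forall>t. (g has_real_derivative step (1/5) (3/10) (rb t)) (at t)))"

lemma T2_pos: "T2 > 0" using eps by (simp add: T2_def)

lemma rb_T2: "t \<le> - T2 \<Longrightarrow> rb t \<le> 1/10"
  by (rule rb_leI) (use ub_mono[of t "- T2"] ub_at[of "297/2"] in \<open>simp_all add: T2_def power2_eq_square\<close>)

lemma rb_T5: "rb (- T5) \<le> 1/5"
  by (rule rb_leI) (use ub_at[of 36] in \<open>simp_all add: T5_def power2_eq_square\<close>)

lemma corridor_integrals:
  "ZZ (- T2) = 0" "(ZZ has_real_derivative chk (rb t)) (at t)"
  "gC m (- T2) = 0" "(gC m has_real_derivative exp (m * t) * chk (rb t)) (at t)"
  "AT (- T5) = 0" "(AT has_real_derivative step (1/5) (3/10) (rb t)) (at t)"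
proof -
  have r: "continuous_on UNIV rb" using rb_deriv DERIV_isCont continuous_at_imp_continuous_on by blast
  have c: "continuous_on UNIV (\<lambda>t. chk (rb t))"
    by (intro continuous_on_compose2[OF smoothR_continuous[OF smoothR_cutoffs(9)] r]) auto
  have c2: "continuous_on UNIV (\<lambda>t. exp (m * t) * chk (rb t))" by (intro continuous_intros c)
  have c3: "continuous_on UNIV (\<lambda>t. step (1/5) (3/10) (rb t))"
    by (intro continuous_on_compose2[OF smoothR_continuous[OF smoothR_step] r]) auto
  have ex: "\<exists>g. g a = 0 \<and> (\<forall>t. (g has_real_derivative F t) (at t))" if "continuous_on UNIV F" for F :: "real \<Rightarrow> real" and a
    using continuous_antiderivative[OF that] by blast
  from someI_ex[OF ex[OF c]] show "ZZ (- T2) = 0" "(ZZ has_real_derivative chk (rb t)) (at t)" by (auto simp: ZZ_def)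
  from someI_ex[OF ex[OF c2]] show "gC m (- T2) = 0" "(gC m has_real_derivative exp (m * t) * chk (rb t)) (at t)" by (auto simp: gC_def)
  from someI_ex[OF ex[OF c3]] show "AT (- T5) = 0" "(AT has_real_derivative step (1/5) (3/10) (rb t)) (at t)" by (auto simp: AT_def)
qed

lemma AT_props: "AT t \<ge> 0" "rb t \<le> 1/5 \<Longrightarrow> AT t = 0"
proof -
  show z: "rb t \<le> 1/5 \<Longrightarrow> AT t = 0" for t
  proof -
    assume r: "rb t \<le> 1/5"
    let ?S = "closed_segment t (- T5)"
    have "\<exists>c. \<forall>x\<in>?S. AT x = c"
    proof (rule has_field_derivative_zero_constant)
      fix x assume "x \<in> ?S"
      then have "x \<le> t \<or> x \<le> - T5" by (auto simp: closed_segment_eq_real_ivl split: if_splits)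
      then have "rb x \<le> 1/5" using rb_mono[of x t] rb_mono[of x "- T5"] r rb_T5 by auto
      then have "step (1/5) (3/10) (rb x) = 0" by (intro step_eq_0) auto
      then show "(AT has_real_derivative 0) (at x within ?S)" using corridor_integrals(6)[of x] by (simp add: has_field_derivative_at_within)
    qed simp
    then show ?thesis using corridor_integrals(5) by (metis ends_in_segment(1,2))
  qed
  show "AT t \<ge> 0"
  proof (cases "t \<le> - T5")
    case True
    then show ?thesis using z rb_mono[OF True] rb_T5 by simp
  next
    case False
    then have "AT (- T5) \<le> AT t"
    proof (intro DERIV_nonneg_imp_nondecreasing[of "- T5" t AT])
      fix x
      show "\<exists>y. (AT has_real_derivative y) (at x) \<and> 0 \<le> y"
        by (intro exI conjI, rule corridor_integrals(6), rule step_bounds)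
    qed simp
    then show ?thesis by (simp add: corridor_integrals)
  qed
qed

text \<open>The upper bounds keep the chain part small during the corridor. By the lower bound a
  mode of rate m retains at time 0 at least exp(-m T2) of a unit kick; rates grow linearly along the
  chain, so this loss is only exponential in M.\<close>

lemma gC_bounds:
  assumes m: "m > 0"
  shows "t \<le> 0 \<Longrightarrow> 0 \<le> gC m t \<and> gC m t \<le> exp (m * t) * T2" "exp (- (m * T2)) * ZZ 0 \<le> gC m 0"
proof -
  show "0 \<le> gC m t \<and> gC m t \<le> exp (m * t) * T2" if t: "t \<le> 0"
  proof (cases "t \<le> - T2")
    case True
    let ?S = "{..- T2}"
    have "\<exists>c. \<forall>x\<in>?S. gC m x = c"
    proof (rule has_field_derivative_zero_constant)
      fix x assume "x \<in> ?S"
      then have "chk (rb x) = 0" using rb_T2[of x] cutoff_values(15)[of "rb x"] by simp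
      then show "(gC m has_real_derivative 0) (at x within ?S)" using corridor_integrals(4)[of m x] by (simp add: has_field_derivative_at_within)
    qed simp
    then have "gC m t = 0" using corridor_integrals(3)[of m] True by auto
    then show ?thesis using T2_pos by simp
  next
    case False
    then have le: "- T2 \<le> t" by simp
    have "gC m (- T2) \<le> gC m t"
    proof (rule DERIV_nonneg_imp_nondecreasing[OF le])
      fix x
      show "\<exists>y. (gC m has_real_derivative y) (at x) \<and> 0 \<le> y"
        by (intro exI conjI, rule corridor_integrals(4)) (simp add: chk_01)
    qed
    moreover have "exp (m * (- T2)) * (- T2 + T2) - gC m (- T2) \<le> exp (m * t) * (t + T2) - gC m t"
    proof (rule DERIV_nonneg_imp_nondecreasing[OF le])
      fix x assume x: "- T2 \<le> x" "x \<le> t"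
      have "((\<lambda>x. exp (m * x) * (x + T2) - gC m x) has_real_derivative exp (m * x) * m * (x + T2) + exp (m * x) * (1 - chk (rb x))) (at x)"
      proof -
        have "((\<lambda>x. exp (m * x)) has_real_derivative exp (m * x) * m) (at x)" by (auto intro!: derivative_eq_intros)
        moreover have "((\<lambda>x. x + T2) has_real_derivative 1) (at x)" by (auto intro!: derivative_eq_intros)
        ultimately have "((\<lambda>x. exp (m * x) * (x + T2) - gC m x) has_real_derivative exp (m * x) * m * (x + T2) + 1 * exp (m * x) - exp (m * x) * chk (rb x)) (at x)"
          by (intro DERIV_diff DERIV_mult corridor_integrals)
        then show ?thesis by (simp add: right_diff_distrib add_diff_eq)
      qed
      moreover have "0 \<le> exp (m * x) * m * (x + T2) + exp (m * x) * (1 - chk (rb x))" using x m chk_01(2)[of "rb x"] by simp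
      ultimately show "\<exists>y. ((\<lambda>x. exp (m * x) * (x + T2) - gC m x) has_real_derivative y) (at x) \<and> 0 \<le> y" by blast
    qed
    ultimately have g: "0 \<le> gC m t" "gC m t \<le> exp (m * t) * (t + T2)" using corridor_integrals(3)[of m] by simp_all
    have "exp (m * t) * (t + T2) \<le> exp (m * t) * T2" using t by simp
    then show ?thesis using order_trans[OF g(2)] g(1) by blast
  qed
  have "gC m (- T2) - exp (- (m * T2)) * ZZ (- T2) \<le> gC m 0 - exp (- (m * T2)) * ZZ 0"
  proof (rule DERIV_nonneg_imp_nondecreasing[where f = "\<lambda>x. gC m x - exp (- (m * T2)) * ZZ x" and a = "- T2" and b = 0])
    show "- T2 \<le> 0" using T2_pos by simp
    fix x assume x: "- T2 \<le> x"
    have "((\<lambda>x. gC m x - exp (- (m * T2)) * ZZ x) has_real_derivative exp (m * x) * chk (rb x) - exp (- (m * T2)) * chk (rb x)) (at x)"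
      by (intro DERIV_diff DERIV_cmult corridor_integrals)
    moreover have "exp (- (m * T2)) * chk (rb x) \<le> exp (m * x) * chk (rb x)"
    proof (rule mult_right_mono)
      have "m * (- T2) \<le> m * x" using m x by (intro mult_left_mono) auto
      then show "exp (- (m * T2)) \<le> exp (m * x)" by simp
    qed (rule chk_01)
    ultimately show "\<exists>y. ((\<lambda>x. gC m x - exp (- (m * T2)) * ZZ x) has_real_derivative y) (at x) \<and> 0 \<le> y" by fastforce
  qed
  then show "exp (- (m * T2)) * ZZ 0 \<le> gC m 0" by (simp add: corridor_integrals)
qed

lemma ZZ_pos: "ZZ 0 > 0"
proof -
  \<comment> \<open>Here the radius is 3/20, the centre of the window, since 1 + (2/3)(391/6) =
    400/9; the integrand \<open>chk\<close> equals 1 there.\<close>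
  define t3 where "t3 = - (ln (391/6) / (2 * \<epsilon>))"
  have mono: "ZZ s \<le> ZZ t" if "s \<le> t" for s t
  proof (rule DERIV_nonneg_imp_nondecreasing[OF that])
    fix x
    show "\<exists>y. (ZZ has_real_derivative y) (at x) \<and> 0 \<le> y"
      by (intro exI conjI, rule corridor_integrals(2)) (simp add: chk_01)
  qed
  have "t3 < 0" using eps by (simp add: t3_def)
  have "- T2 \<le> t3" unfolding t3_def T2_def using eps by (simp add: divide_right_mono)
  have "(rb t3)\<^sup>2 = (3/20)\<^sup>2" unfolding rb_bounds t3_def by (subst ub_at) (auto simp: power2_eq_square)
  then have "rb t3 = 3/20" using rb_bounds(1)[of t3] by (simp add: power2_eq_iff)
  then have "chk (rb t3) = 1" by (simp only:) (simp add: chk_def bump_0)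
  then have "(ZZ has_real_derivative 1) (at t3)" using corridor_integrals(2)[of t3] by simp
  from DERIV_pos_inc_right[OF this] obtain d where d: "d > 0" "\<And>h. h > 0 \<Longrightarrow> h < d \<Longrightarrow> ZZ t3 < ZZ (t3 + h)" by auto
  define h where "h = min (d / 2) (- t3)"
  have "ZZ t3 < ZZ (t3 + h)" using d(1) \<open>t3 < 0\<close> by (intro d(2)) (auto simp: h_def)
  moreover have "ZZ (t3 + h) \<le> ZZ 0" by (rule mono) (auto simp: h_def)
  ultimately show ?thesis using mono[OF \<open>- T2 \<le> t3\<close>] corridor_integrals(1) by simp
qed

end

context turns
begin

text \<open>Profiles of the corridor solution: \<open>AA\<close> is the damping of the parameter
  after the kick, and \<open>CC j\<close> is the response of mode j to a unit kick.\<close>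

definition AA :: "real \<Rightarrow> real" where "AA t = exp (- (m2 0 * AT t))"
definition CC :: "nat \<Rightarrow> real \<Rightarrow> real" where "CC j t = exp (- (m2 j * t)) * gC (m2 j) t"
definition start :: "real \<Rightarrow> (nat \<Rightarrow> real) \<Rightarrow> nat \<Rightarrow> real" where
  "start s \<kappa> j = (if j = 0 then s * AA 0 else \<kappa> j * CC j 0)"

lemma AA_bounds: "0 < AA t" "AA t \<le> 1" "rb t \<le> 1/5 \<Longrightarrow> AA t = 1"
  using AT_props[of t] m_pos(2)[of 0] by (auto simp: AA_def)

lemma AA_deriv: "(AA has_real_derivative - (m2 0 * step (1/5) (3/10) (rb t)) * AA t) (at t)"
  unfolding AA_def[abs_def] by (auto intro!: derivative_eq_intros corridor_integrals)

lemma CC_bounds: "t \<le> 0 \<Longrightarrow> 0 \<le> CC j t \<and> CC j t \<le> T2" "exp (- (m2 j * T2)) * ZZ 0 \<le> CC j 0"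
proof -
  show "exp (- (m2 j * T2)) * ZZ 0 \<le> CC j 0" using gC_bounds(2)[OF m_pos(2)[of j]] by (simp add: CC_def)
  assume "t \<le> 0"
  then have g: "0 \<le> gC (m2 j) t" "gC (m2 j) t \<le> exp (m2 j * t) * T2" using gC_bounds(1)[OF m_pos(2)[of j]] by auto
  have "exp (- (m2 j * t)) * gC (m2 j) t \<le> exp (- (m2 j * t)) * (exp (m2 j * t) * T2)" using g by (intro mult_left_mono) auto
  then show "0 \<le> CC j t \<and> CC j t \<le> T2" using g by (simp add: CC_def mult.assoc[symmetric] exp_minus)
qed

lemma CC_deriv: "(CC j has_real_derivative - m2 j * CC j t + chk (rb t)) (at t)"
proof -
  have "((\<lambda>t. exp (- (m2 j * t))) has_real_derivative exp (- (m2 j * t)) * - m2 j) (at t)" by (auto intro!: derivative_eq_intros)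
  from DERIV_mult[OF this corridor_integrals(4)[of "m2 j"]]
  have "(CC j has_real_derivative exp (- (m2 j * t)) * - m2 j * gC (m2 j) t + exp (m2 j * t) * chk (rb t) * exp (- (m2 j * t))) (at t)"
    unfolding CC_def[abs_def] .
  moreover have "exp (m2 j * t) * chk (rb t) * exp (- (m2 j * t)) = chk (rb t)" by (simp add: exp_minus)
  moreover have "exp (- (m2 j * t)) * - m2 j * gC (m2 j) t = - m2 j * CC j t" by (simp add: CC_def)
  ultimately show ?thesis by (simp only:)
qed

end

text \<open>In the distant past the orbit tends to s \<open>e 1\<close>. While the kick acts, Q
  equals the centre s exactly, so only the vector W n is applied. Afterwards the excess s in
  \<open>e 1\<close> is damped at the rate of \<open>f 0\<close> and rotated into \<open>f 0\<close>
  by the angle \<open>ph\<close>. This ends before the plane starts to rotate, so the planar orbit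
  at time 0 is the same for every s.\<close>

lemma (in flow) corridor:
  assumes s: "s = ctr \<epsilon> n" and B: "B > 0" and k0: "\<kappa> 0 = 0" and kB: "\<And>j. j \<ge> B \<Longrightarrow> \<kappa> j = 0"
    and Wn: "W n = (\<Sum>j<B. \<kappa> j *\<^sub>R f j)" and ks: "(\<Sum>j<B. \<bar>\<kappa> j\<bar>) * T2 \<le> \<epsilon> / 4"
  shows "\<exists>U. bounded (U ` {..0}) \<and> (\<forall>t\<le>0. T (- t) (U t) = vec (pb 0) (qb 0) (start s \<kappa>) B)"
    and "(\<Sum>j<B. \<bar>start s \<kappa> j\<bar>) \<le> \<epsilon> / 2"
proof -
  have s0: "0 < s" "s \<le> \<epsilon> / 4" using eps ctr_antimono[OF eps(1), of 0 n] unfolding s by (auto simp: ctr_def add_pos_nonneg)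
  define ph where "ph t = Sp (rb t)" for t
  define ph' where "ph' t = Sp' (rb t) * (\<epsilon> * rb t * (1 - ub t))" for t
  have phd: "(ph has_real_derivative ph' t) (at t)" for t
    unfolding ph_def[abs_def] ph'_def by (rule DERIV_chain2[OF S_derivs(1) rb_deriv])
  define v where "v t = s * AA t * cos (ph t)" for t
  define q where "q t = v t + qb t" for t
  define x where "x j t = (if j = 0 then s * AA t * sin (ph t) else \<kappa> j * CC j t)" for j t
  define st where "st t = step (1/5) (3/10) (rb t)" for t
  have hi: "cos (ph t) = 0 \<and> ph' t = 0 \<and> sin (ph t) = 1" if "rb t \<ge> 2/5" for t
    using that by (simp add: ph_def ph'_def cutoff_values(1,3))
  have v_le: "\<bar>v t\<bar> \<le> s" for t
  proof -
    have "\<bar>s\<bar> * \<bar>AA t\<bar> * \<bar>cos (ph t)\<bar> \<le> s * 1 * 1" using s0 AA_bounds[of t] by (intro mult_mono) auto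
    then show ?thesis by (simp add: v_def abs_mult)
  qed
  have early: "pb t = rb t" "qb t = 0" "ub t \<le> 1/2" "q t = v t" if "t \<le> - T1" for t
    using th_early[OF that] ub_mono[OF that] ub_T1 by (auto simp: pb_def qb_def q_def)
  have late: "rb t \<ge> 2/5" "pb t \<ge> 1/2" "q t = qb t" "0 \<le> qb t" "qb t \<le> 1/4" if "t \<le> 0" "- T1 < t" for t
  proof -
    have u: "ub t \<ge> 1/2" using ub_mono[of "- T1" t] that ub_T1 by simp
    show r: "rb t \<ge> 2/5" by (rule rb_geI) (use u in \<open>auto simp: power2_eq_square\<close>)
    then show "q t = qb t" using hi by (simp add: q_def v_def)
    have c: "(cos (th t))\<^sup>2 \<ge> 15/16" "cos (th t) \<ge> 0" "0 \<le> sin (th t)" "sin (th t) \<le> 1/4" using cos_sq_small[of "th t"] th_mid[OF that(1)] by auto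
    have "1/2 * (15/16) \<le> (rb t)\<^sup>2 * (cos (th t))\<^sup>2" using u c by (intro mult_mono) (auto simp: rb_bounds)
    moreover have "(1/2)\<^sup>2 \<le> 1/2 * (15/16::real)" by (simp add: power2_eq_square)
    ultimately have "(1/2)\<^sup>2 \<le> (rb t * cos (th t))\<^sup>2" unfolding power_mult_distrib by (rule order_trans[rotated])
    then show "pb t \<ge> 1/2" unfolding pb_def by (rule power2_le_imp_le) (use c rb_bounds[of t] in simp)
    have "rb t * sin (th t) \<le> 1 * (1/4)" using c rb_bounds[of t] by (intro mult_mono) auto
    then show "0 \<le> qb t" "qb t \<le> 1/4" using c rb_bounds[of t] by (auto simp: qb_def)
  qed
  have small: "s \<le> 1/32" using s0 eps by simp
  have q_le: "\<bar>q t\<bar> \<le> 1/4" if "t \<le> 0" for t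
    using early[of t] late[OF that] v_le[of t] small by (cases "t \<le> - T1") auto
  have al0: "al (q t) = 0" "beta1 (pb t) (q t) = 0" "beta2 (pb t) (q t) = 0" if "t \<le> 0" for t
    using q_le[OF that] cutoff_values(10)[of "q t"] cutoff_values(10)[of "- q t"] by (auto simp: beta1_def beta2_def abs_le_iff)
  \<comment> \<open>The excess v is nonzero only for radius below 2/5. There (2/5)^2 + (1/32)^2
    \<le> 1/5, and in that disc the field is independent of Q.\<close>
  have fG: "fG0 (pb t) (q t) = fG0 (pb t) (qb t) \<and> fG1 (pb t) (q t) = fG1 (pb t) (qb t)" if t: "t \<le> 0" for t
  proof (cases "rb t \<ge> 2/5")
    case True
    then show ?thesis using hi by (simp add: q_def v_def)
  next
    case False
    then have e: "t \<le> - T1" using late(1)[OF t] by (cases "t \<le> - T1") auto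
    have "(rb t)\<^sup>2 \<le> (2/5)\<^sup>2" using False rb_bounds(1)[of t] by (intro power_mono) auto
    moreover have "(v t)\<^sup>2 \<le> (1/32)\<^sup>2" using v_le[of t] small by (simp add: abs_le_square_iff[symmetric])
    ultimately have "(rb t)\<^sup>2 + (v t)\<^sup>2 \<le> 1/5" "(rb t)\<^sup>2 \<le> 1/5" by (simp_all add: power2_eq_square)
    then show ?thesis using cutoff_values(16,17)[of "(rb t)\<^sup>2 + (v t)\<^sup>2"] cutoff_values(16,17)[of "(rb t)\<^sup>2"]
      by (simp add: early[OF e] fG0_def fG1_def)
  qed
  have bp: "\<epsilon> * (betap (pb t) (q t) * (\<epsilon> * cutoff (q t / \<epsilon>))) = v t * ph' t \<and> \<epsilon> * betap (pb t) (q t) * (s * AA t * sin (ph t)) = s * AA t * sin (ph t) * ph' t"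
    if t: "t \<le> 0" for t
  proof (cases "t \<le> - T1")
    case True
    have "\<bar>q t\<bar> \<le> 1/8" "\<bar>q t / \<epsilon>\<bar> \<le> 1" using v_le[of t] small s0 eps by (auto simp: early[OF True] abs_divide)
    then have "chq (q t) = 1" "\<epsilon> * cutoff (q t / \<epsilon>) = q t" using cutoff_values(13) cutoff(2) eps by auto
    then show ?thesis by (simp add: betap_def early[OF True] ph'_def rb_bounds)
  next
    case False
    then show ?thesis using late[OF t] hi cutoff_values(1)[of "pb t"] by (simp add: betap_def)
  qed
  have apq: "m2 0 * (ap (pb t) * chq (q t)) * (\<epsilon> * cutoff (q t / \<epsilon>)) = m2 0 * st t * v t" if t: "t \<le> 0" for t
  proof (cases "t \<le> - T1")
    case True
    have "\<bar>q t\<bar> \<le> 1/8" "\<bar>q t / \<epsilon>\<bar> \<le> 1" using v_le[of t] small s0 eps by (auto simp: early[OF True] abs_divide)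
    then have "chq (q t) = 1" "\<epsilon> * cutoff (q t / \<epsilon>) = q t" using cutoff_values(13) cutoff(2) eps by auto
    moreover have "ap (rb t) * v t = st t * v t"
    proof (cases "rb t \<ge> 2/5")
      case True then show ?thesis using hi by (simp add: v_def)
    next
      case False
      then have "step (2/5) (1/2) (rb t) = 0" by (intro step_eq_0) auto
      then show ?thesis by (simp add: ap_def st_def)
    qed
    ultimately show ?thesis unfolding early[OF True] by (simp add: mult.assoc)
  next
    case False
    then show ?thesis using late[OF t] hi[of t] cutoff_values(12)[of "pb t"] by (simp add: v_def)
  qed
  have chk_eq: "chk (pb t) = chk (rb t)" if t: "t \<le> 0" for t
    using early[of t] late[OF t] cutoff_values(15)[of "pb t"] cutoff_values(15)[of "rb t"] by (cases "t \<le> - T1") auto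
  \<comment> \<open>The angle starts to move at 3/10, when the damping is fully on; so mode 0 decays
    at the full rate m2 0 from its birth.\<close>
  have ssin: "st t * sin (ph t) = sin (ph t)" for t
    using cutoff_values(2)[of "rb t"] step_eq_1[of "1/5" "3/10" "rb t"] by (cases "rb t \<le> 3/10") (auto simp: ph_def st_def)
  have rhs_eq: "rhs \<kappa> (pb t) (q t) (\<lambda>i. x i t) j = - m2 j * x j t + (if j = 0 then v t * ph' t else 0) + chk (rb t) * \<kappa> j"
    if t: "t \<le> 0" for t j
    using bp[OF t] by (simp add: rhs_def al0[OF t] chk_eq[OF t])
  have xsum: "(\<Sum>j<B. \<bar>x j t\<bar>) \<le> \<epsilon> / 2" if t: "t \<le> 0" for t
  proof -
    have "(\<Sum>j<B. \<bar>x j t\<bar>) \<le> (\<Sum>j<B. (if j = 0 then s else 0) + \<bar>\<kappa> j\<bar> * T2)"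
    proof (rule sum_mono)
      fix j
      show "\<bar>x j t\<bar> \<le> (if j = 0 then s else 0) + \<bar>\<kappa> j\<bar> * T2"
      proof (cases "j = 0")
        case True
        have "\<bar>s\<bar> * \<bar>AA t\<bar> * \<bar>sin (ph t)\<bar> \<le> s * 1 * 1" using s0 AA_bounds[of t] by (intro mult_mono) auto
        then show ?thesis using True k0 by (simp add: x_def abs_mult)
      next
        case False
        then show ?thesis using CC_bounds(1)[OF t, of j] by (simp add: x_def abs_mult mult_left_mono)
      qed
    qed
    also have "\<dots> = s + (\<Sum>j<B. \<bar>\<kappa> j\<bar>) * T2" using B by (simp add: sum.distrib sum_distrib_right)
    finally show ?thesis using ks s0 by simp
  qed
  define U where "U t = vec (pb t) (q t) (\<lambda>j. x j t) B" for t
  have x00: "(\<lambda>j. x j 0) = start s \<kappa>" "q 0 = qb 0"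
    using hi[of 0] late(1,3)[of 0] T1_pos by (auto simp: fun_eq_iff x_def start_def)
  then show "(\<Sum>j<B. \<bar>start s \<kappa> j\<bar>) \<le> \<epsilon> / 2" using xsum[of 0] by (metis order_refl)
  have "T (- t) (U t) = U 0" if t0: "t \<le> 0" for t
  proof -
    have "T (0 - t) (vec (pb t) (q t) (\<lambda>j. x j t) B) = vec (pb 0) (q 0) (\<lambda>j. x j 0) B"
    proof (rule flow_trajectory[where \<kappa> = \<kappa>])
      fix r assume "r \<in> {t..0}"
      then have r: "r \<le> 0" by simp
      show "(pb has_real_derivative \<epsilon> * fG0 (pb r) (q r)) (at r)" using base_eq(1)[of r] fG[OF r] by simp
      have Ad: "((\<lambda>r. s * AA r) has_real_derivative s * (- (m2 0 * st r) * AA r)) (at r)"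
        unfolding st_def by (rule DERIV_cmult[OF AA_deriv])
      have c: "((\<lambda>t. cos (ph t)) has_real_derivative - sin (ph r) * ph' r) (at r)"
        "((\<lambda>t. sin (ph t)) has_real_derivative cos (ph r) * ph' r) (at r)"
        by (rule DERIV_chain2[OF DERIV_cos phd], rule DERIV_chain2[OF DERIV_sin phd])
      have "(q has_real_derivative (s * (- (m2 0 * st r) * AA r) * cos (ph r) + - sin (ph r) * ph' r * (s * AA r)) + \<epsilon> * fG1 (pb r) (qb r)) (at r)"
        unfolding q_def[abs_def] v_def by (intro DERIV_add DERIV_mult Ad c base_eq)
      moreover have "(s * (- (m2 0 * st r) * AA r) * cos (ph r) + - sin (ph r) * ph' r * (s * AA r)) + \<epsilon> * fG1 (pb r) (qb r)
         = - (m2 0 * st r * v r) + (\<epsilon> * fG1 (pb r) (qb r) - s * AA r * sin (ph r) * ph' r)"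
        by (simp add: v_def algebra_simps)
      moreover have "- (m2 0 * (ap (pb r) * chq (q r)) * (\<epsilon> * cutoff (q r / \<epsilon>))) + \<epsilon> * (fG1 (pb r) (q r) - betap (pb r) (q r) * x 0 r)
         = - (m2 0 * st r * v r) + (\<epsilon> * fG1 (pb r) (qb r) - s * AA r * sin (ph r) * ph' r)"
        unfolding apq[OF r] using bp[OF r] fG[OF r] by (simp add: x_def right_diff_distrib mult_ac)
      ultimately show "(q has_real_derivative - (m2 0 * (ap (pb r) * chq (q r)) * (\<epsilon> * cutoff (q r / \<epsilon>))) + \<epsilon> * (fG1 (pb r) (q r) - betap (pb r) (q r) * x 0 r)) (at r)"
        by (simp only:)
      show "(x j has_real_derivative rhs \<kappa> (pb r) (q r) (\<lambda>i. x i r) j) (at r)" for j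
      proof (cases "j = 0")
        case True
        have "(x 0 has_real_derivative s * (- (m2 0 * st r) * AA r) * sin (ph r) + cos (ph r) * ph' r * (s * AA r)) (at r)"
          unfolding x_def[abs_def] by (simp only: simp_thms if_True) (intro DERIV_mult Ad c)
        moreover have "s * (- (m2 0 * st r) * AA r) * sin (ph r) + cos (ph r) * ph' r * (s * AA r) = - m2 0 * x 0 r + v r * ph' r"
        proof -
          have "s * (- (m2 0 * st r) * AA r) * sin (ph r) = - m2 0 * (s * AA r) * (st r * sin (ph r))" by (simp add: mult_ac)
          then show ?thesis by (simp add: ssin x_def v_def mult_ac)
        qed
        ultimately show ?thesis using True rhs_eq[OF r, of 0] k0 by simp
      next
        case False
        have "(x j has_real_derivative \<kappa> j * (- m2 j * CC j r + chk (rb r))) (at r)"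
          using False DERIV_cmult[OF CC_deriv[of j r], of "\<kappa> j"] by (simp add: x_def[abs_def])
        moreover have "rhs \<kappa> (pb r) (q r) (\<lambda>i. x i r) j = \<kappa> j * (- m2 j * CC j r + chk (rb r))"
          unfolding rhs_eq[OF r] using False by (simp add: x_def[of j] algebra_simps)
        ultimately show ?thesis by (simp only:)
      qed
      show "x j r = 0 \<and> rhs \<kappa> (pb r) (q r) (\<lambda>i. x i r) j = 0" if "B \<le> j" for j
      proof -
        have "j \<noteq> 0" "\<kappa> j = 0" using that B kB by auto
        then show ?thesis using rhs_eq[OF r, of j] by (simp add: x_def)
      qed
      show "\<bar>pb r\<bar> \<le> 1 \<and> \<bar>q r\<bar> \<le> 1 \<and> (\<Sum>j<B. \<bar>x j r\<bar>) \<le> \<epsilon>" using pq_abs[of r] q_le[OF r] xsum[OF r] eps by simp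
      show "chk (pb r) *\<^sub>R kick \<epsilon> W (q r) = chk (pb r) *\<^sub>R (\<Sum>j<B. \<kappa> j *\<^sub>R f j)"
      proof (cases "chk (rb r) = 0")
        case True then show ?thesis using chk_eq[OF r] by simp
      next
        case False
        then have rr: "rb r < 1/5" using cutoff_values(15)[of "rb r"] by (cases "rb r < 1/5") auto
        then have e: "r \<le> - T1" using late(1)[OF r] by (cases "r \<le> - T1") auto
        have "q r = s" using rr AA_bounds(3)[of r] cutoff_values(2)[of "rb r"] by (simp add: early[OF e] v_def ph_def)
        moreover have "kick \<epsilon> W (ctr \<epsilon> n) = W n" by (rule kick_ctr[OF eps(1)])
        ultimately show ?thesis using Wn s by simp
      qed
    qed (use t0 B kB in auto)
    then show ?thesis by (simp add: U_def)
  qed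
  moreover have "U 0 = vec (pb 0) (qb 0) (start s \<kappa>) B" using x00 by (simp add: U_def)
  moreover have "bounded (U ` {..0})"
  proof (rule boundedI)
    fix y assume "y \<in> U ` {..0}"
    then obtain t where t: "t \<le> 0" "y = U t" by auto
    have "norm (\<Sum>j<B. x j t *\<^sub>R f j) \<le> \<epsilon> / 2"
      using order_trans[OF norm_sum, of "\<lambda>j. x j t *\<^sub>R f j" "{..<B}" "\<epsilon> / 2"] xsum[OF t(1)] by (simp add: norm_e)
    then have "norm (U t) \<le> \<bar>pb t\<bar> * norm (e 0) + \<bar>q t\<bar> * norm (e 1) + \<epsilon> / 2"
      unfolding U_def vec_def by (intro norm_triangle_mono) auto
    then show "norm y \<le> 3" using pq_abs[of t] q_le[OF t(1)] eps t(2) by (simp add: norm_e norm_e[unfolded One_nat_def])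
  qed
  ultimately show "\<exists>U. bounded (U ` {..0}) \<and> (\<forall>t\<le>0. T (- t) (U t) = vec (pb 0) (qb 0) (start s \<kappa>) B)" by auto
qed

section \<open>Sizes of the transported amplitudes\<close>

text \<open>The integer part of the binary logarithm for N > 0.\<close>

definition lev :: "nat \<Rightarrow> nat" where "lev N = (LEAST m. N < 2 ^ Suc m)"

lemma lev_upper: "N < 2 ^ Suc (lev N)"
proof -
  have "N < 2 ^ N" by (rule less_exp)
  then have "N < 2 * 2 ^ N" by linarith
  then have "N < 2 ^ Suc N" by simp
  then show ?thesis unfolding lev_def by (rule LeastI)
qed

lemma lev_ge: "2 ^ M \<le> N \<Longrightarrow> M \<le> lev N"
proof (rule ccontr)
  assume "2 ^ M \<le> N" "\<not> M \<le> lev N"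
  then have "(2::nat) ^ Suc (lev N) \<le> 2 ^ M" by (intro power_increasing) auto
  then show False using lev_upper[of N] \<open>2 ^ M \<le> N\<close> by simp
qed

lemma lev_eq: "2 ^ M \<le> N \<Longrightarrow> N < 2 ^ Suc M \<Longrightarrow> lev N = M"
  using lev_ge[of M N] Least_le[of "\<lambda>m. N < 2 ^ Suc m" M] by (simp add: lev_def)

text \<open>The leading bit is common to a dyadic block, so the M low bits determine N.\<close>

lemma level_bits_differ:
  fixes N N' :: nat
  assumes "2 ^ M \<le> N" "N < 2 ^ Suc M" "2 ^ M \<le> N'" "N' < 2 ^ Suc M" "N \<noteq> N'"
  shows "\<exists>i<M. bit N i \<noteq> bit N' i"
proof (rule ccontr)
  assume "\<not> ?thesis"
  then have "take_bit M N = take_bit M N'" by (intro bit_eqI) (auto simp: bit_take_bit_iff)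
  moreover have "N mod 2 ^ M = N - 2 ^ M" if "2 ^ M \<le> N" "N < 2 ^ Suc M" for N :: nat
    using that by (subst le_mod_geq) auto
  ultimately show False using assms by (simp add: take_bit_eq_mod)
qed

lemma exp_quadratic_bound: "\<exists>C. \<forall>M. exp (a + b * real M - (real M)\<^sup>2) \<le> C"
proof (intro exI allI)
  fix M
  have "0 \<le> (b / 2 - real M)\<^sup>2" by simp
  then have "b * real M - (real M)\<^sup>2 \<le> b\<^sup>2 / 4" by (simp add: power2_eq_square algebra_simps)
  then show "exp (a + b * real M - (real M)\<^sup>2) \<le> exp (a + b\<^sup>2 / 4)" by simp
qed

context turns
begin

lemma mu_gaps: "i \<le> j \<Longrightarrow> g0 * (real j - real i) \<le> mu j - mu i" "i \<le> j \<Longrightarrow> mu j - mu i \<le> G * (real j - real i)"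
proof -
  assume "i \<le> j"
  then show "g0 * (real j - real i) \<le> mu j - mu i"
  proof (induction j rule: dec_induct)
    case (step n) then show ?case using gap_ge[of n] by (simp add: algebra_simps)
  qed simp
  from \<open>i \<le> j\<close> show "mu j - mu i \<le> G * (real j - real i)"
  proof (induction j rule: dec_induct)
    case (step n) then show ?case using gap_le[of n] by (simp add: algebra_simps)
  qed simp
qed

lemma cc_exp_bounds:
  "\<bar>cc H k\<bar> \<le> exp (- tau * (\<Sum>h<H. mu (pth (Suc h) k) - 2 * G))"
  "exp (- tau * (\<Sum>h<H. mu (pth (Suc h) k) + 2 * G)) \<le> \<bar>cc H k\<bar>"
proof (induction H)
  case (Suc H)
  { case 1
    have "Mult H (pth (Suc H) k) * \<bar>cc H k\<bar> \<le> exp (- tau * (mu (pth (Suc H) k) - 2 * G)) * exp (- tau * (\<Sum>h<H. mu (pth (Suc h) k) - 2 * G))"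
      using Suc(1) Mult_bounds(2) by (intro mult_mono) auto
    then show ?case unfolding cc_Suc exp_add[symmetric] by (simp add: algebra_simps del: pth.simps)
  next
    case 2
    have "exp (- tau * (mu (pth (Suc H) k) + 2 * G)) * exp (- tau * (\<Sum>h<H. mu (pth (Suc h) k) + 2 * G)) \<le> Mult H (pth (Suc H) k) * \<bar>cc H k\<bar>"
      using Suc(2) Mult_bounds(1) less_imp_le[OF Mult_pos] by (intro mult_mono) auto
    then show ?case unfolding cc_Suc exp_add[symmetric] by (simp add: algebra_simps del: pth.simps) }
qed auto

lemma tau_ge_1: "tau \<ge> 1"
  using eps pi_gt3 by (simp add: tau_def le_divide_eq)

text \<open>Put H = Nc M and K = 2i + 2. While the odd mode is above mode 0 it can gain on it, but
  lose at most G K per half turn in the balance, and this lasts K half turns at most; from then on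
  mode 0 stays K places higher and decays faster by at least g0 K. The balance g0 K (H - K) - G K^2
  is quadratic in M, whereas the errors of 4 G per half turn add up to something linear in
  M.\<close>

lemma cc_ratio:
  "\<exists>Nc M0. Nc > 0 \<and> M0 > 0 \<and> (\<forall>M i. M0 \<le> M \<longrightarrow> M \<le> i \<longrightarrow> i < 2 * M \<longrightarrow> \<bar>cc (Nc * M) 0\<bar> \<le> exp (- ((real M)\<^sup>2)) * \<bar>cc (Nc * M) (2 * i + 1)\<bar>)"
proof -
  \<comment> \<open>Since 2M \<le> K \<le> 4M, the balance is at least (2 g0 (Nc - 4) - 16 G) M^2.
    This Nc makes it 2 M^2, and \<open>M0\<close> ensures that the linear errors consume at most one
    M^2.\<close>
  obtain Nc where Nc: "(16 * G + 2) / (2 * g0) + 4 \<le> real Nc" using real_arch_simple by blast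
  have Nc4: "Nc \<ge> 4" 
  proof -
    have "0 \<le> (16 * G + 2) / (2 * g0)" using G_pos g0_pos by simp
    then show ?thesis using Nc by simp
  qed
  have Nc': "2 * g0 * (real Nc - 4) \<ge> 16 * G + 2"
  proof -
    have "(16 * G + 2) / (2 * g0) \<le> real Nc - 4" using Nc by simp
    then show ?thesis using g0_pos by (simp add: pos_divide_le_eq mult.commute)
  qed
  obtain M0 where M0: "4 * G * real Nc + 1 \<le> real M0" using real_arch_simple by blast
  have "\<bar>cc (Nc * M) 0\<bar> \<le> exp (- ((real M)\<^sup>2)) * \<bar>cc (Nc * M) (2 * i + 1)\<bar>" if M: "M0 \<le> M" and i: "M \<le> i" "i < 2 * M" for M i
  proof -
    define H K where "H = Nc * M" and "K = 2 * i + 2"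
    have K: "2 * M \<le> K" "K \<le> 4 * M" using i by (auto simp: K_def)
    have "4 * M \<le> Nc * M" using Nc4 by (intro mult_right_mono) auto
    then have KH: "K \<le> H" unfolding H_def by (rule order_trans[OF K(2)])
    have rH: "4 * real M \<le> real H" using of_nat_mono[OF \<open>4 * M \<le> Nc * M\<close>, where 'a = real] by (simp add: H_def)
    \<comment> \<open>At h = K - 1 the modes are already K places apart, but this half turn is still
      counted with the crude bound.\<close>
    define dl where "dl h = (if h < K then - G * real K else g0 * real K)" for h
    have gap: "dl h \<le> mu (pth (Suc h) 0) - mu (pth (Suc h) (2 * i + 1))" for h
    proof (cases "Suc h \<le> 2 * i + 1")
      case True
      have "0 \<le> g0 * (real (2 * i + 1) - real (2 * i + 1 - Suc h))" using g0_pos by (intro mult_nonneg_nonneg) (simp_all add: of_nat_diff)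
      then have "mu (2 * i + 1 - Suc h) \<le> mu (2 * i + 1)" using mu_gaps(1)[of "2 * i + 1 - Suc h" "2 * i + 1"] by linarith
      moreover have "mu (2 * i + 1) - mu 0 \<le> G * real K" using mu_gaps(2)[of 0 "2 * i + 1"] G_pos by (simp add: K_def algebra_simps)
      moreover have "mu 0 \<le> mu (Suc h)"
      proof -
        have "0 \<le> g0 * (real (Suc h) - real 0)" using g0_pos by simp
        then show ?thesis using mu_gaps(1)[of 0 "Suc h"] by linarith
      qed
      moreover have "h < K" using True by (simp add: K_def)
      ultimately show ?thesis using True unfolding pth_0 pth_odd dl_def by simp
    next
      case False
      have "pth (Suc h) (2 * i + 1) = Suc h - K" using False by (simp only: pth_odd if_False K_def)
      moreover have "g0 * (real (Suc h) - real (Suc h - K)) \<le> mu (Suc h) - mu (Suc h - K)" by (rule mu_gaps) simp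
      moreover have "real (Suc h) - real (Suc h - K) = real K" using False by (simp add: K_def of_nat_diff)
      moreover have "- G * real K \<le> g0 * real K" using G_pos g0_pos by (intro mult_right_mono) auto
      moreover from this have "dl h \<le> g0 * real K" by (simp add: dl_def)
      ultimately show ?thesis unfolding pth_0 by (simp only:)
    qed
    have "(\<Sum>h<H. dl h) = (\<Sum>h<K. dl h) + (\<Sum>h=K..<H. dl h)"
      using sum.atLeastLessThan_concat[of 0 K H dl] KH by (simp add: lessThan_atLeast0)
    also have "\<dots> = - G * real K * real K + g0 * real K * (real H - real K)"
      using KH by (simp add: dl_def of_nat_diff)
    finally have dls: "(\<Sum>h<H. dl h) = - G * real K * real K + g0 * real K * (real H - real K)" .
    have rM: "2 * real M \<le> real K" "real K \<le> 4 * real M" using K by auto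
    have "G * (real K * real K) \<le> G * (4 * real M * (4 * real M))" using rM G_pos by (intro mult_left_mono mult_mono) auto
    moreover have "g0 * (2 * real M * (real H - 4 * real M)) \<le> g0 * (real K * (real H - real K))"
    proof (intro mult_left_mono mult_mono)
      show "real H - 4 * real M \<le> real H - real K" "2 * real M \<le> real K" using rM by simp_all
      show "0 \<le> real H - 4 * real M" using rH by simp
    qed (use g0_pos in simp_all)
    moreover have "g0 * (2 * real M * (real H - 4 * real M)) = (2 * g0 * (real Nc - 4)) * (real M)\<^sup>2"
      by (simp add: H_def power2_eq_square algebra_simps)
    moreover have "(16 * G + 2) * (real M)\<^sup>2 \<le> (2 * g0 * (real Nc - 4)) * (real M)\<^sup>2" using Nc' by (rule mult_right_mono) simp
    moreover have "4 * G * real H \<le> (real M)\<^sup>2"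
    proof -
      have "4 * G * real Nc \<le> real M" using M0 M by (simp add: order_trans)
      then have "(4 * G * real Nc) * real M \<le> real M * real M" by (rule mult_right_mono) simp
      then show ?thesis by (simp add: H_def power2_eq_square mult.assoc)
    qed
    moreover have "G * (4 * real M * (4 * real M)) = 16 * G * (real M)\<^sup>2" by (simp add: power2_eq_square)
    moreover have "(16 * G + 2) * (real M)\<^sup>2 = 16 * G * (real M)\<^sup>2 + 2 * (real M)\<^sup>2" by (simp add: algebra_simps)
    moreover have "(\<Sum>h<H. dl h) = g0 * (real K * (real H - real K)) - G * (real K * real K)"
      unfolding dls by (simp add: mult.assoc)
    ultimately have "(real M)\<^sup>2 \<le> (\<Sum>h<H. dl h) - 4 * G * real H" by linarith
    also have "\<dots> = (\<Sum>h<H. dl h - 4 * G)" by (simp add: sum_subtractf mult.commute)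
    also have "\<dots> \<le> (\<Sum>h<H. (mu (pth (Suc h) 0) - 2 * G) - (mu (pth (Suc h) (2 * i + 1)) + 2 * G))"
      by (rule sum_mono) (use gap in \<open>simp del: pth.simps\<close>)
    finally have "(real M)\<^sup>2 \<le> (\<Sum>h<H. mu (pth (Suc h) 0) - 2 * G) - (\<Sum>h<H. mu (pth (Suc h) (2 * i + 1)) + 2 * G)"
      by (simp only: sum_subtractf)
    then have "1 * (real M)\<^sup>2 \<le> tau * ((\<Sum>h<H. mu (pth (Suc h) 0) - 2 * G) - (\<Sum>h<H. mu (pth (Suc h) (2 * i + 1)) + 2 * G))"
      using tau_ge_1 by (intro mult_mono) auto
    then have "exp (- tau * (\<Sum>h<H. mu (pth (Suc h) 0) - 2 * G)) \<le> exp (- ((real M)\<^sup>2)) * exp (- tau * (\<Sum>h<H. mu (pth (Suc h) (2 * i + 1)) + 2 * G))"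
      unfolding exp_add[symmetric] by (simp add: algebra_simps del: pth.simps)
    also have "\<dots> \<le> exp (- ((real M)\<^sup>2)) * \<bar>cc H (2 * i + 1)\<bar>" by (intro mult_left_mono cc_exp_bounds) simp
    finally show ?thesis using cc_exp_bounds(1)[of H 0] by (simp add: H_def del: pth.simps)
  qed
  moreover have "M0 > 0"
  proof -
    have "0 \<le> 4 * G * real Nc" using G_pos by simp
    then have "0 < real M0" using M0 by linarith
    then show ?thesis by simp
  qed
  moreover have "Nc > 0" using Nc4 by simp
  ultimately show ?thesis by blast
qed

text \<open>Mode 0 climbs one place per half turn, so its exponents grow linearly and sum to O(M^2);
  this keeps the sides of the cubes from being too small.\<close>

lemma cc_lower:
  "M > 0 \<Longrightarrow> \<bar>cc (Nc * M) 0\<bar> \<ge> exp (- (tau * (real Nc * (mu 0 + G * real Nc + 3 * G))) * (real M)\<^sup>2)"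
proof -
  assume M: "M > 0"
  define H where "H = Nc * M"
  have "(\<Sum>h<H. mu (pth (Suc h) 0) + 2 * G) \<le> (\<Sum>h<H. mu 0 + G * real H + 2 * G)"
  proof (rule sum_mono)
    fix h assume "h \<in> {..<H}"
    then have "real (Suc h) \<le> real H" by simp
    then have "G * real (Suc h) \<le> G * real H" using G_pos by (intro mult_left_mono) auto
    then show "mu (pth (Suc h) 0) + 2 * G \<le> mu 0 + G * real H + 2 * G" using mu_gaps(2)[of 0 "Suc h"] unfolding pth_0 by simp
  qed
  also have "\<dots> = real H * (mu 0 + G * real H + 2 * G)" by simp
  also have "\<dots> \<le> (real Nc * (mu 0 + G * real Nc + 3 * G)) * (real M)\<^sup>2"
  proof -
    have m0: "mu 0 > 0" using lam_ge by simp
    have M1: "real M \<ge> 1" using M by simp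
    have "mu 0 + G * real H + 2 * G \<le> (mu 0 + G * real Nc + 3 * G) * real M"
    proof -
      have "mu 0 * 1 \<le> mu 0 * real M" "3 * G * 1 \<le> 3 * G * real M" using M1 m0 G_pos by (intro mult_left_mono; simp)+
      moreover have "(mu 0 + G * real Nc + 3 * G) * real M = mu 0 * real M + G * real H + 3 * G * real M"
        by (simp add: H_def algebra_simps)
      ultimately show ?thesis using G_pos by linarith
    qed
    then have "real H * (mu 0 + G * real H + 2 * G) \<le> real H * ((mu 0 + G * real Nc + 3 * G) * real M)" by (rule mult_left_mono) simp
    then show ?thesis by (simp add: H_def power2_eq_square mult_ac)
  qed
  finally have "tau * (\<Sum>h<H. mu (pth (Suc h) 0) + 2 * G) \<le> tau * ((real Nc * (mu 0 + G * real Nc + 3 * G)) * (real M)\<^sup>2)"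
    using tau_pos by (intro mult_left_mono) auto
  then have "exp (- (tau * (real Nc * (mu 0 + G * real Nc + 3 * G))) * (real M)\<^sup>2) \<le> exp (- tau * (\<Sum>h<H. mu (pth (Suc h) 0) + 2 * G))"
    by (simp add: mult.assoc del: pth.simps)
  from order_trans[OF this cc_exp_bounds(2)] show ?thesis by (simp only: H_def)
qed

text \<open>Mode \<open>2 (M + i) + 1\<close> receives the \<open>i\<close>-th bit of \<open>N\<close>, where \<open>M = lev N\<close>. The denominator undoes the decay in the corridor
  and on the following \<open>Nc * M\<close> half turns, so the final coordinate is exactly the side of the cube.\<close>

definition kap :: "nat \<Rightarrow> nat \<Rightarrow> nat \<Rightarrow> nat \<Rightarrow> real" where
  "kap Nc N0 N j = (if N0 \<le> N \<and> odd j \<and> lev N \<le> j div 2 \<and> j div 2 < 2 * lev N \<and> bit N (j div 2 - lev N)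
     then \<epsilon> * \<bar>cc (Nc * lev N) 0\<bar> / (CC j 0 * cc (Nc * lev N) j) else 0)"

lemma CC0_pos: "CC j 0 > 0"
  by (rule less_le_trans[OF mult_pos_pos[OF exp_gt_zero ZZ_pos] CC_bounds(2)])

lemma kap_zero: "kap Nc N0 N 0 = 0" "j \<ge> 4 * lev N + 2 \<Longrightarrow> kap Nc N0 N j = 0" "N < N0 \<Longrightarrow> kap Nc N0 N j = 0"
  by (auto simp: kap_def)

text \<open>The ratio of the \<open>cc\<close> is at most exp(-M^2), the response \<open>CC\<close>
  is at least exp(-O(M)), and powers of N are exp(O(M)) because N < 2^(M+1); the Gaussian factor
  wins. Every power of N has to be beaten, since each derivative of the kick costs a factor 1 /
  \<open>rad\<close>.\<close>

lemma kap_decay: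
  assumes r: "\<And>M i. M0 \<le> M \<Longrightarrow> M \<le> i \<Longrightarrow> i < 2 * M \<Longrightarrow> \<bar>cc (Nc * M) 0\<bar> \<le> exp (- ((real M)\<^sup>2)) * \<bar>cc (Nc * M) (2 * i + 1)\<bar>"
  shows "\<exists>C\<ge>0. \<forall>N0 N. 2 ^ M0 \<le> N0 \<longrightarrow> (\<Sum>j<4 * lev N + 2. \<bar>kap Nc N0 N j\<bar>) * (real N + 2) ^ k \<le> C"
proof -
  \<comment> \<open>\<open>a\<close> and \<open>b\<close> collect the exponents: ln(\<epsilon> / ZZ
    0) and the terms with T2 from the corridor, 4M + 2 from the number of modes, which is bounded by
    its exponential, and k (M + 2) ln 2 from the power of N.\<close>
  define a where "a = ln (\<epsilon> / ZZ 0) + (mu 0 + 4 * G) * T2 + 2 + 2 * (real k * ln 2)"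
  define b where "b = 4 + 4 * G * T2 + real k * ln 2"
  obtain C where C: "\<And>M. exp (a + b * real M - (real M)\<^sup>2) \<le> C" using exp_quadratic_bound by blast
  have C0: "C \<ge> 0" using order_trans[OF exp_ge_zero C[of 0]] .
  have "(\<Sum>j<4 * lev N + 2. \<bar>kap Nc N0 N j\<bar>) * (real N + 2) ^ k \<le> C" if N0: "2 ^ M0 \<le> N0" for N0 N
  proof (cases "N0 \<le> N")
    case False
    then show ?thesis using C0 kap_zero(3)[of N N0] by simp
  next
    case True
    define M where "M = lev N"
    have M: "M0 \<le> M" unfolding M_def by (rule lev_ge) (use True N0 in simp)
    have kb: "\<bar>kap Nc N0 N j\<bar> \<le> exp (ln (\<epsilon> / ZZ 0) - (real M)\<^sup>2 + (mu 0 + 4 * G + 4 * G * real M) * T2)" for j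
    proof (cases "kap Nc N0 N j = 0")
      case False
      then have j: "odd j" "M \<le> j div 2" "j div 2 < 2 * M" and kj: "kap Nc N0 N j = \<epsilon> * \<bar>cc (Nc * M) 0\<bar> / (CC j 0 * cc (Nc * M) j)"
        by (auto simp: kap_def M_def split: if_splits)
      have c: "cc (Nc * M) j \<noteq> 0" by (rule cc_bounds)
      have "2 * (j div 2) + 1 = j" using j(1) by (simp add: odd_two_times_div_two_succ)
      then have "\<bar>cc (Nc * M) 0\<bar> \<le> exp (- ((real M)\<^sup>2)) * \<bar>cc (Nc * M) j\<bar>" using r[OF M j(2,3)] by simp
      then have cr: "\<bar>cc (Nc * M) 0\<bar> / \<bar>cc (Nc * M) j\<bar> \<le> exp (- ((real M)\<^sup>2))" using c by (simp add: pos_divide_le_eq)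
      have "m2 j \<le> mu 0 + 4 * G + 4 * G * real M"
      proof -
        have "real j \<le> 4 * real M" using j by linarith
        then have "G * real j \<le> G * (4 * real M)" using G_pos by (intro mult_left_mono) auto
        moreover have "mu j - mu 0 \<le> G * real j" using mu_gaps(2)[of 0 j] by simp
        moreover have "G * (4 * real M) = 4 * G * real M" by simp
        ultimately show ?thesis using m_near2(4)[of j] G_pos by linarith
      qed
      then have "m2 j * T2 \<le> (mu 0 + 4 * G + 4 * G * real M) * T2" using T2_pos by (intro mult_right_mono) auto
      then have "exp (- ((mu 0 + 4 * G + 4 * G * real M) * T2)) * ZZ 0 \<le> exp (- (m2 j * T2)) * ZZ 0" using ZZ_pos by (intro mult_right_mono) auto
      then have C1: "exp (- ((mu 0 + 4 * G + 4 * G * real M) * T2)) * ZZ 0 \<le> CC j 0" using CC_bounds(2)[of j] by simp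
      have "\<bar>kap Nc N0 N j\<bar> = \<epsilon> / CC j 0 * (\<bar>cc (Nc * M) 0\<bar> / \<bar>cc (Nc * M) j\<bar>)"
        unfolding kj using eps CC0_pos[of j] by (simp add: abs_mult abs_divide)
      also have "\<dots> \<le> \<epsilon> / (exp (- ((mu 0 + 4 * G + 4 * G * real M) * T2)) * ZZ 0) * exp (- ((real M)\<^sup>2))"
        using C1 cr eps ZZ_pos by (intro mult_mono divide_left_mono mult_pos_pos CC0_pos) auto
      also have "\<dots> = exp (ln (\<epsilon> / ZZ 0) - (real M)\<^sup>2 + (mu 0 + 4 * G + 4 * G * real M) * T2)"
        using eps ZZ_pos by (simp add: exp_add exp_diff exp_minus field_simps)
      finally show ?thesis .
    qed simp
    have "(\<Sum>j<4 * M + 2. \<bar>kap Nc N0 N j\<bar>) \<le> real (4 * M + 2) * exp (ln (\<epsilon> / ZZ 0) - (real M)\<^sup>2 + (mu 0 + 4 * G + 4 * G * real M) * T2)"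
      using sum_bounded_above[of "{..<4 * M + 2}" "\<lambda>j. \<bar>kap Nc N0 N j\<bar>", OF kb] by simp
    also have "\<dots> \<le> exp (4 * real M + 2) * exp (ln (\<epsilon> / ZZ 0) - (real M)\<^sup>2 + (mu 0 + 4 * G + 4 * G * real M) * T2)"
      using exp_ge_add_one_self[of "4 * real M + 2"] by (intro mult_right_mono) auto
    finally have s: "(\<Sum>j<4 * M + 2. \<bar>kap Nc N0 N j\<bar>) \<le> exp (4 * real M + 2) * exp (ln (\<epsilon> / ZZ 0) - (real M)\<^sup>2 + (mu 0 + 4 * G + 4 * G * real M) * T2)" .
    have "(real N + 2) ^ k \<le> exp ((real M + 2) * ln 2) ^ k"
    proof (rule power_mono)
      have "N + 2 \<le> 2 ^ (M + 2)"
        using lev_upper[of N] one_le_power[of "2::nat" M] unfolding M_def[symmetric] by (simp add: power_add)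
      then have "real (N + 2) \<le> real (2 ^ (M + 2))" by (rule of_nat_mono)
      also have "\<dots> = exp (ln 2) ^ (M + 2)" by simp
      also have "\<dots> = exp (real (M + 2) * ln 2)" by (simp only: exp_of_nat_mult)
      finally show "real N + 2 \<le> exp ((real M + 2) * ln 2)" by (simp add: add.commute)
    qed simp
    then have "(real N + 2) ^ k \<le> exp (real k * ((real M + 2) * ln 2))" by (simp add: exp_of_nat_mult)
    then have "(\<Sum>j<4 * M + 2. \<bar>kap Nc N0 N j\<bar>) * (real N + 2) ^ k \<le>
        (exp (4 * real M + 2) * exp (ln (\<epsilon> / ZZ 0) - (real M)\<^sup>2 + (mu 0 + 4 * G + 4 * G * real M) * T2)) * exp (real k * ((real M + 2) * ln 2))"
      by (intro mult_mono s) auto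
    also have "\<dots> = exp (a + b * real M - (real M)\<^sup>2)"
      unfolding exp_add[symmetric] by (rule arg_cong[where f = exp]) (simp add: a_def b_def algebra_simps)
    finally show ?thesis using C[of M] by (simp add: M_def)
  qed
  then show ?thesis using C0 by blast
qed

end

lemma (in design) norm_sum_f: "norm (\<Sum>j\<in>A. a j *\<^sub>R f j) \<le> (\<Sum>j\<in>A. \<bar>a j\<bar>)"
  using norm_sum[of "\<lambda>j. a j *\<^sub>R f j" A] by (simp add: norm_e)

context turns
begin

definition WW :: "nat \<Rightarrow> nat \<Rightarrow> nat \<Rightarrow> 'a" where
  "WW Nc N0 N = (\<Sum>j<4 * lev N + 2. kap Nc N0 N j *\<^sub>R f j)"

text \<open>The decay constants do not depend on N0. Dropping the kicks with N < N0 therefore makes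
  all sums small like 1 / N0, while every later dyadic block stays intact.\<close>

lemma WW_small:
  assumes r: "\<And>M i. M0 \<le> M \<Longrightarrow> M \<le> i \<Longrightarrow> i < 2 * M \<Longrightarrow> \<bar>cc (Nc * M) 0\<bar> \<le> exp (- ((real M)\<^sup>2)) * \<bar>cc (Nc * M) (2 * i + 1)\<bar>"
    and eta: "\<eta> > 0"
  shows "\<exists>N0\<ge>2 ^ M0. (\<forall>j. summable (\<lambda>N. norm (WW Nc N0 N) / rad \<epsilon> N ^ j))
    \<and> (\<Sum>N. norm (WW Nc N0 N)) \<le> \<eta> \<and> (\<Sum>N. norm (WW Nc N0 N) / rad \<epsilon> N) \<le> \<eta>
    \<and> (\<forall>N. (\<Sum>j<4 * lev N + 2. \<bar>kap Nc N0 N j\<bar>) * T2 \<le> \<epsilon> / 4)"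
proof -
  define a where "a N0 N = (\<Sum>j<4 * lev N + 2. \<bar>kap Nc N0 N j\<bar>)" for N0 N
  have a0: "a N0 N \<ge> 0" for N0 N by (simp add: a_def sum_nonneg)
  have Wa: "norm (WW Nc N0 N) \<le> a N0 N" for N0 N unfolding WW_def a_def by (rule norm_sum_f)
  have "\<forall>k. \<exists>C\<ge>0. \<forall>N0 N. 2 ^ M0 \<le> N0 \<longrightarrow> a N0 N * (real N + 2) ^ k \<le> C"
    unfolding a_def by (intro allI kap_decay r)
  from choice[OF this] obtain C where C': "\<forall>k. C k \<ge> 0 \<and> (\<forall>N0 N. 2 ^ M0 \<le> N0 \<longrightarrow> a N0 N * (real N + 2) ^ k \<le> C k)" ..
  have C: "C k \<ge> 0" "2 ^ M0 \<le> N0 \<Longrightarrow> a N0 N * (real N + 2) ^ k \<le> C k" for k N0 N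
    using spec[OF C', of k] by simp_all
  have rad: "1 / rad \<epsilon> N ^ j \<le> (4 / \<epsilon>) ^ j * (real N + 2) ^ (2 * j)" for N j
  proof -
    have "1 / rad \<epsilon> N = 4 / \<epsilon> * ((real N + 1) * (real N + 2))" by (simp add: rad_def)
    also have "\<dots> \<le> 4 / \<epsilon> * (real N + 2)\<^sup>2" unfolding power2_eq_square using eps by (intro mult_left_mono mult_right_mono) auto
    finally have "(1 / rad \<epsilon> N) ^ j \<le> (4 / \<epsilon> * (real N + 2)\<^sup>2) ^ j" using rad_pos[OF eps(1), of N] by (intro power_mono) auto
    then show ?thesis unfolding power_mult_distrib power_mult by (simp only: power_divide power_one)
  qed
  define g where "g N = 1 / (real N + 2)\<^sup>2" for N
  have sg: "summable g"
    using summable_ignore_initial_segment[OF inverse_power_summable[of 2, where 'a = real], of 2] by (simp add: g_def[abs_def] inverse_eq_divide add.commute)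
  have tail: "a N0 N \<le> C (2 + l) / (real N + 2) ^ l * g N" if "2 ^ M0 \<le> N0" for N0 N l
  proof -
    have "a N0 N \<le> C (2 + l) / (real N + 2) ^ (2 + l)" using C(2)[OF that, of N "2 + l"] by (simp add: pos_le_divide_eq)
    also have "\<dots> = C (2 + l) / (real N + 2) ^ l * g N" unfolding g_def power_add by (simp only: times_divide_times_eq mult_1_right mult.commute)
    finally show ?thesis .
  qed
  have sm: "summable (\<lambda>N. norm (WW Nc N0 N) / rad \<epsilon> N ^ j)" if N0: "2 ^ M0 \<le> N0" for N0 j
  proof (rule summable_comparison_test'[OF summable_mult[OF sg, of "(4 / \<epsilon>) ^ j * C (2 + 2 * j)"]])
    fix N
    have "norm (WW Nc N0 N) * (1 / rad \<epsilon> N ^ j) \<le> (C (2 + 2 * j) / (real N + 2) ^ (2 * j) * g N) * ((4 / \<epsilon>) ^ j * (real N + 2) ^ (2 * j))"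
      using order_trans[OF Wa tail[OF N0, of N "2 * j"]] rad[of N j] rad_pos[OF eps(1), of N] C(1) by (intro mult_mono) (auto simp: g_def)
    also have "\<dots> = (4 / \<epsilon>) ^ j * C (2 + 2 * j) * g N" by simp
    finally show "norm (norm (WW Nc N0 N) / rad \<epsilon> N ^ j) \<le> (4 / \<epsilon>) ^ j * C (2 + 2 * j) * g N"
      using rad_pos[OF eps(1), of N] by (simp add: abs_mult)
  qed
  define Y where "Y = C 3 * suminf g / \<eta> + (4 / \<epsilon>) * C 5 * suminf g / \<eta> + C 2 * T2 * 4 / \<epsilon> + C 3 * T2 * 4 / \<epsilon>"
  obtain n where n: "Y \<le> real n" using real_arch_simple by blast
  define N0 where "N0 = max n (2 ^ M0)"
  have N0: "2 ^ M0 \<le> N0" by (simp add: N0_def)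
  have sg0: "suminf g \<ge> 0" by (rule suminf_nonneg[OF sg]) (simp add: g_def)
  have p: "0 \<le> C 3 * suminf g / \<eta>" "0 \<le> (4 / \<epsilon>) * C 5 * suminf g / \<eta>" "0 \<le> C 2 * T2 * 4 / \<epsilon>" "0 \<le> C 3 * T2 * 4 / \<epsilon>"
    using C(1) sg0 eta eps T2_pos by auto
  have YN: "Y \<le> real N0 + 2" using n by (simp add: N0_def)
  have q: "C 3 / (real N0 + 2) * suminf g \<le> \<eta>" "(4 / \<epsilon>) * C 5 / (real N0 + 2) * suminf g \<le> \<eta>" "C 3 / (real N0 + 2) * T2 \<le> \<epsilon> / 4"
  proof -
    have "C 3 * suminf g / \<eta> \<le> real N0 + 2" "(4 / \<epsilon>) * C 5 * suminf g / \<eta> \<le> real N0 + 2" "C 3 * T2 * 4 / \<epsilon> \<le> real N0 + 2"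
      using p YN unfolding Y_def by linarith+
    then have m: "C 3 * suminf g \<le> (real N0 + 2) * \<eta>" "(4 / \<epsilon>) * C 5 * suminf g \<le> (real N0 + 2) * \<eta>" "C 3 * T2 * 4 \<le> (real N0 + 2) * \<epsilon>"
      using eta eps by (simp_all only: pos_divide_le_eq)
    have dv: "x / (real N0 + 2) * y \<le> z" if "x * y \<le> (real N0 + 2) * z" for x y z
      using that by (simp add: pos_divide_le_eq mult.commute)
    show "C 3 / (real N0 + 2) * suminf g \<le> \<eta>" "(4 / \<epsilon>) * C 5 / (real N0 + 2) * suminf g \<le> \<eta>"
      by (rule dv[OF m(1)], rule dv[OF m(2)])
    show "C 3 / (real N0 + 2) * T2 \<le> \<epsilon> / 4" by (rule dv) (use m(3) in simp)
  qed
  have t1: "a N0 N \<le> C 3 / (real N0 + 2) * g N" for N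
  proof (cases "N0 \<le> N")
    case True
    have "a N0 N \<le> C 3 / (real N + 2) * g N" using tail[OF N0, of N 1] by (simp add: numeral_3_eq_3)
    also have "\<dots> \<le> C 3 / (real N0 + 2) * g N" using True C(1) by (intro mult_right_mono divide_left_mono mult_pos_pos) (auto simp: g_def)
    finally show ?thesis .
  next
    case False then show ?thesis using C(1)[of 3] by (simp add: a_def kap_zero g_def)
  qed
  have t2: "a N0 N * (1 / rad \<epsilon> N) \<le> (4 / \<epsilon>) * C 5 / (real N0 + 2) * g N" for N
  proof (cases "N0 \<le> N")
    case True
    have "a N0 N * (1 / rad \<epsilon> N) \<le> (C 5 / (real N + 2) ^ 3 * g N) * ((4 / \<epsilon>) * (real N + 2)\<^sup>2)"
      using tail[OF N0, of N 3] rad[of N 1] rad_pos[OF eps(1), of N] C(1) a0 by (intro mult_mono) (auto simp: g_def)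
    also have "\<dots> = (4 / \<epsilon>) * C 5 / (real N + 2) * g N"
    proof -
      have "c / y ^ 3 * x * (k * y\<^sup>2) = k * c / y * x" if "y \<noteq> 0" for c y x k :: real
        using that by (simp add: power2_eq_square power3_eq_cube)
      then show ?thesis by simp
    qed
    also have "\<dots> \<le> (4 / \<epsilon>) * C 5 / (real N0 + 2) * g N" using True C(1) eps by (intro mult_right_mono divide_left_mono mult_pos_pos) (auto simp: g_def)
    finally show ?thesis .
  next
    case False then show ?thesis using C(1)[of 5] eps by (simp add: a_def kap_zero g_def)
  qed
  have s1: "summable (\<lambda>N. norm (WW Nc N0 N))" "summable (\<lambda>N. norm (WW Nc N0 N) / rad \<epsilon> N)" using sm[OF N0, of 0] sm[OF N0, of 1] by auto
  have "(\<Sum>N. norm (WW Nc N0 N)) \<le> (\<Sum>N. C 3 / (real N0 + 2) * g N)"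
    by (rule suminf_le[OF order_trans[OF Wa t1] s1(1) summable_mult[OF sg]])
  then have r1: "(\<Sum>N. norm (WW Nc N0 N)) \<le> \<eta>" unfolding suminf_mult[OF sg] by (rule order_trans[OF _ q(1)])
  have "norm (WW Nc N0 N) / rad \<epsilon> N \<le> (4 / \<epsilon>) * C 5 / (real N0 + 2) * g N" for N
  proof -
    have "norm (WW Nc N0 N) * (1 / rad \<epsilon> N) \<le> a N0 N * (1 / rad \<epsilon> N)" using Wa rad_pos[OF eps(1), of N] by (intro mult_right_mono) auto
    then show ?thesis using t2[of N] by simp
  qed
  from suminf_le[OF this s1(2) summable_mult[OF sg]]
  have r2: "(\<Sum>N. norm (WW Nc N0 N) / rad \<epsilon> N) \<le> \<eta>" unfolding suminf_mult[OF sg] by (rule order_trans[OF _ q(2)])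
  have r3: "a N0 N * T2 \<le> \<epsilon> / 4" for N
  proof -
    have "1 \<le> (real N + 2)\<^sup>2" by (rule one_le_power) simp
    then have "g N \<le> 1" by (simp add: g_def)
    then have "C 3 / (real N0 + 2) * g N \<le> C 3 / (real N0 + 2) * 1" using C(1) by (intro mult_left_mono) auto
    then have "a N0 N * T2 \<le> C 3 / (real N0 + 2) * T2" using t1[of N] T2_pos by (intro mult_right_mono) auto
    then show ?thesis by (rule order_trans[OF _ q(3)])
  qed
  show ?thesis using N0 sm[OF N0] r1 r2 r3 unfolding a_def by blast
qed

definition FF :: "(nat \<Rightarrow> 'a) \<Rightarrow> 'a \<Rightarrow> 'a" where
  "FF W u = F0 \<epsilon> u + chk (Pc u) *\<^sub>R kick \<epsilon> W (Qc u)"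

text \<open>The room L - l0 left by \<open>F0\<close> is spent on the kick: \<eta> is chosen so that
  the product of window and kick has Lipschitz constant at most L - l0.\<close>

lemma flow_exists:
  assumes r: "\<And>M i. M0 \<le> M \<Longrightarrow> M \<le> i \<Longrightarrow> i < 2 * M \<Longrightarrow> \<bar>cc (Nc * M) 0\<bar> \<le> exp (- ((real M)\<^sup>2)) * \<bar>cc (Nc * M) (2 * i + 1)\<bar>"
    and lip: "\<And>u v. norm (F0 \<epsilon> u - F0 \<epsilon> v) \<le> l0 * norm (u - v)" and L: "0 \<le> l0" "l0 < L"
  shows "\<exists>N0 K. flow e lam c G g0 L1 \<epsilon> (WW Nc N0) (FF (WW Nc N0)) L K \<and> Csmooth (FF (WW Nc N0))
    \<and> (\<forall>N. (\<Sum>j<4 * lev N + 2. \<bar>kap Nc N0 N j\<bar>) * T2 \<le> \<epsilon> / 4)"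
proof -
  have "UBL (\<lambda>\<epsilon> u. chk (Pc u))" by (intro UBL_intros UBL_base)
  then obtain Lc where Lc': "Lc \<ge> 0" "\<And>\<epsilon> u v. 0 < \<epsilon> \<Longrightarrow> \<epsilon> \<le> (1::real) \<Longrightarrow> norm (chk (Pc u) - chk (Pc v)) \<le> Lc * norm (u - v)"
    by (rule UBLE) auto
  note Lc = Lc'(1) Lc'(2)[OF zero_less_one order_refl]
  obtain Ck where Ck': "Ck > 0 \<and> (\<forall>\<epsilon> (W::nat \<Rightarrow> 'a) \<eta>. \<epsilon> > 0 \<longrightarrow> summable (\<lambda>N. norm (W N)) \<longrightarrow> summable (\<lambda>N. norm (W N) / rad \<epsilon> N) \<longrightarrow>
    (\<Sum>N. norm (W N)) \<le> \<eta> \<longrightarrow> (\<Sum>N. norm (W N) / rad \<epsilon> N) \<le> \<eta> \<longrightarrow>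
    (\<forall>q. norm (kick \<epsilon> W q) \<le> Ck * \<eta>) \<and> (\<forall>q q'. norm (kick \<epsilon> W q - kick \<epsilon> W q') \<le> Ck * \<eta> * \<bar>q - q'\<bar>))"
    using kick_bounds[where 'a = 'a] ..
  note Ck = conjunct1[OF Ck']
  define \<eta> where "\<eta> = (L - l0) / (Ck * (Lc + 1))"
  have eta: "\<eta> > 0" "Ck * \<eta> * (Lc + 1) = L - l0" using L Ck Lc(1) by (simp_all add: \<eta>_def)
  obtain N0 where N0: "\<And>j. summable (\<lambda>N. norm (WW Nc N0 N) / rad \<epsilon> N ^ j)" "(\<Sum>N. norm (WW Nc N0 N)) \<le> \<eta>"
    "(\<Sum>N. norm (WW Nc N0 N) / rad \<epsilon> N) \<le> \<eta>" "\<And>N. (\<Sum>j<4 * lev N + 2. \<bar>kap Nc N0 N j\<bar>) * T2 \<le> \<epsilon> / 4"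
    using WW_small[OF r eta(1)] by blast
  have s: "summable (\<lambda>N. norm (WW Nc N0 N))" "summable (\<lambda>N. norm (WW Nc N0 N) / rad \<epsilon> N)" using N0(1)[of 0] N0(1)[of 1] by auto
  define kk where "kk = kick \<epsilon> (WW Nc N0)"
  have kb: "norm (kk q) \<le> Ck * \<eta>" "norm (kk q - kk q') \<le> Ck * \<eta> * \<bar>q - q'\<bar>" for q q'
    using conjunct2[OF Ck', THEN spec[of _ \<epsilon>], THEN spec[of _ "WW Nc N0"], THEN spec[of _ \<eta>], THEN mp, OF eps(1), THEN mp, OF s(1),
      THEN mp, OF s(2), THEN mp, OF N0(2), THEN mp, OF N0(3)] by (simp_all add: kk_def)
  have F: "FF (WW Nc N0) u = F0 \<epsilon> u + chk (Pc u) *\<^sub>R kk (Qc u)" for u by (simp add: FF_def kk_def)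
  have lipF: "norm (FF (WW Nc N0) u - FF (WW Nc N0) v) \<le> L * norm (u - v)" for u v
  proof -
    have "FF (WW Nc N0) u - FF (WW Nc N0) v = (F0 \<epsilon> u - F0 \<epsilon> v) + (chk (Pc u) - chk (Pc v)) *\<^sub>R kk (Qc u) + chk (Pc v) *\<^sub>R (kk (Qc u) - kk (Qc v))"
      unfolding F by (simp add: algebra_simps)
    also have "norm \<dots> \<le> l0 * norm (u - v) + (Lc * norm (u - v)) * (Ck * \<eta>) + 1 * (Ck * \<eta> * norm (u - v))"
    proof (intro norm_triangle_mono lip)
      show "norm ((chk (Pc u) - chk (Pc v)) *\<^sub>R kk (Qc u)) \<le> (Lc * norm (u - v)) * (Ck * \<eta>)"
        unfolding norm_scaleR using Lc kb(1) by (intro mult_mono) auto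
      have "\<bar>Qc u - Qc v\<bar> \<le> norm (u - v)" using order_trans[OF PQ_lip(2)[of u v] Cauchy_Schwarz_ineq2] by (simp add: norm_e[unfolded One_nat_def] norm_e)
      then have "Ck * \<eta> * \<bar>Qc u - Qc v\<bar> \<le> Ck * \<eta> * norm (u - v)" using Ck eta(1) by (intro mult_left_mono) auto
      then have "norm (kk (Qc u) - kk (Qc v)) \<le> Ck * \<eta> * norm (u - v)" using kb(2)[of "Qc u" "Qc v"] by simp
      then show "norm (chk (Pc v) *\<^sub>R (kk (Qc u) - kk (Qc v))) \<le> 1 * (Ck * \<eta> * norm (u - v))"
        unfolding norm_scaleR using chk_01[of "Pc v"] by (intro mult_mono) auto
    qed
    also have "\<dots> = (l0 + Ck * \<eta> * (Lc + 1)) * norm (u - v)" by (simp add: algebra_simps)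
    finally show ?thesis by (simp add: eta(2))
  qed
  obtain K0 where K0: "\<And>u. norm (F0 \<epsilon> u) \<le> K0" using bounded_F0[OF eps(1)] eps(2) by auto
  have bddF: "norm (FF (WW Nc N0) u) \<le> K0 + 1 * (Ck * \<eta>)" for u
    unfolding F
  proof (intro norm_triangle_mono K0)
    show "norm (chk (Pc u) *\<^sub>R kk (Qc u)) \<le> 1 * (Ck * \<eta>)" unfolding norm_scaleR using chk_01[of "Pc u"] kb(1) by (intro mult_mono) auto
  qed
  have "flow e lam c G g0 L1 \<epsilon> (WW Nc N0) (FF (WW Nc N0)) L (K0 + 1 * (Ck * \<eta>))"
  proof unfold_locales
    show "FF (WW Nc N0) = (\<lambda>u. F0 \<epsilon> u + chk (Pc u) *\<^sub>R kick \<epsilon> (WW Nc N0) (Qc u))" by (simp add: fun_eq_iff FF_def)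
    show "L-lipschitz_on UNIV (FF (WW Nc N0))" using lipF L by (intro lipschitz_onI) (auto simp: dist_norm)
  qed (rule bddF)
  moreover have "Csmooth (FF (WW Nc N0))"
  proof -
    have "smoothR kk" unfolding kk_def by (rule kick_props[OF eps(1) N0(1)])
    then show ?thesis unfolding F[abs_def]
      by (intro Csmooth_add Csmooth_F0 Csmooth_scaleR Csmooth_compose[OF smoothR_cutoffs(9)] Csmooth_compose[of kk] Csmooth_PQ eps(1))
  qed
  ultimately show ?thesis using N0(4) by blast
qed

end

section \<open>Cubes in the attractor\<close>

lemma pow2_large: "m \<ge> 10 \<Longrightarrow> 8 * m\<^sup>2 + 6 \<le> (2::nat) ^ m"
proof (induction m rule: dec_induct)
  case (step n)
  have "10 * n \<le> n * n" using step(1) by simp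
  moreover have "8 * (Suc n)\<^sup>2 = 8 * (n * n) + 16 * n + 8" "8 * n\<^sup>2 = 8 * (n * n)" by (simp_all add: power2_eq_square)
  moreover have "(2::nat) ^ Suc n = 2 * 2 ^ n" by simp
  ultimately show ?case using step(1,3) by linarith
qed simp

context flow
begin

text \<open>By the normalisation of \<open>kap\<close>, each set bit contributes exactly b to its
  mode after Nc M half turns. The parameter in mode 0 varies by at most \<epsilon> and is multiplied
  by the same \<open>cc\<close> that defines b, so its differences are at most b as well. Hence
  distinct vertices are between b and (number of modes) b apart.\<close>

lemma block_points:
  assumes A: "\<forall>z x. bounded (range z) \<longrightarrow> (\<forall>n. T (real n) (z n) = x) \<longrightarrow> x \<in> A"
    and W: "W = WW Nc N0" and ks: "\<And>N. (\<Sum>j<4 * lev N + 2. \<bar>kap Nc N0 N j\<bar>) * T2 \<le> \<epsilon> / 4"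
    and M: "2 ^ M \<ge> N0" and b: "b = \<epsilon> * \<bar>cc (Nc * M) 0\<bar>"
  shows "\<exists>z. \<forall>(N::nat) (N'::nat). 2 ^ M \<le> N \<longrightarrow> N < 2 ^ Suc M \<longrightarrow> 2 ^ M \<le> N' \<longrightarrow> N' < 2 ^ Suc M \<longrightarrow>
    z N \<in> A \<and> dist (z N) (z N') \<le> (4 * real M + 2) * b \<and> (N \<noteq> N' \<longrightarrow> b \<le> dist (z N) (z N'))"
proof -
  define H where "H = Nc * M"
  define B where "B = 4 * M + 2"
  define st where "st N = start (ctr \<epsilon> N) (kap Nc N0 N)" for N
  define z where "z N = vec (pb (real H * tau)) (qb (real H * tau)) (XX (st N) H) (B + H)" for N
  have stz: "st N j = 0" if "lev N = M" "j \<ge> B" for N j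
    using that kap_zero(2)[of N j] by (simp add: st_def start_def B_def)
  have zA: "z N \<in> A" if l: "lev N = M" for N
  proof -
    have cor: "\<exists>U. bounded (U ` {..0}) \<and> (\<forall>t\<le>0. T (- t) (U t) = vec (pb 0) (qb 0) (st N) B)"
      "(\<Sum>j<B. \<bar>st N j\<bar>) \<le> \<epsilon> / 2"
      unfolding st_def
      by (rule corridor[OF refl, where \<kappa> = "kap Nc N0 N" and B = B],
          (use l ks[of N] kap_zero in \<open>simp_all add: B_def W WW_def\<close>)[5])+
    obtain U where U: "bounded (U ` {..0})" "\<And>t. t \<le> 0 \<Longrightarrow> T (- t) (U t) = vec (pb 0) (qb 0) (st N) B" using cor(1) by blast
    have "T (real H * tau) (vec (pb 0) (qb 0) (st N) B) \<in> A"
      by (rule backward_orbit_in_attractor[OF A U(2) U(1)]) (use tau_pos in auto)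
    moreover have "T (real H * tau) (vec (pb 0) (qb 0) (st N) B) = z N"
      unfolding z_def by (rule turns_trajectory) (use stz[OF l] cor(2) in auto)
    ultimately show ?thesis by simp
  qed
  have co: "z N - z N' = (\<Sum>j<B + H. XX (\<lambda>k. st N k - st N' k) H j *\<^sub>R f j)" for N N'
    unfolding z_def vec_def XX_diff[symmetric] by (simp add: sum_subtractf scaleR_left_diff_distrib)
  have b0: "b \<ge> 0" using eps by (simp add: b)
  have key: "z N \<in> A \<and> dist (z N) (z N') \<le> (4 * real M + 2) * b \<and> (N \<noteq> N' \<longrightarrow> b \<le> dist (z N) (z N'))"
    if N: "2 ^ M \<le> N" "N < 2 ^ Suc M" "2 ^ M \<le> N'" "N' < 2 ^ Suc M" for N N'
  proof -
    have l: "lev N = M" "lev N' = M" using lev_eq N by auto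
    define X where "X k = st N k - st N' k" for k
    have X0: "X k = 0" if "k \<notin> {..<B}" for k using stz[OF l(1), of k] stz[OF l(2), of k] that by (simp add: X_def)
    have NN: "N0 \<le> N" "N0 \<le> N'" using M N by auto
    have ck: "cc H k * st n k = (if odd k \<and> M \<le> k div 2 \<and> k div 2 < 2 * M \<and> bit n (k div 2 - M) then b else 0)"
      if "k \<noteq> 0" "lev n = M" "N0 \<le> n" for k n
      using that CC0_pos[of k] cc_bounds(1)[of H k] by (simp add: st_def start_def kap_def H_def b)
    have cX: "\<bar>cc H k * X k\<bar> \<le> b" for k
    proof (cases "k = 0")
      case True
      have "0 < ctr \<epsilon> n \<and> ctr \<epsilon> n \<le> \<epsilon> / 4" for n
        using eps ctr_antimono[OF eps(1), of 0 n] by (auto simp: ctr_def add_pos_nonneg)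
      from this[of N] this[of N'] have "\<bar>ctr \<epsilon> N - ctr \<epsilon> N'\<bar> \<le> \<epsilon>" by (auto simp: abs_le_iff)
      then have "\<bar>ctr \<epsilon> N - ctr \<epsilon> N'\<bar> * AA 0 \<le> \<epsilon> * 1" using AA_bounds[of 0] eps by (intro mult_mono) auto
      then have "\<bar>cc H 0\<bar> * (\<bar>ctr \<epsilon> N - ctr \<epsilon> N'\<bar> * AA 0) \<le> \<bar>cc H 0\<bar> * \<epsilon>" by (intro mult_left_mono) auto
      moreover have "\<bar>X 0\<bar> = \<bar>ctr \<epsilon> N - ctr \<epsilon> N'\<bar> * AA 0"
        using AA_bounds(1)[of 0] by (simp add: X_def st_def start_def left_diff_distrib[symmetric] abs_mult)
      ultimately show ?thesis using True by (simp add: abs_mult b H_def mult.commute)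
    next
      case False
      have "cc H k * X k = cc H k * st N k - cc H k * st N' k" by (simp add: X_def right_diff_distrib)
      then show ?thesis unfolding ck[OF False l(1) NN(1)] ck[OF False l(2) NN(2)] using b0 by auto
    qed
    have "dist (z N) (z N') \<le> (\<Sum>j<B + H. \<bar>XX X H j\<bar>)" unfolding dist_norm co X_def[symmetric] by (rule norm_sum_f)
    also have "\<dots> \<le> (\<Sum>k<B. \<bar>cc H k * X k\<bar>)" by (rule XX_sum) (use X0 in auto)
    also have "\<dots> \<le> real B * b" using sum_bounded_above[of "{..<B}" "\<lambda>k. \<bar>cc H k * X k\<bar>", OF cX] by simp
    finally have up: "dist (z N) (z N') \<le> (4 * real M + 2) * b" by (simp add: B_def add.commute)
    have lo: "b \<le> dist (z N) (z N')" if ne: "N \<noteq> N'"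
    proof -
      obtain i where i: "i < M" "bit N i \<noteq> bit N' i" using level_bits_differ[OF N ne] by blast
      define k where "k = 2 * (M + i) + 1"
      have k: "odd k" "k div 2 = M + i" "k \<noteq> 0" by (simp_all add: k_def)
      have "cc H k * X k = cc H k * st N k - cc H k * st N' k" by (simp add: X_def right_diff_distrib)
      then have "\<bar>cc H k * X k\<bar> = b" unfolding ck[OF k(3) l(1) NN(1)] ck[OF k(3) l(2) NN(2)] using i k b0 by auto
      then have e: "\<bar>XX X H (pth H k)\<bar> = b" by (simp add: XX_pth)
      have z0: "XX X H j = 0" if "j \<ge> B + H" for j by (rule XX_zero[OF _ that]) (use X0 in auto)
      have "inner (z N - z N') (f (pth H k)) = XX X H (pth H k)"
        unfolding co X_def[symmetric] using ch.inner_sum_ons[of "{..<B + H}" "XX X H" "pth H k"] z0[of "pth H k"] by auto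
      then have "b \<le> norm (z N - z N') * norm (f (pth H k))" using e Cauchy_Schwarz_ineq2[of "z N - z N'" "f (pth H k)"] by simp
      then show ?thesis by (simp add: dist_norm norm_e)
    qed
    show ?thesis using zA[OF l(1)] up lo by blast
  qed
  then show ?thesis by blast
qed

lemma attractor_dimension:
  assumes A: "\<forall>z x. bounded (range z) \<longrightarrow> (\<forall>n. T (real n) (z n) = x) \<longrightarrow> x \<in> A" and comp: "compact A"
    and W: "W = WW Nc N0" and ks: "\<And>N. (\<Sum>j<4 * lev N + 2. \<bar>kap Nc N0 N j\<bar>) * T2 \<le> \<epsilon> / 4"
    and M0: "M0 > 0" and r: "\<And>M i. M0 \<le> M \<Longrightarrow> M \<le> i \<Longrightarrow> i < 2 * M \<Longrightarrow> \<bar>cc (Nc * M) 0\<bar> \<le> exp (- ((real M)\<^sup>2)) * \<bar>cc (Nc * M) (2 * i + 1)\<bar>"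
  shows "dim_logD A = \<infinity>"
proof (rule dim_logD_eq_infI)
  fix R \<eta> :: real assume eta: "\<eta> > 0"
  define Q where "Q = tau * (real Nc * (mu 0 + G * real Nc + 3 * G))"
  have Q0: "Q \<ge> 0" using tau_pos G_pos lam_ge(2)[of "c 0"] by (simp add: Q_def)
  define C1 where "C1 = \<bar>ln \<epsilon>\<bar> + Q + 1"
  have C1: "C1 \<ge> 1" using Q0 by (simp add: C1_def)
  \<comment> \<open>First condition on m: the scale falls below \<eta> and below exp(-3), the latter
    making ln ln(1/\<epsilon>') positive.\<close>
  have "((\<lambda>m::nat. (4 * (real m)\<^sup>2 + 3) * exp (- (((real m)\<^sup>2)\<^sup>2))) \<longlongrightarrow> 0) sequentially" by real_asymp
  then have ev1: "eventually (\<lambda>m::nat. (4 * (real m)\<^sup>2 + 3) * exp (- (((real m)\<^sup>2)\<^sup>2)) < min \<eta> (exp (-3))) sequentially"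
    by (rule order_tendstoD(2)) (use eta in simp)
  \<comment> \<open>Second condition on m: m ln 2, the logarithm of a doubling number, outgrows R
    times ln(C1 m^4), the bound for ln ln(1/\<epsilon>').\<close>
  have "((\<lambda>m::nat. (ln C1 + 4 * ln (real m)) / (real m * ln 2)) \<longlongrightarrow> 0) sequentially" by real_asymp
  then have ev2: "eventually (\<lambda>m::nat. (ln C1 + 4 * ln (real m)) / (real m * ln 2) < 1 / (\<bar>R\<bar> + 1)) sequentially"
    by (rule order_tendstoD(2)) simp
  obtain m :: nat where m: "m \<ge> 10 + M0 + N0" "(4 * (real m)\<^sup>2 + 3) * exp (- (((real m)\<^sup>2)\<^sup>2)) < min \<eta> (exp (-3))"
    "(ln C1 + 4 * ln (real m)) / (real m * ln 2) < 1 / (\<bar>R\<bar> + 1)"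
    using eventually_happens'[OF sequentially_bot eventually_conj[OF eventually_ge_at_top[of "10 + M0 + N0"] eventually_conj[OF ev1 ev2]]] by blast
  define M where "M = m\<^sup>2"
  have mM: "m \<le> M" by (simp add: M_def power2_eq_square)
  have M: "M0 \<le> M" "M > 0" "real M = (real m)\<^sup>2" using mM m(1) by (auto simp: M_def)
  have NM: "N0 \<le> 2 ^ M" using less_exp[of M] mM m(1) by linarith
  define b where "b = \<epsilon> * \<bar>cc (Nc * M) 0\<bar>"
  have b0: "b > 0" using eps cc_bounds(1) by (simp add: b_def)
  obtain z where z: "\<And>N N' :: nat. 2 ^ M \<le> N \<Longrightarrow> N < 2 ^ Suc M \<Longrightarrow> 2 ^ M \<le> N' \<Longrightarrow> N' < 2 ^ Suc M \<Longrightarrow>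
    z N \<in> A \<and> dist (z N) (z N') \<le> (4 * real M + 2) * b \<and> (N \<noteq> N' \<longrightarrow> b \<le> dist (z N) (z N'))"
    using block_points[OF A W ks NM b_def] by blast
  \<comment> \<open>One b more than the bound on the diameter, because balls are open.\<close>
  define \<rho> where "\<rho> = (4 * real M + 3) * b"
  have rho0: "\<rho> > 0" using b0 by (simp add: \<rho>_def add_nonneg_pos)
  let ?I = "{2 ^ M..<2 ^ Suc M :: nat}"
  have p0: "2 ^ M \<in> ?I" by simp
  have inj: "inj_on z ?I"
  proof (rule inj_onI, rule ccontr)
    fix N N' assume "N \<in> ?I" "N' \<in> ?I" "z N = z N'" "N \<noteq> N'"
    then show False using z[of N N'] b0 by simp
  qed
  have DD: "real (card (z ` ?I)) \<le> D ^ m" if D: "\<And>j. j < m \<Longrightarrow> doubling_fn (\<rho> / 2 ^ j) A \<le> D" "D \<ge> 0" for D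
  proof (rule separated_card_le[OF comp rho0 D])
    show "z (2 ^ M) \<in> A" using z[of "2 ^ M" "2 ^ M"] by simp
    show "finite (z ` ?I)" by simp
    show "z ` ?I \<subseteq> A \<inter> ball (z (2 ^ M)) \<rho>"
    proof
      fix y assume "y \<in> z ` ?I"
      then obtain N where N: "N \<in> ?I" "y = z N" by blast
      have "dist (z (2 ^ M)) (z N) \<le> (4 * real M + 2) * b" using z[of "2 ^ M" N] N(1) by simp
      also have "\<dots> < \<rho>" using b0 by (simp add: \<rho>_def)
      finally show "y \<in> A \<inter> ball (z (2 ^ M)) \<rho>" using z[of N N] N by simp
    qed
    fix y y' assume y: "y \<in> z ` ?I" "y' \<in> z ` ?I" "y \<noteq> y'"
    then obtain N N' where N: "N \<in> ?I" "y = z N" "N' \<in> ?I" "y' = z N'" by blast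
    then have "b \<le> dist y y'" using z[of N N'] y(3) by auto
    moreover have "2 * (\<rho> / 2 ^ m) \<le> b"
    proof -
      have "real (8 * m\<^sup>2 + 6) \<le> real (2 ^ m)" by (rule of_nat_mono[OF pow2_large]) (use m(1) in simp)
      then have "8 * real M + 6 \<le> 2 ^ m" using M(3) by simp
      then have "(8 * real M + 6) * b \<le> 2 ^ m * b" using b0 by (intro mult_right_mono) auto
      then show ?thesis by (simp add: \<rho>_def pos_divide_le_eq algebra_simps)
    qed
    ultimately show "2 * (\<rho> / 2 ^ m) \<le> dist y y'" by simp
  qed
  have card: "card (z ` ?I) = 2 ^ M" using card_image[OF inj] by simp
  have "\<exists>j<m. 2 ^ m \<le> doubling_fn (\<rho> / 2 ^ j) A"
  proof (rule ccontr)
    assume no: "\<not> ?thesis"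
    \<comment> \<open>If all m doubling numbers were below 2^m, then D^m < 2^(m^2) = 2^M, which is
      fewer than the number of vertices.\<close>
    define D where "D = Max ((\<lambda>j. doubling_fn (\<rho> / 2 ^ j) A) ` {..<m})"
    have m0: "m > 0" using m(1) by simp
    have le: "doubling_fn (\<rho> / 2 ^ j) A \<le> D" if "j < m" for j unfolding D_def using that by (intro Max_ge) auto
    have "D < 2 ^ m" unfolding D_def using no m0 by (subst Max_less_iff) (auto simp: not_le)
    have "1 \<le> doubling_fn (\<rho> / 2 ^ 0) A" by (rule doubling_fn_ge_1[OF comp, of _ "z (2 ^ M)"]) (use rho0 z[of "2 ^ M" "2 ^ M"] in auto)
    then have D1: "D \<ge> 1" using le[OF m0] by simp
    have "real (2 ^ M) \<le> D ^ m" using DD[OF le] D1 card by simp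
    also have "\<dots> < (2 ^ m) ^ m" by (rule power_strict_mono) (use \<open>D < 2 ^ m\<close> D1 m0 in auto)
    also have "\<dots> = 2 ^ M" by (simp add: M_def power_mult[symmetric] power2_eq_square)
    finally show False by simp
  qed
  then obtain j where j: "j < m" "2 ^ m \<le> doubling_fn (\<rho> / 2 ^ j) A" by blast
  define \<epsilon>' where "\<epsilon>' = \<rho> / 2 ^ j"
  have e0: "\<epsilon>' > 0" using rho0 by (simp add: \<epsilon>'_def)
  have e_le: "\<epsilon>' \<le> \<rho>" using rho0 divide_left_mono[of 1 "2 ^ j" \<rho>] by (simp add: \<epsilon>'_def)
  have "b \<le> 1 * exp (- ((real M)\<^sup>2))"
  proof -
    have "\<bar>cc (Nc * M) 0\<bar> \<le> exp (- ((real M)\<^sup>2)) * \<bar>cc (Nc * M) (2 * M + 1)\<bar>" using r[OF M(1), of M] M(2) by simp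
    also have "\<dots> \<le> exp (- ((real M)\<^sup>2)) * 1" by (intro mult_left_mono cc_bounds) simp
    finally show ?thesis unfolding b_def using eps by (intro mult_mono) auto
  qed
  then have "\<rho> \<le> (4 * real M + 3) * exp (- ((real M)\<^sup>2))" unfolding \<rho>_def by (intro mult_left_mono) auto
  then have rho: "\<rho> < \<eta>" "\<rho> < exp (-3)" using m(2) unfolding M(3) by auto
  have inv: "1 / \<epsilon>' > 0" using e0 by simp
  have L3: "3 \<le> ln (1 / \<epsilon>')"
  proof -
    have "\<epsilon>' \<le> exp (-3)" using e_le rho(2) by simp
    then have "ln \<epsilon>' \<le> -3" using e0 by (metis ln_exp ln_le_cancel_iff exp_gt_zero)
    then show ?thesis using e0 by (simp add: ln_div)
  qed
  \<comment> \<open>The exponent of b is O(M^2) = O(m^4), and the halvings up to \<epsilon>' add at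
    most m ln 2.\<close>
  have "ln (1 / \<epsilon>') \<le> C1 * real m ^ 4"
  proof -
    have "b \<le> \<rho>" using b0 unfolding \<rho>_def by (simp add: mult_le_cancel_right1)
    then have "ln b \<le> ln \<rho>" using b0 rho0 by simp
    have "ln (1 / \<epsilon>') = real j * ln 2 - ln \<rho>" using rho0 by (simp add: \<epsilon>'_def ln_div ln_realpow)
    moreover have "real j * ln 2 \<le> real m * 1" using j(1) ln_le_minus_one[of "2::real"] by (intro mult_mono) auto
    moreover have "ln b = ln \<epsilon> + ln \<bar>cc (Nc * M) 0\<bar>" unfolding b_def using eps cc_bounds(1) by (simp add: ln_mult)
    moreover have "ln (exp (- Q * (real M)\<^sup>2)) \<le> ln \<bar>cc (Nc * M) 0\<bar>"
      using cc_lower[OF M(2), of Nc] cc_bounds(1)[of "Nc * M" 0] unfolding Q_def by (intro ln_mono) auto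
    ultimately have "ln (1 / \<epsilon>') \<le> \<bar>ln \<epsilon>\<bar> + Q * (real M)\<^sup>2 + real m" using \<open>ln b \<le> ln \<rho>\<close> by simp
    moreover have "Q * (real M)\<^sup>2 = Q * real m ^ 4" unfolding M(3) by (simp flip: power_mult)
    moreover have m1: "1 \<le> real m" using m(1) by simp
    moreover have "1 \<le> real m ^ 4" using m1 by (rule one_le_power)
    moreover have "real m ^ 1 \<le> real m ^ 4" using m1 by (intro power_increasing) auto
    moreover have "\<bar>ln \<epsilon>\<bar> * 1 \<le> \<bar>ln \<epsilon>\<bar> * real m ^ 4" using calculation(4) by (intro mult_left_mono) auto
    moreover have "C1 * real m ^ 4 = \<bar>ln \<epsilon>\<bar> * real m ^ 4 + Q * real m ^ 4 + real m ^ 4" by (simp add: C1_def algebra_simps)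
    moreover have "real m ^ 1 = real m" by simp
    ultimately show ?thesis by linarith
  qed
  then have "ln (ln (1 / \<epsilon>')) \<le> ln (C1 * real m ^ 4)" using L3 by (intro ln_mono) auto
  also have "\<dots> = ln C1 + 4 * ln (real m)" using C1 m(1) by (simp add: ln_mult ln_realpow)
  finally have LL: "ln (ln (1 / \<epsilon>')) \<le> ln C1 + 4 * ln (real m)" .
  have LLpos: "ln (ln (1 / \<epsilon>')) > 0" using L3 by simp
  have "R * ln (ln (1 / \<epsilon>')) \<le> (\<bar>R\<bar> + 1) * ln (ln (1 / \<epsilon>'))" using LLpos by (intro mult_right_mono) auto
  also have "\<dots> \<le> (\<bar>R\<bar> + 1) * (ln C1 + 4 * ln (real m))" using LL by (intro mult_left_mono) auto
  also have "\<dots> \<le> real m * ln 2"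
  proof -
    have "0 < real m * ln 2" using m(1) by simp
    then have "ln C1 + 4 * ln (real m) < 1 / (\<bar>R\<bar> + 1) * (real m * ln 2)" using m(3) by (simp only: pos_divide_less_eq)
    then have "(\<bar>R\<bar> + 1) * (ln C1 + 4 * ln (real m)) \<le> (\<bar>R\<bar> + 1) * (1 / (\<bar>R\<bar> + 1) * (real m * ln 2))" by (intro mult_left_mono) auto
    then show ?thesis by simp
  qed
  also have "\<dots> = ln (2 ^ m)" by (simp add: ln_realpow)
  also have "\<dots> \<le> ln (doubling_fn \<epsilon>' A)" using j(2) unfolding \<epsilon>'_def by (intro ln_mono) auto
  finally have "R \<le> ln (doubling_fn \<epsilon>' A) / ln (ln (1 / \<epsilon>'))" using LLpos by (simp add: pos_le_divide_eq)
  then show "\<exists>\<epsilon>'. 0 < \<epsilon>' \<and> \<epsilon>' < \<eta> \<and> R \<le> ln (doubling_fn \<epsilon>' A) / ln (ln (1 / \<epsilon>'))" using e0 e_le rho(1) by (intro exI[of _ \<epsilon>']) auto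
qed

end

text \<open>Greedy choice: go to the last index whose eigenvalue is within G of the current one. The
  next eigenvalue exceeds this bound and gaps are at most l, so the step is at least G - l > 0, even
  when eigenvalues are repeated or clustered.\<close>

lemma chain_exists:
  fixes lam :: "nat \<Rightarrow> real"
  assumes mono: "mono lam" and top: "filterlim lam at_top sequentially"
    and gap: "\<And>n. lam (Suc n) - lam n \<le> l" and l: "l < G"
  shows "\<exists>c. strict_mono c \<and> c 0 = 2 \<and> (\<forall>j. lam (c (Suc j)) - lam (c j) \<le> G \<and> G - l \<le> lam (c (Suc j)) - lam (c j))"
proof -
  define nx where "nx n = (LEAST k. lam n + G < lam (Suc k))" for n
  have nx: "lam n + G < lam (Suc (nx n))" "n < nx n" "lam (nx n) \<le> lam n + G" for n
  proof -
    have "eventually (\<lambda>k. lam n + G < lam k) sequentially" using top by (simp add: filterlim_at_top_dense)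
    then obtain k where k: "\<And>i. i \<ge> k \<Longrightarrow> lam n + G < lam i" by (auto simp: eventually_sequentially)
    show g: "lam n + G < lam (Suc (nx n))" unfolding nx_def by (rule LeastI[of _ k]) (use k in simp)
    show n: "n < nx n"
    proof (rule ccontr)
      assume "\<not> n < nx n"
      then have "lam (Suc (nx n)) \<le> lam (Suc n)" using mono by (simp add: monoD)
      then show False using g gap[of n] l by simp
    qed
    then obtain i where i: "nx n = Suc i" by (cases "nx n") auto
    then have "\<not> lam n + G < lam (Suc i)" using not_less_Least[of i "\<lambda>k. lam n + G < lam (Suc k)"] by (simp add: nx_def)
    then show "lam (nx n) \<le> lam n + G" using i by simp
  qed
  define c where "c j = (nx ^^ j) 2" for j
  have cS: "c (Suc j) = nx (c j)" for j by (simp add: c_def)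
  have "strict_mono c" unfolding strict_mono_Suc_iff cS using nx(2) by blast
  moreover have "c 0 = 2" by (simp add: c_def)
  moreover have "lam (c (Suc j)) - lam (c j) \<le> G \<and> G - l \<le> lam (c (Suc j)) - lam (c j)" for j
    using nx(1)[of "c j"] nx(3)[of "c j"] gap[of "nx (c j)"] by (simp add: cS)
  ultimately show ?thesis by blast
qed

theorem theorem3p1:
  fixes e :: "nat \<Rightarrow> 'a::{real_inner,complete_space}" and lam :: "nat \<Rightarrow> real" and L :: real
  assumes orthonormal: "\<forall>m n. inner (e m) (e n) = (if m = n then 1 else 0)"
    and basis: "closure (span (range e)) = UNIV"
    and pos: "0 < lam 0"
    and mono: "mono lam"
    and compact_inv: "filterlim lam at_top sequentially"
    and L0_finite: "bdd_above (range (\<lambda>n. lam (Suc n) - lam n))"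
    and L_big: "L > max ((SUP n. lam (Suc n) - lam n) / 2) (lam 1)"
  shows "\<exists>F :: 'a \<Rightarrow> 'a. C_infinity F \<and> lipschitz_on L UNIV F \<and>
           (\<exists>\<A>. global_attractor e lam F \<A> \<and> dim_logD \<A> = \<infinity> \<and>
                 (\<forall>P. \<not> loglip_Mane_proj P \<A>) \<and>
                 (\<forall>N M. \<A> \<subseteq> M \<longrightarrow> \<not> loglip_manifold N M))"
proof -
  define l where "l = (SUP n. lam (Suc n) - lam n)"
  have gap: "lam (Suc n) - lam n \<le> l" for n unfolding l_def by (rule cSUP_upper[OF _ L0_finite]) simp
  have l0: "0 \<le> l" using gap[of 0] monoD[OF mono, of 0 "Suc 0"] by simp
  have Ll: "l < 2 * L" "lam 1 < L" using L_big by (simp_all add: l_def)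
  \<comment> \<open>The midpoint of l and 2 L: above l, so that the chain has gaps bounded below,
    and with G/2 below L.\<close>
  define G where "G = (l + 2 * L) / 2"
  define L1 where "L1 = max (lam 1) (G / 2)"
  have G: "l < G" "G / 2 < L" using Ll by (simp_all add: G_def)
  have L1: "L1 < L" using G Ll by (simp add: L1_def)
  obtain c where c: "strict_mono c" "c 0 = 2" "\<And>j. lam (c (Suc j)) - lam (c j) \<le> G" "\<And>j. G - l \<le> lam (c (Suc j)) - lam (c j)"
    using chain_exists[OF mono compact_inv gap G(1)] by blast
  interpret design e lam c G "G - l" L1
  proof unfold_locales
    show "lam 2 - lam 1 \<le> G" using gap[of 1] G by (simp add: numeral_2_eq_2)
  qed (use orthonormal basis pos mono compact_inv c G in \<open>auto simp: L1_def\<close>)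
  obtain C where C: "C \<ge> 0" "\<And>\<epsilon> u v. 0 < \<epsilon> \<Longrightarrow> \<epsilon> \<le> 1 \<Longrightarrow> norm (F0 \<epsilon> u - F0 \<epsilon> v) \<le> (L1 + C * \<epsilon>) * norm (u - v)"
    using lip_F0 by blast
  \<comment> \<open>1/8 is what the geometry of the base orbit uses; the other bound keeps the
    O(\<epsilon>) excess below L - L1 and leaves room for the kick.\<close>
  define \<epsilon> where "\<epsilon> = min (1/8) ((L - L1) / (2 * (C + 1)))"
  have eps: "0 < \<epsilon>" "\<epsilon> \<le> 1/8" unfolding \<epsilon>_def using L1 C(1) by simp (rule min.cobounded1)
  have "C * \<epsilon> < L - L1"
  proof -
    have "(C + 1) * \<epsilon> \<le> (C + 1) * ((L - L1) / (2 * (C + 1)))" using C(1) by (intro mult_left_mono) (auto simp: \<epsilon>_def)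
    also have "\<dots> = (L - L1) / 2" using C(1) by (simp add: field_simps)
    finally have "C * \<epsilon> + \<epsilon> \<le> (L - L1) / 2" by (simp add: algebra_simps)
    moreover have "(L - L1) / 2 < L - L1" using L1 by simp
    ultimately show ?thesis using eps(1) by linarith
  qed
  then have lL: "L1 + C * \<epsilon> < L" by simp
  have L10: "0 \<le> L1 + C * \<epsilon>" using lam_ge(2)[of 1] lam1_le C(1) eps by simp
  interpret turns e lam c G "G - l" L1 \<epsilon>
    by unfold_locales (use eps in auto)
  obtain Nc M0 where r: "M0 > 0" "\<And>M i. M0 \<le> M \<Longrightarrow> M \<le> i \<Longrightarrow> i < 2 * M \<Longrightarrow> \<bar>cc (Nc * M) 0\<bar> \<le> exp (- ((real M)\<^sup>2)) * \<bar>cc (Nc * M) (2 * i + 1)\<bar>"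
    using cc_ratio by blast
  have lip: "norm (F0 \<epsilon> u - F0 \<epsilon> v) \<le> (L1 + C * \<epsilon>) * norm (u - v)" for u v using C(2)[of \<epsilon> u v] eps by simp
  obtain N0 K where fl: "flow e lam c G (G - l) L1 \<epsilon> (WW Nc N0) (FF (WW Nc N0)) L K" "Csmooth (FF (WW Nc N0))"
    "\<And>N. (\<Sum>j<4 * lev N + 2. \<bar>kap Nc N0 N j\<bar>) * T2 \<le> \<epsilon> / 4"
    using flow_exists[OF r(2) lip L10 lL] by blast
  interpret flow e lam c G "G - l" L1 \<epsilon> "WW Nc N0" "FF (WW Nc N0)" L K by (rule fl(1))
  obtain A where A: "global_attractor e lam (FF (WW Nc N0)) A"
    "\<forall>z x. bounded (range z) \<longrightarrow> (\<forall>n. sg e lam (FF (WW Nc N0)) (real n) (z n) = x) \<longrightarrow> x \<in> A"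
    using attractor_exists by blast
  have comp: "compact A" using A(1) by (simp add: global_attractor_def)
  have dim: "dim_logD A = \<infinity>" by (rule attractor_dimension[OF A(2) comp refl fl(3) r])
  \<comment> \<open>The dyadic block of level N0 already supplies a point, because N0 <
    2^N0.\<close>
  have ne: "A \<noteq> {}" 
  proof -
    obtain z where "\<forall>(N::nat) (N'::nat). 2 ^ N0 \<le> N \<longrightarrow> N < 2 ^ Suc N0 \<longrightarrow> 2 ^ N0 \<le> N' \<longrightarrow> N' < 2 ^ Suc N0 \<longrightarrow>
      z N \<in> A \<and> dist (z N) (z N') \<le> (4 * real N0 + 2) * (\<epsilon> * \<bar>cc (Nc * N0) 0\<bar>) \<and> (N \<noteq> N' \<longrightarrow> \<epsilon> * \<bar>cc (Nc * N0) 0\<bar> \<le> dist (z N) (z N'))"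
      using block_points[OF A(2) refl fl(3) less_imp_le[OF less_exp] refl] by blast
    then have "z (2 ^ N0) \<in> A" by (auto dest!: spec[of _ "2 ^ N0"])
    then show ?thesis by blast
  qed
  show ?thesis
    using Csmooth_imp_C_infinity[OF fl(2)] F_lip A(1) dim no_loglip_Mane_proj[OF comp ne dim] no_loglip_manifold[OF comp ne dim] by blast
qed

end
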